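(* Let $d\ge2$, let $\mathscr B\subset\mathbb R^d$ be a bounded ball, let $b$ ($\mathbb R^d$-valued) and $V$ (real valued) be Borel functions on $\mathscr B^c$, and let $u$ be a real-valued function with $\Delta u+\langle b,\nabla u\rangle+Vu=0$ in $\mathscr B^c$. Suppose that the following hold. (i) $\|b\|_\infty\le M$ and $\|V\|_\infty\le\gamma$, and there exists a ball $B_r$ centered at $0$ of radius $r>0$, with $\mathscr B\subset B_r$, such that $b$ and $V$ are constant in $B_r^c$. (ii) For some positive $\varepsilon,C_\varepsilon$, $$|u(x)|\le C_\varepsilon\exp\left(-\left(\frac M2+\sqrt{\frac{M^2}{4}+\gamma}+\varepsilon\right)|x|\right)\qquad\forall\,x\in\mathscr B^c.$$ Then $u\equiv0$ (in $\mathscr B^c$).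
   Context: Solutions are strong solutions: $u\in W^{2,d}_{\mathrm{loc}}$ on the open set $\mathbb R^d\setminus\overline{\mathscr B}$ and the equation holds almost everywhere there. $\|\cdot\|_\infty$ denotes the $L^\infty$ norm (on $\mathscr B^c$). *)

theory Defs
  imports "HOL-Analysis.Analysis" "HOL-Probability.Essential_Supremum"
begin

text \<open>
  Local Sobolev spaces and strong solutions on an open set \<open>\<Omega>\<close> of a Euclidean space
  \<open>'a\<close> (that is, of \<open>\<real>\<^sup>d\<close> with \<open>d = DIM('a)\<close>).
  All functions are total; their values outside the set under consideration are irrelevant.
\<close>

primrec Ck :: "nat \<Rightarrow> ('a::euclidean_space \<Rightarrow> real) \<Rightarrow> bool" where
  "Ck 0 f \<longleftrightarrow> continuous_on UNIV f"
| "Ck (Suc k) f \<longleftrightarrow> (\<exists>g. (\<forall>x. GDERIV f x :> g x) \<and> (\<forall>i\<in>Basis. Ck k (\<lambda>x. g x \<bullet> i)))"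

text \<open>
  Elements of \<open>C\<^sub>c\<^sup>\<infinity>(\<Omega>)\<close>, extended by zero to the whole space.
\<close>
definition test_function :: "'a::euclidean_space set \<Rightarrow> ('a \<Rightarrow> real) \<Rightarrow> bool" where
  "test_function \<Omega> \<phi> \<longleftrightarrow>
     (\<forall>k. Ck k \<phi>) \<and> compact (closure {x. \<phi> x \<noteq> 0}) \<and> closure {x. \<phi> x \<noteq> 0} \<subseteq> \<Omega>"

definition Lp_loc :: "real \<Rightarrow> 'a::euclidean_space set \<Rightarrow> ('a \<Rightarrow> real) \<Rightarrow> bool" where
  "Lp_loc p \<Omega> f \<longleftrightarrow>
     f \<in> borel_measurable (lebesgue_on \<Omega>) \<and>
     (\<forall>K. compact K \<and> K \<subseteq> \<Omega> \<longrightarrow> integrable (lebesgue_on K) (\<lambda>x. \<bar>f x\<bar> powr p))"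

text \<open>
  \<open>g\<close> is the weak partial derivative of \<open>f\<close> on \<open>\<Omega>\<close> in the direction of the basis vector \<open>i\<close>;
  it is determined up to null sets.
\<close>
definition weak_partial ::
    "'a::euclidean_space set \<Rightarrow> 'a \<Rightarrow> ('a \<Rightarrow> real) \<Rightarrow> ('a \<Rightarrow> real) \<Rightarrow> bool" where
  "weak_partial \<Omega> i f g \<longleftrightarrow>
     Lp_loc 1 \<Omega> f \<and> Lp_loc 1 \<Omega> g \<and>
     (\<forall>\<phi>. test_function \<Omega> \<phi> \<longrightarrow>
        (\<integral>x. f x * frechet_derivative \<phi> (at x) i \<partial>lebesgue_on \<Omega>)
          = - (\<integral>x. g x * \<phi> x \<partial>lebesgue_on \<Omega>))"

text \<open>
  The space \<open>W\<^sup>k\<^sup>,\<^sup>p\<close>, local version: all weak partial derivatives of order at most \<open>k\<close>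
  exist and lie in \<open>Lp_loc p \<Omega>\<close>.
\<close>
primrec sobolev_loc ::
    "nat \<Rightarrow> real \<Rightarrow> 'a::euclidean_space set \<Rightarrow> ('a \<Rightarrow> real) \<Rightarrow> bool" where
  "sobolev_loc 0 p \<Omega> f \<longleftrightarrow> Lp_loc p \<Omega> f"
| "sobolev_loc (Suc k) p \<Omega> f \<longleftrightarrow>
     Lp_loc p \<Omega> f \<and> (\<forall>i\<in>Basis. \<exists>g. weak_partial \<Omega> i f g \<and> sobolev_loc k p \<Omega> g)"

text \<open>
  Strong solutions of \<open>\<Delta>u + \<langle>b, \<nabla>u\<rangle> + V u = 0\<close> on \<open>\<Omega>\<close>. Here \<open>G\<close> is the weak gradient of \<open>u\<close> and
  \<open>H i\<close> its second weak derivative \<open>\<partial>\<^sub>i\<partial>\<^sub>iu\<close>. Both are unique up to null sets, so it does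
  not matter that they are quantified existentially.
\<close>
definition strong_solution ::
    "'a::euclidean_space set \<Rightarrow> ('a \<Rightarrow> 'a) \<Rightarrow> ('a \<Rightarrow> real) \<Rightarrow> ('a \<Rightarrow> real) \<Rightarrow> bool" where
  "strong_solution \<Omega> b V u \<longleftrightarrow>
     sobolev_loc 2 (real DIM('a)) \<Omega> u \<and>
     (\<exists>G H.
        (\<forall>i\<in>Basis. weak_partial \<Omega> i u (\<lambda>x. G x \<bullet> i) \<and>
                   weak_partial \<Omega> i (\<lambda>x. G x \<bullet> i) (H i)) \<and>
        (AE x in lebesgue_on \<Omega>. (\<Sum>i\<in>Basis. H i x) + b x \<bullet> G x + V x * u x = 0))"

definition Linf_norm :: "'a::euclidean_space set \<Rightarrow> ('a \<Rightarrow> 'b::real_normed_vector) \<Rightarrow> ereal" where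
  "Linf_norm S f = esssup (lebesgue_on S) (\<lambda>x. ereal (norm (f x)))"

end

theory Submission
  imports Defs "HOL-Real_Asymp.Real_Asymp"
begin

text \<open>
  After the gauge transform \<open>u \<mapsto> e\<^sup>\<beta>\<^sup>\<bullet>\<^sup>x\<^sup>/\<^sup>2 u\<close>, where \<open>\<beta>\<close> and \<open>v\<close> are the values of \<open>b\<close> and \<open>V\<close> near infinity, the
  equation outside \<open>B\<^sub>r\<close> becomes \<open>\<Delta>w + k w = 0\<close> with \<open>k = v - \<bar>\<beta>\<bar>\<^sup>2/4\<close>. For \<open>l = \<surd>(M\<^sup>2/4 + \<gamma>) + \<epsilon>/2\<close> one has
  \<open>l\<^sup>2 + k \<ge> 0\<close>, and under this condition the weight \<open>\<phi> = l r + 2 \<tau> \<surd>r\<close> in \<open>r = \<bar>x - a\<bar>\<close> satisfies a Carleman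
  estimate with constant \<open>O(1/\<tau>)\<close> all the way to infinity, because \<open>r\<^sup>2 (\<phi>'(r)\<^sup>2 + k)\<close> is increasing. The decay
  hypothesis is exactly what makes \<open>e\<^sup>\<phi> w\<close> admissible for every \<open>\<tau>\<close>. The estimate is proved for \<open>C\<^sup>2\<close> functions by
  a Rellich multiplier and transferred to \<open>u\<close> by mollification. The terms in \<open>b - \<beta>\<close> and \<open>V - v\<close> have bounded
  support, so for large \<open>\<tau>\<close> they are absorbed, and since \<open>\<phi>\<close> is increasing in \<open>r\<close>, the cut-off error near
  the inner boundary is negligible as \<open>\<tau> \<rightarrow> \<infinity>\<close>.
\<close>

section \<open>Smooth functions\<close>

text \<open>Nothing is assumed about the size of \<nabla>u at infinity, yet e^\<phi> \<nabla>u has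
  to be square integrable. Mollification settles this together with the regularity: derivatives of a
  convolution fall on the kernel, so they inherit the decay of u. To mollify without commutator
  errors, the equation is written with its constant far-field coefficients on the left, and the rest
  is collected in a source N = (\<beta> - b) \<bullet> \<nabla>u + (v - V) u that vanishes far out.
  Convolution commutes with such a left side exactly, and the limit only involves L2 convergence of
  u, \<nabla>u and N on a compact annulus.

  The linear part of \<phi> is limited by the decay rate, so the large parameter must sit in a term
  of lower order at infinity; \<surd>r is such a term and still makes the quadratic form of the
  Carleman estimate positive. Weight and cut-offs are centred at a, inside the hole, so the
  singularity of \<phi> is never met and the annuli may come arbitrarily close to the inner sphere.
  Vanishing therefore does not have to be continued inwards from infinity. Centring at a instead of
  0 changes the decay bound only by a constant factor.\<close>

lemma Ck_SucI:
  assumes "\<And>x. GDERIV f x :> g x" "\<And>i. i \<in> Basis \<Longrightarrow> Ck k (\<lambda>x. g x \<bullet> i)"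
  shows "Ck (Suc k) f"
  using assms by auto

lemma Ck_imp_continuous: "Ck k f \<Longrightarrow> continuous_on UNIV f"
proof (cases k)
  case (Suc m)
  assume "Ck k f"
  then obtain g where "\<And>x. GDERIV f x :> g x" using Suc by auto
  then have "isCont f x" for x
    unfolding gderiv_def by (rule has_derivative_continuous)
  then show ?thesis by (simp add: continuous_at_imp_continuous_on)
qed simp

lemma Ck_SucD: "Ck (Suc k) f \<Longrightarrow> Ck k f"
proof (induction k arbitrary: f)
  case 0 then show ?case using Ck_imp_continuous[of "Suc 0" f] by simp
next
  case (Suc k)
  then obtain g where g: "\<And>x. GDERIV f x :> g x" "\<And>i. i \<in> Basis \<Longrightarrow> Ck (Suc k) (\<lambda>x. g x \<bullet> i)"
    unfolding Ck.simps(2)[of "Suc k"] by blast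
  show ?case by (rule Ck_SucI[OF g(1)]) (auto intro: Suc.IH g(2))
qed

lemma Ck_const: "Ck k (\<lambda>x. c)"
proof (induction k arbitrary: c)
  case (Suc k)
  show ?case by (rule Ck_SucI[OF GDERIV_const]) (simp add: Suc)
qed simp

lemma Ck_add: "Ck k f \<Longrightarrow> Ck k g \<Longrightarrow> Ck k (\<lambda>x. f x + g x)"
proof (induction k arbitrary: f g)
  case 0 then show ?case by (simp add: continuous_on_add)
next
  case (Suc k)
  obtain f' where f: "\<And>x. GDERIV f x :> f' x" "\<And>i. i \<in> Basis \<Longrightarrow> Ck k (\<lambda>x. f' x \<bullet> i)"
    using Suc.prems unfolding Ck.simps by blast
  obtain g' where g: "\<And>x. GDERIV g x :> g' x" "\<And>i. i \<in> Basis \<Longrightarrow> Ck k (\<lambda>x. g' x \<bullet> i)"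
    using Suc.prems unfolding Ck.simps by blast
  show ?case
    by (rule Ck_SucI[OF GDERIV_add[OF f(1) g(1)]]) (simp add: inner_add_left Suc.IH f g)
qed

lemma Ck_mult: "Ck k f \<Longrightarrow> Ck k g \<Longrightarrow> Ck k (\<lambda>x. f x * g x)"
proof (induction k arbitrary: f g)
  case 0 then show ?case by (simp add: continuous_on_mult)
next
  case (Suc k)
  obtain f' where f: "\<And>x. GDERIV f x :> f' x" "\<And>i. i \<in> Basis \<Longrightarrow> Ck k (\<lambda>x. f' x \<bullet> i)"
    using Suc.prems unfolding Ck.simps by blast
  obtain g' where g: "\<And>x. GDERIV g x :> g' x" "\<And>i. i \<in> Basis \<Longrightarrow> Ck k (\<lambda>x. g' x \<bullet> i)"
    using Suc.prems unfolding Ck.simps by blast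
  show ?case
    by (rule Ck_SucI[OF GDERIV_mult[OF f(1) g(1)]])
      (simp add: inner_add_left Ck_add Suc.IH f g Ck_SucD[OF Suc.prems(1)] Ck_SucD[OF Suc.prems(2)])
qed

lemma Ck_sum: "(\<And>i. i \<in> I \<Longrightarrow> Ck k (f i)) \<Longrightarrow> Ck k (\<lambda>x. \<Sum>i\<in>I. f i x)"
  by (induction I rule: infinite_finite_induct) (auto simp: Ck_const Ck_add)

lemma Ck_compose:
  fixes p :: "'a::euclidean_space \<Rightarrow> real" and q :: "real \<Rightarrow> real"
  shows "Ck k q \<Longrightarrow> Ck k p \<Longrightarrow> Ck k (\<lambda>x. q (p x))"
proof (induction k arbitrary: p q)
  case 0
  then show ?case by (auto intro: continuous_on_compose2[of UNIV q])
next
  case (Suc k)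
  obtain p' where p: "\<And>x. GDERIV p x :> p' x" "\<And>i. i \<in> Basis \<Longrightarrow> Ck k (\<lambda>x. p' x \<bullet> i)"
    using Suc.prems unfolding Ck.simps by blast
  obtain q' where q: "\<And>x. GDERIV q x :> q' x" "Ck k q'"
    using Suc.prems(1) unfolding Ck.simps Basis_real_def by auto
  have d: "GDERIV (\<lambda>x. q (p x)) x :> q' (p x) *\<^sub>R p' x" for x
    using GDERIV_DERIV_compose[OF p(1)] q(1) by simp
  show ?case
    by (rule Ck_SucI[OF d])
      (simp add: Ck_mult Suc.IH p q Ck_SucD[OF Suc.prems(2)])
qed

lemma Ck_inner_left: "Ck k (\<lambda>x. x \<bullet> c)"
proof (cases k)
  case 0 then show ?thesis by (auto intro: continuous_intros)
next
  case (Suc m)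
  have "GDERIV (\<lambda>x. x \<bullet> c) x :> c" for x
    unfolding gderiv_def by (auto intro!: derivative_eq_intros)
  then show ?thesis unfolding Suc by (rule Ck_SucI) (rule Ck_const)
qed

lemma Ck_sq_dist: "Ck k (\<lambda>x. (x - c) \<bullet> (x - c))"
proof -
  have eq: "(x - c) \<bullet> (x - c) = (\<Sum>i\<in>Basis. (x \<bullet> i + - (c \<bullet> i)) * (x \<bullet> i + - (c \<bullet> i)))" for x
    by (subst euclidean_inner) (simp add: inner_diff_left)
  show ?thesis
    unfolding eq by (rule Ck_sum, rule Ck_mult; rule Ck_add[OF Ck_inner_left Ck_const])
qed

text \<open>The functions \<open>t \<mapsto> t\<^sup>-\<^sup>m exp (-1/t)\<close>, extended by zero, are closed under differentiation
  up to linear combinations.\<close>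

definition flat :: "nat \<Rightarrow> real \<Rightarrow> real" where
  "flat m t = (if 0 < t then inverse t ^ m * exp (- inverse t) else 0)"

lemma flat_tendsto: "(flat m \<longlongrightarrow> 0) (at 0)"
proof -
  have "((\<lambda>y::real. y ^ m / exp y) \<longlongrightarrow> 0) at_top" by (rule tendsto_power_div_exp_0)
  then have "((\<lambda>t::real. inverse t ^ m / exp (inverse t)) \<longlongrightarrow> 0) (at_right 0)"
    by (rule filterlim_compose) (rule filterlim_inverse_at_top_right)
  then have r: "(flat m \<longlongrightarrow> 0) (at_right 0)"
    by (rule Lim_transform_eventually)
      (auto simp: flat_def eventually_at_right_field exp_minus divide_inverse intro!: exI[of _ 1])
  have l: "(flat m \<longlongrightarrow> 0) (at_left 0)"
    by (rule Lim_transform_eventually[OF tendsto_const])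
      (auto simp: flat_def eventually_at_left_field intro!: exI[of _ "-1"])
  show ?thesis using l r by (simp add: filterlim_split_at)
qed

lemma flat_DERIV: "(flat m has_real_derivative flat (m + 2) t - m * flat (m + 1) t) (at t)"
proof -
  consider "t > 0" | "t < 0" | "t = 0" by linarith
  then show ?thesis
  proof cases
    case 1
    \<comment> \<open>The exponent m - 1 is a truncated subtraction; the factor m makes the case m =
      0 harmless.\<close>
    have m: "real m * inverse t ^ (m - 1) = real m * inverse t ^ m * t"
      using 1 by (cases m) auto
    have "((\<lambda>t. inverse t ^ m * exp (- inverse t)) has_real_derivative
          (real m * inverse t ^ (m - 1)) * (- (inverse t * inverse t)) * exp (- inverse t)
            + exp (- inverse t) * (inverse t * inverse t) * inverse t ^ m) (at t)"
      using 1 by (auto intro!: derivative_eq_intros)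
    then have "((\<lambda>t. inverse t ^ m * exp (- inverse t)) has_real_derivative
        flat (m + 2) t - m * flat (m + 1) t) (at t)"
      by (rule DERIV_cong) (use 1 in \<open>unfold m, simp add: flat_def\<close>)
    then show ?thesis
      by (rule has_field_derivative_transform_within_open[where S="{0<..}"])
        (use 1 in \<open>auto simp: flat_def\<close>)
  next
    case 2
    have "((\<lambda>t. 0) has_real_derivative flat (m + 2) t - m * flat (m + 1) t) (at t)"
      using 2 by (simp add: flat_def)
    then show ?thesis
      by (rule has_field_derivative_transform_within_open[where S="{..<0}"])
        (use 2 in \<open>auto simp: flat_def\<close>)
  next
    case 3
    \<comment> \<open>The difference quotient at 0 is again a member of the family, with the index
      raised by one. This is what the free exponent m is for.\<close>
    have e: "(\<lambda>h. (flat m (0 + h) - flat m 0) / h) = flat (Suc m)"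
      by (rule ext) (simp add: flat_def divide_inverse)
    have z: "flat (m + 2) 0 - m * flat (m + 1) 0 = 0" by (simp add: flat_def)
    show ?thesis
      unfolding 3 DERIV_def e z by (rule flat_tendsto)
  qed
qed

lemma Ck_flat: "Ck k (flat m)"
proof (induction k arbitrary: m)
  case 0
  have "isCont (flat m) t" for t using flat_DERIV by (rule DERIV_isCont)
  then show ?case by (simp add: continuous_at_imp_continuous_on)
next
  case (Suc k)
  have "Ck k (\<lambda>t. flat (m + 2) t + (- real m) * flat (m + 1) t)"
    by (intro Ck_add Ck_mult Ck_const Suc)
  then show ?case
    by (intro Ck_SucI[where g="\<lambda>t. flat (m + 2) t - m * flat (m + 1) t"])
      (use flat_DERIV in \<open>auto simp: gderiv_deriv\<close>)
qed

lemma flat_nonneg: "0 \<le> flat m t" by (simp add: flat_def)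
lemma flat_pos: "0 < t \<Longrightarrow> 0 < flat m t" by (simp add: flat_def)
lemma flat_zero: "t \<le> 0 \<Longrightarrow> flat m t = 0" by (simp add: flat_def)

section \<open>Integral identities\<close>

lemma nn_integral_lborel_translate:
  fixes f :: "'a::euclidean_space \<Rightarrow> ennreal"
  assumes "f \<in> borel_measurable borel"
  shows "(\<integral>\<^sup>+x. f (c + x) \<partial>lborel) = (\<integral>\<^sup>+x. f x \<partial>lborel)"
proof -
  have "(\<integral>\<^sup>+x. f x \<partial>lborel) = (\<integral>\<^sup>+x. f x \<partial>distr lborel borel ((+) c))"
    by (simp add: lborel_distr_plus)
  also have "\<dots> = (\<integral>\<^sup>+x. f (c + x) \<partial>lborel)"
    by (rule nn_integral_distr) (use assms in auto)
  finally show ?thesis by simp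
qed

lemma integral_lborel_translate:
  fixes f :: "'a::euclidean_space \<Rightarrow> 'b::{banach,second_countable_topology}"
  assumes "f \<in> borel_measurable borel"
  shows "(\<integral>x. f (c + x) \<partial>lborel) = (\<integral>x. f x \<partial>lborel)"
proof -
  have "(\<integral>x. f x \<partial>lborel) = (\<integral>x. f x \<partial>distr lborel borel ((+) c))"
    by (simp add: lborel_distr_plus)
  also have "\<dots> = (\<integral>x. f (c + x) \<partial>lborel)"
    by (rule integral_distr) (use assms in auto)
  finally show ?thesis by simp
qed

lemma integrable_lborel_translate:
  fixes f :: "'a::euclidean_space \<Rightarrow> 'b::{banach,second_countable_topology}"
  assumes "integrable lborel f"
  shows "integrable lborel (\<lambda>x. f (c + x))"
proof -
  have "integrable (distr lborel borel ((+) c)) f"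
    using assms by (simp add: lborel_distr_plus)
  then show ?thesis
    by (rule integrable_distr[rotated]) auto
qed

text \<open>Difference quotients integrate to zero by translation invariance, and the mean value
  theorem supplies a bounded dominating function of bounded support. The derivative is prescribed
  only on U because the weights used later are singular at a point off K; since f vanishes on the
  open complement of K, extending the derivative by zero is correct everywhere.\<close>

lemma integral_directional_derivative_zero:
  fixes f :: "'a::euclidean_space \<Rightarrow> real"
  assumes K: "compact K" "K \<subseteq> U"
    and zero: "\<And>x. x \<notin> K \<Longrightarrow> f x = 0"
    and der: "\<And>x. x \<in> U \<Longrightarrow> (f has_derivative f' x) (at x)"
    and cont: "continuous_on K (\<lambda>x. f' x i)"
  shows "(LINT x:K|lborel. f' x i) = 0"
proof -
  define D where "D x = (if x \<in> K then f' x i else 0)" for x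
  have oK: "open (- K)" using K(1) by (simp add: compact_imp_closed open_Compl)
  have der0: "(f has_derivative (\<lambda>h. 0)) (at x)" if "x \<notin> K" for x
    by (rule has_derivative_transform_within_open[OF _ oK])
      (use that zero in \<open>auto intro: has_derivative_const\<close>)
  have dir: "((\<lambda>t. f (x + t *\<^sub>R i)) has_real_derivative D (x + t *\<^sub>R i)) (at t)" for x t
  proof -
    define y where "y = x + t *\<^sub>R i"
    have "\<exists>F. (f has_derivative F) (at y) \<and> F i = D y"
      using der0[of y] der[of y] K(2) by (cases "y \<in> K") (auto simp: D_def)
    then obtain F where F: "(f has_derivative F) (at y)" "F i = D y" by blast
    interpret F: bounded_linear F using F(1) by (rule has_derivative_bounded_linear)
    have "((\<lambda>t. x + t *\<^sub>R i) has_derivative (\<lambda>s. s *\<^sub>R i)) (at t)"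
      by (auto intro!: derivative_eq_intros)
    from has_derivative_compose[OF this, of f F] F(1)
    have "((\<lambda>t. f (x + t *\<^sub>R i)) has_derivative (\<lambda>s. F (s *\<^sub>R i))) (at t)"
      unfolding y_def by simp
    moreover have "(\<lambda>s. F (s *\<^sub>R i)) = (\<lambda>s. s * D y)"
      using F(2) by (simp add: F.scaleR)
    ultimately show ?thesis
      unfolding has_field_derivative_def y_def by (simp add: mult.commute[of _ "D _"])
  qed
  have "bounded ((\<lambda>x. f' x i) ` K)"
    using compact_continuous_image[OF cont K(1)] by (rule compact_imp_bounded)
  then obtain B where B: "B > 0" "\<And>x. x \<in> K \<Longrightarrow> \<bar>f' x i\<bar> \<le> B"
    unfolding bounded_pos by auto
  have DB: "\<bar>D x\<bar> \<le> B" for x using B by (auto simp: D_def)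
  have fcont: "isCont f x" for x
    using der0[of x] der[of x] K(2) by (cases "x \<in> K") (auto intro: has_derivative_continuous)
  then have fc: "continuous_on UNIV f" by (simp add: continuous_at_imp_continuous_on)
  then have fm: "f \<in> borel_measurable borel" by (rule borel_measurable_continuous_onI)
  obtain R where R: "\<And>x. x \<in> K \<Longrightarrow> norm x \<le> R"
    using K(1) compact_imp_bounded bounded_iff by metis
  have fint: "integrable lborel f"
  proof -
    have "f = (\<lambda>x. indicator K x *\<^sub>R f x)"
    proof
      show "f x = indicator K x *\<^sub>R f x" for x using zero[of x] by (cases "x \<in> K") auto
    qed
    moreover have "integrable lborel (\<lambda>x. indicator K x *\<^sub>R f x)"
      by (rule borel_integrable_compact[OF K(1)]) (use fc continuous_on_subset in blast)
    ultimately show ?thesis by simp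
  qed
  \<comment> \<open>Increments of at most 1 keep the supports of all translates inside one fixed
    ball.\<close>
  define h where "h n = inverse (real (Suc n))" for n
  have hpos: "h n > 0" "h n \<le> 1" for n by (auto simp: h_def inverse_le_1_iff)
  have h0: "h \<longlonglongrightarrow> 0" unfolding h_def by (rule LIMSEQ_inverse_real_of_nat)
  define F where "F n x = (f (h n *\<^sub>R i + x) - f x) / h n" for n x
  have lim: "(\<lambda>n. F n x) \<longlonglongrightarrow> D x" for x
  proof -
    have "((\<lambda>s. (f (x + s *\<^sub>R i) - f x) / s) \<longlongrightarrow> D x) (at 0)"
      using dir[of x 0] by (simp add: DERIV_def)
    moreover have "filterlim h (at 0) sequentially"
      using h0 hpos by (auto simp: filterlim_at less_le)
    ultimately have "(\<lambda>n. (f (x + h n *\<^sub>R i) - f x) / h n) \<longlonglongrightarrow> D x"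
      by (rule filterlim_compose)
    then show ?thesis by (simp add: F_def add.commute)
  qed
  have Fint: "integrable lborel (F n)" for n
    unfolding F_def by (intro integrable_divide Bochner_Integration.integrable_diff integrable_lborel_translate fint)
  have F0: "(\<integral>x. F n x \<partial>lborel) = 0" for n
    unfolding F_def
    by (subst integral_divide_zero, subst Bochner_Integration.integral_diff)
      (auto intro: integrable_lborel_translate fint simp: integral_lborel_translate[OF fm])
  have Fb: "\<bar>F n x\<bar> \<le> B * indicator (cball 0 (R + norm i)) x" for n x
  proof (cases "x \<in> cball 0 (R + norm i)")
    case False
    then have x: "norm x > R + norm i" by simp
    have "x \<notin> K" using R[of x] x norm_ge_zero[of i] by linarith
    moreover have "h n *\<^sub>R i + x \<notin> K"
    proof
      assume "h n *\<^sub>R i + x \<in> K"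
      then have "norm (h n *\<^sub>R i + x) \<le> R" by (rule R)
      moreover have "norm (h n *\<^sub>R i) \<le> norm i" using hpos[of n] by (simp add: mult_left_le_one_le)
      moreover have "norm x \<le> norm (h n *\<^sub>R i + x) + norm (h n *\<^sub>R i)"
        using norm_triangle_ineq4[of "h n *\<^sub>R i + x" "h n *\<^sub>R i"] by simp
      ultimately show False using x by linarith
    qed
    ultimately show ?thesis using False zero by (simp add: F_def)
  next
    case True
    obtain z where z: "f (x + h n *\<^sub>R i) - f (x + 0 *\<^sub>R i) = (h n - 0) * D (x + z *\<^sub>R i)"
      using MVT2[of 0 "h n" "\<lambda>t. f (x + t *\<^sub>R i)" "\<lambda>t. D (x + t *\<^sub>R i)"] dir hpos by blast
    then have "F n x = D (x + z *\<^sub>R i)" using hpos[of n] by (simp add: F_def add.commute)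
    then show ?thesis using DB True by simp
  qed
  have "(\<lambda>n. \<integral>x. F n x \<partial>lborel) \<longlonglongrightarrow> (\<integral>x. D x \<partial>lborel)"
  proof (rule integral_dominated_convergence)
    show "D \<in> borel_measurable lborel"
      by (rule borel_measurable_LIMSEQ_real[OF lim]) (use Fint in auto)
    show "integrable lborel (\<lambda>x. B * indicator (cball 0 (R + norm i)) x)"
      by (intro integrable_mult_right integrable_real_indicator emeasure_bounded_finite) auto
  qed (use lim Fint Fb in auto)
  then have "(\<integral>x. D x \<partial>lborel) = 0" by (simp add: F0 LIMSEQ_const_iff)
  moreover have "D = (\<lambda>x. indicator K x *\<^sub>R f' x i)" by (rule ext) (simp add: D_def)
  ultimately show ?thesis by (simp add: set_lebesgue_integral_def)
qed

lemma has_derivative_imp_continuous_on: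
  assumes "\<And>x. x \<in> U \<Longrightarrow> (f has_derivative f' x) (at x)"
  shows "continuous_on U f"
proof (intro continuous_at_imp_continuous_on ballI)
  fix x assume "x \<in> U"
  from assms[OF this] show "isCont f x" by (rule has_derivative_continuous)
qed

text \<open>The divergence of a field and the Laplacian of a function are both traces of a
  derivative. With the linearity and rank-one rules below, product-rule terms become inner products
  without any computation in coordinates.\<close>

definition trace_op :: "('a::euclidean_space \<Rightarrow> 'a) \<Rightarrow> real" where
  "trace_op F = (\<Sum>i\<in>Basis. F i \<bullet> i)"

lemma trace_op_add: "trace_op (\<lambda>h. F h + G h) = trace_op F + trace_op G"
  by (simp add: trace_op_def inner_add_left sum.distrib)

lemma trace_op_diff: "trace_op (\<lambda>h. F h - G h) = trace_op F - trace_op G"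
  by (simp add: trace_op_def inner_diff_left sum_subtractf)

lemma trace_op_scaleR: "trace_op (\<lambda>h. c *\<^sub>R F h) = c * trace_op F"
  by (simp add: trace_op_def sum_distrib_left)

lemma trace_op_rank_one: "trace_op (\<lambda>h. (c \<bullet> h) *\<^sub>R v) = c \<bullet> v"
  by (simp add: trace_op_def euclidean_inner[of c v])

lemma trace_op_id: "trace_op (\<lambda>h::'a::euclidean_space. h) = DIM('a)"
  by (simp add: trace_op_def)

lemma divergence_theorem:
  fixes Y :: "'a::euclidean_space \<Rightarrow> 'a"
  assumes K: "compact K" "K \<subseteq> U"
    and zero: "\<And>x. x \<notin> K \<Longrightarrow> Y x = 0"
    and der: "\<And>x. x \<in> U \<Longrightarrow> (Y has_derivative DY x) (at x)"
    and cont: "\<And>h. continuous_on K (\<lambda>x. DY x h)"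
  shows "(LINT x:K|lborel. trace_op (DY x)) = 0"
proof -
  have "(LINT x:K|lborel. DY x i \<bullet> i) = 0" for i
    by (rule integral_directional_derivative_zero[OF K, where f="\<lambda>x. Y x \<bullet> i" and f'="\<lambda>x h. DY x h \<bullet> i"])
      (auto simp: zero intro!: has_derivative_inner_left der continuous_intros cont)
  moreover have "set_integrable lborel K (\<lambda>x. DY x i \<bullet> i)" for i
    unfolding set_integrable_def
    by (rule borel_integrable_compact[OF K(1)]) (intro continuous_intros cont)
  ultimately show ?thesis
    unfolding trace_op_def set_lebesgue_integral_def set_integrable_def scaleR_sum_right
    by (subst Bochner_Integration.integral_sum) auto
qed

text \<open>The derivatives are carried along as data, the Hessian as a linear map. Its symmetry is
  a clause of the definition: it is visible for the weight and the radial functions, and products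
  and convolutions preserve it.\<close>

definition C2_on ::
  "'a::euclidean_space set \<Rightarrow> ('a \<Rightarrow> real) \<Rightarrow> ('a \<Rightarrow> 'a) \<Rightarrow> ('a \<Rightarrow> 'a \<Rightarrow> 'a) \<Rightarrow> bool" where
  "C2_on U f Df D2f \<longleftrightarrow>
    (\<forall>x\<in>U. (f has_derivative (\<lambda>h. Df x \<bullet> h)) (at x)) \<and>
    (\<forall>x\<in>U. (Df has_derivative D2f x) (at x)) \<and>
    (\<forall>x\<in>U. \<forall>h k. D2f x h \<bullet> k = D2f x k \<bullet> h) \<and>
    (\<forall>h. continuous_on U (\<lambda>x. D2f x h))"

lemma C2_onD:
  assumes "C2_on U f Df D2f"
  shows "x \<in> U \<Longrightarrow> (f has_derivative (\<lambda>h. Df x \<bullet> h)) (at x)"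
    "x \<in> U \<Longrightarrow> (Df has_derivative D2f x) (at x)"
    "x \<in> U \<Longrightarrow> D2f x h \<bullet> k = D2f x k \<bullet> h"
    "continuous_on U (\<lambda>x. D2f x h)" "continuous_on U Df" "continuous_on U f"
proof -
  show c: "continuous_on U Df" "continuous_on U f"
    using assms unfolding C2_on_def
    by (meson continuous_at_imp_continuous_on has_derivative_continuous)+
qed (use assms in \<open>auto simp: C2_on_def\<close>)

lemma C2_on_subset: "C2_on U f Df D2f \<Longrightarrow> V \<subseteq> U \<Longrightarrow> C2_on V f Df D2f"
  unfolding C2_on_def by (meson continuous_on_subset subsetD)

lemma C2_on_mult:
  assumes f: "C2_on U f Df D2f" and g: "C2_on U g Dg D2g"
  shows "C2_on U (\<lambda>x. f x * g x) (\<lambda>x. f x *\<^sub>R Dg x + g x *\<^sub>R Df x)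
    (\<lambda>x h. f x *\<^sub>R D2g x h + (Df x \<bullet> h) *\<^sub>R Dg x + (Dg x \<bullet> h) *\<^sub>R Df x + g x *\<^sub>R D2f x h)"
  unfolding C2_on_def
proof (intro conjI ballI allI)
  fix x assume x: "x \<in> U"
  note d = C2_onD(1,2)[OF f x] C2_onD(1,2)[OF g x]
  show "((\<lambda>x. f x * g x) has_derivative (\<lambda>h. (f x *\<^sub>R Dg x + g x *\<^sub>R Df x) \<bullet> h)) (at x)"
    by (rule has_derivative_eq_rhs[OF has_derivative_mult[OF d(1) d(3)]])
      (auto simp: inner_add_left)
  show "((\<lambda>x. f x *\<^sub>R Dg x + g x *\<^sub>R Df x) has_derivative
     (\<lambda>h. f x *\<^sub>R D2g x h + (Df x \<bullet> h) *\<^sub>R Dg x + (Dg x \<bullet> h) *\<^sub>R Df x + g x *\<^sub>R D2f x h)) (at x)"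
    by (rule has_derivative_eq_rhs[OF has_derivative_add[OF has_derivative_scaleR[OF d(1) d(4)]
            has_derivative_scaleR[OF d(3) d(2)]]])
      (auto simp: algebra_simps)
  fix h k
  show "(f x *\<^sub>R D2g x h + (Df x \<bullet> h) *\<^sub>R Dg x + (Dg x \<bullet> h) *\<^sub>R Df x + g x *\<^sub>R D2f x h) \<bullet> k
    = (f x *\<^sub>R D2g x k + (Df x \<bullet> k) *\<^sub>R Dg x + (Dg x \<bullet> k) *\<^sub>R Df x + g x *\<^sub>R D2f x k) \<bullet> h"
    using C2_onD(3)[OF f x, of h k] C2_onD(3)[OF g x, of h k] by (simp add: inner_add_left)
next
  fix h
  show "continuous_on U (\<lambda>x. f x *\<^sub>R D2g x h + (Df x \<bullet> h) *\<^sub>R Dg x + (Dg x \<bullet> h) *\<^sub>R Df x + g x *\<^sub>R D2f x h)"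
    by (intro continuous_intros C2_onD(4-6)[OF f] C2_onD(4-6)[OF g])
qed

text \<open>The integrands of the next two identities are the divergences of
  \<open>2 ((x - a) \<bullet> \<nabla>g) \<nabla>g - \<bar>\<nabla>g\<bar>\<^sup>2 (x - a) + (d - 2) g \<nabla>g + q g\<^sup>2 (x - a) - (d - 2) p g\<^sup>2 (x - a)\<close>
  and of \<open>g \<nabla>g - p g\<^sup>2 (x - a)\<close>.\<close>

lemma rellich_identity:
  fixes g p q :: "'a::euclidean_space \<Rightarrow> real" and a :: 'a
  assumes K: "compact K" "K \<subseteq> U"
    and g: "C2_on U g Dg D2g" and zero: "\<And>x. x \<notin> K \<Longrightarrow> g x = 0" "\<And>x. x \<notin> K \<Longrightarrow> Dg x = 0"
    and p: "\<And>x. x \<in> U \<Longrightarrow> (p has_derivative (\<lambda>h. Dp x \<bullet> h)) (at x)" "continuous_on U Dp"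
    and q: "\<And>x. x \<in> U \<Longrightarrow> (q has_derivative (\<lambda>h. Dq x \<bullet> h)) (at x)" "continuous_on U Dq"
  shows "(LINT x:K|lborel.
      (trace_op (D2g x) - 2 * p x * ((x - a) \<bullet> Dg x) + q x * g x) * (2 * ((x - a) \<bullet> Dg x) + (real DIM('a) - 2) * g x)
      + 4 * p x * ((x - a) \<bullet> Dg x)\<^sup>2
      + (2 * q x + (x - a) \<bullet> Dq x - (real DIM('a) - 2) * (real DIM('a) * p x + (x - a) \<bullet> Dp x)) * (g x)\<^sup>2) = 0"
proof -
  define d :: real where "d = DIM('a)"
  define Y where "Y x = (2 * ((x - a) \<bullet> Dg x)) *\<^sub>R Dg x - (Dg x \<bullet> Dg x) *\<^sub>R (x - a)
     + ((d - 2) * g x) *\<^sub>R Dg x + (q x * (g x * g x)) *\<^sub>R (x - a)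
     - ((d - 2) * (g x * g x * p x)) *\<^sub>R (x - a)" for x
  define DY where "DY x h = (2 * ((x - a) \<bullet> Dg x)) *\<^sub>R D2g x h + 2 *\<^sub>R ((Dg x \<bullet> h) *\<^sub>R Dg x)
       + 2 *\<^sub>R ((D2g x (x - a) \<bullet> h) *\<^sub>R Dg x)
     - ((Dg x \<bullet> Dg x) *\<^sub>R h + 2 *\<^sub>R ((D2g x (Dg x) \<bullet> h) *\<^sub>R (x - a)))
     + (((d - 2) * g x) *\<^sub>R D2g x h + (d - 2) *\<^sub>R ((Dg x \<bullet> h) *\<^sub>R Dg x))
     + ((q x * (g x * g x)) *\<^sub>R h + (g x * g x) *\<^sub>R ((Dq x \<bullet> h) *\<^sub>R (x - a))
         + (2 * q x * g x) *\<^sub>R ((Dg x \<bullet> h) *\<^sub>R (x - a)))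
     - (((d - 2) * (g x * g x * p x)) *\<^sub>R h
         + ((d - 2) * (2 * g x * p x)) *\<^sub>R ((Dg x \<bullet> h) *\<^sub>R (x - a))
         + ((d - 2) * (g x * g x)) *\<^sub>R ((Dp x \<bullet> h) *\<^sub>R (x - a)))" for x h
  \<comment> \<open>This is the form that the product rule yields. In \<open>DY\<close>, symmetry of
    the Hessian has freed h from \<open>D2g\<close>, so that every such term is a scalar product
    with h times a vector and \<open>trace_op_rank_one\<close> applies.\<close>
  define DY' where "DY' x h = (2 * ((x - a) \<bullet> Dg x)) *\<^sub>R D2g x h + 2 *\<^sub>R ((Dg x \<bullet> h) *\<^sub>R Dg x)
       + 2 *\<^sub>R ((D2g x h \<bullet> (x - a)) *\<^sub>R Dg x)
     - ((Dg x \<bullet> Dg x) *\<^sub>R h + 2 *\<^sub>R ((D2g x h \<bullet> Dg x) *\<^sub>R (x - a)))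
     + (((d - 2) * g x) *\<^sub>R D2g x h + (d - 2) *\<^sub>R ((Dg x \<bullet> h) *\<^sub>R Dg x))
     + ((q x * (g x * g x)) *\<^sub>R h + (g x * g x) *\<^sub>R ((Dq x \<bullet> h) *\<^sub>R (x - a))
         + (2 * q x * g x) *\<^sub>R ((Dg x \<bullet> h) *\<^sub>R (x - a)))
     - (((d - 2) * (g x * g x * p x)) *\<^sub>R h
         + ((d - 2) * (2 * g x * p x)) *\<^sub>R ((Dg x \<bullet> h) *\<^sub>R (x - a))
         + ((d - 2) * (g x * g x)) *\<^sub>R ((Dp x \<bullet> h) *\<^sub>R (x - a)))" for x h
  have DY': "DY x h = DY' x h" if "x \<in> U" for x h
    unfolding DY_def DY'_def using C2_onD(3)[OF g that] by simp
  have der: "(Y has_derivative DY' x) (at x)" if "x \<in> U" for x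
  proof -
    note gd = C2_onD(1,2)[OF g that]
    have id: "((\<lambda>x. x - a) has_derivative (\<lambda>h. h)) (at x)"
      by (auto intro!: derivative_eq_intros)
    have s1: "((\<lambda>x. 2 * ((x - a) \<bullet> Dg x)) has_derivative
        (\<lambda>h. 2 * (Dg x \<bullet> h + D2g x h \<bullet> (x - a)))) (at x)"
      by (rule has_derivative_eq_rhs[OF has_derivative_mult_right[OF has_derivative_inner[OF id gd(2)]]])
        (simp add: inner_commute add.commute)
    have s2: "((\<lambda>x. Dg x \<bullet> Dg x) has_derivative (\<lambda>h. 2 * (D2g x h \<bullet> Dg x))) (at x)"
      by (rule has_derivative_eq_rhs[OF has_derivative_inner[OF gd(2) gd(2)]])
        (simp add: inner_commute)
    have s3: "((\<lambda>x. g x * g x) has_derivative (\<lambda>h. 2 * g x * (Dg x \<bullet> h))) (at x)"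
      by (rule has_derivative_eq_rhs[OF has_derivative_mult[OF gd(1) gd(1)]]) (simp add: fun_eq_iff)
    note s4 = has_derivative_mult_right[OF gd(1), of "d - 2"]
    note s5 = has_derivative_mult[OF q(1)[OF that] s3]
    note s6 = has_derivative_mult_right[OF has_derivative_mult[OF s3 p(1)[OF that]], of "d - 2"]
    show ?thesis
      unfolding Y_def
      by (rule has_derivative_eq_rhs[OF
          has_derivative_diff[OF has_derivative_add[OF has_derivative_add[OF has_derivative_diff[OF
          has_derivative_scaleR[OF s1 gd(2)] has_derivative_scaleR[OF s2 id]]
          has_derivative_scaleR[OF s4 gd(2)]] has_derivative_scaleR[OF s5 id]]
          has_derivative_scaleR[OF s6 id]]])
        (simp add: fun_eq_iff DY'_def scaleR_add_left scaleR_add_right distrib_left mult_ac)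
  qed
  have cont: "continuous_on K (\<lambda>x. DY' x h)" for h
  proof -
    have sub: "continuous_on K f" if "continuous_on U f" for f :: "'a \<Rightarrow> 'c::topological_space"
      using that K(2) continuous_on_subset by blast
    have "continuous_on U p"
      by (rule has_derivative_imp_continuous_on[OF p(1)])
    moreover have "continuous_on U q"
      by (rule has_derivative_imp_continuous_on[OF q(1)])
    ultimately have c: "continuous_on U p" "continuous_on U q" by auto
    note [THEN sub, continuous_intros] = c p(2) q(2) C2_onD(4-6)[OF g]
    show ?thesis unfolding DY'_def by (intro continuous_intros)
  qed
  have "(LINT x:K|lborel. trace_op (DY' x)) = 0"
    by (rule divergence_theorem[OF K _ der cont]) (auto simp: Y_def zero)
  also have "(LINT x:K|lborel. trace_op (DY' x)) = (LINT x:K|lborel.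
      (trace_op (D2g x) - 2 * p x * ((x - a) \<bullet> Dg x) + q x * g x) * (2 * ((x - a) \<bullet> Dg x) + (d - 2) * g x)
      + 4 * p x * ((x - a) \<bullet> Dg x)\<^sup>2
      + (2 * q x + (x - a) \<bullet> Dq x - (d - 2) * (d * p x + (x - a) \<bullet> Dp x)) * (g x)\<^sup>2)"
  proof (rule set_lebesgue_integral_cong, simp add: K compact_imp_closed, intro allI impI)
    fix x assume "x \<in> K"
    then have x: "x \<in> U" using K by auto
    \<comment> \<open>The two Hessian terms that pair x - a with \<nabla>g cancel by symmetry, and
      |\<nabla>g|^2 receives the coefficient 2 - d + (d - 2) = 0. The summand (d - 2) g of the
      multiplier is there for this second cancellation.\<close>
    have "trace_op (DY' x) = trace_op (DY x)" using DY'[OF x] by presburger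
    also have "\<dots> = (trace_op (D2g x) - 2 * p x * ((x - a) \<bullet> Dg x) + q x * g x) * (2 * ((x - a) \<bullet> Dg x) + (d - 2) * g x)
      + 4 * p x * ((x - a) \<bullet> Dg x)\<^sup>2
      + (2 * q x + (x - a) \<bullet> Dq x - (d - 2) * (d * p x + (x - a) \<bullet> Dp x)) * (g x)\<^sup>2"
      unfolding DY_def trace_op_add trace_op_diff trace_op_scaleR trace_op_rank_one trace_op_id
      using C2_onD(3)[OF g x, of "Dg x" "x - a"]
      by (simp add: d_def[symmetric] inner_commute power2_eq_square algebra_simps)
    finally show "trace_op (DY' x) = (trace_op (D2g x) - 2 * p x * ((x - a) \<bullet> Dg x) + q x * g x) * (2 * ((x - a) \<bullet> Dg x) + (d - 2) * g x)
      + 4 * p x * ((x - a) \<bullet> Dg x)\<^sup>2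
      + (2 * q x + (x - a) \<bullet> Dq x - (d - 2) * (d * p x + (x - a) \<bullet> Dp x)) * (g x)\<^sup>2" .
  qed
  finally show ?thesis unfolding d_def .
qed

lemma energy_identity:
  fixes g p q :: "'a::euclidean_space \<Rightarrow> real" and a :: 'a
  assumes K: "compact K" "K \<subseteq> U"
    and g: "C2_on U g Dg D2g" and zero: "\<And>x. x \<notin> K \<Longrightarrow> g x = 0" "\<And>x. x \<notin> K \<Longrightarrow> Dg x = 0"
    and p: "\<And>x. x \<in> U \<Longrightarrow> (p has_derivative (\<lambda>h. Dp x \<bullet> h)) (at x)" "continuous_on U Dp"
  shows "(LINT x:K|lborel.
      (trace_op (D2g x) - 2 * p x * ((x - a) \<bullet> Dg x) + q x * g x) * g x + Dg x \<bullet> Dg x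
      - (real DIM('a) * p x + (x - a) \<bullet> Dp x + q x) * (g x)\<^sup>2) = 0"
proof -
  define d :: real where "d = DIM('a)"
  define Y where "Y x = g x *\<^sub>R Dg x - (g x * g x * p x) *\<^sub>R (x - a)" for x
  define DY where "DY x h = g x *\<^sub>R D2g x h + (Dg x \<bullet> h) *\<^sub>R Dg x
     - ((g x * g x * p x) *\<^sub>R h + (2 * g x * p x) *\<^sub>R ((Dg x \<bullet> h) *\<^sub>R (x - a))
         + (g x * g x) *\<^sub>R ((Dp x \<bullet> h) *\<^sub>R (x - a)))" for x h
  have der: "(Y has_derivative DY x) (at x)" if "x \<in> U" for x
  proof -
    note gd = C2_onD(1,2)[OF g that]
    have id: "((\<lambda>x. x - a) has_derivative (\<lambda>h. h)) (at x)"
      by (auto intro!: derivative_eq_intros)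
    have s3: "((\<lambda>x. g x * g x) has_derivative (\<lambda>h. 2 * g x * (Dg x \<bullet> h))) (at x)"
      by (rule has_derivative_eq_rhs[OF has_derivative_mult[OF gd(1) gd(1)]]) (simp add: fun_eq_iff)
    note s6 = has_derivative_mult[OF s3 p(1)[OF that]]
    show ?thesis
      unfolding Y_def
      by (rule has_derivative_eq_rhs[OF
          has_derivative_diff[OF has_derivative_scaleR[OF gd(1) gd(2)] has_derivative_scaleR[OF s6 id]]])
        (simp add: fun_eq_iff DY_def scaleR_add_left scaleR_add_right distrib_left mult_ac)
  qed
  have cont: "continuous_on K (\<lambda>x. DY x h)" for h
  proof -
    have sub: "continuous_on K f" if "continuous_on U f" for f :: "'a \<Rightarrow> 'c::topological_space"
      using that K(2) continuous_on_subset by blast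
    have "continuous_on U p"
      by (rule has_derivative_imp_continuous_on[OF p(1)])
    note [THEN sub, continuous_intros] = this p(2) C2_onD(4-6)[OF g]
    show ?thesis unfolding DY_def by (intro continuous_intros)
  qed
  have "(LINT x:K|lborel. trace_op (DY x)) = 0"
    by (rule divergence_theorem[OF K _ der cont]) (auto simp: Y_def zero)
  also have "(LINT x:K|lborel. trace_op (DY x)) = (LINT x:K|lborel.
      (trace_op (D2g x) - 2 * p x * ((x - a) \<bullet> Dg x) + q x * g x) * g x + Dg x \<bullet> Dg x
      - (d * p x + (x - a) \<bullet> Dp x + q x) * (g x)\<^sup>2)"
    unfolding DY_def trace_op_add trace_op_diff trace_op_scaleR trace_op_rank_one trace_op_id
    by (simp add: d_def[symmetric] inner_commute power2_eq_square algebra_simps)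
  finally show ?thesis unfolding d_def .
qed

section \<open>The Carleman estimate\<close>

definition rp :: "'a::euclidean_space \<Rightarrow> real \<Rightarrow> 'a \<Rightarrow> real" where
  "rp a p x = norm (x - a) powr p"

lemma rp_nonneg: "0 \<le> rp a p x" by (simp add: rp_def)
lemma rp_pos: "x \<noteq> a \<Longrightarrow> 0 < rp a p x" by (simp add: rp_def)
lemma rp_add: "rp a (p + q) x = rp a p x * rp a q x" by (simp add: rp_def powr_add)

lemma rp_2: "rp a 2 x = (x - a) \<bullet> (x - a)"
  by (simp add: rp_def power2_norm_eq_inner)

lemma rp_has_derivative:
  assumes "x \<noteq> a"
  shows "(rp a p has_derivative (\<lambda>h. ((p * rp a (p - 2) x) *\<^sub>R (x - a)) \<bullet> h)) (at x)"
proof -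
  have pos: "norm (x - a) > 0" using assms by simp
  have n: "((\<lambda>x. norm (x - a)) has_derivative (\<lambda>h. h \<bullet> sgn (x - a))) (at x)"
  proof -
    have "((\<lambda>x. x - a) has_derivative (\<lambda>h. h)) (at x)"
      by (auto intro!: derivative_eq_intros)
    then show ?thesis
      using has_derivative_compose[of "\<lambda>x. x - a" "\<lambda>h. h" x UNIV norm "\<lambda>h. h \<bullet> sgn (x - a)"]
        has_derivative_norm[of "x - a"] assms by simp
  qed
  have d: "((\<lambda>z. z powr p) has_derivative (\<lambda>t. p * norm (x - a) powr (p - 1) * t)) (at (norm (x - a)))"
    using has_real_derivative_powr[OF pos, of p] by (simp add: has_field_derivative_def)
  have "((\<lambda>x. norm (x - a) powr p) has_derivative
      (\<lambda>h. p * norm (x - a) powr (p - 1) * (h \<bullet> sgn (x - a)))) (at x)"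
    using has_derivative_compose[OF n d] .
  moreover have "p * norm (x - a) powr (p - 1) * (h \<bullet> sgn (x - a))
      = ((p * rp a (p - 2) x) *\<^sub>R (x - a)) \<bullet> h" for h
  proof -
    have "norm (x - a) powr (p - 1) = norm (x - a) powr (p - 2) * norm (x - a)"
      using pos powr_add[of "norm (x - a)" "p - 2" 1] by simp
    moreover have "h \<bullet> sgn (x - a) = ((x - a) \<bullet> h) / norm (x - a)"
      by (simp only: sgn_div_norm inner_scaleR_right inner_commute[of h] divide_inverse mult.commute)
    ultimately show ?thesis using pos by (simp only: rp_def inner_scaleR_left) simp
  qed
  ultimately show ?thesis unfolding rp_def[abs_def] by simp
qed

lemma rp_continuous_on: "continuous_on (- {a}) (rp a p)"
  by (rule has_derivative_imp_continuous_on) (auto intro: rp_has_derivative)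

text \<open>With \<open>r = norm (x - a)\<close> and the Carleman weight \<open>\<phi> = l r + 2 \<tau> \<surd>r\<close>: \<open>rp a p = r\<^sup>p\<close>, \<open>\<nabla>\<phi> = cpsi *\<^sub>R (x - a)\<close>,
  \<open>cq = \<bar>\<nabla>\<phi>\<bar>\<^sup>2 - \<Delta>\<phi> + k\<close>, \<open>cE = exp (\<phi> + \<beta> \<bullet> x / 2)\<close> and \<open>\<nabla>cE = cE *\<^sub>R cP\<close>.\<close>

definition cpsi :: "'a::euclidean_space \<Rightarrow> real \<Rightarrow> real \<Rightarrow> 'a \<Rightarrow> real" where
  "cpsi a l \<tau> x = l * rp a (-1) x + \<tau> * rp a (-3/2) x"

definition Dcpsi :: "'a::euclidean_space \<Rightarrow> real \<Rightarrow> real \<Rightarrow> 'a \<Rightarrow> 'a" where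
  "Dcpsi a l \<tau> x = (- l * rp a (-3) x - 3/2 * \<tau> * rp a (-7/2) x) *\<^sub>R (x - a)"

definition cq :: "'a::euclidean_space \<Rightarrow> real \<Rightarrow> real \<Rightarrow> real \<Rightarrow> 'a \<Rightarrow> real" where
  "cq a l k \<tau> x = (l\<^sup>2 + k) + 2 * l * \<tau> * rp a (-1/2) x + (\<tau>\<^sup>2 - l * (real DIM('a) - 1)) * rp a (-1) x
     - \<tau> * (real DIM('a) - 3/2) * rp a (-3/2) x"

definition Dcq :: "'a::euclidean_space \<Rightarrow> real \<Rightarrow> real \<Rightarrow> 'a \<Rightarrow> 'a" where
  "Dcq a l \<tau> x = (- l * \<tau> * rp a (-5/2) x - (\<tau>\<^sup>2 - l * (real DIM('a) - 1)) * rp a (-3) x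
     + 3/2 * \<tau> * (real DIM('a) - 3/2) * rp a (-7/2) x) *\<^sub>R (x - a)"

definition cP :: "'a::euclidean_space \<Rightarrow> 'a \<Rightarrow> real \<Rightarrow> real \<Rightarrow> 'a \<Rightarrow> 'a" where
  "cP a \<beta> l \<tau> x = cpsi a l \<tau> x *\<^sub>R (x - a) + (1/2) *\<^sub>R \<beta>"

definition cE :: "'a::euclidean_space \<Rightarrow> 'a \<Rightarrow> real \<Rightarrow> real \<Rightarrow> 'a \<Rightarrow> real" where
  "cE a \<beta> l \<tau> x = exp (l * norm (x - a) + 2 * \<tau> * sqrt (norm (x - a)) + (\<beta> \<bullet> x) / 2)"

lemma cE_pos: "0 < cE a \<beta> l \<tau> x" by (simp add: cE_def)

lemma cpsi_has_derivative:
  assumes "x \<noteq> a"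
  shows "(cpsi a l \<tau> has_derivative (\<lambda>h. Dcpsi a l \<tau> x \<bullet> h)) (at x)"
  unfolding cpsi_def[abs_def]
  by (rule has_derivative_eq_rhs[OF has_derivative_add[OF
        has_derivative_mult_right[OF rp_has_derivative[OF assms]]
        has_derivative_mult_right[OF rp_has_derivative[OF assms]]]])
    (simp add: fun_eq_iff Dcpsi_def inner_add_left algebra_simps)

lemma cq_arith:
  fixes z :: real
  shows "0 + 2 * l * \<tau> * (- 1 / 2 * rp a (- 1 / 2 - 2) x * z) +
      (\<tau>\<^sup>2 - l * e) * (- 1 * rp a (- 1 - 2) x * z) - \<tau> * f * (- 3 / 2 * rp a (- 3 / 2 - 2) x * z)
    = (- l * \<tau> * rp a (- 5 / 2) x - (\<tau>\<^sup>2 - l * e) * rp a (- 3) x + 3 / 2 * \<tau> * f * rp a (- 7 / 2) x) * z"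
  by (simp add: algebra_simps)

lemma cq_has_derivative:
  fixes x :: "'a::euclidean_space"
  assumes "x \<noteq> a"
  shows "(cq a l k \<tau> has_derivative (\<lambda>h. Dcq a l \<tau> x \<bullet> h)) (at x)"
  unfolding cq_def[abs_def]
  by (rule has_derivative_eq_rhs[OF has_derivative_diff[OF has_derivative_add[OF has_derivative_add[OF
        has_derivative_const has_derivative_mult_right[OF rp_has_derivative[OF assms]]]
        has_derivative_mult_right[OF rp_has_derivative[OF assms]]]
        has_derivative_mult_right[OF rp_has_derivative[OF assms]]]])
    (rule ext, unfold Dcq_def inner_scaleR_left, rule cq_arith)

text \<open>For E with \<nabla>E = E P, the Hessian is E times the sum of the rank-one map of P and
  the derivative of P. In this shape the factor E can be split off after conjugation.\<close>

lemma C2_on_cE: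
  "C2_on (- {a}) (cE a \<beta> l \<tau>) (\<lambda>x. cE a \<beta> l \<tau> x *\<^sub>R cP a \<beta> l \<tau> x)
    (\<lambda>x h. cE a \<beta> l \<tau> x *\<^sub>R ((cP a \<beta> l \<tau> x \<bullet> h) *\<^sub>R cP a \<beta> l \<tau> x
        + ((Dcpsi a l \<tau> x \<bullet> h) *\<^sub>R (x - a) + cpsi a l \<tau> x *\<^sub>R h)))"
proof -
  have dE: "(cE a \<beta> l \<tau> has_derivative (\<lambda>h. (cE a \<beta> l \<tau> x *\<^sub>R cP a \<beta> l \<tau> x) \<bullet> h)) (at x)"
    if "x \<in> - {a}" for x
  proof -
    have xa: "x \<noteq> a" using that by simp
    have "cE a \<beta> l \<tau> = (\<lambda>x. exp (l * rp a 1 x + (2 * \<tau>) * rp a (1/2) x + (1/2) * (\<beta> \<bullet> x)))"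
      by (rule ext) (simp add: cE_def rp_def powr_half_sqrt)
    moreover have "((\<lambda>x. exp (l * rp a 1 x + (2 * \<tau>) * rp a (1/2) x + (1/2) * (\<beta> \<bullet> x))) has_derivative
       (\<lambda>h. (cE a \<beta> l \<tau> x *\<^sub>R cP a \<beta> l \<tau> x) \<bullet> h)) (at x)"
      by (rule has_derivative_eq_rhs[OF has_derivative_exp[OF has_derivative_add[OF has_derivative_add[OF
        has_derivative_mult_right[OF rp_has_derivative[OF xa]]
        has_derivative_mult_right[OF rp_has_derivative[OF xa]]]
        has_derivative_mult_right[OF has_derivative_inner_right[OF has_derivative_ident]]]]])
       (simp add: fun_eq_iff cE_def cP_def cpsi_def rp_def powr_half_sqrt inner_add_left algebra_simps)
    ultimately show ?thesis by simp
  qed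
  have dP: "(cP a \<beta> l \<tau> has_derivative (\<lambda>h. (Dcpsi a l \<tau> x \<bullet> h) *\<^sub>R (x - a) + cpsi a l \<tau> x *\<^sub>R h)) (at x)"
    if "x \<in> - {a}" for x
  proof -
    have xa: "x \<noteq> a" using that by simp
    have id: "((\<lambda>x. x - a) has_derivative (\<lambda>h. h)) (at x)"
      by (auto intro!: derivative_eq_intros)
    show ?thesis
      unfolding cP_def[abs_def]
      by (rule has_derivative_eq_rhs[OF has_derivative_add[OF
            has_derivative_scaleR[OF cpsi_has_derivative[OF xa] id] has_derivative_const]])
        (simp add: fun_eq_iff)
  qed
  have c: "continuous_on (- {a}) (cE a \<beta> l \<tau>)" "continuous_on (- {a}) (cP a \<beta> l \<tau>)"
    "continuous_on (- {a}) (cpsi a l \<tau>)" "continuous_on (- {a}) (Dcpsi a l \<tau>)"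
    by (rule has_derivative_imp_continuous_on[OF dE], simp)
      (rule has_derivative_imp_continuous_on[OF dP], simp,
       rule has_derivative_imp_continuous_on[OF cpsi_has_derivative], simp,
       unfold Dcpsi_def[abs_def], intro continuous_intros rp_continuous_on)
  show ?thesis
    unfolding C2_on_def
  proof (intro conjI ballI allI)
    fix x assume x: "x \<in> - {a}"
    show "(cE a \<beta> l \<tau> has_derivative (\<lambda>h. (cE a \<beta> l \<tau> x *\<^sub>R cP a \<beta> l \<tau> x) \<bullet> h)) (at x)"
      by (rule dE[OF x])
    show "((\<lambda>x. cE a \<beta> l \<tau> x *\<^sub>R cP a \<beta> l \<tau> x) has_derivative
      (\<lambda>h. cE a \<beta> l \<tau> x *\<^sub>R ((cP a \<beta> l \<tau> x \<bullet> h) *\<^sub>R cP a \<beta> l \<tau> x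
        + ((Dcpsi a l \<tau> x \<bullet> h) *\<^sub>R (x - a) + cpsi a l \<tau> x *\<^sub>R h)))) (at x)"
      by (rule has_derivative_eq_rhs[OF has_derivative_scaleR[OF dE[OF x] dP[OF x]]])
        (simp add: fun_eq_iff algebra_simps)
    fix h k
    show "(cE a \<beta> l \<tau> x *\<^sub>R ((cP a \<beta> l \<tau> x \<bullet> h) *\<^sub>R cP a \<beta> l \<tau> x
        + ((Dcpsi a l \<tau> x \<bullet> h) *\<^sub>R (x - a) + cpsi a l \<tau> x *\<^sub>R h))) \<bullet> k
      = (cE a \<beta> l \<tau> x *\<^sub>R ((cP a \<beta> l \<tau> x \<bullet> k) *\<^sub>R cP a \<beta> l \<tau> x
        + ((Dcpsi a l \<tau> x \<bullet> k) *\<^sub>R (x - a) + cpsi a l \<tau> x *\<^sub>R k))) \<bullet> h"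
      by (simp add: inner_add_left Dcpsi_def inner_commute[of h k])
  next
    fix h
    show "continuous_on (- {a}) (\<lambda>x. cE a \<beta> l \<tau> x *\<^sub>R ((cP a \<beta> l \<tau> x \<bullet> h) *\<^sub>R cP a \<beta> l \<tau> x
        + ((Dcpsi a l \<tau> x \<bullet> h) *\<^sub>R (x - a) + cpsi a l \<tau> x *\<^sub>R h)))"
      by (intro continuous_intros c)
  qed
qed

text \<open>In terms of s = r^(-1/2) the weight, its derivatives and the remaining powers of r are
  integer powers of s, so the identities and inequalities that follow are polynomial in s.\<close>

lemma rp_as_powers:
  assumes "x \<noteq> a" and s: "s = rp a (-1/2) x"
  shows "rp a (-1) x = s^2" "rp a (-3/2) x = s^3" "s > 0"
    "rp a (3/2) x * s ^ 3 = 1" "(x - a) \<bullet> (x - a) * s^4 = 1"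
    "rp a (-5/2) x * ((x - a) \<bullet> (x - a)) = s"
    "rp a (-3) x * ((x - a) \<bullet> (x - a)) = s^2"
    "rp a (-7/2) x * ((x - a) \<bullet> (x - a)) = s^3"
proof -
  have n: "norm (x - a) > 0" using assms by simp
  show "s > 0" using assms rp_pos by simp
  have pw: "rp a (- real n / 2) x = s ^ n" for n
  proof -
    have "s ^ n = (norm (x - a) powr (-1/2)) powr real n"
      using n by (simp add: s rp_def powr_realpow)
    then show ?thesis by (simp add: powr_powr rp_def)
  qed
  show 1: "rp a (-1) x = s^2" "rp a (-3/2) x = s^3" using pw[of 2] pw[of 3] by simp_all
  show "rp a (3/2) x * s ^ 3 = 1" "(x - a) \<bullet> (x - a) * s^4 = 1"
    using n pw[of 3] pw[of 4] rp_add[of a "3/2" "-3/2" x] rp_add[of a 2 "-2" x]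
    by (simp_all add: rp_2[symmetric]) (simp_all add: rp_def)
  show "rp a (-5/2) x * ((x - a) \<bullet> (x - a)) = s"
    "rp a (-3) x * ((x - a) \<bullet> (x - a)) = s^2"
    "rp a (-7/2) x * ((x - a) \<bullet> (x - a)) = s^3"
    using rp_add[of a "-5/2" 2 x] rp_add[of a "-3" 2 x] rp_add[of a "-7/2" 2 x] 1
    by (simp_all add: rp_2[symmetric] s)
qed

text \<open>Conjugating \<open>\<Delta> + \<beta> \<bullet> \<nabla> + (\<bar>\<beta>\<bar>\<^sup>2/4 + k)\<close> with \<open>cE\<close> removes the drift and gives
  \<open>\<Delta> - 2 \<nabla>\<phi> \<bullet> \<nabla> + cq\<close>.\<close>

lemma conjugated_operator:
  fixes x a \<beta> :: "'a::euclidean_space" and l \<tau> :: real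
  assumes x: "x \<noteq> a"
  defines "E \<equiv> cE a \<beta> l \<tau> x" and "P \<equiv> cP a \<beta> l \<tau> x" and "p \<equiv> cpsi a l \<tau> x" and "Dp \<equiv> Dcpsi a l \<tau> x"
  shows "(E * D2v + 2 * (E *\<^sub>R P \<bullet> Dv) + v * (E * (P \<bullet> P + (Dp \<bullet> (x - a) + p * real DIM('a)))))
     - 2 * p * ((x - a) \<bullet> (E *\<^sub>R Dv + v *\<^sub>R (E *\<^sub>R P))) + cq a l k \<tau> x * (E * v)
     = E * (D2v + \<beta> \<bullet> Dv + (\<beta> \<bullet> \<beta> / 4 + k) * v)"
proof -
  define s where "s = rp a (-1/2) x"
  note r = rp_as_powers[OF x s_def]
  define t where "t = (x - a) \<bullet> (x - a)"
  have p: "p = l * s^2 + \<tau> * s^3" unfolding p_def cpsi_def r by simp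
  have Dp: "Dp \<bullet> (x - a) = - l * s^2 - 3/2 * \<tau> * s^3"
    unfolding Dp_def Dcpsi_def inner_scaleR_left left_diff_distrib mult.assoc r(7,8) by simp
  have q: "cq a l k \<tau> x = p\<^sup>2 * t + k - (Dp \<bullet> (x - a) + p * real DIM('a))"
  proof -
    have "p\<^sup>2 * t = (l + \<tau> * s)\<^sup>2 * (t * s^4)" unfolding p by algebra
    also have "t * s ^ 4 = 1" using r(5) by (simp add: t_def)
    finally have "p\<^sup>2 * t = (l + \<tau> * s)\<^sup>2" by simp
    note pt = this
    have "l\<^sup>2 + k + 2 * l * \<tau> * s + (\<tau>\<^sup>2 - l * (d - 1)) * s\<^sup>2 - \<tau> * (d - 3 / 2) * s ^ 3
      = (l + \<tau> * s)\<^sup>2 + k - (- l * s\<^sup>2 - 3 / 2 * \<tau> * s ^ 3 + (l * s\<^sup>2 + \<tau> * s ^ 3) * d)" for d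
      by (simp add: power2_eq_square algebra_simps)
    then show ?thesis
      unfolding cq_def pt Dp r(1,2) s_def[symmetric] unfolding p by blast
  qed
  \<comment> \<open>The scalars c, z and w occur only in cancelling pairs: each comes once from
    derivatives of the exponential and once, with opposite sign, from the first-order term or from
    \<open>cq\<close>. What remains of P is its part \<beta>/2, which reproduces the drift and the
    term |\<beta>|^2/4.\<close>
  define c where "c = \<beta> \<bullet> (x - a)"
  define z where "z = (x - a) \<bullet> Dv"
  define w where "w = Dp \<bullet> (x - a) + p * real DIM('a)"
  have P: "P \<bullet> P = p\<^sup>2 * t + p * c + \<beta> \<bullet> \<beta> / 4" "P \<bullet> Dv = p * z + \<beta> \<bullet> Dv / 2" "(x - a) \<bullet> P = p * t + c / 2"
  proof -
    have "(p *\<^sub>R X + (1/2) *\<^sub>R \<beta>) \<bullet> (p *\<^sub>R X + (1/2) *\<^sub>R \<beta>) = p\<^sup>2 * (X \<bullet> X) + p * (\<beta> \<bullet> X) + \<beta> \<bullet> \<beta> / 4"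
      "X \<bullet> (p *\<^sub>R X + (1/2) *\<^sub>R \<beta>) = p * (X \<bullet> X) + \<beta> \<bullet> X / 2"
      "(p *\<^sub>R X + (1/2) *\<^sub>R \<beta>) \<bullet> Dv = p * (X \<bullet> Dv) + \<beta> \<bullet> Dv / 2" for X
      by (simp_all add: inner_add_left inner_add_right inner_commute power2_eq_square distrib_left)
    then show "P \<bullet> P = p\<^sup>2 * t + p * c + \<beta> \<bullet> \<beta> / 4" "P \<bullet> Dv = p * z + \<beta> \<bullet> Dv / 2" "(x - a) \<bullet> P = p * t + c / 2"
      unfolding P_def cP_def p_def[symmetric] t_def c_def z_def by blast+
  qed
  show ?thesis
    unfolding q w_def[symmetric] inner_scaleR_left inner_add_right inner_scaleR_right P z_def[symmetric]
    by (simp add: algebra_simps power2_eq_square)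
qed

text \<open>Here y = g, A = (x - a) \<bullet> \<nabla>g, N = |\<nabla>g|^2, and f is the conjugated
  operator applied to g; the two brackets on the right are the integrands of the energy and the
  Rellich identity, whose integrals vanish. The Rellich bracket is positive in A and y but contains
  no N. One copy of the energy bracket supplies N at the price of a multiple of y^2, and eight
  copies of the Rellich bracket outweigh that price. The condition l^2 + k \<ge> 0 makes the part of
  the coefficient that survives as s tends to 0, that is at infinity, nonnegative.\<close>

lemma carleman_pointwise:
  fixes s \<tau> l k d f y A N p c s1 :: real
  assumes s: "0 < s" "s \<le> s1" and d: "d \<ge> 2" and l: "l > 0" and k: "l\<^sup>2 + k \<ge> 0"
    and \<tau>: "\<tau> \<ge> 2 * d\<^sup>2 * s1"
    and p: "p = l * s^2 + \<tau> * s^3"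
    and c: "c = 2 * (l\<^sup>2 + k) + 3 * l * \<tau> * s + \<tau>\<^sup>2 * s^2 - l * (d - 1)\<^sup>2 * s^2 - \<tau> * (d - 3/2)\<^sup>2 * s^3"
  shows "N + \<tau>\<^sup>2 * s^2 * y^2 \<le>
     (f * y + N - (l\<^sup>2 + k + 2 * l * \<tau> * s + \<tau>\<^sup>2 * s^2) * y^2)
     + 8 * (f * (2 * A + (d - 2) * y) + 4 * p * A\<^sup>2 + c * y^2)
     + (2 + 16 * d\<^sup>2) / \<tau> * (f^2 / s^3)"
proof -
  have s1: "s1 > 0" using s by simp
  have d2: "d\<^sup>2 \<ge> 4" using d power_mono[of 2 d 2] by simp
  have "2 * d\<^sup>2 * s1 \<ge> 8 * s1" using d2 s1 by simp
  then have \<tau>1: "\<tau> \<ge> 8 * s1" "\<tau> > 0" using \<tau> s1 by linarith+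
  have \<tau>s: "\<tau> \<ge> 2 * d\<^sup>2 * s" "\<tau> \<ge> s"
  proof -
    have "2 * d\<^sup>2 * s \<le> 2 * d\<^sup>2 * s1" using s by (simp add: mult_left_mono)
    then show "\<tau> \<ge> 2 * d\<^sup>2 * s" using \<tau> by linarith
    show "\<tau> \<ge> s" using \<tau>1 s s1 by linarith
  qed
  \<comment> \<open>Each negative term of c carries one more factor s and one factor \<tau> less
    than the positive term it is compared with. The bound \<tau> \<ge> 2 d^2 s, which follows from s
    \<le> s1, therefore pays for both.\<close>
  have c1: "l * (d - 1)\<^sup>2 * s^2 \<le> l * \<tau> * s"
  proof -
    have "(d - 1)\<^sup>2 \<le> d\<^sup>2" using d by (intro power_mono) auto
    then have "(d - 1)\<^sup>2 * s \<le> d\<^sup>2 * s" using s by simp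
    also have "\<dots> \<le> \<tau>" using \<tau>s s mult_pos_pos[of "d\<^sup>2" s] d2 by linarith
    finally have "(d - 1)\<^sup>2 * s * (l * s) \<le> \<tau> * (l * s)" using s l by (intro mult_right_mono) auto
    then show ?thesis by (simp add: power2_eq_square algebra_simps)
  qed
  have c2: "\<tau> * (d - 3/2)\<^sup>2 * s^3 \<le> \<tau>\<^sup>2 * s^2 / 2"
  proof -
    have "(d - 3/2)\<^sup>2 \<le> d\<^sup>2" using d by (intro power_mono) auto
    then have "2 * (d - 3/2)\<^sup>2 * s \<le> 2 * d\<^sup>2 * s" using s by simp
    also have "\<dots> \<le> \<tau>" by (rule \<tau>s)
    finally have "2 * (d - 3/2)\<^sup>2 * s * (\<tau> * s^2) \<le> \<tau> * (\<tau> * s^2)" using s \<tau>1 by (intro mult_right_mono) auto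
    then show ?thesis by (simp add: power2_eq_square power3_eq_cube algebra_simps)
  qed
  \<comment> \<open>Of these three units of \<tau>^2 s^2, one is claimed by the conclusion and one
    is spent on the cross term f y in \<open>py\<close>.\<close>
  have cb: "8 * c - (l\<^sup>2 + k + 2 * l * \<tau> * s + \<tau>\<^sup>2 * s^2) \<ge> 3 * (\<tau>\<^sup>2 * s^2)"
  proof -
    have "l * \<tau> * s \<ge> 0" using l \<tau>1 s by simp
    moreover have "3 * e \<le> 8 * (2 * X + 3 * b + e - a1 - a2) - (X + 2 * b + e)"
      if "0 \<le> X" "0 \<le> b" "a1 \<le> b" "a2 \<le> e / 2" for X b e a1 a2 :: real
      using that by (simp add: algebra_simps)
    ultimately show ?thesis using c1 c2 k unfolding c by (simp only: mult.assoc)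
  qed
  then have cy: "(8 * c - (l\<^sup>2 + k + 2 * l * \<tau> * s + \<tau>\<^sup>2 * s^2)) * y^2 \<ge> 3 * (\<tau>\<^sup>2 * s^2) * y^2"
    by (intro mult_right_mono) auto
  \<comment> \<open>Completing the square in A, with p \<ge> \<tau> s^3, produces f^2 / (\<tau>
    s^3). This is where both the gain 1/\<tau> and the weight r^(3/2) on the right side of the
    Carleman estimate originate.\<close>
  have pA: "16 * f * A + 32 * p * A\<^sup>2 \<ge> - (2 * (f^2 / (\<tau> * s^3)))"
  proof -
    have "32 * p * A\<^sup>2 \<ge> 32 * (\<tau> * s^3) * A\<^sup>2"
      unfolding p using l s by (intro mult_right_mono) auto
    moreover have "0 \<le> 2 * (4 * A * (\<tau> * s^3) + f)\<^sup>2 / (\<tau> * s^3)"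
      using \<tau>1 s by simp
    moreover have "2 * (4 * A * (\<tau> * s^3) + f)\<^sup>2 / (\<tau> * s^3)
       = 32 * (\<tau> * s^3) * A\<^sup>2 + 16 * f * A + 2 * (f^2 / (\<tau> * s^3))"
      using \<tau>1 s by (simp add: field_simps power2_eq_square)
    ultimately show ?thesis by linarith
  qed
  \<comment> \<open>The number 8 d - 15 = 8 (d - 2) + 1 collects the products f y from eight Rellich
    brackets and one energy bracket.\<close>
  have py: "(8 * d - 15) * f * y \<ge> - (\<tau>\<^sup>2 * s^2 * y^2) - 16 * d\<^sup>2 * (f^2 / (\<tau> * s^3))"
  proof -
    have "0 \<le> (\<tau> * s * y + (8 * d - 15) * f / (2 * (\<tau> * s)))\<^sup>2" by simp
    also have "\<dots> = \<tau>\<^sup>2 * s^2 * y^2 + (8 * d - 15) * f * y + (8 * d - 15)\<^sup>2 / 4 * (f^2 / (\<tau> * s)\<^sup>2)"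
      using \<tau>1 s by (simp add: field_simps power2_eq_square)
    finally have 1: "(8 * d - 15) * f * y \<ge> - (\<tau>\<^sup>2 * s^2 * y^2) - (8 * d - 15)\<^sup>2 / 4 * (f^2 / (\<tau> * s)\<^sup>2)"
      by linarith
    have "(8 * d - 15)\<^sup>2 \<le> (8 * d)\<^sup>2" using d by (intro power_mono) auto
    then have 2: "(8 * d - 15)\<^sup>2 / 4 \<le> 16 * d\<^sup>2" by (simp add: power2_eq_square)
    have "\<tau> * s^3 \<le> (\<tau> * s)\<^sup>2"
    proof -
      have "s * (\<tau> * s^2) \<le> \<tau> * (\<tau> * s^2)" using \<tau>s \<tau>1 s by (intro mult_right_mono) auto
      then show ?thesis by (simp add: power2_eq_square power3_eq_cube algebra_simps)
    qed
    then have 3: "f^2 / (\<tau> * s)\<^sup>2 \<le> f^2 / (\<tau> * s^3)"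
      using \<tau>1 s by (intro divide_left_mono) auto
    have "(8 * d - 15)\<^sup>2 / 4 * (f^2 / (\<tau> * s)\<^sup>2) \<le> 16 * d\<^sup>2 * (f^2 / (\<tau> * s^3))"
      by (rule mult_mono[OF 2 3]) auto
    then show ?thesis using 1 by linarith
  qed
  have e: "(2 + 16 * d\<^sup>2) / \<tau> * (f^2 / s^3) = 2 * (f^2 / (\<tau> * s^3)) + 16 * d\<^sup>2 * (f^2 / (\<tau> * s^3))"
    using \<tau>1 s by (simp add: field_simps)
  have T: "0 \<le> \<tau>\<^sup>2 * s\<^sup>2 * y\<^sup>2" by simp
  show ?thesis
  proof -
    define S where "S = l\<^sup>2 + k + 2 * l * \<tau> * s + \<tau>\<^sup>2 * s\<^sup>2"
    have e1: "(8 * c - S) * y\<^sup>2 = 8 * (c * y\<^sup>2) - S * y\<^sup>2"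
      "8 * (f * (2 * A + (d - 2) * y) + 4 * p * A\<^sup>2 + c * y\<^sup>2)
        = (16 * f * A + 32 * p * A\<^sup>2) + ((8 * d - 15) * f * y - f * y) + 8 * (c * y\<^sup>2)"
      "3 * (\<tau>\<^sup>2 * s\<^sup>2) * y\<^sup>2 = 3 * (\<tau>\<^sup>2 * s\<^sup>2 * y\<^sup>2)"
      by (simp_all add: algebra_simps)
    show ?thesis
      using cy pA py T unfolding e S_def[symmetric] e1 by linarith
  qed
qed

lemma integral_mono_compact:
  fixes f g :: "'a::euclidean_space \<Rightarrow> real"
  assumes "compact K" "continuous_on K f" "continuous_on K g" "\<And>x. x \<in> K \<Longrightarrow> f x \<le> g x"
  shows "(LINT x:K|lborel. f x) \<le> (LINT x:K|lborel. g x)"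
proof (rule set_integral_mono)
  show "set_integrable lborel K f" "set_integrable lborel K g"
    unfolding set_integrable_def by (intro borel_integrable_compact assms)+
qed (use assms in auto)

text \<open>Integrating \<open>carleman_pointwise\<close> over K removes both brackets and leaves
  only the f^2 term. The set K stays at distance at least \<rho> from the centre, which bounds s by
  \<rho>^(-1/2) and so fixes the threshold for \<tau>.\<close>

lemma carleman_conjugated:
  fixes g :: "'a::euclidean_space \<Rightarrow> real" and a :: 'a and l k \<tau> \<rho> :: real
  assumes K: "compact K" "\<And>x. x \<in> K \<Longrightarrow> \<rho> \<le> norm (x - a)" and \<rho>: "\<rho> > 0"
    and dim: "DIM('a) \<ge> 2" and l: "l > 0" and k: "l\<^sup>2 + k \<ge> 0"
    and \<tau>: "\<tau> \<ge> 2 * (real DIM('a))\<^sup>2 * \<rho> powr (-1/2)"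
    and g: "C2_on (- {a}) g Dg D2g" and zero: "\<And>x. x \<notin> K \<Longrightarrow> g x = 0" "\<And>x. x \<notin> K \<Longrightarrow> Dg x = 0"
    and f: "\<And>x. x \<in> K \<Longrightarrow> f x = trace_op (D2g x) - 2 * cpsi a l \<tau> x * ((x - a) \<bullet> Dg x) + cq a l k \<tau> x * g x"
  shows "(LINT x:K|lborel. Dg x \<bullet> Dg x + \<tau>\<^sup>2 * rp a (-1) x * (g x)\<^sup>2)
    \<le> (2 + 16 * (real DIM('a))\<^sup>2) / \<tau> * (LINT x:K|lborel. rp a (3/2) x * (f x)\<^sup>2)"
proof -
  define d where "d = real DIM('a)"
  define U where "U = - {a}"
  have KU: "K \<subseteq> U" using K(2)[of a] \<rho> by (auto simp: U_def)
  define F where "F x = trace_op (D2g x) - 2 * cpsi a l \<tau> x * ((x - a) \<bullet> Dg x) + cq a l k \<tau> x * g x" for x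
  have FK: "\<And>x. x \<in> K \<Longrightarrow> f x = F x" using f by (simp add: F_def)
  define J1 where "J1 x = F x * (2 * ((x - a) \<bullet> Dg x) + (d - 2) * g x)
      + 4 * cpsi a l \<tau> x * ((x - a) \<bullet> Dg x)\<^sup>2
      + (2 * cq a l k \<tau> x + (x - a) \<bullet> Dcq a l \<tau> x - (d - 2) * (d * cpsi a l \<tau> x + (x - a) \<bullet> Dcpsi a l \<tau> x)) * (g x)\<^sup>2" for x
  define J2 where "J2 x = F x * g x + Dg x \<bullet> Dg x
      - (d * cpsi a l \<tau> x + (x - a) \<bullet> Dcpsi a l \<tau> x + cq a l k \<tau> x) * (g x)\<^sup>2" for x
  have dps: "\<And>x. x \<in> U \<Longrightarrow> (cpsi a l \<tau> has_derivative (\<lambda>h. Dcpsi a l \<tau> x \<bullet> h)) (at x)"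
    "\<And>x. x \<in> U \<Longrightarrow> (cq a l k \<tau> has_derivative (\<lambda>h. Dcq a l \<tau> x \<bullet> h)) (at x)"
    by (auto simp: U_def intro: cpsi_has_derivative cq_has_derivative)
  have cD: "continuous_on U (Dcpsi a l \<tau>)" "continuous_on U (Dcq a l \<tau>)"
    unfolding U_def Dcpsi_def[abs_def] Dcq_def[abs_def] by (intro continuous_intros rp_continuous_on)+
  have cp: "continuous_on U (cpsi a l \<tau>)" "continuous_on U (cq a l k \<tau>)"
    by (rule has_derivative_imp_continuous_on[OF dps(1)], simp)
      (rule has_derivative_imp_continuous_on[OF dps(2)], simp)
  note g' = g[folded U_def]
  have cF: "continuous_on U F"
    unfolding F_def[abs_def] trace_op_def by (intro continuous_intros cp C2_onD(4-6)[OF g'])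
  have cJ: "continuous_on U J1" "continuous_on U J2"
    unfolding J1_def[abs_def] J2_def[abs_def]
    by (intro continuous_intros cF cp cD C2_onD(4-6)[OF g'])+
  have crp: "continuous_on U (rp a q)" for q unfolding U_def by (rule rp_continuous_on)
  have sub: "continuous_on K h" if "continuous_on U h" for h :: "'a \<Rightarrow> real"
    using that KU continuous_on_subset by blast
  have int: "set_integrable lborel K h" if "continuous_on U h" for h :: "'a \<Rightarrow> real"
    unfolding set_integrable_def by (rule borel_integrable_compact[OF K(1) sub[OF that]])
  have I1: "(LINT x:K|lborel. J1 x) = 0"
    unfolding J1_def F_def d_def
    by (rule rellich_identity[OF K(1) KU g' zero dps(1) cD(1) dps(2) cD(2)])
  have I2: "(LINT x:K|lborel. J2 x) = 0"
    unfolding J2_def F_def d_def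
    by (rule energy_identity[OF K(1) KU g' zero dps(1) cD(1)])
  have pt: "Dg x \<bullet> Dg x + \<tau>\<^sup>2 * rp a (-1) x * (g x)\<^sup>2
      \<le> J2 x + 8 * J1 x + (2 + 16 * d\<^sup>2) / \<tau> * (rp a (3/2) x * (F x)\<^sup>2)" if "x \<in> K" for x
  proof -
    have xa: "x \<noteq> a" using that KU by (auto simp: U_def)
    define s where "s = rp a (-1/2) x"
    note r = rp_as_powers[OF xa s_def]
    have p: "cpsi a l \<tau> x = l * s^2 + \<tau> * s^3" unfolding cpsi_def r ..
    have Dp: "(x - a) \<bullet> Dcpsi a l \<tau> x = - l * s^2 - 3/2 * \<tau> * s^3"
      unfolding Dcpsi_def inner_scaleR_right left_diff_distrib mult.assoc r(7,8) by simp
    have q: "cq a l k \<tau> x = (l\<^sup>2 + k) + 2 * l * \<tau> * s + (\<tau>\<^sup>2 - l * (d - 1)) * s^2 - \<tau> * (d - 3/2) * s^3"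
      unfolding cq_def r s_def[symmetric] d_def ..
    have Dq: "(x - a) \<bullet> Dcq a l \<tau> x = - l * \<tau> * s - (\<tau>\<^sup>2 - l * (d - 1)) * s^2 + 3/2 * \<tau> * (d - 3/2) * s^3"
      unfolding Dcq_def inner_scaleR_right left_diff_distrib distrib_right mult.assoc r(6,7,8) d_def
      by simp
    \<comment> \<open>The first three terms are 1/r times the derivative of r^2 (\<phi>'(r)^2 + k).
      The two negative squares are the contribution of \<Delta>\<phi> and of the (d - 2) part of the
      multiplier.\<close>
    have c: "2 * cq a l k \<tau> x + (x - a) \<bullet> Dcq a l \<tau> x - (d - 2) * (d * cpsi a l \<tau> x + (x - a) \<bullet> Dcpsi a l \<tau> x)
      = 2 * (l\<^sup>2 + k) + 3 * l * \<tau> * s + \<tau>\<^sup>2 * s^2 - l * (d - 1)\<^sup>2 * s^2 - \<tau> * (d - 3/2)\<^sup>2 * s^3"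
      unfolding p Dp q Dq by (simp add: power2_eq_square field_simps)
    have e: "d * cpsi a l \<tau> x + (x - a) \<bullet> Dcpsi a l \<tau> x + cq a l k \<tau> x = l\<^sup>2 + k + 2 * l * \<tau> * s + \<tau>\<^sup>2 * s^2"
      unfolding p Dp q by (simp add: algebra_simps)
    have r3: "rp a (3/2) x * (F x)\<^sup>2 = (F x)\<^sup>2 / s^3"
      using r(3,4) by (simp add: field_simps)
    have s1: "s \<le> \<rho> powr (-1/2)"
      unfolding s_def rp_def using K(2)[OF that] \<rho> by (intro powr_mono2') auto
    have "Dg x \<bullet> Dg x + \<tau>\<^sup>2 * s^2 * (g x)\<^sup>2 \<le>
     (F x * g x + Dg x \<bullet> Dg x - (l\<^sup>2 + k + 2 * l * \<tau> * s + \<tau>\<^sup>2 * s^2) * (g x)^2)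
     + 8 * (F x * (2 * ((x - a) \<bullet> Dg x) + (d - 2) * g x) + 4 * cpsi a l \<tau> x * ((x - a) \<bullet> Dg x)\<^sup>2
       + (2 * (l\<^sup>2 + k) + 3 * l * \<tau> * s + \<tau>\<^sup>2 * s^2 - l * (d - 1)\<^sup>2 * s^2 - \<tau> * (d - 3/2)\<^sup>2 * s^3) * (g x)^2)
     + (2 + 16 * d\<^sup>2) / \<tau> * ((F x)^2 / s^3)"
      by (rule carleman_pointwise[OF r(3) s1 _ l k _ p refl]) (use dim \<tau> in \<open>auto simp: d_def\<close>)
    then show ?thesis unfolding J1_def J2_def c e r3 r(1) .
  qed
  have mono: "(LINT x:K|lborel. Dg x \<bullet> Dg x + \<tau>\<^sup>2 * rp a (-1) x * (g x)\<^sup>2)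
     \<le> (LINT x:K|lborel. J2 x + 8 * J1 x + (2 + 16 * d\<^sup>2) / \<tau> * (rp a (3/2) x * (F x)\<^sup>2))"
    by (rule integral_mono_compact[OF K(1) sub sub pt])
      (intro continuous_intros C2_onD(4-6)[OF g'] crp cJ cF)+
  have i: "set_integrable lborel K J1" "set_integrable lborel K J2"
    "set_integrable lborel K (\<lambda>x. rp a (3/2) x * (F x)\<^sup>2)"
    by (intro int continuous_intros cJ cF crp)+
  note mono
  also have "(LINT x:K|lborel. J2 x + 8 * J1 x + (2 + 16 * d\<^sup>2) / \<tau> * (rp a (3/2) x * (F x)\<^sup>2))
      = (LINT x:K|lborel. J2 x) + 8 * (LINT x:K|lborel. J1 x)
      + (2 + 16 * d\<^sup>2) / \<tau> * (LINT x:K|lborel. rp a (3/2) x * (F x)\<^sup>2)"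
    by (simp add: i set_integral_add set_integral_mult_right set_integrable_mult_right)
  also have "(LINT x:K|lborel. rp a (3/2) x * (F x)\<^sup>2) = (LINT x:K|lborel. rp a (3/2) x * (f x)\<^sup>2)"
    by (rule set_lebesgue_integral_cong) (auto simp: FK K(1) compact_imp_closed)
  finally show ?thesis unfolding d_def I1 I2 by simp
qed

text \<open>The constant-coefficient operator valid near infinity. Its zeroth-order coefficient is
  written as |\<beta>|^2/4 + k because k is the part that survives removal of the drift.\<close>

definition gauged :: "'a::euclidean_space \<Rightarrow> real \<Rightarrow> ('a \<Rightarrow> real) \<Rightarrow> ('a \<Rightarrow> 'a) \<Rightarrow> ('a \<Rightarrow> 'a \<Rightarrow> 'a) \<Rightarrow> 'a \<Rightarrow> real" where
  "gauged \<beta> k v Dv D2v x = trace_op (D2v x) + \<beta> \<bullet> Dv x + (\<beta> \<bullet> \<beta> / 4 + k) * v x"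

text \<open>To undo the conjugation, E \<nabla>v is written as \<nabla>(E v) - E v P. The error is
  controlled where |P|^2 \<le> 9 \<tau>^2 / r, which the three thresholds on \<tau>^2 guarantee
  inside the ball of radius R0; hence the left side is taken only over that ball. The constant 19 is
  2 * 9 from the gradient plus 1 from v itself.\<close>

lemma carleman_compact:
  fixes v :: "'a::euclidean_space \<Rightarrow> real" and a \<beta> :: 'a and l k \<tau> \<rho> R0 :: real
  assumes K: "compact K" "\<And>x. x \<in> K \<Longrightarrow> \<rho> \<le> norm (x - a)" and \<rho>: "\<rho> > 0"
    and dim: "DIM('a) \<ge> 2" and l: "l > 0" and k: "l\<^sup>2 + k \<ge> 0"
    and \<tau>: "\<tau> \<ge> 2 * (real DIM('a))\<^sup>2 * \<rho> powr (-1/2)"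
    and \<tau>2: "\<tau>\<^sup>2 \<ge> R0 * l\<^sup>2" "\<tau>\<^sup>2 \<ge> R0 * (\<beta> \<bullet> \<beta>)" "\<tau>\<^sup>2 \<ge> R0"
    and v: "C2_on (- {a}) v Dv D2v" and zero: "\<And>x. x \<notin> K \<Longrightarrow> v x = 0" "\<And>x. x \<notin> K \<Longrightarrow> Dv x = 0"
  shows "(LINT x:K \<inter> cball a R0|lborel. (cE a \<beta> l \<tau> x)\<^sup>2 * (Dv x \<bullet> Dv x + (v x)\<^sup>2))
    \<le> 19 * (2 + 16 * (real DIM('a))\<^sup>2) / \<tau> *
      (LINT x:K|lborel. rp a (3/2) x * (cE a \<beta> l \<tau> x)\<^sup>2 * (gauged \<beta> k v Dv D2v x)\<^sup>2)"
proof -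
  define E where "E = cE a \<beta> l \<tau>"
  define P where "P = cP a \<beta> l \<tau>"
  define g where "g x = E x * v x" for x
  define Dg where "Dg x = E x *\<^sub>R Dv x + v x *\<^sub>R (E x *\<^sub>R P x)" for x
  define D2g where "D2g x h = E x *\<^sub>R D2v x h + ((E x *\<^sub>R P x) \<bullet> h) *\<^sub>R Dv x + (Dv x \<bullet> h) *\<^sub>R (E x *\<^sub>R P x)
     + v x *\<^sub>R (E x *\<^sub>R ((P x \<bullet> h) *\<^sub>R P x
        + ((Dcpsi a l \<tau> x \<bullet> h) *\<^sub>R (x - a) + cpsi a l \<tau> x *\<^sub>R h)))" for x h
  have g: "C2_on (- {a}) g Dg D2g"
    using C2_on_mult[OF C2_on_cE[of a \<beta> l \<tau>] v]
    unfolding g_def[abs_def] Dg_def[abs_def] D2g_def[abs_def] E_def P_def .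
  have xa: "x \<noteq> a" if "x \<in> K" for x using K(2)[OF that] \<rho> by auto
  have trg: "trace_op (D2g x) = E x * trace_op (D2v x) + 2 * ((E x *\<^sub>R P x) \<bullet> Dv x)
      + v x * (E x * (P x \<bullet> P x + (Dcpsi a l \<tau> x \<bullet> (x - a) + cpsi a l \<tau> x * real DIM('a))))" for x
    unfolding D2g_def trace_op_add trace_op_scaleR trace_op_rank_one trace_op_id by (simp add: inner_commute[of "Dv x"])
  have main: "(LINT x:K|lborel. Dg x \<bullet> Dg x + \<tau>\<^sup>2 * rp a (-1) x * (g x)\<^sup>2)
    \<le> (2 + 16 * (real DIM('a))\<^sup>2) / \<tau> * (LINT x:K|lborel. rp a (3/2) x * (E x * gauged \<beta> k v Dv D2v x)\<^sup>2)"
  proof (rule carleman_conjugated[OF K \<rho> dim l k \<tau> g])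
    fix x assume "x \<in> K"
    show "E x * gauged \<beta> k v Dv D2v x = trace_op (D2g x) - 2 * cpsi a l \<tau> x * ((x - a) \<bullet> Dg x) + cq a l k \<tau> x * g x"
      using conjugated_operator[OF xa[OF \<open>x \<in> K\<close>], of \<beta> l \<tau> "trace_op (D2v x)" "Dv x" "v x" k]
      unfolding trg Dg_def g_def gauged_def E_def P_def by (simp add: inner_commute)
  qed (auto simp: g_def Dg_def zero)
  have pt: "(E x)\<^sup>2 * (Dv x \<bullet> Dv x + (v x)\<^sup>2) \<le> 19 * (Dg x \<bullet> Dg x + \<tau>\<^sup>2 * rp a (-1) x * (g x)\<^sup>2)"
    if "x \<in> K \<inter> cball a R0" for x
  proof -
    have x: "x \<noteq> a" "norm (x - a) \<le> R0" using that xa by (auto simp: dist_norm norm_minus_commute)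
    define r where "r = norm (x - a)"
    have r0: "r > 0" "r \<le> R0" using x by (auto simp: r_def)
    define s where "s = rp a (-1/2) x"
    note rr = rp_as_powers[OF x(1) s_def]
    have sr: "s\<^sup>2 * r = 1" using r0 rr(1) by (simp add: rp_def r_def powr_minus field_simps)
    \<comment> \<open>Inside the ball, s^2 = 1/r \<ge> 1/R0, so every constant c with R0 c \<le>
      \<tau>^2 is dominated by \<tau>^2 s^2.\<close>
    have big: "c \<le> \<tau>\<^sup>2 * s\<^sup>2" if "R0 * c \<le> \<tau>\<^sup>2" "c \<ge> 0" for c
    proof -
      have "r * c \<le> R0 * c" using r0 that by (simp add: mult_right_mono)
      then have "r * c * s\<^sup>2 \<le> \<tau>\<^sup>2 * s\<^sup>2" using that(1) by (intro mult_right_mono) auto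
      moreover have "r * c * s\<^sup>2 = c * (s\<^sup>2 * r)" by simp
      ultimately show ?thesis by (simp add: sr)
    qed
    define T where "T = \<tau>\<^sup>2 * s\<^sup>2"
    have T: "l\<^sup>2 \<le> T" "\<beta> \<bullet> \<beta> \<le> T" "1 \<le> T"
      unfolding T_def using big[of "l\<^sup>2"] big[of "\<beta> \<bullet> \<beta>"] big[of 1] \<tau>2 by auto
    have n2: "norm (y + z) ^ 2 \<le> 2 * norm y ^ 2 + 2 * norm z ^ 2" for y z :: 'a
    proof -
      have "norm (y + z) ^ 2 \<le> (norm y + norm z) ^ 2" by (intro power_mono norm_triangle_ineq) auto
      moreover have "0 \<le> (norm y - norm z)\<^sup>2" by simp
      ultimately show ?thesis by (simp add: power2_eq_square algebra_simps)
    qed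
    have "cpsi a l \<tau> x * r = l * (s\<^sup>2 * r) + \<tau> * s * (s\<^sup>2 * r)"
      unfolding cpsi_def rr(1,2) by (simp add: power3_eq_cube power2_eq_square algebra_simps)
    then have pr: "cpsi a l \<tau> x * r = l + \<tau> * s" by (simp add: sr)
    have "(l + \<tau> * s)\<^sup>2 \<le> 2 * l\<^sup>2 + 2 * T"
      unfolding T_def using zero_le_power2[of "l - \<tau> * s"] by (simp add: power2_eq_square algebra_simps)
    then have p4: "(norm (cpsi a l \<tau> x *\<^sub>R (x - a)))\<^sup>2 \<le> 4 * T"
    proof -
      assume "(l + \<tau> * s)\<^sup>2 \<le> 2 * l\<^sup>2 + 2 * T"
      moreover have "(norm (cpsi a l \<tau> x *\<^sub>R (x - a)))\<^sup>2 = (cpsi a l \<tau> x * r)\<^sup>2"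
        by (simp add: power_mult_distrib r_def)
      ultimately show ?thesis using T(1) unfolding pr by linarith
    qed
    have "norm (P x) ^ 2 \<le> 2 * (norm (cpsi a l \<tau> x *\<^sub>R (x - a)))\<^sup>2 + 2 * norm ((1/2) *\<^sub>R \<beta>) ^ 2"
      unfolding P_def cP_def by (rule n2)
    also have "norm ((1/2) *\<^sub>R \<beta>) ^ 2 = \<beta> \<bullet> \<beta> / 4" by (simp add: power_divide dot_square_norm)
    finally have PT: "norm (P x) ^ 2 \<le> 9 * T" using p4 T(2,3) by linarith
    have "E x *\<^sub>R Dv x = Dg x + (- (g x)) *\<^sub>R P x"
      by (simp add: Dg_def g_def mult.commute)
    then have "norm (E x *\<^sub>R Dv x) ^ 2 \<le> 2 * norm (Dg x) ^ 2 + 2 * norm ((- (g x)) *\<^sub>R P x) ^ 2"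
      using n2 by metis
    also have "norm ((- (g x)) *\<^sub>R P x) ^ 2 = (g x)\<^sup>2 * norm (P x) ^ 2" by (simp add: power_mult_distrib)
    also have "(g x)\<^sup>2 * norm (P x) ^ 2 \<le> (g x)\<^sup>2 * (9 * T)" using PT by (intro mult_left_mono) auto
    finally have 1: "(E x)\<^sup>2 * (Dv x \<bullet> Dv x) \<le> 2 * (Dg x \<bullet> Dg x) + 18 * (T * (g x)\<^sup>2)"
      by (simp add: power_mult_distrib power2_norm_eq_inner mult.commute[of T])
    have "(g x)\<^sup>2 * 1 \<le> (g x)\<^sup>2 * T" using T(3) by (intro mult_left_mono) auto
    then have 2: "(E x)\<^sup>2 * (v x)\<^sup>2 \<le> T * (g x)\<^sup>2" by (simp add: g_def power_mult_distrib mult.commute)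
    have "0 \<le> Dg x \<bullet> Dg x" by simp
    then show ?thesis using 1 2 unfolding rr(1) T_def[symmetric] distrib_left by linarith
  qed
  have KU: "K \<subseteq> - {a}" using xa by auto
  have sub: "continuous_on K h" if "continuous_on (- {a}) h" for h :: "'a \<Rightarrow> real"
    using that KU continuous_on_subset by blast
  note cont = C2_onD(4-6)[OF v] C2_onD(4-6)[OF g] C2_onD(6)[OF C2_on_cE, of a \<beta> l \<tau>, folded E_def]
  have cR: "continuous_on K (\<lambda>x. 19 * (Dg x \<bullet> Dg x + \<tau>\<^sup>2 * rp a (-1) x * (g x)\<^sup>2))"
    by (intro sub continuous_intros cont rp_continuous_on)
  have cL: "continuous_on K (\<lambda>x. (E x)\<^sup>2 * (Dv x \<bullet> Dv x + (v x)\<^sup>2))"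
    by (intro sub continuous_intros cont)
  have "(LINT x:K \<inter> cball a R0|lborel. (E x)\<^sup>2 * (Dv x \<bullet> Dv x + (v x)\<^sup>2))
    \<le> (LINT x:K|lborel. 19 * (Dg x \<bullet> Dg x + \<tau>\<^sup>2 * rp a (-1) x * (g x)\<^sup>2))"
    unfolding set_lebesgue_integral_def
  proof (rule integral_mono)
    show "integrable lborel (\<lambda>x. indicat_real (K \<inter> cball a R0) x *\<^sub>R ((E x)\<^sup>2 * (Dv x \<bullet> Dv x + (v x)\<^sup>2)))"
      by (rule borel_integrable_compact) (auto intro: compact_Int K continuous_on_subset[OF cL])
    show "integrable lborel (\<lambda>x. indicat_real K x *\<^sub>R (19 * (Dg x \<bullet> Dg x + \<tau>\<^sup>2 * rp a (-1) x * (g x)\<^sup>2)))"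
      by (rule borel_integrable_compact[OF K(1) cR])
    fix x
    have "0 \<le> 19 * (Dg x \<bullet> Dg x + \<tau>\<^sup>2 * rp a (-1) x * (g x)\<^sup>2)" by (simp add: rp_nonneg)
    then show "indicat_real (K \<inter> cball a R0) x *\<^sub>R ((E x)\<^sup>2 * (Dv x \<bullet> Dv x + (v x)\<^sup>2))
      \<le> indicat_real K x *\<^sub>R (19 * (Dg x \<bullet> Dg x + \<tau>\<^sup>2 * rp a (-1) x * (g x)\<^sup>2))"
      using pt[of x] by (cases "x \<in> K"; cases "x \<in> cball a R0") (auto simp: indicator_def)
  qed
  also have "\<dots> = 19 * (LINT x:K|lborel. Dg x \<bullet> Dg x + \<tau>\<^sup>2 * rp a (-1) x * (g x)\<^sup>2)"
    by (rule set_integral_mult_right)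
  also have "\<dots> \<le> 19 * ((2 + 16 * (real DIM('a))\<^sup>2) / \<tau> * (LINT x:K|lborel. rp a (3/2) x * (E x * gauged \<beta> k v Dv D2v x)\<^sup>2))"
    using main by simp
  finally show ?thesis
    unfolding E_def by (simp only: power_mult_distrib mult.assoc times_divide_eq_right times_divide_eq_left)
qed

section \<open>Cut-off functions and the estimate without compact support\<close>

lemma DERIV_max_zero_power:
  "((\<lambda>t::real. max 0 t ^ Suc (Suc n)) has_real_derivative real (n + 2) * max 0 t ^ Suc n) (at t)"
proof -
  consider "t > 0" | "t < 0" | "t = 0" by linarith
  then show ?thesis
  proof cases
    case 1
    have "((\<lambda>t. t ^ Suc (Suc n)) has_real_derivative real (n + 2) * max 0 t ^ Suc n) (at t)"
      using 1 DERIV_pow[of "Suc (Suc n)" t UNIV] by (simp add: max_def)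
    then show ?thesis
      by (rule has_field_derivative_transform_within_open[where S="{0<..}"]) (use 1 in auto)
  next
    case 2
    have "((\<lambda>t. 0) has_real_derivative real (n + 2) * max 0 t ^ Suc n) (at t)"
      using 2 by simp
    then show ?thesis
      by (rule has_field_derivative_transform_within_open[where S="{..<0}"]) (use 2 in auto)
  next
    case 3
    have e: "(\<lambda>h::real. (max 0 (0 + h) ^ Suc (Suc n) - max 0 0 ^ Suc (Suc n)) / h) = (\<lambda>h. max 0 h ^ Suc n)"
      by (rule ext) (simp add: max_def)
    have "isCont (\<lambda>h::real. max 0 h ^ Suc n) 0" by (intro continuous_intros)
    then show ?thesis
      unfolding 3 DERIV_def e by (simp add: isCont_def)
  qed
qed

text \<open>The cube of the positive part is twice continuously differentiable, and nesting it as 1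
  - ((1 - t_+^3)_+)^3 joins the values 0 and 1 with this smoothness. The derivatives are explicit
  and supported in the unit interval, hence bounded.\<close>

lemma C2_step_exists:
  obtains S S' S'' :: "real \<Rightarrow> real" and B :: real
  where "\<And>t. (S has_real_derivative S' t) (at t)" "\<And>t. (S' has_real_derivative S'' t) (at t)"
    "continuous_on UNIV S''" "\<And>t. t \<le> 0 \<Longrightarrow> S t = 0" "\<And>t. t \<ge> 1 \<Longrightarrow> S t = 1"
    "\<And>t. t \<le> 0 \<or> t \<ge> 1 \<Longrightarrow> S' t = 0 \<and> S'' t = 0" "\<And>t. 0 \<le> S t \<and> S t \<le> 1"
    "\<And>t. \<bar>S' t\<bar> \<le> B" "\<And>t. \<bar>S'' t\<bar> \<le> B" "B > 0"
proof -
  define m :: "real \<Rightarrow> real" where "m t = max 0 t" for t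
  define S where "S t = 1 - m (1 - m t ^ 3) ^ 3" for t
  define S' where "S' t = 3 * m (1 - m t ^ 3) ^ 2 * (3 * m t ^ 2)" for t
  define S'' where "S'' t = 3 * m (1 - m t ^ 3) ^ 2 * (6 * m t) - 6 * m (1 - m t ^ 3) * (3 * m t ^ 2) * (3 * m t ^ 2)" for t
  have d3: "((\<lambda>t. m t ^ 3) has_real_derivative 3 * m t ^ 2) (at t)" for t
    using DERIV_max_zero_power[of 1 t] by (simp add: m_def numeral_eq_Suc)
  have d2: "((\<lambda>t. m t ^ 2) has_real_derivative 2 * m t) (at t)" for t
    using DERIV_max_zero_power[of 0 t] by (simp add: m_def numeral_eq_Suc)
  have di: "((\<lambda>t. 1 - m t ^ 3) has_real_derivative - (3 * m t ^ 2)) (at t)" for t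
    by (rule DERIV_cong[OF DERIV_diff[OF DERIV_const d3]]) simp
  have S: "(S has_real_derivative S' t) (at t)" for t
    unfolding S_def[abs_def]
    by (rule DERIV_cong[OF DERIV_diff[OF DERIV_const DERIV_chain2[OF d3 di]]]) (simp add: S'_def)
  have S': "(S' has_real_derivative S'' t) (at t)" for t
    unfolding S'_def[abs_def]
    by (rule DERIV_cong[OF DERIV_mult[OF DERIV_cmult[OF DERIV_chain2[OF d2 di]] DERIV_cmult[OF d2]]])
      (simp add: S''_def algebra_simps)
  have c: "continuous_on UNIV S''" "continuous_on UNIV S'"
    unfolding S''_def[abs_def] S'_def[abs_def] m_def[abs_def] by (intro continuous_intros)+
  have one: "1 \<le> m t ^ 3" if "t \<ge> 1" for t using that by (simp add: m_def)
  have z: "S' t = 0 \<and> S'' t = 0" if "t \<le> 0 \<or> t \<ge> 1" for t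
  proof (cases "t \<le> 0")
    case True then have "m t = 0" by (simp add: m_def)
    then show ?thesis by (simp add: S'_def S''_def)
  next
    case False
    then have "m (1 - m t ^ 3) = 0" using that one[of t] by (simp add: m_def)
    then show ?thesis by (simp add: S'_def S''_def)
  qed
  have "bounded (S' ` {0..1})" "bounded (S'' ` {0..1})"
    by (intro compact_imp_bounded compact_continuous_image continuous_on_subset[OF c(1)]
        continuous_on_subset[OF c(2)] compact_Icc subset_UNIV)+
  then obtain B1 B2 where "\<forall>x\<in>S' ` {0..1}. norm x \<le> B1" "\<forall>x\<in>S'' ` {0..1}. norm x \<le> B2"
    unfolding bounded_iff by blast
  then have B: "\<And>t. t \<in> {0..1} \<Longrightarrow> \<bar>S' t\<bar> \<le> B1" "\<And>t. t \<in> {0..1} \<Longrightarrow> \<bar>S'' t\<bar> \<le> B2"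
    by auto
  define B where "B = \<bar>B1\<bar> + \<bar>B2\<bar> + 1"
  have b: "\<bar>S' t\<bar> \<le> B" "\<bar>S'' t\<bar> \<le> B" for t
    using B[of t] z[of t] by (cases "t \<in> {0..1}"; force simp: B_def)+
  have r: "0 \<le> S t \<and> S t \<le> 1" for t
  proof -
    have "m (1 - m t ^ 3) ^ 3 \<le> 1" by (intro power_le_one) (auto simp: m_def)
    then show ?thesis by (simp add: S_def m_def)
  qed
  have s0: "S t = 0" if "t \<le> 0" for t using that by (simp add: S_def m_def)
  have s1: "S t = 1" if "t \<ge> 1" for t
  proof -
    have "m (1 - m t ^ 3) = 0" using that one[of t] by (simp add: m_def)
    then show ?thesis by (simp add: S_def)
  qed
  show ?thesis by (rule that[OF S S' c(1) s0 s1 z r b]) (simp_all add: B_def)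
qed

text \<open>A function of |x - a|^2 rather than of |x - a| has no singularity at the centre. The
  same computation serves the outer cut-off, the inner cut-off and the mollifier.\<close>

lemma C2_on_radial:
  fixes a :: "'a::euclidean_space" and S S' S'' :: "real \<Rightarrow> real" and c m :: real
  assumes S: "\<And>t. (S has_real_derivative S' t) (at t)" "\<And>t. (S' has_real_derivative S'' t) (at t)"
    "continuous_on UNIV S''"
  defines "q \<equiv> \<lambda>x. c + m * ((x - a) \<bullet> (x - a))"
  shows "C2_on UNIV (\<lambda>x. S (q x)) (\<lambda>x. (2 * m * S' (q x)) *\<^sub>R (x - a))
    (\<lambda>x h. (2 * m * S' (q x)) *\<^sub>R h + (4 * m\<^sup>2 * S'' (q x)) *\<^sub>R (((x - a) \<bullet> h) *\<^sub>R (x - a)))"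
proof -
  have id: "((\<lambda>x. x - a) has_derivative (\<lambda>h. h)) (at x)" for x
    by (auto intro!: derivative_eq_intros)
  have q: "(q has_derivative (\<lambda>h. 2 * m * ((x - a) \<bullet> h))) (at x)" for x
    unfolding q_def
    by (rule has_derivative_eq_rhs[OF has_derivative_add[OF has_derivative_const
            has_derivative_mult_right[OF has_derivative_inner[OF id id]]]])
      (rule ext, simp add: inner_commute[of _ "x - a"])
  have comp: "((\<lambda>x. f (q x)) has_derivative (\<lambda>h. f' (q x) * (2 * m * ((x - a) \<bullet> h)))) (at x)"
    if "\<And>t. (f has_real_derivative f' t) (at t)" for f f' :: "real \<Rightarrow> real" and x
    using has_derivative_compose[OF q[of x], of f "\<lambda>s. f' (q x) * s"] that[of "q x"]
    by (simp add: has_field_derivative_def)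
  have cq: "continuous_on UNIV q" by (rule has_derivative_imp_continuous_on[OF q])
  have cS: "continuous_on UNIV (\<lambda>x. S' (q x))" "continuous_on UNIV (\<lambda>x. S'' (q x))"
    by (rule has_derivative_imp_continuous_on[OF comp[OF S(2)]])
      (rule continuous_on_compose2[OF S(3) cq], simp)
  show ?thesis
    unfolding C2_on_def
  proof (intro conjI ballI allI)
    fix x h k
    show "((\<lambda>x. S (q x)) has_derivative (\<lambda>h. ((2 * m * S' (q x)) *\<^sub>R (x - a)) \<bullet> h)) (at x)"
      by (rule has_derivative_eq_rhs[OF comp[OF S(1)]]) (rule ext, simp only: inner_scaleR_left mult_ac)
    show "((\<lambda>x. (2 * m * S' (q x)) *\<^sub>R (x - a)) has_derivative
        (\<lambda>h. (2 * m * S' (q x)) *\<^sub>R h + (4 * m\<^sup>2 * S'' (q x)) *\<^sub>R (((x - a) \<bullet> h) *\<^sub>R (x - a)))) (at x)"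
      by (rule has_derivative_eq_rhs[OF has_derivative_scaleR[OF has_derivative_mult_right[OF comp[OF S(2)]] id]])
        (rule ext, simp only: scaleR_scaleR power2_eq_square mult_ac, simp)
    show "((2 * m * S' (q x)) *\<^sub>R h + (4 * m\<^sup>2 * S'' (q x)) *\<^sub>R (((x - a) \<bullet> h) *\<^sub>R (x - a))) \<bullet> k =
      ((2 * m * S' (q x)) *\<^sub>R k + (4 * m\<^sup>2 * S'' (q x)) *\<^sub>R (((x - a) \<bullet> k) *\<^sub>R (x - a))) \<bullet> h"
      by (simp only: inner_add_left inner_scaleR_left inner_commute[of k h] mult_ac)
  next
    fix h
    show "continuous_on UNIV (\<lambda>x. (2 * m * S' (q x)) *\<^sub>R h + (4 * m\<^sup>2 * S'' (q x)) *\<^sub>R (((x - a) \<bullet> h) *\<^sub>R (x - a)))"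
      by (intro continuous_intros cS)
  qed
qed

text \<open>The constant of \<open>carleman_compact\<close> does not depend on the support, so the
  estimate can be applied to v times cut-offs of growing radius. The derivatives of the cut-offs are
  bounded uniformly in n and vanish near any given point for large n; the commutator terms thus
  disappear by dominated convergence, and the integrability hypotheses supply the dominating
  function. The left side lives on a fixed ball and is eventually constant in n.\<close>

lemma carleman_decay:
  fixes v :: "'a::euclidean_space \<Rightarrow> real" and a \<beta> :: 'a and l k \<tau> \<rho> R0 :: real
  assumes \<rho>: "\<rho> > 0" and dim: "DIM('a) \<ge> 2" and l: "l > 0" and k: "l\<^sup>2 + k \<ge> 0"
    and \<tau>: "\<tau> \<ge> 2 * (real DIM('a))\<^sup>2 * \<rho> powr (-1/2)"
    and \<tau>2: "\<tau>\<^sup>2 \<ge> R0 * l\<^sup>2" "\<tau>\<^sup>2 \<ge> R0 * (\<beta> \<bullet> \<beta>)" "\<tau>\<^sup>2 \<ge> R0"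
    and v: "C2_on UNIV v Dv D2v"
    and zero: "\<And>x. norm (x - a) < \<rho> \<Longrightarrow> v x = 0" "\<And>x. norm (x - a) < \<rho> \<Longrightarrow> Dv x = 0"
      "\<And>x h. norm (x - a) < \<rho> \<Longrightarrow> D2v x h = 0"
    and int: "integrable lborel (\<lambda>x. rp a (3/2) x * (cE a \<beta> l \<tau> x)\<^sup>2 * (v x)\<^sup>2)"
      "integrable lborel (\<lambda>x. rp a (3/2) x * (cE a \<beta> l \<tau> x)\<^sup>2 * (Dv x \<bullet> Dv x))"
      "integrable lborel (\<lambda>x. rp a (3/2) x * (cE a \<beta> l \<tau> x)\<^sup>2 * (gauged \<beta> k v Dv D2v x)\<^sup>2)"
  shows "(LINT x:cball a R0|lborel. (cE a \<beta> l \<tau> x)\<^sup>2 * (Dv x \<bullet> Dv x + (v x)\<^sup>2))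
    \<le> 19 * (2 + 16 * (real DIM('a))\<^sup>2) / \<tau> *
      (\<integral>x. rp a (3/2) x * (cE a \<beta> l \<tau> x)\<^sup>2 * (gauged \<beta> k v Dv D2v x)\<^sup>2 \<partial>lborel)"
proof -
  obtain S S' S'' :: "real \<Rightarrow> real" and B :: real where
    S: "\<And>t. (S has_real_derivative S' t) (at t)" "\<And>t. (S' has_real_derivative S'' t) (at t)"
    "continuous_on UNIV S''" and S0: "\<And>t. t \<le> 0 \<Longrightarrow> S t = 0" and S1: "\<And>t. t \<ge> 1 \<Longrightarrow> S t = 1"
    and Sz: "\<And>t. t \<le> 0 \<or> t \<ge> 1 \<Longrightarrow> S' t = 0 \<and> S'' t = 0" and Sr: "\<And>t. 0 \<le> S t \<and> S t \<le> 1"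
    and B: "\<And>t. \<bar>S' t\<bar> \<le> B" "\<And>t. \<bar>S'' t\<bar> \<le> B" "B > 0"
    using C2_step_exists by metis
  define W where "W x = rp a (3/2) x * (cE a \<beta> l \<tau> x)\<^sup>2" for x
  have W0: "W x \<ge> 0" for x by (simp add: W_def rp_nonneg)
  define L where "L = gauged \<beta> k v Dv D2v"
  \<comment> \<open>This is 2 - |x - a|^2 / (n+1)^2: at least 1 up to radius n+1 and negative beyond
    twice that radius. The successor avoids a division by zero.\<close>
  define q where "q n x = 2 + (- (1 / (real (Suc n))\<^sup>2)) * ((x - a) \<bullet> (x - a))" for n x
  define c where "c n x = S (q n x)" for n x
  define Dc where "Dc n x = (2 * (- (1 / (real (Suc n))\<^sup>2)) * S' (q n x)) *\<^sub>R (x - a)" for n x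
  define D2c where "D2c n x h = (2 * (- (1 / (real (Suc n))\<^sup>2)) * S' (q n x)) *\<^sub>R h
      + (4 * (- (1 / (real (Suc n))\<^sup>2))\<^sup>2 * S'' (q n x)) *\<^sub>R (((x - a) \<bullet> h) *\<^sub>R (x - a))" for n x h
  have C2c: "C2_on UNIV (c n) (Dc n) (D2c n)" for n
    using C2_on_radial[OF S, of 2 "- (1 / (real (Suc n))\<^sup>2)" a]
    unfolding c_def[abs_def] Dc_def[abs_def] D2c_def[abs_def] q_def .
  have trc: "trace_op (D2c n x) = (2 * (- (1 / (real (Suc n))\<^sup>2)) * S' (q n x)) * real DIM('a)
      + (4 * (- (1 / (real (Suc n))\<^sup>2))\<^sup>2 * S'' (q n x)) * ((x - a) \<bullet> (x - a))" for n x
    unfolding D2c_def trace_op_add trace_op_scaleR trace_op_rank_one trace_op_id ..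
  define vn where "vn n x = c n x * v x" for n x
  define Dvn where "Dvn n x = c n x *\<^sub>R Dv x + v x *\<^sub>R Dc n x" for n x
  define D2vn where "D2vn n x h = c n x *\<^sub>R D2v x h + (Dc n x \<bullet> h) *\<^sub>R Dv x + (Dv x \<bullet> h) *\<^sub>R Dc n x + v x *\<^sub>R D2c n x h" for n x h
  have C2vn: "C2_on UNIV (vn n) (Dvn n) (D2vn n)" for n
    using C2_on_mult[OF C2c v] unfolding vn_def[abs_def] Dvn_def[abs_def] D2vn_def[abs_def] .
  define L' where "L' n x = gauged \<beta> k (vn n) (Dvn n) (D2vn n) x" for n x
  have L': "L' n x = c n x * L x + 2 * (Dc n x \<bullet> Dv x) + v x * (trace_op (D2c n x) + \<beta> \<bullet> Dc n x)" for n x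
    unfolding L'_def L_def gauged_def D2vn_def Dvn_def vn_def trace_op_add trace_op_scaleR trace_op_rank_one
    by (simp add: inner_add_right inner_commute[of "Dv x"] algebra_simps)
  \<comment> \<open>A bound, uniform in n, for every coefficient that differentiating the cut-off
    places in front of v or \<nabla>v.\<close>
  define C where "C = (16 + 2 * real DIM('a)) * B + 4 * B * norm \<beta> + 8 * B"
  have near: "c n x = 1 \<and> Dc n x = 0 \<and> (\<forall>h. D2c n x h = 0)" if "norm (x - a) \<le> real (Suc n)" for n x
  proof -
    have "(x - a) \<bullet> (x - a) \<le> (real (Suc n))\<^sup>2"
      using that power_mono[OF that norm_ge_zero, of 2] by (simp add: power2_norm_eq_inner)
    then have "(1 / (real (Suc n))\<^sup>2) * ((x - a) \<bullet> (x - a)) \<le> 1" by (simp add: field_simps)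
    then have "q n x \<ge> 1" unfolding q_def by linarith
    then show ?thesis using S1[of "q n x"] Sz[of "q n x"] by (simp add: c_def Dc_def D2c_def)
  qed
  have far: "c n x = 0 \<and> Dc n x = 0 \<and> (\<forall>h. D2c n x h = 0)" if "norm (x - a) \<ge> 2 * real (Suc n)" for n x
  proof -
    have "(2 * real (Suc n))\<^sup>2 \<le> (x - a) \<bullet> (x - a)"
      using that power_mono[OF that, of 2] by (simp add: power2_norm_eq_inner)
    then have "4 * (real (Suc n))\<^sup>2 \<le> (x - a) \<bullet> (x - a)" by (simp only: power_mult_distrib) simp
    then have "(1 / (real (Suc n))\<^sup>2) * ((x - a) \<bullet> (x - a)) \<ge> 4" by (simp add: field_simps)
    then have "q n x \<le> 0" unfolding q_def by linarith
    then show ?thesis using S0[of "q n x"] Sz[of "q n x"] by (simp add: c_def Dc_def D2c_def)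
  qed
  have bounds: "norm (Dc n x) \<le> 4 * B \<and> \<bar>trace_op (D2c n x)\<bar> \<le> (16 + 2 * real DIM('a)) * B" for n x
  proof (cases "norm (x - a) \<ge> 2 * real (Suc n)")
    case True
    then show ?thesis using far[OF True] B(3) by (simp add: trace_op_def)
  next
    case False
    define m where "m = real (Suc n)"
    have m: "m \<ge> 1" "norm (x - a) \<le> 2 * m" using False by (auto simp: m_def)
    define e where "e = 1 / m\<^sup>2"
    have m2: "m\<^sup>2 \<ge> m" "m\<^sup>2 \<ge> 1" "m > 0" using m(1) by (auto simp: power2_eq_square mult_ge1_I)
    have e: "e \<ge> 0" "e \<le> 1" "e * m \<le> 1" "e * m\<^sup>2 = 1"
      unfolding e_def using m2 by (auto simp: field_simps)
    have er: "e * norm (x - a) \<le> 2"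
      using mult_left_mono[OF m(2) e(1)] e(3) by linarith
    have "(x - a) \<bullet> (x - a) \<le> 4 * m\<^sup>2"
      using power_mono[OF m(2) norm_ge_zero, of 2] by (simp add: power2_norm_eq_inner power_mult_distrib)
    then have et: "e * ((x - a) \<bullet> (x - a)) \<le> 4" using mult_left_mono[OF _ e(1)] e(4) by fastforce
    have D: "Dc n x = (- 2 * e * S' (q n x)) *\<^sub>R (x - a)"
      unfolding Dc_def e_def m_def by simp
    have "norm (Dc n x) = 2 * \<bar>S' (q n x)\<bar> * (e * norm (x - a))"
      unfolding D using e(1) by (simp add: abs_mult)
    also have "\<dots> \<le> 2 * B * 2"
      using B er e(1) by (intro mult_mono) (auto intro: mult_nonneg_nonneg order_trans[OF abs_ge_zero])
    finally have 1: "norm (Dc n x) \<le> 4 * B" by simp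
    have T: "trace_op (D2c n x) = - (2 * real DIM('a)) * (e * S' (q n x)) + 4 * (S'' (q n x) * (e * (e * ((x - a) \<bullet> (x - a)))))"
      unfolding trc e_def m_def by (simp add: power2_eq_square mult_ac)
    have a1: "\<bar>e * S' (q n x)\<bar> \<le> 1 * B"
      unfolding abs_mult using e B by (intro mult_mono) auto
    have "e * (e * ((x - a) \<bullet> (x - a))) \<le> 1 * 4" using e et by (intro mult_mono) auto
    then have a2: "\<bar>S'' (q n x) * (e * (e * ((x - a) \<bullet> (x - a))))\<bar> \<le> B * 4"
      unfolding abs_mult using e(1) B by (intro mult_mono) (auto simp: abs_mult)
    have "\<bar>trace_op (D2c n x)\<bar> \<le> 2 * real DIM('a) * \<bar>e * S' (q n x)\<bar> + 4 * \<bar>S'' (q n x) * (e * (e * ((x - a) \<bullet> (x - a))))\<bar>"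
      unfolding T by (rule order_trans[OF abs_triangle_ineq]) (simp add: abs_mult)
    also have "\<dots> \<le> 2 * real DIM('a) * (1 * B) + 4 * (B * 4)"
      using a1 a2 by (intro add_mono mult_left_mono) auto
    finally show ?thesis using 1 by (simp add: algebra_simps)
  qed
  have Lb: "(L' n x)\<^sup>2 \<le> 3 * (L x)\<^sup>2 + 3 * C\<^sup>2 * (Dv x \<bullet> Dv x) + 3 * C\<^sup>2 * (v x)\<^sup>2" for n x
  proof -
    have a1: "\<bar>c n x * L x\<bar> \<le> \<bar>L x\<bar>"
      unfolding abs_mult c_def using Sr[of "q n x"] by (intro mult_left_le_one_le) auto
    have "\<bar>Dc n x \<bullet> Dv x\<bar> \<le> norm (Dc n x) * norm (Dv x)" by (rule Cauchy_Schwarz_ineq2)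
    also have "\<dots> \<le> 4 * B * norm (Dv x)" using bounds by (intro mult_right_mono) auto
    finally have a2: "\<bar>2 * (Dc n x \<bullet> Dv x)\<bar> \<le> 8 * B * norm (Dv x)" by simp
    have C8: "8 * B \<le> C" "(16 + 2 * real DIM('a)) * B + 4 * B * norm \<beta> \<le> C"
      unfolding C_def using B(3) by auto
    have a2': "\<bar>2 * (Dc n x \<bullet> Dv x)\<bar> \<le> C * norm (Dv x)"
      using a2 mult_right_mono[OF C8(1) norm_ge_zero[of "Dv x"]] by linarith
    have "\<bar>\<beta> \<bullet> Dc n x\<bar> \<le> norm \<beta> * norm (Dc n x)" by (rule Cauchy_Schwarz_ineq2)
    also have "\<dots> \<le> norm \<beta> * (4 * B)" using bounds by (intro mult_left_mono) auto
    finally have "\<bar>\<beta> \<bullet> Dc n x\<bar> \<le> 4 * B * norm \<beta>" by (simp add: mult.commute)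
    then have "\<bar>trace_op (D2c n x) + \<beta> \<bullet> Dc n x\<bar> \<le> C"
      using bounds[of n x, THEN conjunct2] C8(2) by linarith
    then have a3: "\<bar>v x * (trace_op (D2c n x) + \<beta> \<bullet> Dc n x)\<bar> \<le> C * \<bar>v x\<bar>"
      unfolding abs_mult by (subst mult.commute) (intro mult_right_mono, auto)
    have "\<bar>L' n x\<bar> \<le> \<bar>L x\<bar> + C * norm (Dv x) + C * \<bar>v x\<bar>"
      unfolding L' using a1 a2' a3 by linarith
    then have "(L' n x)\<^sup>2 \<le> (\<bar>L x\<bar> + C * norm (Dv x) + C * \<bar>v x\<bar>)\<^sup>2"
      using power_mono[of "\<bar>L' n x\<bar>" _ 2] by simp
    also have "\<dots> \<le> 3 * \<bar>L x\<bar>\<^sup>2 + 3 * (C * norm (Dv x))\<^sup>2 + 3 * (C * \<bar>v x\<bar>)\<^sup>2"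
    proof -
      have "(y1 + y2 + y3)\<^sup>2 \<le> 3 * y1\<^sup>2 + 3 * y2\<^sup>2 + 3 * y3\<^sup>2" for y1 y2 y3 :: real
        using zero_le_power2[of "y1 - y2"] zero_le_power2[of "y1 - y3"] zero_le_power2[of "y2 - y3"]
        by (simp add: power2_eq_square algebra_simps)
      then show ?thesis .
    qed
    finally show ?thesis by (simp add: power_mult_distrib power2_norm_eq_inner)
  qed
  define K where "K n = cball a (2 * real (Suc n)) - ball a \<rho>" for n
  have Kc: "compact (K n)" for n unfolding K_def by (intro compact_diff) auto
  have Krho: "\<rho> \<le> norm (x - a)" if "x \<in> K n" for x n
    using that by (auto simp: K_def dist_norm norm_minus_commute)
  have outK: "norm (x - a) < \<rho> \<or> norm (x - a) \<ge> 2 * real (Suc n)" if "x \<notin> K n" for x n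
    using that by (auto simp: K_def dist_norm norm_minus_commute)
  have znK: "vn n x = 0" "Dvn n x = 0" "L' n x = 0" if "x \<notin> K n" for n x
    using outK[OF that] far[of n x] zero[of x]
    by (auto simp: vn_def Dvn_def L' L_def gauged_def trace_op_def)
  have step: "(LINT x:cball a R0|lborel. (cE a \<beta> l \<tau> x)\<^sup>2 * (Dv x \<bullet> Dv x + (v x)\<^sup>2))
    \<le> 19 * (2 + 16 * (real DIM('a))\<^sup>2) / \<tau> * (\<integral>x. W x * (L' n x)\<^sup>2 \<partial>lborel)" if n: "R0 \<le> real (Suc n)" for n
  proof -
    have "(LINT x:K n \<inter> cball a R0|lborel. (cE a \<beta> l \<tau> x)\<^sup>2 * (Dvn n x \<bullet> Dvn n x + (vn n x)\<^sup>2))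
    \<le> 19 * (2 + 16 * (real DIM('a))\<^sup>2) / \<tau> *
      (LINT x:K n|lborel. rp a (3/2) x * (cE a \<beta> l \<tau> x)\<^sup>2 * (gauged \<beta> k (vn n) (Dvn n) (D2vn n) x)\<^sup>2)"
      by (rule carleman_compact[OF Kc Krho \<rho> dim l k \<tau> \<tau>2 C2_on_subset[OF C2vn subset_UNIV] znK(1,2)])
    also have "(LINT x:K n \<inter> cball a R0|lborel. (cE a \<beta> l \<tau> x)\<^sup>2 * (Dvn n x \<bullet> Dvn n x + (vn n x)\<^sup>2))
      = (LINT x:cball a R0|lborel. (cE a \<beta> l \<tau> x)\<^sup>2 * (Dv x \<bullet> Dv x + (v x)\<^sup>2))"
      unfolding set_lebesgue_integral_def
    proof (rule Bochner_Integration.integral_cong[OF refl])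
      fix x
      show "indicat_real (K n \<inter> cball a R0) x *\<^sub>R ((cE a \<beta> l \<tau> x)\<^sup>2 * (Dvn n x \<bullet> Dvn n x + (vn n x)\<^sup>2))
        = indicat_real (cball a R0) x *\<^sub>R ((cE a \<beta> l \<tau> x)\<^sup>2 * (Dv x \<bullet> Dv x + (v x)\<^sup>2))"
      proof (cases "x \<in> cball a R0")
        case True
        then have "norm (x - a) \<le> real (Suc n)" using n by (simp add: dist_norm norm_minus_commute)
        from near[OF this] have "vn n x = v x" "Dvn n x = Dv x" by (simp_all add: vn_def Dvn_def)
        then show ?thesis using True znK[of x n] by (cases "x \<in> K n") simp_all
      qed simp
    qed
    also have "(LINT x:K n|lborel. rp a (3/2) x * (cE a \<beta> l \<tau> x)\<^sup>2 * (gauged \<beta> k (vn n) (Dvn n) (D2vn n) x)\<^sup>2)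
      = (\<integral>x. W x * (L' n x)\<^sup>2 \<partial>lborel)"
      unfolding set_lebesgue_integral_def
    proof (rule Bochner_Integration.integral_cong[OF refl])
      fix x
      show "indicat_real (K n) x *\<^sub>R (rp a (3/2) x * (cE a \<beta> l \<tau> x)\<^sup>2 * (gauged \<beta> k (vn n) (Dvn n) (D2vn n) x)\<^sup>2)
        = W x * (L' n x)\<^sup>2"
        using znK(3)[of x n] by (cases "x \<in> K n") (simp_all add: W_def L'_def)
    qed
    finally show ?thesis .
  qed
  have cont: "continuous_on UNIV (L' n)" "continuous_on UNIV L" for n
    unfolding L'_def[abs_def] L_def gauged_def[abs_def] trace_op_def
    by (intro continuous_intros C2_onD(4-6)[OF C2vn] C2_onD(4-6)[OF v])+
  have Wm: "W \<in> borel_measurable borel"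
    unfolding W_def[abs_def] rp_def[abs_def] cE_def[abs_def] by measurable
  have lim: "(\<lambda>n. \<integral>x. W x * (L' n x)\<^sup>2 \<partial>lborel) \<longlonglongrightarrow> (\<integral>x. W x * (L x)\<^sup>2 \<partial>lborel)"
  proof (rule integral_dominated_convergence)
    show "integrable lborel (\<lambda>x. 3 * (W x * (L x)\<^sup>2) + 3 * C\<^sup>2 * (W x * (Dv x \<bullet> Dv x)) + 3 * C\<^sup>2 * (W x * (v x)\<^sup>2))"
      unfolding W_def L_def by (intro Bochner_Integration.integrable_add integrable_mult_right int)
    show "(\<lambda>x. W x * (L x)\<^sup>2) \<in> borel_measurable lborel"
      using Wm borel_measurable_continuous_onI[OF cont(2)] by simp
    show "(\<lambda>x. W x * (L' n x)\<^sup>2) \<in> borel_measurable lborel" for n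
      using Wm borel_measurable_continuous_onI[OF cont(1)] by simp
    show "AE x in lborel. (\<lambda>n. W x * (L' n x)\<^sup>2) \<longlonglongrightarrow> W x * (L x)\<^sup>2"
    proof (intro AE_I2)
      fix x
      obtain N :: nat where N: "norm (x - a) \<le> real N" using real_arch_simple by blast
      have "L' n x = L x" if "n \<ge> N" for n
        using near[of x n] N that by (simp add: L' trace_op_def)
      then have "\<forall>\<^sub>F n in sequentially. W x * (L' n x)\<^sup>2 = W x * (L x)\<^sup>2"
        by (intro eventually_sequentiallyI[of N]) simp
      then show "(\<lambda>n. W x * (L' n x)\<^sup>2) \<longlonglongrightarrow> W x * (L x)\<^sup>2"
        by (rule tendsto_eventually)
    qed
    show "AE x in lborel. norm (W x * (L' n x)\<^sup>2)
        \<le> 3 * (W x * (L x)\<^sup>2) + 3 * C\<^sup>2 * (W x * (Dv x \<bullet> Dv x)) + 3 * C\<^sup>2 * (W x * (v x)\<^sup>2)" for n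
    proof (intro AE_I2)
      fix x
      have "W x * (L' n x)\<^sup>2 \<le> W x * (3 * (L x)\<^sup>2 + 3 * C\<^sup>2 * (Dv x \<bullet> Dv x) + 3 * C\<^sup>2 * (v x)\<^sup>2)"
        by (rule mult_left_mono[OF Lb W0])
      then show "norm (W x * (L' n x)\<^sup>2)
        \<le> 3 * (W x * (L x)\<^sup>2) + 3 * C\<^sup>2 * (W x * (Dv x \<bullet> Dv x)) + 3 * C\<^sup>2 * (W x * (v x)\<^sup>2)"
        using W0 by (simp add: algebra_simps)
    qed
  qed
  obtain N :: nat where N: "R0 \<le> real N" using real_arch_simple by blast
  have "(LINT x:cball a R0|lborel. (cE a \<beta> l \<tau> x)\<^sup>2 * (Dv x \<bullet> Dv x + (v x)\<^sup>2))
     \<le> 19 * (2 + 16 * (real DIM('a))\<^sup>2) / \<tau> * (\<integral>x. W x * (L x)\<^sup>2 \<partial>lborel)"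
    by (rule LIMSEQ_le_const[OF tendsto_mult_left[OF lim]]) (use step N in \<open>auto intro!: exI[of _ N]\<close>)
  then show ?thesis unfolding W_def L_def by simp
qed

section \<open>Mollification\<close>

text \<open>\<open>corr u F\<close> is the convolution of \<open>u\<close> with the reflected kernel \<open>z \<mapsto> F (- z)\<close>. The reflection makes
  \<open>y \<mapsto> F (y - x)\<close> the test function, so its derivatives in \<open>x\<close> are \<open>- corr u DF\<close> and \<open>corr u D2F\<close>.\<close>

definition corr :: "('a::euclidean_space \<Rightarrow> real) \<Rightarrow> ('a \<Rightarrow> 'b::{banach,second_countable_topology}) \<Rightarrow> 'a \<Rightarrow> 'b" where
  "corr u F x = (\<integral>y. u y *\<^sub>R F (y - x) \<partial>lborel)"

lemma bounded_of_compact_support: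
  fixes F :: "'a::euclidean_space \<Rightarrow> 'b::euclidean_space"
  assumes "continuous_on UNIV F" "\<And>z. norm z \<ge> \<delta> \<Longrightarrow> F z = 0"
  obtains B where "B > 0" "\<And>z. norm (F z) \<le> B"
proof -
  have "bounded (F ` cball 0 \<delta>)"
    by (intro compact_imp_bounded compact_continuous_image continuous_on_subset[OF assms(1)]) auto
  then obtain B where B: "B > 0" "\<And>z. z \<in> cball 0 \<delta> \<Longrightarrow> norm (F z) \<le> B"
    unfolding bounded_pos by auto
  have "norm (F z) \<le> B" for z
    using B assms(2)[of z] by (cases "norm z \<le> \<delta>") auto
  then show ?thesis using that B(1) by blast
qed

lemma uniform_continuity_of_compact_support:
  fixes F :: "'a::euclidean_space \<Rightarrow> 'b::euclidean_space"
  assumes "continuous_on UNIV F" and z: "\<And>z. norm z \<ge> \<delta> \<Longrightarrow> F z = 0" and "\<epsilon> > 0"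
  obtains d where "d > 0" "\<And>z w. norm (z - w) < d \<Longrightarrow> norm (F z - F w) \<le> \<epsilon>"
proof -
  have "uniformly_continuous_on (cball 0 (\<delta> + 1)) F"
    by (intro compact_uniformly_continuous continuous_on_subset[OF assms(1)]) auto
  then obtain d where d: "d > 0"
    "\<And>z w. z \<in> cball 0 (\<delta> + 1) \<Longrightarrow> w \<in> cball 0 (\<delta> + 1) \<Longrightarrow> dist w z < d \<Longrightarrow> dist (F w) (F z) < \<epsilon>"
    unfolding uniformly_continuous_on_def using \<open>\<epsilon> > 0\<close> by metis
  show ?thesis
  proof (rule that[of "min d 1"])
    fix z w :: 'a assume zw: "norm (z - w) < min d 1"
    show "norm (F z - F w) \<le> \<epsilon>"
    proof (cases "z \<in> cball 0 (\<delta> + 1) \<and> w \<in> cball 0 (\<delta> + 1)")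
      case True
      then show ?thesis using d(2)[of w z] zw by (simp add: dist_norm)
    next
      case False
      have "norm z \<le> norm w + norm (z - w)" "norm w \<le> norm z + norm (z - w)"
        using norm_triangle_sub[of z w] norm_triangle_sub[of w z] by (simp_all add: norm_minus_commute)
      then have "norm z \<ge> \<delta>" "norm w \<ge> \<delta>" using False zw by auto
      then show ?thesis using z \<open>\<epsilon> > 0\<close> by simp
    qed
  qed (use d in auto)
qed

lemma integrable_corr:
  fixes F :: "'a::euclidean_space \<Rightarrow> 'b::euclidean_space"
  assumes u: "integrable lborel u" and F: "continuous_on UNIV F" "\<And>z. norm z \<ge> \<delta> \<Longrightarrow> F z = 0"
  shows "integrable lborel (\<lambda>y. u y *\<^sub>R F (y - x))"
proof -
  obtain B where B: "B > 0" "\<And>z. norm (F z) \<le> B" using bounded_of_compact_support[OF F] by blast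
  have Fm: "F \<in> borel_measurable borel" by (rule borel_measurable_continuous_onI[OF F(1)])
  show ?thesis
  proof (rule Bochner_Integration.integrable_bound)
    show "integrable lborel (\<lambda>y. B * u y)" using u by simp
    show "(\<lambda>y. u y *\<^sub>R F (y - x)) \<in> borel_measurable lborel"
      using Fm borel_measurable_integrable[OF u] by measurable
    show "AE y in lborel. norm (u y *\<^sub>R F (y - x)) \<le> norm (B * u y)"
    proof (intro AE_I2)
      fix y
      have "norm (u y *\<^sub>R F (y - x)) = norm (F (y - x)) * \<bar>u y\<bar>" by simp
      also have "\<dots> \<le> B * \<bar>u y\<bar>" by (intro mult_right_mono B) simp
      finally show "norm (u y *\<^sub>R F (y - x)) \<le> norm (B * u y)" using B(1) by (simp add: abs_mult)
    qed
  qed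
qed

lemma norm_corr_diff_le:
  fixes f :: "'a::euclidean_space \<Rightarrow> 'b::euclidean_space" and u :: "'a \<Rightarrow> real"
  assumes u: "integrable lborel u" and "integrable lborel f" and "\<And>y. norm (f y) \<le> \<epsilon> * norm (u y)"
  shows "norm (\<integral>y. f y \<partial>lborel) \<le> \<epsilon> * (\<integral>y. norm (u y) \<partial>lborel)"
proof -
  have "norm (\<integral>y. f y \<partial>lborel) \<le> (\<integral>y. norm (f y) \<partial>lborel)" by (rule integral_norm_bound)
  also have "\<dots> \<le> (\<integral>y. \<epsilon> * norm (u y) \<partial>lborel)"
    by (rule integral_mono[OF integrable_norm[OF assms(2)]
          integrable_mult_right[OF integrable_norm[OF u]] assms(3)])
  finally show ?thesis by simp
qed

lemma continuous_corr:
  fixes F :: "'a::euclidean_space \<Rightarrow> 'b::euclidean_space"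
  assumes u: "integrable lborel u" and F: "continuous_on UNIV F" "\<And>z. norm z \<ge> \<delta> \<Longrightarrow> F z = 0"
  shows "continuous_on UNIV (corr u F)"
  unfolding continuous_on_iff
proof (intro ballI allI impI)
  fix x :: 'a and e :: real assume e: "e > 0"
  define I where "I = (\<integral>y. norm (u y) \<partial>lborel)"
  have I: "I \<ge> 0" unfolding I_def by simp
  define \<epsilon> where "\<epsilon> = e / (2 * (I + 1))"
  have "\<epsilon> > 0" using e I by (simp add: \<epsilon>_def)
  then obtain d where d: "d > 0" "\<And>z w. norm (z - w) < d \<Longrightarrow> norm (F z - F w) \<le> \<epsilon>"
    using uniform_continuity_of_compact_support[OF F] by blast
  show "\<exists>d>0. \<forall>x'\<in>UNIV. dist x' x < d \<longrightarrow> dist (corr u F x') (corr u F x) < e"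
  proof (intro exI[of _ d] conjI ballI impI d(1))
    fix x' assume x': "dist x' x < d"
    have i: "integrable lborel (\<lambda>y. u y *\<^sub>R F (y - w))" for w by (rule integrable_corr[OF u F])
    have "corr u F x' - corr u F x = (\<integral>y. u y *\<^sub>R F (y - x') - u y *\<^sub>R F (y - x) \<partial>lborel)"
      unfolding corr_def by (rule Bochner_Integration.integral_diff[symmetric]) (rule i)+
    also have "norm \<dots> \<le> \<epsilon> * I"
      unfolding I_def
    proof (rule norm_corr_diff_le[OF u])
      show "integrable lborel (\<lambda>y. u y *\<^sub>R F (y - x') - u y *\<^sub>R F (y - x))"
        by (intro Bochner_Integration.integrable_diff i)
      fix y
      have "norm (F (y - x') - F (y - x)) \<le> \<epsilon>" using x' by (intro d(2)) (simp add: dist_norm norm_minus_commute)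
      then show "norm (u y *\<^sub>R F (y - x') - u y *\<^sub>R F (y - x)) \<le> \<epsilon> * norm (u y)"
        by (simp add: scaleR_diff_right[symmetric] mult.commute[of \<epsilon>] mult_left_mono)
    qed
    also have "\<epsilon> * I < e"
    proof -
      have "\<epsilon> * I \<le> \<epsilon> * (I + 1)" using \<open>\<epsilon> > 0\<close> by simp
      also have "\<dots> = e / 2" using I by (simp add: \<epsilon>_def field_simps)
      finally show ?thesis using e by linarith
    qed
    finally show "dist (corr u F x') (corr u F x) < e" by (simp add: dist_norm)
  qed
qed

text \<open>Uniform continuity of the gradient of the kernel bounds its first-order Taylor remainder
  by \<epsilon> |h| with the same \<epsilon> for all base points. Integrating this bound against u
  then uses only the L1 norm of u.\<close>

lemma corr_has_derivative:
  fixes f :: "'a::euclidean_space \<Rightarrow> real"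
  assumes u: "integrable lborel u"
    and f: "\<And>z. (f has_derivative (\<lambda>h. Df z \<bullet> h)) (at z)" "\<And>z. norm z \<ge> \<delta> \<Longrightarrow> f z = 0"
    and Df: "continuous_on UNIV Df" "\<And>z. norm z \<ge> \<delta> \<Longrightarrow> Df z = 0"
  shows "(corr u f has_derivative (\<lambda>h. - (corr u Df x) \<bullet> h)) (at x)"
  unfolding has_derivative_at_alt
proof (intro conjI allI impI)
  show "bounded_linear ((\<bullet>) (- corr u Df x))" by (rule bounded_linear_inner_right)
  fix e :: real assume e: "e > 0"
  have fc: "continuous_on UNIV f" by (rule has_derivative_imp_continuous_on[OF f(1)])
  define I where "I = (\<integral>y. norm (u y) \<partial>lborel)"
  have I: "I \<ge> 0" unfolding I_def by simp
  define \<epsilon> where "\<epsilon> = e / (I + 1)"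
  have \<epsilon>: "\<epsilon> > 0" using e I by (simp add: \<epsilon>_def)
  then obtain d where d: "d > 0" "\<And>z w. norm (z - w) < d \<Longrightarrow> norm (Df z - Df w) \<le> \<epsilon>"
    using uniform_continuity_of_compact_support[OF Df] by blast
  show "\<exists>d>0. \<forall>y. norm (y - x) < d \<longrightarrow>
      norm (corr u f y - corr u f x - (- corr u Df x) \<bullet> (y - x)) \<le> e * norm (y - x)"
  proof (intro exI[of _ d] conjI allI impI d(1))
    fix x' assume x': "norm (x' - x) < d"
    define h where "h = x' - x"
    have rem: "\<bar>f (z - h) - f z + Df z \<bullet> h\<bar> \<le> \<epsilon> * norm h" for z
    proof -
      have der: "((\<lambda>t. f (z - t *\<^sub>R h)) has_real_derivative - (Df (z - t *\<^sub>R h) \<bullet> h)) (at t)" for t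
      proof -
        have "((\<lambda>t. z - t *\<^sub>R h) has_derivative (\<lambda>s. - (s *\<^sub>R h))) (at t)"
          by (auto intro!: derivative_eq_intros)
        from has_derivative_compose[OF this f(1)]
        show ?thesis
          unfolding has_field_derivative_def
          by (rule has_derivative_eq_rhs) (simp add: fun_eq_iff)
      qed
      obtain s where s: "0 < s" "s < 1" "f (z - 1 *\<^sub>R h) - f (z - 0 *\<^sub>R h) = (1 - 0) * - (Df (z - s *\<^sub>R h) \<bullet> h)"
        using MVT2[of 0 1 "\<lambda>t. f (z - t *\<^sub>R h)" "\<lambda>t. - (Df (z - t *\<^sub>R h) \<bullet> h)"] der by auto
      have "f (z - h) - f z + Df z \<bullet> h = (Df z - Df (z - s *\<^sub>R h)) \<bullet> h"
        using s(3) by (simp add: inner_diff_left)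
      also have "\<bar>\<dots>\<bar> \<le> norm (Df z - Df (z - s *\<^sub>R h)) * norm h" by (rule Cauchy_Schwarz_ineq2)
      also have "\<dots> \<le> \<epsilon> * norm h"
      proof (rule mult_right_mono[OF d(2)])
        have "s * norm h \<le> 1 * norm h" using s by (intro mult_right_mono) auto
        then show "norm (z - (z - s *\<^sub>R h)) < d" using s x' by (simp add: h_def)
      qed simp
      finally show ?thesis .
    qed
    have i: "integrable lborel (\<lambda>y. u y *\<^sub>R f (y - w))" "integrable lborel (\<lambda>y. u y *\<^sub>R Df (y - x))" for w
      by (rule integrable_corr[OF u fc f(2)], assumption) (rule integrable_corr[OF u Df])
    have i2: "integrable lborel (\<lambda>y. (u y *\<^sub>R Df (y - x)) \<bullet> h)"
      by (rule integrable_inner_left) (rule i(2))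
    have "corr u f x' - corr u f x - (- corr u Df x) \<bullet> h
      = (\<integral>y. u y *\<^sub>R f (y - x') - u y *\<^sub>R f (y - x) + (u y *\<^sub>R Df (y - x)) \<bullet> h \<partial>lborel)"
      unfolding corr_def inner_minus_left integral_inner_left[OF i(2), symmetric]
      using i(1) i2 by (simp del: inner_scaleR_left)
    also have "norm \<dots> \<le> (\<epsilon> * norm h) * I"
      unfolding I_def
    proof (rule norm_corr_diff_le[OF u])
      show "integrable lborel (\<lambda>y. u y *\<^sub>R f (y - x') - u y *\<^sub>R f (y - x) + (u y *\<^sub>R Df (y - x)) \<bullet> h)"
        by (intro Bochner_Integration.integrable_add Bochner_Integration.integrable_diff i i2)
      fix y
      have "u y *\<^sub>R f (y - x') - u y *\<^sub>R f (y - x) + (u y *\<^sub>R Df (y - x)) \<bullet> h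
        = u y * (f ((y - x) - h) - f (y - x) + Df (y - x) \<bullet> h)"
        by (simp add: h_def algebra_simps)
      then show "norm (u y *\<^sub>R f (y - x') - u y *\<^sub>R f (y - x) + (u y *\<^sub>R Df (y - x)) \<bullet> h) \<le> \<epsilon> * norm h * norm (u y)"
        using rem[of "y - x"] by (simp add: abs_mult mult.commute[of "\<bar>u y\<bar>"] mult_right_mono)
    qed
    also have "\<dots> \<le> e * norm h"
    proof -
      have "\<epsilon> * I \<le> \<epsilon> * (I + 1)" using \<epsilon> by simp
      also have "\<dots> = e" using I by (simp add: \<epsilon>_def)
      finally have "\<epsilon> * I * norm h \<le> e * norm h" by (rule mult_right_mono) simp
      then show ?thesis by (simp add: mult_ac)
    qed
    finally show "norm (corr u f x' - corr u f x - (- corr u Df x) \<bullet> (x' - x)) \<le> e * norm (x' - x)"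
      by (simp add: h_def)
  qed
qed

lemma C2_on_corr:
  fixes K :: "'a::euclidean_space \<Rightarrow> real"
  assumes u: "integrable lborel u" and K: "C2_on UNIV K DK D2K"
    and z: "\<And>z. norm z \<ge> \<delta> \<Longrightarrow> K z = 0" "\<And>z. norm z \<ge> \<delta> \<Longrightarrow> DK z = 0" "\<And>z h. norm z \<ge> \<delta> \<Longrightarrow> D2K z h = 0"
  shows "C2_on UNIV (corr u K) (\<lambda>x. - corr u DK x) (\<lambda>x h. corr u (\<lambda>z. D2K z h) x)"
proof -
  note Kd = C2_onD[OF K]
  have i2: "integrable lborel (\<lambda>y. u y *\<^sub>R D2K (y - x) h)" for x h
    by (rule integrable_corr[OF u Kd(4) z(3)])
  have i1: "integrable lborel (\<lambda>y. u y *\<^sub>R DK (y - x))" for x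
    by (rule integrable_corr[OF u Kd(5) z(2)])
  have sym: "corr u (\<lambda>z. D2K z h) x \<bullet> k = corr u (\<lambda>z. D2K z k) x \<bullet> h" for x h k
    unfolding corr_def integral_inner_left[OF i2, symmetric] using Kd(3) by simp
  show ?thesis
    unfolding C2_on_def
  proof (intro conjI ballI allI)
    fix x
    show "(corr u K has_derivative (\<lambda>h. - corr u DK x \<bullet> h)) (at x)"
      by (rule corr_has_derivative[OF u Kd(1) z(1) Kd(5) z(2)]) auto
    show "((\<lambda>x. - corr u DK x) has_derivative (\<lambda>h. corr u (\<lambda>z. D2K z h) x)) (at x)"
    proof (subst has_derivative_componentwise_within, intro ballI)
      fix i :: 'a assume "i \<in> Basis"
      \<comment> \<open>The preceding lemma concerns scalar kernels, so the gradient is treated by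
        components. Symmetry of the Hessian identifies the gradient of the i-th component with
        \<open>D2K z i\<close>.\<close>
      have d: "((\<lambda>z. DK z \<bullet> i) has_derivative (\<lambda>h. D2K z i \<bullet> h)) (at z)" for z
        by (rule has_derivative_eq_rhs[OF has_derivative_inner_left[OF Kd(2)]]) (auto simp: Kd(3)[of z _ i])
      have "(corr u (\<lambda>z. DK z \<bullet> i) has_derivative (\<lambda>h. - corr u (\<lambda>z. D2K z i) x \<bullet> h)) (at x)"
        by (rule corr_has_derivative[OF u d _ Kd(4), where \<delta>=\<delta>]) (auto simp: z)
      then have "((\<lambda>x. - corr u (\<lambda>z. DK z \<bullet> i) x) has_derivative (\<lambda>h. corr u (\<lambda>z. D2K z i) x \<bullet> h)) (at x)"
        using has_derivative_minus by fastforce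
      moreover have "- corr u (\<lambda>z. DK z \<bullet> i) x = - corr u DK x \<bullet> i" for x
        using integral_inner_left[OF i1[of x], of i] by (simp add: corr_def)
      ultimately show "((\<lambda>x. - corr u DK x \<bullet> i) has_derivative (\<lambda>h. corr u (\<lambda>z. D2K z h) x \<bullet> i)) (at x)"
        by (simp add: sym[of _ x i])
    qed
    show "corr u (\<lambda>z. D2K z h) x \<bullet> k = corr u (\<lambda>z. D2K z k) x \<bullet> h" for h k by (rule sym)
  next
    fix h
    show "continuous_on UNIV (\<lambda>x. corr u (\<lambda>z. D2K z h) x)"
      using continuous_corr[OF u Kd(4) z(3)] by simp
  qed
qed

text \<open>Two kinds of smoothness are recorded for two purposes: the C2 data make the mollified
  function admissible in the Carleman estimate, and the \<open>Ck\<close> clause makes each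
  translate of the kernel a test function for the weak derivatives.\<close>

definition mollifier :: "real \<Rightarrow> ('a::euclidean_space \<Rightarrow> real) \<Rightarrow> ('a \<Rightarrow> 'a) \<Rightarrow> ('a \<Rightarrow> 'a \<Rightarrow> 'a) \<Rightarrow> bool" where
  "mollifier \<delta> K DK D2K \<longleftrightarrow> C2_on UNIV K DK D2K \<and> (\<forall>x k. Ck k (\<lambda>y. K (y - x))) \<and> (\<forall>z. 0 \<le> K z) \<and>
    (\<forall>z. norm z \<ge> \<delta> \<longrightarrow> K z = 0 \<and> DK z = 0 \<and> (\<forall>h. D2K z h = 0)) \<and>
    integrable lborel K \<and> (\<integral>z. K z \<partial>lborel) = 1"

lemma mollifier_exists:
  assumes \<delta>: "\<delta> > 0"
  obtains K :: "'a::euclidean_space \<Rightarrow> real" and DK D2K where "mollifier \<delta> K DK D2K"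
proof -
  \<comment> \<open>Composed with \<delta>^2 - |z|^2 this gives the bump exp (-1 / (\<delta>^2 -
    |z|^2)), to be divided by its integral. The formulas for S' and S'' are
    \<open>flat_DERIV\<close> at m = 0 and m = 2.\<close>
  define S where "S = flat 0"
  define S' where "S' t = flat 2 t" for t
  define S'' where "S'' t = flat 4 t - 2 * flat 3 t" for t
  have S: "\<And>t. (S has_real_derivative S' t) (at t)" "\<And>t. (S' has_real_derivative S'' t) (at t)"
    using flat_DERIV[of 0] flat_DERIV[of 2]
    unfolding S_def S'_def[abs_def] S''_def by (simp_all add: numeral_eq_Suc)
  have cf: "continuous_on UNIV (flat m)" for m using Ck_flat[of 0 m] by simp
  have cS: "continuous_on UNIV S''" unfolding S''_def[abs_def] by (intro continuous_intros cf)
  define q :: "'a \<Rightarrow> real" where "q z = \<delta>\<^sup>2 + (-1) * ((z - 0) \<bullet> (z - 0))" for z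
  define K0 where "K0 z = S (q z)" for z
  define DK0 where "DK0 z = (2 * (-1) * S' (q z)) *\<^sub>R (z - 0)" for z
  define D2K0 where "D2K0 z h = (2 * (-1) * S' (q z)) *\<^sub>R h + (4 * (-1)\<^sup>2 * S'' (q z)) *\<^sub>R (((z - 0) \<bullet> h) *\<^sub>R (z - 0))" for z h
  have C: "C2_on UNIV K0 DK0 D2K0"
    using C2_on_radial[OF S cS, of "\<delta>\<^sup>2" "-1" "0::'a"]
    unfolding K0_def[abs_def] DK0_def[abs_def] D2K0_def[abs_def] q_def[abs_def] .
  have far: "K0 z = 0 \<and> DK0 z = 0 \<and> (\<forall>h. D2K0 z h = 0)" if "norm z \<ge> \<delta>" for z
  proof -
    have "\<delta>\<^sup>2 \<le> z \<bullet> z" using power_mono[OF that, of 2] \<delta> by (simp add: power2_norm_eq_inner)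
    then have "q z \<le> 0" by (simp add: q_def)
    then show ?thesis by (simp add: K0_def DK0_def D2K0_def S_def S'_def S''_def flat_zero)
  qed
  have nn: "K0 z \<ge> 0" for z by (simp add: K0_def S_def flat_nonneg)
  have K0c: "continuous_on UNIV K0" using C2_onD(6)[OF C] .
  have K0e: "K0 = (\<lambda>z. indicator (cball 0 \<delta>) z *\<^sub>R K0 z)"
  proof
    show "K0 z = indicator (cball 0 \<delta>) z *\<^sub>R K0 z" for z
      using far[of z] by (cases "norm z \<le> \<delta>") auto
  qed
  have int: "integrable lborel K0"
    by (subst K0e, rule borel_integrable_compact) (auto intro: continuous_on_subset[OF K0c])
  define c where "c = (\<integral>z. K0 z \<partial>lborel)"
  have c: "c > 0"
  proof -
    have "c \<ge> 0" unfolding c_def using nn by (intro Bochner_Integration.integral_nonneg) auto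
    moreover have "c \<noteq> 0"
    proof
      assume "c = 0"
      then have "AE z in lborel. K0 z = 0"
        using integral_nonneg_eq_0_iff_AE[OF int] nn by (auto simp: c_def)
      then have "AE z in lborel. z \<notin> ball (0::'a) \<delta>"
      proof eventually_elim
        case (elim z)
        show "z \<notin> ball 0 \<delta>"
        proof
          assume "z \<in> ball 0 \<delta>"
          then have "(norm z)\<^sup>2 < \<delta>\<^sup>2" by (intro power_strict_mono) auto
          then have "q z > 0" by (simp add: q_def power2_norm_eq_inner)
          then show False using elim flat_pos[of "q z" 0] by (simp add: K0_def S_def)
        qed
      qed
      then have "emeasure lborel (ball (0::'a) \<delta>) = 0"
        by (subst (asm) AE_iff_measurable[where N="ball (0::'a) \<delta>"]) auto
      then have "negligible (ball (0::'a) \<delta>)"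
        by (auto simp: negligible_iff_null_sets simp del: mem_ball intro!: null_sets_completionI null_setsI)
      then show False using \<delta> open_not_negligible[of "ball (0::'a) \<delta>"] by auto
    qed
    ultimately show ?thesis by simp
  qed
  define K where "K z = (1 / c) * K0 z" for z
  have CK: "C2_on UNIV K (\<lambda>z. (1 / c) *\<^sub>R DK0 z) (\<lambda>z h. (1 / c) *\<^sub>R D2K0 z h)"
  proof -
    have "C2_on UNIV (\<lambda>z::'a. 1 / c) (\<lambda>z. 0) (\<lambda>z h. 0)"
    proof -
      have "(\<lambda>h. (0::'a) \<bullet> h) = (\<lambda>h. 0)" by auto
      then show ?thesis by (simp add: C2_on_def)
    qed
    from C2_on_mult[OF this C] show ?thesis unfolding K_def[abs_def] by simp
  qed
  have "Ck k (\<lambda>y. K (y - x))" for x k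
    unfolding K_def K0_def S_def q_def
    using Ck_mult[OF Ck_const[of k "1/c"] Ck_compose[OF Ck_flat[of k 0]
          Ck_add[OF Ck_const[of k "\<delta>\<^sup>2"] Ck_mult[OF Ck_const[of k "-1"] Ck_sq_dist[of k x]]]]]
    by simp
  then have "mollifier \<delta> K (\<lambda>z. (1 / c) *\<^sub>R DK0 z) (\<lambda>z h. (1 / c) *\<^sub>R D2K0 z h)"
    unfolding mollifier_def using CK far nn c int
    by (auto simp: K_def[abs_def] c_def[symmetric])
  then show ?thesis by (rule that)
qed

section \<open>Approximation in L2 by convolution\<close>

definition unit_kernel :: "real \<Rightarrow> ('a::euclidean_space \<Rightarrow> real) \<Rightarrow> bool" where
  "unit_kernel \<delta> K \<longleftrightarrow> continuous_on UNIV K \<and> (\<forall>z. 0 \<le> K z) \<and> (\<forall>z. norm z \<ge> \<delta> \<longrightarrow> K z = 0) \<and>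
    integrable lborel K \<and> (\<integral>z. K z \<partial>lborel) = 1"

lemma mollifier_unit_kernel: "mollifier \<delta> K DK D2K \<Longrightarrow> unit_kernel \<delta> K"
  unfolding mollifier_def unit_kernel_def using C2_onD(6)[of UNIV K DK D2K] by auto

lemma kernD:
  assumes "unit_kernel \<delta> K"
  shows "continuous_on UNIV K" "0 \<le> K z" "norm z \<ge> \<delta> \<Longrightarrow> K z = 0" "K \<in> borel_measurable borel"
    "integrable lborel (\<lambda>y. K (y - x))" "(\<integral>y. K (y - x) \<partial>lborel) = 1"
proof -
  show K: "continuous_on UNIV K" "0 \<le> K z" "norm z \<ge> \<delta> \<Longrightarrow> K z = 0" using assms by (auto simp: unit_kernel_def)
  show m: "K \<in> borel_measurable borel" by (rule borel_measurable_continuous_onI[OF K(1)])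
  have "integrable lborel K" "(\<integral>z. K z \<partial>lborel) = 1" using assms by (auto simp: unit_kernel_def)
  then show "integrable lborel (\<lambda>y. K (y - x))" "(\<integral>y. K (y - x) \<partial>lborel) = 1"
    using integrable_lborel_translate[of K "- x"] integral_lborel_translate[OF m, of "- x"]
    by (simp_all add: add.commute[of "- x"])
qed

text \<open>Jensen's inequality for the probability density K (y - x), obtained by expanding the
  nonnegative integral of (f - c)^2 K with c the mean value. The extended nonnegative integral
  disposes of the case of an infinite right side.\<close>

lemma corr_square_le:
  assumes K: "unit_kernel \<delta> K" and f: "f \<in> borel_measurable borel"
  shows "ennreal ((corr f K x)\<^sup>2) \<le> (\<integral>\<^sup>+y. ennreal ((f y)\<^sup>2 * K (y - x)) \<partial>lborel)"
proof (cases "(\<integral>\<^sup>+y. ennreal ((f y)\<^sup>2 * K (y - x)) \<partial>lborel) = \<infinity>")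
  case False
  note k = kernD[OF K]
  have m: "(\<lambda>y. (f y)\<^sup>2 * K (y - x)) \<in> borel_measurable lborel"
    "(\<lambda>y. f y * K (y - x)) \<in> borel_measurable lborel"
    using f k(4) by measurable
  have i2: "integrable lborel (\<lambda>y. (f y)\<^sup>2 * K (y - x))"
    by (rule integrableI_nonneg[OF m(1)]) (use False k(2) in \<open>auto simp: top.not_eq_extremum less_top\<close>)
  have i1: "integrable lborel (\<lambda>y. f y * K (y - x))"
  proof (rule Bochner_Integration.integrable_bound[OF Bochner_Integration.integrable_add[OF i2 k(5)[of x]] m(2)])
    show "AE y in lborel. norm (f y * K (y - x)) \<le> norm ((f y)\<^sup>2 * K (y - x) + K (y - x))"
    proof (intro AE_I2)
      fix y
      have "\<bar>f y\<bar> \<le> (f y)\<^sup>2 + 1"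
        using zero_le_power2[of "\<bar>f y\<bar> - 1"] by (simp add: power2_eq_square algebra_simps)
      then have "\<bar>f y\<bar> * K (y - x) \<le> ((f y)\<^sup>2 + 1) * K (y - x)" by (intro mult_right_mono k(2))
      then show "norm (f y * K (y - x)) \<le> norm ((f y)\<^sup>2 * K (y - x) + K (y - x))"
        using k(2)[of "y - x"] by (simp add: abs_mult distrib_right)
    qed
  qed
  define c where "c = corr f K x"
  have c: "(\<integral>y. f y * K (y - x) \<partial>lborel) = c" by (simp add: c_def corr_def)
  have "0 \<le> (\<integral>y. (f y)\<^sup>2 * K (y - x) - 2 * c * (f y * K (y - x)) + c\<^sup>2 * K (y - x) \<partial>lborel)"
  proof (intro Bochner_Integration.integral_nonneg)
    fix y
    have "0 \<le> (f y - c)\<^sup>2 * K (y - x)" using k(2) by simp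
    then show "0 \<le> (f y)\<^sup>2 * K (y - x) - 2 * c * (f y * K (y - x)) + c\<^sup>2 * K (y - x)"
      by (simp add: power2_eq_square algebra_simps)
  qed
  also have "\<dots> = (\<integral>y. (f y)\<^sup>2 * K (y - x) \<partial>lborel) - 2 * c * c + c\<^sup>2"
    using i1 i2 k(5)[of x] k(6)[of x] c by simp
  finally have "c\<^sup>2 \<le> (\<integral>y. (f y)\<^sup>2 * K (y - x) \<partial>lborel)" by (simp add: power2_eq_square)
  then have "ennreal (c\<^sup>2) \<le> ennreal (\<integral>y. (f y)\<^sup>2 * K (y - x) \<partial>lborel)" by (rule ennreal_leI)
  also have "\<dots> = (\<integral>\<^sup>+y. ennreal ((f y)\<^sup>2 * K (y - x)) \<partial>lborel)"
    by (rule nn_integral_eq_integral[OF i2, symmetric]) (use k(2) in auto)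
  finally show ?thesis by (simp add: c_def)
qed simp

text \<open>After Jensen's inequality, exchanging the order of integration leaves the mass of the
  kernel, which is 1, times a translation-invariant integral.\<close>

lemma corr_contraction:
  fixes f :: "'a::euclidean_space \<Rightarrow> real"
  assumes K: "unit_kernel \<delta> K" and f[measurable]: "f \<in> borel_measurable borel"
  shows "(\<integral>\<^sup>+x. ennreal ((corr f K x)\<^sup>2) \<partial>lborel) \<le> (\<integral>\<^sup>+x. ennreal ((f x)\<^sup>2) \<partial>lborel)"
proof -
  note k = kernD[OF K]
  have [measurable]: "K \<in> borel_measurable borel" by (rule k(4))
  have "(\<integral>\<^sup>+x. ennreal ((corr f K x)\<^sup>2) \<partial>lborel) \<le> (\<integral>\<^sup>+x. (\<integral>\<^sup>+y. ennreal ((f y)\<^sup>2 * K (y - x)) \<partial>lborel) \<partial>lborel)"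
    by (intro nn_integral_mono corr_square_le[OF K f])
  also have "\<dots> = (\<integral>\<^sup>+x. (\<integral>\<^sup>+z. ennreal ((f (x + z))\<^sup>2 * K z) \<partial>lborel) \<partial>lborel)"
  proof (rule nn_integral_cong)
    fix x :: 'a
    have "(\<integral>\<^sup>+z. ennreal ((f (x + z))\<^sup>2 * K ((x + z) - x)) \<partial>lborel) = (\<integral>\<^sup>+y. ennreal ((f y)\<^sup>2 * K (y - x)) \<partial>lborel)"
      by (rule nn_integral_lborel_translate) measurable
    then show "(\<integral>\<^sup>+y. ennreal ((f y)\<^sup>2 * K (y - x)) \<partial>lborel) = (\<integral>\<^sup>+z. ennreal ((f (x + z))\<^sup>2 * K z) \<partial>lborel)"
      by simp
  qed
  also have "\<dots> = (\<integral>\<^sup>+z. (\<integral>\<^sup>+x. ennreal ((f (x + z))\<^sup>2 * K z) \<partial>lborel) \<partial>lborel)"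
  proof (rule lborel_pair.Fubini'[symmetric])
    have "(\<lambda>w. ennreal ((f (fst w + snd w))\<^sup>2 * K (snd w))) \<in> borel_measurable (lborel \<Otimes>\<^sub>M lborel)"
      by measurable
    then show "(\<lambda>(x, z). ennreal ((f (x + z))\<^sup>2 * K z)) \<in> borel_measurable (lborel \<Otimes>\<^sub>M lborel)"
      by (simp add: case_prod_beta')
  qed
  also have "\<dots> = (\<integral>\<^sup>+z. ennreal (K z) * (\<integral>\<^sup>+x. ennreal ((f x)\<^sup>2) \<partial>lborel) \<partial>lborel)"
  proof (rule nn_integral_cong)
    fix z :: 'a
    have "(\<integral>\<^sup>+x. ennreal ((f (x + z))\<^sup>2 * K z) \<partial>lborel) = (\<integral>\<^sup>+x. ennreal (K z) * ennreal ((f (z + x))\<^sup>2) \<partial>lborel)"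
      using k(2) by (intro nn_integral_cong) (simp add: ennreal_mult mult.commute add.commute)
    also have "\<dots> = ennreal (K z) * (\<integral>\<^sup>+x. ennreal ((f (z + x))\<^sup>2) \<partial>lborel)"
      by (rule nn_integral_cmult) measurable
    also have "(\<integral>\<^sup>+x. ennreal ((f (z + x))\<^sup>2) \<partial>lborel) = (\<integral>\<^sup>+x. ennreal ((f x)\<^sup>2) \<partial>lborel)"
      by (rule nn_integral_lborel_translate) measurable
    finally show "(\<integral>\<^sup>+x. ennreal ((f (x + z))\<^sup>2 * K z) \<partial>lborel) = ennreal (K z) * (\<integral>\<^sup>+x. ennreal ((f x)\<^sup>2) \<partial>lborel)" .
  qed
  also have "\<dots> = (\<integral>\<^sup>+z. ennreal (K z) \<partial>lborel) * (\<integral>\<^sup>+x. ennreal ((f x)\<^sup>2) \<partial>lborel)"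
    by (rule nn_integral_multc) measurable
  also have "(\<integral>\<^sup>+z. ennreal (K z) \<partial>lborel) = 1"
    using k(2) k(5)[of 0] k(6)[of 0] by (simp add: nn_integral_eq_integral)
  finally show ?thesis by simp
qed

lemma square_add_le: "(x + y)\<^sup>2 \<le> 2 * x\<^sup>2 + 2 * (y::real)\<^sup>2"
  using zero_le_power2[of "x - y"] by (simp add: power2_eq_square algebra_simps)

lemma square_add3_le: "(x + y + z)\<^sup>2 \<le> 3 * x\<^sup>2 + 3 * y\<^sup>2 + 3 * (z::real)\<^sup>2"
  using zero_le_power2[of "x - y"] zero_le_power2[of "x - z"] zero_le_power2[of "y - z"]
  by (simp add: power2_eq_square algebra_simps)

text \<open>Truncation at height m costs little by dominated convergence. A bounded measurable
  function is an almost everywhere limit of continuous ones, which is how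
  \<open>measurable_on\<close> is defined. Both errors are made smaller than \<epsilon>/4, since (x
  + y)^2 \<le> 2 x^2 + 2 y^2 doubles each of them.\<close>

lemma continuous_dense_L2:
  fixes f :: "'a::euclidean_space \<Rightarrow> real"
  assumes f[measurable]: "f \<in> borel_measurable borel" and fz: "\<And>x. norm x > R \<Longrightarrow> f x = 0"
    and fin: "(\<integral>\<^sup>+x. ennreal ((f x)\<^sup>2) \<partial>lborel) < \<infinity>" and e: "\<epsilon> > 0"
  obtains p where "continuous_on UNIV p" "\<And>x. norm x \<ge> R + 1 \<Longrightarrow> p x = 0"
    "(\<integral>\<^sup>+x. ennreal ((f x - p x)\<^sup>2) \<partial>lborel) \<le> ennreal \<epsilon>"
proof -
  define fm where "fm m x = max (- real m) (min (real m) (f x))" for m x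
  have [measurable]: "fm m \<in> borel_measurable borel" for m unfolding fm_def[abs_def] by measurable
  have "(\<lambda>m. \<integral>\<^sup>+x. ennreal ((f x - fm m x)\<^sup>2) \<partial>lborel) \<longlonglongrightarrow> (\<integral>\<^sup>+x. ennreal 0 \<partial>(lborel::'a measure))"
  proof (rule nn_integral_dominated_convergence[where w="\<lambda>x. ennreal ((f x)\<^sup>2)"])
    show "AE x in lborel. ennreal ((f x - fm m x)\<^sup>2) \<le> ennreal ((f x)\<^sup>2)" for m
    proof (intro AE_I2 ennreal_leI)
      fix x show "(f x - fm m x)\<^sup>2 \<le> (f x)\<^sup>2"
        by (rule abs_le_square_iff[THEN iffD1]) (auto simp: fm_def)
    qed
    show "AE x in lborel. (\<lambda>m. ennreal ((f x - fm m x)\<^sup>2)) \<longlonglongrightarrow> ennreal 0"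
    proof (intro AE_I2 tendsto_eventually)
      fix x
      obtain N :: nat where "\<bar>f x\<bar> \<le> real N" using real_arch_simple by blast
      then have "\<And>m. m \<ge> N \<Longrightarrow> fm m x = f x" unfolding fm_def by (auto simp: max_def min_def)
      then show "\<forall>\<^sub>F m in sequentially. ennreal ((f x - fm m x)\<^sup>2) = ennreal 0"
        by (intro eventually_sequentiallyI[of N]) simp
    qed
  qed (use fin in auto)
  then have "\<forall>\<^sub>F m in sequentially. (\<integral>\<^sup>+x. ennreal ((f x - fm m x)\<^sup>2) \<partial>lborel) < ennreal (\<epsilon> / 4)"
    by (rule order_tendstoD) (use e in simp)
  then obtain m where m: "(\<integral>\<^sup>+x. ennreal ((f x - fm m x)\<^sup>2) \<partial>lborel) < ennreal (\<epsilon> / 4)"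
    using eventually_happens by force
  have "fm m \<in> borel_measurable (lebesgue_on UNIV)"
    by (intro measurable_restrict_space1 measurable_completion) simp
  then have "fm m measurable_on UNIV" by (simp add: measurable_on_iff_borel_measurable)
  then obtain N g where N: "negligible N" and g: "\<And>n. continuous_on UNIV (g n)"
    and lim: "\<And>x. x \<notin> N \<Longrightarrow> (\<lambda>n. g n x) \<longlonglongrightarrow> fm m x"
    unfolding measurable_on_def by auto
  define c where "c x = max 0 (min 1 (R + 1 - norm x))" for x :: 'a
  have c: "continuous_on UNIV c" unfolding c_def[abs_def] by (intro continuous_intros)
  have c01: "0 \<le> c x" "c x \<le> 1" for x by (auto simp: c_def)
  \<comment> \<open>The continuous approximants converge only pointwise. Truncating them at m and
    multiplying by the cut-off c gives a common bound and a common support, while the limit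
    \<open>fm m\<close> is left unchanged by both operations.\<close>
  define p where "p n x = c x * max (- real m) (min (real m) (g n x))" for n x
  have pc: "continuous_on UNIV (p n)" for n unfolding p_def[abs_def] by (intro continuous_intros c g)
  have [measurable]: "p n \<in> borel_measurable borel" for n by (rule borel_measurable_continuous_onI[OF pc])
  have pz: "p n x = 0" if "norm x \<ge> R + 1" for n x using that by (simp add: p_def c_def)
  have fmz: "fm m x = 0" if "norm x > R" for x using fz[OF that] by (simp add: fm_def)
  have pb: "\<bar>p n x\<bar> \<le> real m" for n x
  proof -
    have "\<bar>p n x\<bar> \<le> 1 * real m" unfolding p_def abs_mult using c01[of x] by (intro mult_mono) auto
    then show ?thesis by simp
  qed
  have fmb: "\<bar>fm m x\<bar> \<le> real m" for x by (auto simp: fm_def)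
  have "(\<lambda>n. \<integral>\<^sup>+x. ennreal ((fm m x - p n x)\<^sup>2) \<partial>lborel) \<longlonglongrightarrow> (\<integral>\<^sup>+x. ennreal 0 \<partial>(lborel::'a measure))"
  proof (rule nn_integral_dominated_convergence[where w="\<lambda>x. ennreal ((2 * real m)\<^sup>2) * indicator (cball 0 (R + 1)) x"])
    show "AE x in lborel. ennreal ((fm m x - p n x)\<^sup>2) \<le> ennreal ((2 * real m)\<^sup>2) * indicator (cball 0 (R + 1)) x" for n
    proof (intro AE_I2)
      fix x
      have "\<bar>fm m x - p n x\<bar> \<le> \<bar>2 * real m\<bar>" using fmb[of x] pb[of n x] by auto
      then have "(fm m x - p n x)\<^sup>2 \<le> (2 * real m)\<^sup>2" by (rule abs_le_square_iff[THEN iffD1])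
      then show "ennreal ((fm m x - p n x)\<^sup>2) \<le> ennreal ((2 * real m)\<^sup>2) * indicator (cball 0 (R + 1)) x"
        using pz[of x n] fmz[of x] by (cases "norm x \<le> R + 1") (auto intro: ennreal_leI)
    qed
    show "(\<integral>\<^sup>+x. ennreal ((2 * real m)\<^sup>2) * indicator (cball 0 (R + 1)) x \<partial>(lborel::'a measure)) < \<infinity>"
      by (subst nn_integral_cmult_indicator)
        (auto intro!: ennreal_mult_less_top[THEN iffD2] simp: emeasure_lborel_cball_finite[unfolded infinity_ennreal_def])
    have "AE x in lebesgue. x \<notin> N" using N by (auto simp: negligible_iff_null_sets intro: AE_not_in)
    then have "AE x in lborel. x \<notin> N" by (simp add: AE_completion_iff)
    then show "AE x in lborel. (\<lambda>n. ennreal ((fm m x - p n x)\<^sup>2)) \<longlonglongrightarrow> ennreal 0"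
    proof eventually_elim
      case (elim x)
      have "(\<lambda>n. p n x) \<longlonglongrightarrow> c x * max (- real m) (min (real m) (fm m x))"
        unfolding p_def by (intro tendsto_intros lim elim)
      also have "c x * max (- real m) (min (real m) (fm m x)) = fm m x"
        using fmb[of x] fmz[of x] by (cases "norm x > R") (auto simp: c_def max_def min_def)
      finally have "(\<lambda>n. (fm m x - p n x)\<^sup>2) \<longlonglongrightarrow> (fm m x - fm m x)\<^sup>2" by (intro tendsto_intros)
      then show ?case by (intro tendsto_ennrealI) simp
    qed
    show "(\<lambda>x. ennreal ((2 * real m)\<^sup>2) * indicator (cball (0::'a) (R + 1)) x) \<in> borel_measurable lborel"
      by (intro borel_measurable_times_ennreal borel_measurable_const borel_measurable_indicator) simp
  qed auto
  then have "\<forall>\<^sub>F n in sequentially. (\<integral>\<^sup>+x. ennreal ((fm m x - p n x)\<^sup>2) \<partial>lborel) < ennreal (\<epsilon> / 4)"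
    by (rule order_tendstoD) (use e in simp)
  then obtain n where n: "(\<integral>\<^sup>+x. ennreal ((fm m x - p n x)\<^sup>2) \<partial>lborel) < ennreal (\<epsilon> / 4)"
    using eventually_happens by force
  have "(\<integral>\<^sup>+x. ennreal ((f x - p n x)\<^sup>2) \<partial>lborel)
    \<le> (\<integral>\<^sup>+x. 2 * ennreal ((f x - fm m x)\<^sup>2) + 2 * ennreal ((fm m x - p n x)\<^sup>2) \<partial>lborel)"
  proof (intro nn_integral_mono)
    fix x
    have "(f x - p n x)\<^sup>2 \<le> 2 * (f x - fm m x)\<^sup>2 + 2 * (fm m x - p n x)\<^sup>2"
      using square_add_le[of "f x - fm m x" "fm m x - p n x"] by simp
    then have "ennreal ((f x - p n x)\<^sup>2) \<le> ennreal (2 * (f x - fm m x)\<^sup>2 + 2 * (fm m x - p n x)\<^sup>2)"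
      by (rule ennreal_leI)
    then show "ennreal ((f x - p n x)\<^sup>2) \<le> 2 * ennreal ((f x - fm m x)\<^sup>2) + 2 * ennreal ((fm m x - p n x)\<^sup>2)"
      by (simp add: ennreal_plus ennreal_mult del: ennreal_plus[symmetric])
  qed
  also have "\<dots> = 2 * (\<integral>\<^sup>+x. ennreal ((f x - fm m x)\<^sup>2) \<partial>lborel) + 2 * (\<integral>\<^sup>+x. ennreal ((fm m x - p n x)\<^sup>2) \<partial>lborel)"
    by (subst nn_integral_add) (auto simp: nn_integral_cmult)
  also have "\<dots> \<le> 2 * ennreal (\<epsilon> / 4) + 2 * ennreal (\<epsilon> / 4)"
    using m n by (intro add_mono mult_left_mono) auto
  also have "\<dots> = ennreal \<epsilon>"
  proof -
    have "2 * ennreal (\<epsilon> / 4) = ennreal (\<epsilon> / 2)"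
      using e ennreal_mult[of 2 "\<epsilon> / 4"] by simp
    then show ?thesis using e ennreal_plus[of "\<epsilon>/2" "\<epsilon>/2"] by simp
  qed
  finally show ?thesis using that[of "p n"] pc pz by blast
qed

lemma integrable_of_square_integrable:
  fixes f :: "'a::euclidean_space \<Rightarrow> real"
  assumes f[measurable]: "f \<in> borel_measurable borel" and fz: "\<And>x. norm x > R \<Longrightarrow> f x = 0"
    and fin: "(\<integral>\<^sup>+x. ennreal ((f x)\<^sup>2) \<partial>lborel) < \<infinity>"
  shows "integrable lborel f"
proof -
  have i2: "integrable lborel (\<lambda>x. (f x)\<^sup>2)"
    by (rule integrableI_nonneg) (use fin in auto)
  have i1: "integrable lborel (\<lambda>x. indicator (cball 0 R) x :: real)"
    by (intro integrable_real_indicator emeasure_bounded_finite) auto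
  show ?thesis
  proof (rule Bochner_Integration.integrable_bound[OF Bochner_Integration.integrable_add[OF i2 i1]])
    show "AE x in lborel. norm (f x) \<le> norm ((f x)\<^sup>2 + indicator (cball 0 R) x)"
    proof (intro AE_I2)
      fix x
      have "\<bar>f x\<bar> \<le> (f x)\<^sup>2 + 1"
        using zero_le_power2[of "\<bar>f x\<bar> - 1"] by (simp add: power2_eq_square algebra_simps)
      then show "norm (f x) \<le> norm ((f x)\<^sup>2 + indicator (cball 0 R) x)"
        using fz[of x] by (cases "norm x \<le> R") auto
    qed
  qed auto
qed

lemma corr_uniform:
  fixes p :: "'a::euclidean_space \<Rightarrow> real"
  assumes K: "unit_kernel \<delta> K" and p: "integrable lborel p"
    and unif: "\<And>z w. norm (z - w) < d \<Longrightarrow> norm (p z - p w) \<le> \<epsilon>" and "\<delta> \<le> d"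
  shows "\<bar>corr p K x - p x\<bar> \<le> \<epsilon>"
proof -
  note k = kernD[OF K]
  have i: "integrable lborel (\<lambda>y. p y *\<^sub>R K (y - x))" by (rule integrable_corr[OF p k(1) k(3)])
  have i': "integrable lborel (\<lambda>y. p y *\<^sub>R K (y - x) - p x * K (y - x))"
    by (intro Bochner_Integration.integrable_diff i integrable_mult_right k(5))
  have "corr p K x - p x = (\<integral>y. p y *\<^sub>R K (y - x) - p x * K (y - x) \<partial>lborel)"
    unfolding corr_def using i k(5)[of x] k(6)[of x] by simp
  also have "\<bar>\<dots>\<bar> \<le> (\<integral>y. \<bar>p y *\<^sub>R K (y - x) - p x * K (y - x)\<bar> \<partial>lborel)"
    using integral_norm_bound[of lborel "\<lambda>y. p y *\<^sub>R K (y - x) - p x * K (y - x)"] by simp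
  also have "\<dots> \<le> (\<integral>y. \<epsilon> * K (y - x) \<partial>lborel)"
  proof (rule integral_mono)
    show "integrable lborel (\<lambda>y. \<bar>p y *\<^sub>R K (y - x) - p x * K (y - x)\<bar>)" using i' by (rule integrable_abs)
    show "integrable lborel (\<lambda>y. \<epsilon> * K (y - x))" by (intro integrable_mult_right k(5))
    fix y
    show "\<bar>p y *\<^sub>R K (y - x) - p x * K (y - x)\<bar> \<le> \<epsilon> * K (y - x)"
    proof (cases "norm (y - x) < \<delta>")
      case True
      then have "\<bar>p y - p x\<bar> \<le> \<epsilon>" using unif[of y x] \<open>\<delta> \<le> d\<close> by simp
      then have "\<bar>p y - p x\<bar> * K (y - x) \<le> \<epsilon> * K (y - x)" by (intro mult_right_mono k(2))
      moreover have "\<bar>p y *\<^sub>R K (y - x) - p x * K (y - x)\<bar> = \<bar>p y - p x\<bar> * K (y - x)"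
        using k(2)[of "y - x"] by (simp add: left_diff_distrib[symmetric] abs_mult)
      ultimately show ?thesis by simp
    next
      case False
      then show ?thesis using k(3)[of "y - x"] by simp
    qed
  qed
  also have "\<dots> = \<epsilon>" using k(6) by simp
  finally show ?thesis .
qed

lemma corr_local_zero:
  fixes p :: "'a::euclidean_space \<Rightarrow> real"
  assumes K: "unit_kernel \<delta> K" and "\<And>y. norm (y - x) < \<delta> \<Longrightarrow> p y = 0"
  shows "corr p K x = 0"
proof -
  have "p y *\<^sub>R K (y - x) = 0" for y
    using assms(2)[of y] kernD(3)[OF K, of "y - x"] by (cases "norm (y - x) < \<delta>") auto
  then have "(\<lambda>y. p y *\<^sub>R K (y - x)) = (\<lambda>y. 0)" by blast
  then show ?thesis by (simp only: corr_def Bochner_Integration.integral_zero)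
qed

lemma corr_measurable[measurable]:
  fixes f :: "'a::euclidean_space \<Rightarrow> real"
  assumes "unit_kernel \<delta> K" "integrable lborel f"
  shows "corr f K \<in> borel_measurable borel"
  using continuous_corr[OF assms(2) kernD(1)[OF assms(1)] kernD(3)[OF assms(1)]]
  by (rule borel_measurable_continuous_onI)

text \<open>The function f is split as (f - p) + p with p continuous of bounded support. Convolution
  is a contraction on f - p and moves p only slightly in the supremum norm. Three squared errors of
  at most e2/12, each weighted by 3, stay below e2.\<close>

lemma corr_L2_convergence:
  fixes f :: "'a::euclidean_space \<Rightarrow> real"
  assumes f[measurable]: "f \<in> borel_measurable borel" and fz: "\<And>x. norm x > R \<Longrightarrow> f x = 0"
    and fin: "(\<integral>\<^sup>+x. ennreal ((f x)\<^sup>2) \<partial>lborel) < \<infinity>"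
    and K: "\<And>n. unit_kernel (\<delta> n) (K n)" and \<delta>: "\<delta> \<longlonglongrightarrow> 0"
  shows "(\<lambda>n. \<integral>\<^sup>+x. ennreal ((corr f (K n) x - f x)\<^sup>2) \<partial>lborel) \<longlonglongrightarrow> 0"
proof (rule order_tendstoI)
  fix e :: ennreal assume "0 < e"
  \<comment> \<open>The tolerance e may be infinite, so a positive real number strictly below it is
    selected first.\<close>
  then obtain e1 where e1: "0 < e1" "e1 < e" using dense by blast
  define e2 where "e2 = enn2real e1"
  have "e1 < top" using e1 by (auto simp: less_top[symmetric] top_unique)
  then have e2: "e2 > 0" "ennreal e2 < e" using e1 by (auto simp: e2_def enn2real_positive_iff)
  have fint: "integrable lborel f" by (rule integrable_of_square_integrable[OF f fz fin])
  obtain p where p: "continuous_on UNIV p" and pz: "\<And>x. norm x \<ge> R + 1 \<Longrightarrow> p x = 0"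
    and fp: "(\<integral>\<^sup>+x. ennreal ((f x - p x)\<^sup>2) \<partial>lborel) \<le> ennreal (e2 / 12)"
    by (rule continuous_dense_L2[OF f _ fin, of R "e2 / 12"]) (use fz e2 in auto)
  have [measurable]: "p \<in> borel_measurable borel" by (rule borel_measurable_continuous_onI[OF p])
  have pint: "integrable lborel p"
  proof -
    have e: "(\<lambda>z. indicator (cball 0 (R + 1)) z *\<^sub>R p z) = p"
    proof
      show "indicator (cball 0 (R + 1)) z *\<^sub>R p z = p z" for z
        using pz[of z] by (cases "norm z \<le> R + 1") auto
    qed
    have "integrable lborel (\<lambda>z. indicator (cball 0 (R + 1)) z *\<^sub>R p z)"
      by (rule borel_integrable_compact) (auto intro: continuous_on_subset[OF p])
    then show ?thesis unfolding e .
  qed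
  define V where "V = measure lborel (cball (0::'a) (R + 2))"
  have V: "emeasure lborel (cball (0::'a) (R + 2)) = ennreal V" "V \<ge> 0"
    unfolding V_def
    using emeasure_lborel_cball_finite[of "0::'a" "R + 2"] by (auto simp: emeasure_eq_ennreal_measure)
  define \<epsilon> where "\<epsilon> = sqrt (e2 / (12 * (V + 1)))"
  have \<epsilon>: "\<epsilon> > 0" "\<epsilon>\<^sup>2 * V \<le> e2 / 12"
  proof -
    show "\<epsilon> > 0" using e2 V by (simp add: \<epsilon>_def)
    have "\<epsilon>\<^sup>2 = e2 / (12 * (V + 1))" using e2 V by (simp add: \<epsilon>_def)
    then have "\<epsilon>\<^sup>2 * (V + 1) = e2 / 12" using V by (simp add: field_simps)
    moreover have "\<epsilon>\<^sup>2 * V \<le> \<epsilon>\<^sup>2 * (V + 1)" by (intro mult_left_mono) auto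
    ultimately show "\<epsilon>\<^sup>2 * V \<le> e2 / 12" by simp
  qed
  \<comment> \<open>Kernel radii below d keep the convolution of p within \<epsilon> of p; radii
    below 1 keep its support in the ball of radius R + 2, whose volume V entered the choice of
    \<epsilon>.\<close>
  obtain d where d: "d > 0" "\<And>z w. norm (z - w) < d \<Longrightarrow> norm (p z - p w) \<le> \<epsilon>"
    using uniform_continuity_of_compact_support[OF p pz \<epsilon>(1)] by blast
  have "\<forall>\<^sub>F n in sequentially. \<delta> n < min d 1" using order_tendstoD(2)[OF \<delta>, of "min d 1"] d by simp
  then show "\<forall>\<^sub>F n in sequentially. (\<integral>\<^sup>+x. ennreal ((corr f (K n) x - f x)\<^sup>2) \<partial>lborel) < e"
  proof eventually_elim
    case (elim n)
    note k = kernD[OF K[of n]]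
    have [measurable]: "corr f (K n) \<in> borel_measurable borel" "corr p (K n) \<in> borel_measurable borel"
      by (rule corr_measurable[OF K fint], rule corr_measurable[OF K pint])
    have fpint: "integrable lborel (\<lambda>x. f x - p x)" using fint pint by simp
    have lin: "corr f (K n) x = corr (\<lambda>x. f x - p x) (K n) x + corr p (K n) x" for x
    proof -
      have "corr (\<lambda>x. f x - p x) (K n) x = corr f (K n) x - corr p (K n) x"
        unfolding corr_def scaleR_diff_left
        by (rule Bochner_Integration.integral_diff) (rule integrable_corr[OF fint k(1) k(3)] integrable_corr[OF pint k(1) k(3)], assumption)+
      then show ?thesis by simp
    qed
    have "(\<integral>\<^sup>+x. ennreal ((corr f (K n) x - f x)\<^sup>2) \<partial>lborel)
      \<le> (\<integral>\<^sup>+x. 3 * ennreal ((corr (\<lambda>x. f x - p x) (K n) x)\<^sup>2) + 3 * (ennreal (\<epsilon>\<^sup>2) * indicator (cball 0 (R + 2)) x) + 3 * ennreal ((f x - p x)\<^sup>2) \<partial>lborel)"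
    proof (intro nn_integral_mono)
      fix x
      have b: "ennreal ((corr p (K n) x - p x)\<^sup>2) \<le> ennreal (\<epsilon>\<^sup>2) * indicator (cball 0 (R + 2)) x"
      proof (cases "norm x \<le> R + 2")
        case True
        have "\<bar>corr p (K n) x - p x\<bar> \<le> \<epsilon>" by (rule corr_uniform[OF K pint d(2)]) (use elim in auto)
        then have "(corr p (K n) x - p x)\<^sup>2 \<le> \<epsilon>\<^sup>2" using \<epsilon>(1) by (intro abs_le_square_iff[THEN iffD1]) simp
        then show ?thesis using True by (simp add: ennreal_leI)
      next
        case False
        have "p y = 0" if "norm (y - x) < \<delta> n" for y
          using False that elim norm_triangle_sub[of x y] by (intro pz) (simp add: norm_minus_commute)
        then have "corr p (K n) x = 0" by (rule corr_local_zero[OF K])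
        then show ?thesis using False pz[of x] by simp
      qed
      have "(corr f (K n) x - f x)\<^sup>2 \<le> 3 * (corr (\<lambda>x. f x - p x) (K n) x)\<^sup>2 + 3 * (corr p (K n) x - p x)\<^sup>2 + 3 * (f x - p x)\<^sup>2"
        using square_add3_le[of "corr (\<lambda>x. f x - p x) (K n) x" "corr p (K n) x - p x" "- (f x - p x)"]
        by (simp add: lin power2_commute[of "p x"] add_diff_eq)
      then have "ennreal ((corr f (K n) x - f x)\<^sup>2) \<le> ennreal (3 * (corr (\<lambda>x. f x - p x) (K n) x)\<^sup>2 + 3 * (corr p (K n) x - p x)\<^sup>2 + 3 * (f x - p x)\<^sup>2)"
        by (rule ennreal_leI)
      also have "\<dots> = 3 * ennreal ((corr (\<lambda>x. f x - p x) (K n) x)\<^sup>2) + 3 * ennreal ((corr p (K n) x - p x)\<^sup>2) + 3 * ennreal ((f x - p x)\<^sup>2)"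
        by (simp add: ennreal_plus ennreal_mult del: ennreal_plus[symmetric])
      also have "\<dots> \<le> 3 * ennreal ((corr (\<lambda>x. f x - p x) (K n) x)\<^sup>2) + 3 * (ennreal (\<epsilon>\<^sup>2) * indicator (cball 0 (R + 2)) x) + 3 * ennreal ((f x - p x)\<^sup>2)"
        by (intro add_mono mult_left_mono b order_refl) auto
      finally show "ennreal ((corr f (K n) x - f x)\<^sup>2) \<le> 3 * ennreal ((corr (\<lambda>x. f x - p x) (K n) x)\<^sup>2) + 3 * (ennreal (\<epsilon>\<^sup>2) * indicator (cball 0 (R + 2)) x) + 3 * ennreal ((f x - p x)\<^sup>2)" .
    qed
    also have "\<dots> = 3 * (\<integral>\<^sup>+x. ennreal ((corr (\<lambda>x. f x - p x) (K n) x)\<^sup>2) \<partial>lborel) + 3 * (ennreal (\<epsilon>\<^sup>2) * ennreal V) + 3 * (\<integral>\<^sup>+x. ennreal ((f x - p x)\<^sup>2) \<partial>lborel)"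
    proof -
      have [measurable]: "corr (\<lambda>x. f x - p x) (K n) \<in> borel_measurable borel"
        by (rule corr_measurable[OF K fpint])
      have m: "(\<lambda>x. ennreal ((corr (\<lambda>x. f x - p x) (K n) x)\<^sup>2)) \<in> borel_measurable lborel"
        "(\<lambda>x. ennreal ((f x - p x)\<^sup>2)) \<in> borel_measurable lborel"
        by measurable
      have mi: "(\<lambda>x. ennreal (\<epsilon>\<^sup>2) * indicator (cball (0::'a) (R + 2)) x) \<in> borel_measurable lborel"
        by (intro borel_measurable_times_ennreal borel_measurable_const borel_measurable_indicator) simp
      have m3: "(\<lambda>x. 3 * g x) \<in> borel_measurable lborel"
        if "g \<in> borel_measurable lborel" for g :: "'a \<Rightarrow> ennreal"
        using that by measurable
      have i: "(\<integral>\<^sup>+x. ennreal (\<epsilon>\<^sup>2) * indicator (cball (0::'a) (R + 2)) x \<partial>lborel) = ennreal (\<epsilon>\<^sup>2) * ennreal V"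
        by (subst nn_integral_cmult_indicator) (simp_all add: V(1))
      show ?thesis
        by (simp only: nn_integral_add borel_measurable_add m3 m mi nn_integral_cmult i)
    qed
    also have "\<dots> \<le> 3 * ennreal (e2 / 12) + 3 * ennreal (e2 / 12) + 3 * ennreal (e2 / 12)"
    proof (intro add_mono mult_left_mono)
      show "(\<integral>\<^sup>+x. ennreal ((corr (\<lambda>x. f x - p x) (K n) x)\<^sup>2) \<partial>lborel) \<le> ennreal (e2 / 12)"
        by (rule order_trans[OF corr_contraction[OF K] fp]) measurable
      show "ennreal (\<epsilon>\<^sup>2) * ennreal V \<le> ennreal (e2 / 12)"
        using \<epsilon> V by (simp add: ennreal_mult[symmetric] ennreal_leI)
    qed (use fp in auto)
    also have "\<dots> = ennreal (3 * (e2 / 12) + 3 * (e2 / 12) + 3 * (e2 / 12))"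
    proof -
      have "3 * ennreal (e2 / 12) = ennreal (3 * (e2 / 12))"
        using e2 ennreal_mult[of 3 "e2 / 12"] by simp
      then show ?thesis
        using e2 ennreal_plus[of "3 * (e2 / 12)" "3 * (e2 / 12)"]
          ennreal_plus[of "3 * (e2 / 12) + 3 * (e2 / 12)" "3 * (e2 / 12)"] by simp
    qed
    also have "\<dots> \<le> ennreal e2" using e2 by (intro ennreal_leI) simp
    finally show ?case using e2 by simp
  qed
qed simp

text \<open>On the shell n \<le> |x - a| \<le> n+1 the integrand is at most exp (- \<mu> n), and the
  volume of the shell is bounded by that of an enclosing cube, a polynomial in n.\<close>

lemma integrable_exp_decay:
  fixes a :: "'a::euclidean_space"
  assumes \<mu>: "\<mu> > 0"
  shows "integrable lborel (\<lambda>x. exp (- \<mu> * norm (x - a)))"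
proof -
  define V where "V = emeasure lborel (cball (0::'a) 1)"
  define d where "d = DIM('a)"
  obtain n0 :: nat where n0: "real d + 2 \<le> real n0" using real_arch_simple by blast
  have meas: "emeasure lborel (cball a (real (Suc n))) \<le> ennreal ((2 * (real (Suc n) + norm a)) ^ d)" for n
  proof -
    define m where "m = real (Suc n)"
    have "cball a m \<subseteq> cbox (a - (\<Sum>i\<in>Basis. m *\<^sub>R i)) (a + (\<Sum>i\<in>Basis. m *\<^sub>R i))"
    proof
      fix x assume "x \<in> cball a m"
      then have n: "norm (x - a) \<le> m" by (simp add: dist_norm norm_minus_commute)
      have "\<bar>(x - a) \<bullet> i\<bar> \<le> m" if "i \<in> Basis" for i
        using Basis_le_norm[OF that, of "x - a"] n by linarith
      then show "x \<in> cbox (a - (\<Sum>i\<in>Basis. m *\<^sub>R i)) (a + (\<Sum>i\<in>Basis. m *\<^sub>R i))"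
        unfolding mem_box by (auto simp: inner_diff_left inner_add_left abs_le_iff inner_sum_left_Basis)
          (smt (verit))+
    qed
    then have "emeasure lborel (cball a m) \<le> emeasure lborel (cbox (a - (\<Sum>i\<in>Basis. m *\<^sub>R i)) (a + (\<Sum>i\<in>Basis. m *\<^sub>R i)))"
      by (rule emeasure_mono) simp
    also have "\<dots> = (\<Prod>b\<in>Basis. ((a + (\<Sum>i\<in>Basis. m *\<^sub>R i)) - (a - (\<Sum>i\<in>Basis. m *\<^sub>R i))) \<bullet> b)"
      by (rule emeasure_lborel_cbox)
        (auto simp: m_def inner_diff_left inner_add_left inner_sum_left_Basis)
    also have "\<dots> = ennreal ((2 * m) ^ d)"
      by (auto simp: d_def inner_diff_left inner_add_left inner_sum_left_Basis)
    also have "\<dots> \<le> ennreal ((2 * (m + norm a)) ^ d)"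
      by (intro ennreal_leI power_mono) (auto simp: m_def)
    finally show ?thesis unfolding m_def .
  qed
  \<comment> \<open>In the convergence test below half of the exponential rate is kept for a
    geometric series, and the other half absorbs the polynomial.\<close>
  define c where "c n = (2 * (real (Suc n) + norm a)) ^ d * exp (- \<mu> * real n)" for n
  have sc: "summable c"
  proof (rule summable_comparison_test_bigo)
    show "summable (\<lambda>n. norm (exp (- \<mu> / 2) ^ n))"
      using \<mu> by (simp add: summable_geometric)
    show "c \<in> O(\<lambda>n. exp (- \<mu> / 2) ^ n)"
    proof (rule bigoI_tendsto)
      have "c n / exp (- \<mu> / 2) ^ n = (2 * (real (Suc n) + norm a)) ^ d * exp (- (\<mu> / 2) * real n)" for n
      proof -
        have "exp (- \<mu> * real n) = exp (- (\<mu> / 2) * real n) * exp (- \<mu> / 2) ^ n"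
          by (simp add: exp_of_nat_mult[symmetric] exp_add[symmetric] field_simps)
        then show ?thesis by (simp add: c_def)
      qed
      moreover have "(\<lambda>n. (2 * (real (Suc n) + norm a)) ^ d * exp (- (\<mu> / 2) * real n)) \<longlonglongrightarrow> 0"
        using \<mu> by real_asymp
      ultimately show "(\<lambda>n. c n / exp (- \<mu> / 2) ^ n) \<longlonglongrightarrow> 0" by simp
    qed simp
  qed
  show ?thesis
  proof (rule integrableI_nonneg)
    show "(\<lambda>x. exp (- \<mu> * norm (x - a))) \<in> borel_measurable lborel" by measurable
    have "(\<integral>\<^sup>+x. ennreal (exp (- \<mu> * norm (x - a))) \<partial>lborel)
       \<le> (\<integral>\<^sup>+x. (\<Sum>n. ennreal (exp (- \<mu> * real n)) * indicator (cball a (real (Suc n))) x) \<partial>lborel)"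
    proof (intro nn_integral_mono)
      fix x :: 'a
      define n where "n = nat \<lfloor>norm (x - a)\<rfloor>"
      have n: "real n \<le> norm (x - a)" "norm (x - a) \<le> real (Suc n)"
      proof -
        have "real n = of_int \<lfloor>norm (x - a)\<rfloor>" by (simp add: n_def)
        then show "real n \<le> norm (x - a)" "norm (x - a) \<le> real (Suc n)"
          using floor_correct[of "norm (x - a)"] of_nat_Suc[of n, where ?'a=real]
          unfolding of_int_add of_int_1 by linarith+
      qed
      have "ennreal (exp (- \<mu> * norm (x - a))) \<le> ennreal (exp (- \<mu> * real n))"
        using n \<mu> by (intro ennreal_leI) simp
      also have "\<dots> = ennreal (exp (- \<mu> * real n)) * indicator (cball a (real (Suc n))) x"
        using n by (simp add: dist_norm norm_minus_commute)
      also have "\<dots> \<le> (\<Sum>n. ennreal (exp (- \<mu> * real n)) * indicator (cball a (real (Suc n))) x)"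
      proof -
        define f where "f = (\<lambda>n. ennreal (exp (- \<mu> * real n)) * indicator (cball a (real (Suc n))) x)"
        have "sum f {n} \<le> suminf f" by (rule sum_le_suminf) auto
        then have "f n \<le> suminf f" by simp
        then show ?thesis unfolding f_def .
      qed
      finally show "ennreal (exp (- \<mu> * norm (x - a))) \<le> (\<Sum>n. ennreal (exp (- \<mu> * real n)) * indicator (cball a (real (Suc n))) x)" .
    qed
    also have "\<dots> = (\<Sum>n. \<integral>\<^sup>+x. ennreal (exp (- \<mu> * real n)) * indicator (cball a (real (Suc n))) x \<partial>lborel)"
      by (rule nn_integral_suminf)
        (intro borel_measurable_times_ennreal borel_measurable_const borel_measurable_indicator, simp)
    also have "\<dots> \<le> (\<Sum>n. ennreal (c n))"
    proof (intro suminf_le allI)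
      fix n
      have "(\<integral>\<^sup>+x. ennreal (exp (- \<mu> * real n)) * indicator (cball a (real (Suc n))) x \<partial>lborel)
        = ennreal (exp (- \<mu> * real n)) * emeasure lborel (cball a (real (Suc n)))"
        by (rule nn_integral_cmult_indicator) simp
      also have "\<dots> \<le> ennreal (exp (- \<mu> * real n)) * ennreal ((2 * (real (Suc n) + norm a)) ^ d)"
        by (intro mult_left_mono meas) simp
      also have "\<dots> = ennreal (c n)"
        by (simp add: c_def ennreal_mult[symmetric] mult.commute)
      finally show "(\<integral>\<^sup>+x. ennreal (exp (- \<mu> * real n)) * indicator (cball a (real (Suc n))) x \<partial>lborel) \<le> ennreal (c n)" .
    qed auto
    also have "\<dots> = ennreal (\<Sum>n. c n)" by (rule suminf_ennreal2[OF _ sc]) (simp add: c_def)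
    finally show "(\<integral>\<^sup>+x. ennreal (exp (- \<mu> * norm (x - a))) \<partial>lborel) < \<infinity>"
      by (simp add: le_less_trans)
  qed auto
qed

text \<open>The exponential surplus in the product is 2 \<mu> r with \<mu> = L - l - |\<beta>|/2. A
  quarter of it absorbs 4 \<tau> \<surd>r by completing a square, another quarter absorbs r^(3/2),
  and \<mu> r is left. Because \<surd>r grows slower than r, this works for every \<tau>, with a
  constant C that depends on \<tau>.\<close>

lemma weight_bound:
  fixes a \<beta> :: "'a::euclidean_space" and l \<tau> L :: real
  assumes L: "l + norm \<beta> / 2 < L"
  obtains C where "C > 0" "\<And>x. rp a (3/2) x * (cE a \<beta> l \<tau> x)\<^sup>2 * exp (- (2 * L) * norm (x - a))
     \<le> C * exp (- (L - l - norm \<beta> / 2) * norm (x - a))"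
proof -
  define \<mu> where "\<mu> = L - l - norm \<beta> / 2"
  have \<mu>: "\<mu> > 0" using L by (simp add: \<mu>_def)
  define C where "C = (1 + 8 / \<mu>\<^sup>2) * exp (8 * \<tau>\<^sup>2 / \<mu> + norm \<beta> * norm a)"
  have "rp a (3/2) x * (cE a \<beta> l \<tau> x)\<^sup>2 * exp (- (2 * L) * norm (x - a)) \<le> C * exp (- \<mu> * norm (x - a))" for x
  proof -
    define r where "r = norm (x - a)"
    have r: "r \<ge> 0" by (simp add: r_def)
    have sq: "4 * \<tau> * sqrt r \<le> \<mu> * r / 2 + 8 * \<tau>\<^sup>2 / \<mu>"
    proof -
      have "0 \<le> (\<mu> * sqrt r - 4 * \<tau>)\<^sup>2 / (2 * \<mu>)" using \<mu> by simp
      also have "\<dots> = \<mu> * r / 2 + 8 * \<tau>\<^sup>2 / \<mu> - 4 * \<tau> * sqrt r"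
        using \<mu> r by (simp add: power2_diff power_mult_distrib field_simps) (simp add: power2_eq_square algebra_simps)
      finally show ?thesis by simp
    qed
    have r32: "r powr (3/2) \<le> (1 + 8 / \<mu>\<^sup>2) * exp (\<mu> * r / 2)"
    proof -
      have "r powr (3/2) \<le> 1 + r\<^sup>2"
      proof (cases "r \<le> 1")
        case True
        then have "r powr (3/2) \<le> 1" using r by (simp add: powr_le1)
        then show ?thesis using zero_le_power2[of r] by linarith
      next
        case False
        then have "r powr (3/2) \<le> r powr 2" by (intro powr_mono) auto
        then show ?thesis using False by simp
      qed
      moreover have "1 \<le> exp (\<mu> * r / 2)" using \<mu> r by simp
      moreover have "r\<^sup>2 \<le> 8 / \<mu>\<^sup>2 * exp (\<mu> * r / 2)"
      proof -
        have "(\<mu> * r / 2)\<^sup>2 / 2 \<le> exp (\<mu> * r / 2)"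
          using exp_lower_Taylor_quadratic[of "\<mu> * r / 2"] mult_nonneg_nonneg[of \<mu> r] \<mu> r by linarith
        then show ?thesis using \<mu> by (simp add: field_simps power2_eq_square)
      qed
      ultimately show ?thesis unfolding distrib_right by linarith
    qed
    have bx: "\<beta> \<bullet> x \<le> norm \<beta> * r + norm \<beta> * norm a"
    proof -
      have "\<beta> \<bullet> x \<le> norm \<beta> * norm x" by (rule norm_cauchy_schwarz)
      also have "norm x \<le> r + norm a" unfolding r_def using norm_triangle_sub[of x a] by simp
      finally show ?thesis by (simp add: distrib_left mult_left_mono)
    qed
    have "(cE a \<beta> l \<tau> x)\<^sup>2 = exp (2 * l * r + 4 * \<tau> * sqrt r + \<beta> \<bullet> x)"
      unfolding cE_def r_def[symmetric] by (simp add: power2_eq_square exp_add[symmetric])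
    then have "rp a (3/2) x * (cE a \<beta> l \<tau> x)\<^sup>2 * exp (- (2 * L) * norm (x - a))
       = r powr (3/2) * exp (2 * l * r + 4 * \<tau> * sqrt r + \<beta> \<bullet> x - 2 * L * r)"
      by (simp add: rp_def r_def[symmetric] exp_diff exp_minus field_simps)
    also have "\<dots> \<le> ((1 + 8 / \<mu>\<^sup>2) * exp (\<mu> * r / 2)) * exp (2 * l * r + (\<mu> * r / 2 + 8 * \<tau>\<^sup>2 / \<mu>) + (norm \<beta> * r + norm \<beta> * norm a) - 2 * L * r)"
      using r32 sq bx by (intro mult_mono) auto
    also have "\<dots> = (1 + 8 / \<mu>\<^sup>2) * exp (8 * \<tau>\<^sup>2 / \<mu> + norm \<beta> * norm a + - \<mu> * r)"
    proof -
      have "\<mu> * r / 2 + (2 * l * r + (\<mu> * r / 2 + 8 * \<tau>\<^sup>2 / \<mu>) + (norm \<beta> * r + norm \<beta> * norm a) - 2 * L * r)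
        = 8 * \<tau>\<^sup>2 / \<mu> + norm \<beta> * norm a + - \<mu> * r" unfolding \<mu>_def by (simp add: algebra_simps)
      then show ?thesis by (simp add: exp_add[symmetric] mult.assoc)
    qed
    also have "\<dots> = C * exp (- \<mu> * r)" unfolding C_def exp_add by simp
    finally show ?thesis by (simp add: r_def)
  qed
  moreover have "C > 0" using \<mu> by (simp add: C_def add_pos_nonneg)
  ultimately show ?thesis using that unfolding \<mu>_def by blast
qed

lemma weighted_integrable:
  fixes a \<beta> :: "'a::euclidean_space" and l \<tau> L C :: real
  assumes L: "l + norm \<beta> / 2 < L" and f[measurable]: "f \<in> borel_measurable borel"
    and b: "\<And>x. \<bar>f x\<bar> \<le> C * exp (- (2 * L) * norm (x - a))"
  shows "integrable lborel (\<lambda>x. rp a (3/2) x * (cE a \<beta> l \<tau> x)\<^sup>2 * f x)"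
proof -
  obtain D where D: "D > 0" "\<And>x. rp a (3/2) x * (cE a \<beta> l \<tau> x)\<^sup>2 * exp (- (2 * L) * norm (x - a))
     \<le> D * exp (- (L - l - norm \<beta> / 2) * norm (x - a))"
    using weight_bound[OF L] by blast
  have C: "C \<ge> 0" using b[of a] by simp
  show ?thesis
  proof (rule Bochner_Integration.integrable_bound)
    show "integrable lborel (\<lambda>x. (C * D) * exp (- (L - l - norm \<beta> / 2) * norm (x - a)))"
      by (intro integrable_mult_right integrable_exp_decay) (use L in simp)
    show "(\<lambda>x. rp a (3/2) x * (cE a \<beta> l \<tau> x)\<^sup>2 * f x) \<in> borel_measurable lborel"
      unfolding rp_def cE_def by measurable
    show "AE x in lborel. norm (rp a (3/2) x * (cE a \<beta> l \<tau> x)\<^sup>2 * f x) \<le> norm ((C * D) * exp (- (L - l - norm \<beta> / 2) * norm (x - a)))"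
    proof (intro AE_I2)
      fix x
      have w: "0 \<le> rp a (3/2) x * (cE a \<beta> l \<tau> x)\<^sup>2" by (simp add: rp_nonneg)
      have "norm (rp a (3/2) x * (cE a \<beta> l \<tau> x)\<^sup>2 * f x) = rp a (3/2) x * (cE a \<beta> l \<tau> x)\<^sup>2 * \<bar>f x\<bar>"
        unfolding real_norm_def abs_mult[of _ "f x"] using w by simp
      also have "\<dots> \<le> rp a (3/2) x * (cE a \<beta> l \<tau> x)\<^sup>2 * (C * exp (- (2 * L) * norm (x - a)))"
        by (rule mult_left_mono[OF b w])
      also have "\<dots> = C * (rp a (3/2) x * (cE a \<beta> l \<tau> x)\<^sup>2 * exp (- (2 * L) * norm (x - a)))" by simp
      also have "\<dots> \<le> C * (D * exp (- (L - l - norm \<beta> / 2) * norm (x - a)))"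
        by (rule mult_left_mono[OF D(2) C])
      finally show "norm (rp a (3/2) x * (cE a \<beta> l \<tau> x)\<^sup>2 * f x) \<le> norm ((C * D) * exp (- (L - l - norm \<beta> / 2) * norm (x - a)))"
        using C D(1) by (simp add: abs_mult mult.assoc)
    qed
  qed
qed

text \<open>The kernel only sees points within distance \<delta>, where the exponential changes by a
  factor of at most exp (L \<delta>). Applied with F the gradient of a mollifier, this gives
  exponential decay of the gradient of the mollified u from the bound on u alone.\<close>

lemma corr_decay:
  fixes F :: "'a::euclidean_space \<Rightarrow> 'b::euclidean_space" and u :: "'a \<Rightarrow> real"
  assumes u: "integrable lborel u" and ub: "\<And>x. \<bar>u x\<bar> \<le> C * exp (- L * norm (x - a))" and "L \<ge> 0"
    and F: "continuous_on UNIV F" "\<And>z. norm z \<ge> \<delta> \<Longrightarrow> F z = 0"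
  obtains D where "\<And>x. norm (corr u F x) \<le> D * exp (- L * norm (x - a))" "D \<ge> 0"
proof -
  have C: "C \<ge> 0" using ub[of a] by simp
  have Fe: "(\<lambda>z. indicator (cball 0 \<delta>) z *\<^sub>R F z) = F"
  proof
    show "indicator (cball 0 \<delta>) z *\<^sub>R F z = F z" for z
      using F(2)[of z] by (cases "norm z \<le> \<delta>") auto
  qed
  have "integrable lborel (\<lambda>z. indicator (cball 0 \<delta>) z *\<^sub>R F z)"
    by (rule borel_integrable_compact) (auto intro: continuous_on_subset[OF F(1)])
  then have Fi: "integrable lborel F" unfolding Fe .
  have Fm: "F \<in> borel_measurable borel" by (rule borel_measurable_continuous_onI[OF F(1)])
  define I where "I = (\<integral>z. norm (F z) \<partial>lborel)"
  have I: "(\<integral>y. norm (F (y - x)) \<partial>lborel) = I" for x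
    using integral_lborel_translate[of "\<lambda>z. norm (F z)" "- x"] Fm by (simp add: I_def add.commute[of "- x"])
  have Ii: "integrable lborel (\<lambda>y. norm (F (y - x)))" for x
    using integrable_lborel_translate[OF integrable_norm[OF Fi], of "- x"] by (simp add: add.commute[of "- x"])
  have "norm (corr u F x) \<le> (C * exp (L * \<delta>) * I) * exp (- L * norm (x - a))" for x
  proof -
    have "norm (corr u F x) \<le> (\<integral>y. norm (u y *\<^sub>R F (y - x)) \<partial>lborel)"
      unfolding corr_def by (rule integral_norm_bound)
    also have "\<dots> \<le> (\<integral>y. (C * exp (L * \<delta>) * exp (- L * norm (x - a))) * norm (F (y - x)) \<partial>lborel)"
    proof (rule integral_mono)
      show "integrable lborel (\<lambda>y. norm (u y *\<^sub>R F (y - x)))"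
        by (rule integrable_norm[OF integrable_corr[OF u F]])
      show "integrable lborel (\<lambda>y. (C * exp (L * \<delta>) * exp (- L * norm (x - a))) * norm (F (y - x)))"
        by (intro integrable_mult_right Ii)
      fix y
      show "norm (u y *\<^sub>R F (y - x)) \<le> (C * exp (L * \<delta>) * exp (- L * norm (x - a))) * norm (F (y - x))"
      proof (cases "norm (y - x) \<ge> \<delta>")
        case False
        have "norm (x - a) \<le> norm (y - a) + \<delta>"
          using norm_triangle_ineq[of "y - a" "x - y"] False by (simp add: norm_minus_commute)
        then have "- L * norm (y - a) \<le> L * \<delta> + - L * norm (x - a)"
          using \<open>L \<ge> 0\<close> mult_left_mono[of "norm (x - a)" "norm (y - a) + \<delta>" L] by (simp add: algebra_simps)
        then have "exp (- L * norm (y - a)) \<le> exp (L * \<delta>) * exp (- L * norm (x - a))"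
          by (simp add: exp_add[symmetric])
        then have "C * exp (- L * norm (y - a)) \<le> C * (exp (L * \<delta>) * exp (- L * norm (x - a)))"
          by (rule mult_left_mono[OF _ C])
        then have "\<bar>u y\<bar> \<le> C * exp (L * \<delta>) * exp (- L * norm (x - a))"
          using ub[of y] by (simp add: mult.assoc)
        then show ?thesis by (simp add: mult_right_mono)
      qed (use F(2) in simp)
    qed
    also have "\<dots> = (C * exp (L * \<delta>) * I) * exp (- L * norm (x - a))" by (simp add: I)
    finally show ?thesis .
  qed
  moreover have "C * exp (L * \<delta>) * I \<ge> 0" using C by (simp add: I_def)
  ultimately show ?thesis using that by blast
qed

section \<open>The mollified weak equation\<close>

lemma GDERIV_unique: "GDERIV f x :> D \<Longrightarrow> GDERIV f x :> D' \<Longrightarrow> D = D'"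
proof -
  assume "GDERIV f x :> D" "GDERIV f x :> D'"
  then have "(\<lambda>h. h \<bullet> D) = (\<lambda>h. h \<bullet> D')"
    unfolding gderiv_def by (rule has_derivative_unique)
  then have "\<forall>h. h \<bullet> D = h \<bullet> D'" by meson
  then show "D = D'" by (simp only: vector_eq_ldot)
qed

lemma test_functionI:
  assumes "\<And>k. Ck k \<phi>" "\<And>y. y \<notin> cball x \<delta> \<Longrightarrow> \<phi> y = 0" "cball x \<delta> \<subseteq> \<Omega>"
  shows "test_function \<Omega> \<phi>"
proof -
  have "{y. \<phi> y \<noteq> 0} \<subseteq> cball x \<delta>" using assms(2) by blast
  then have c: "closure {y. \<phi> y \<noteq> 0} \<subseteq> cball x \<delta>" by (intro closure_minimal) auto
  then have "compact (closure {y. \<phi> y \<noteq> 0})"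
    by (intro compact_closure[THEN iffD2]) (meson bounded_cball bounded_subset closure_subset subset_trans)
  then show ?thesis unfolding test_function_def using assms c by blast
qed

lemma integrable_times_kernel:
  fixes F :: "'a::euclidean_space \<Rightarrow> 'b::euclidean_space" and g :: "'a \<Rightarrow> real"
  assumes g: "integrable lborel (\<lambda>y. indicator (cball x \<delta>) y * g y)"
    and F: "continuous_on UNIV F" "\<And>z. norm z \<ge> \<delta> \<Longrightarrow> F z = 0"
  shows "integrable lborel (\<lambda>y. g y *\<^sub>R F (y - x))"
proof -
  have "(\<lambda>y. (indicator (cball x \<delta>) y * g y) *\<^sub>R F (y - x)) = (\<lambda>y. g y *\<^sub>R F (y - x))"
  proof
    fix y
    show "(indicator (cball x \<delta>) y * g y) *\<^sub>R F (y - x) = g y *\<^sub>R F (y - x)"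
      using F(2)[of "y - x"] by (cases "y \<in> cball x \<delta>") (auto simp: dist_norm norm_minus_commute)
  qed
  moreover have "integrable lborel (\<lambda>y. (indicator (cball x \<delta>) y * g y) *\<^sub>R F (y - x))"
    by (rule integrable_corr[OF g F])
  ultimately show ?thesis by simp
qed

text \<open>The left side has constant coefficients, so it commutes with convolution and no
  commutator has to be estimated. The weak gradient is tested with the translate K (y - x) and with
  the components of its gradient, the divergence form \<open>w2\<close> with the translate itself.
  Moving a derivative from y to x and integrating by parts each change the sign, so the signs
  cancel. G and N are integrable only near x, inside the support of the kernel.\<close>

lemma mollified_equation:
  fixes u N :: "'a::euclidean_space \<Rightarrow> real" and G :: "'a \<Rightarrow> 'a"
  assumes K: "mollifier \<delta> K DK D2K" and u: "integrable lborel u"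
    and x: "cball x \<delta> \<subseteq> \<Omega>"
    and G: "\<And>i. i \<in> Basis \<Longrightarrow> integrable lborel (\<lambda>y. indicator (cball x \<delta>) y * (G y \<bullet> i))"
    and N: "integrable lborel (\<lambda>y. indicator (cball x \<delta>) y * N y)"
    and w1: "\<And>\<phi> D\<phi> i. test_function \<Omega> \<phi> \<Longrightarrow> (\<And>y. GDERIV \<phi> y :> D\<phi> y) \<Longrightarrow> i \<in> Basis \<Longrightarrow>
       (\<integral>y. u y * (D\<phi> y \<bullet> i) \<partial>lborel) = - (\<integral>y. (G y \<bullet> i) * \<phi> y \<partial>lborel)"
    and w2: "\<And>\<phi> D\<phi>. test_function \<Omega> \<phi> \<Longrightarrow> (\<And>y. GDERIV \<phi> y :> D\<phi> y) \<Longrightarrow>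
       (\<integral>y. G y \<bullet> D\<phi> y \<partial>lborel) = - (\<integral>y. (N y - \<beta> \<bullet> G y - \<kappa> * u y) * \<phi> y \<partial>lborel)"
  shows "i \<in> Basis \<Longrightarrow> (- corr u DK x) \<bullet> i = corr (\<lambda>y. G y \<bullet> i) K x"
    "trace_op (\<lambda>h. corr u (\<lambda>z. D2K z h) x) + \<beta> \<bullet> (- corr u DK x) + \<kappa> * corr u K x = corr N K x"
proof -
  have C: "C2_on UNIV K DK D2K" and Ck: "\<And>k. Ck k (\<lambda>y. K (y - x))"
    and z: "\<And>z. norm z \<ge> \<delta> \<Longrightarrow> K z = 0" "\<And>z. norm z \<ge> \<delta> \<Longrightarrow> DK z = 0" "\<And>z h. norm z \<ge> \<delta> \<Longrightarrow> D2K z h = 0"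
    using K unfolding mollifier_def by auto
  note Cd = C2_onD[OF C]
  have out: "norm (y - x) \<ge> \<delta>" if "y \<notin> cball x \<delta>" for y
    using that by (simp add: dist_norm norm_minus_commute)
  have sh: "((\<lambda>y. y - x) has_derivative (\<lambda>h. h)) (at y)" for y
    by (auto intro!: derivative_eq_intros)
  have d1: "GDERIV (\<lambda>y. K (y - x)) y :> DK (y - x)" for y
    unfolding gderiv_def
    by (rule has_derivative_eq_rhs[OF has_derivative_compose[OF sh Cd(1)]]) (auto simp: inner_commute)
  have d2: "GDERIV (\<lambda>y. DK (y - x) \<bullet> i) y :> D2K (y - x) i" for y i
    unfolding gderiv_def
    by (rule has_derivative_eq_rhs[OF has_derivative_compose[OF sh has_derivative_inner_left[OF Cd(2)]]])
      (rule UNIV_I, rule ext, metis Cd(3) inner_commute UNIV_I)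
  have t1: "test_function \<Omega> (\<lambda>y. K (y - x))"
    by (rule test_functionI[OF Ck _ x]) (use z out in auto)
  have t2: "test_function \<Omega> (\<lambda>y. DK (y - x) \<bullet> i)" if i: "i \<in> Basis" for i
  proof (rule test_functionI[OF _ _ x])
    fix k
    obtain g where g: "\<And>y. GDERIV (\<lambda>y. K (y - x)) y :> g y" "\<And>i. i \<in> Basis \<Longrightarrow> Ck k (\<lambda>y. g y \<bullet> i)"
      using Ck[of "Suc k"] unfolding Ck.simps by blast
    \<comment> \<open>The predicate \<open>Ck\<close> only asserts that some gradient exists;
      uniqueness identifies it with \<open>DK\<close>, whose components thereby become test
      functions.\<close>
    have "g = (\<lambda>y. DK (y - x))" using GDERIV_unique[OF g(1) d1] by blast
    then show "Ck k (\<lambda>y. DK (y - x) \<bullet> i)" using g(2)[OF i] by simp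
  qed (use z out in auto)
  have iu: "integrable lborel (\<lambda>y. u y *\<^sub>R DK (y - x))" "integrable lborel (\<lambda>y. u y *\<^sub>R D2K (y - x) h)"
     "integrable lborel (\<lambda>y. u y *\<^sub>R K (y - x))" for h
    by (rule integrable_corr[OF u Cd(5) z(2)], assumption)
      (rule integrable_corr[OF u Cd(4) z(3)], assumption, rule integrable_corr[OF u Cd(6) z(1)], assumption)
  show D: "(- corr u DK x) \<bullet> i = corr (\<lambda>y. G y \<bullet> i) K x" if i: "i \<in> Basis" for i
  proof -
    have "corr u DK x \<bullet> i = (\<integral>y. u y * (DK (y - x) \<bullet> i) \<partial>lborel)"
      unfolding corr_def integral_inner_left[OF iu(1), symmetric] by simp
    then show ?thesis using w1[OF t1 d1 i] by (simp add: corr_def)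
  qed
  have iG: "integrable lborel (\<lambda>y. (G y \<bullet> i) * K (y - x))" "integrable lborel (\<lambda>y. (G y \<bullet> i) * (DK (y - x) \<bullet> i))"
    if i: "i \<in> Basis" for i
  proof -
    show "integrable lborel (\<lambda>y. (G y \<bullet> i) * K (y - x))"
      using integrable_times_kernel[OF G[OF i] Cd(6) z(1)] by simp
    have c: "continuous_on UNIV (\<lambda>z. DK z \<bullet> i)" by (intro continuous_intros Cd(5))
    show "integrable lborel (\<lambda>y. (G y \<bullet> i) * (DK (y - x) \<bullet> i))"
      using integrable_times_kernel[OF G[OF i] c] z(2) by simp
  qed
  have iN: "integrable lborel (\<lambda>y. N y * K (y - x))"
    using integrable_times_kernel[OF N Cd(6) z(1)] by simp
  have "trace_op (\<lambda>h. corr u (\<lambda>z. D2K z h) x) = (\<Sum>i\<in>Basis. - (\<integral>y. (G y \<bullet> i) * (DK (y - x) \<bullet> i) \<partial>lborel))"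
    unfolding trace_op_def
  proof (rule sum.cong[OF refl])
    fix i :: 'a assume i: "i \<in> Basis"
    have "corr u (\<lambda>z. D2K z i) x \<bullet> i = (\<integral>y. u y * (D2K (y - x) i \<bullet> i) \<partial>lborel)"
      unfolding corr_def integral_inner_left[OF iu(2), symmetric] by simp
    then show "corr u (\<lambda>z. D2K z i) x \<bullet> i = - (\<integral>y. (G y \<bullet> i) * (DK (y - x) \<bullet> i) \<partial>lborel)"
      using w1[OF t2[OF i] d2 i] by simp
  qed
  also have "\<dots> = - (\<integral>y. (\<Sum>i\<in>Basis. (G y \<bullet> i) * (DK (y - x) \<bullet> i)) \<partial>lborel)"
    using iG(2) by (simp add: sum_negf)
  also have "(\<lambda>y. (\<Sum>i\<in>Basis. (G y \<bullet> i) * (DK (y - x) \<bullet> i))) = (\<lambda>y. G y \<bullet> DK (y - x))"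
    by (simp add: euclidean_inner[symmetric])
  also have "- (\<integral>y. G y \<bullet> DK (y - x) \<partial>lborel) = (\<integral>y. (N y - \<beta> \<bullet> G y - \<kappa> * u y) * K (y - x) \<partial>lborel)"
    using w2[OF t1 d1] by simp
  finally have T: "trace_op (\<lambda>h. corr u (\<lambda>z. D2K z h) x) = (\<integral>y. (N y - \<beta> \<bullet> G y - \<kappa> * u y) * K (y - x) \<partial>lborel)" .
  have iGb: "integrable lborel (\<lambda>y. \<Sum>i\<in>Basis. (\<beta> \<bullet> i) * ((G y \<bullet> i) * K (y - x)))"
    by (intro Bochner_Integration.integrable_sum integrable_mult_right iG)
  have "(N y - \<beta> \<bullet> G y - \<kappa> * u y) * K (y - x)
    = N y * K (y - x) - (\<Sum>i\<in>Basis. (\<beta> \<bullet> i) * ((G y \<bullet> i) * K (y - x))) - \<kappa> * (u y * K (y - x))" for y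
  proof -
    have "(\<beta> \<bullet> G y) * K (y - x) = (\<Sum>i\<in>Basis. (\<beta> \<bullet> i) * ((G y \<bullet> i) * K (y - x)))"
      by (subst euclidean_inner) (simp only: sum_distrib_right mult.assoc)
    then show ?thesis by (simp only: left_diff_distrib mult.assoc)
  qed
  then have "(\<integral>y. (N y - \<beta> \<bullet> G y - \<kappa> * u y) * K (y - x) \<partial>lborel)
    = (\<integral>y. N y * K (y - x) \<partial>lborel) - (\<Sum>i\<in>Basis. (\<beta> \<bullet> i) * (\<integral>y. (G y \<bullet> i) * K (y - x) \<partial>lborel)) - \<kappa> * (\<integral>y. u y * K (y - x) \<partial>lborel)"
    using iN iGb iu(3) iG(1) by (simp add: Bochner_Integration.integral_sum)
  also have "(\<Sum>i\<in>Basis. (\<beta> \<bullet> i) * (\<integral>y. (G y \<bullet> i) * K (y - x) \<partial>lborel)) = \<beta> \<bullet> (- corr u DK x)"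
    by (subst euclidean_inner[of \<beta> "- corr u DK x"], intro sum.cong refl) (simp only: D, simp add: corr_def)
  finally show "trace_op (\<lambda>h. corr u (\<lambda>z. D2K z h) x) + \<beta> \<bullet> (- corr u DK x) + \<kappa> * corr u K x = corr N K x"
    unfolding T by (simp add: corr_def)
qed

text \<open>Measurability and integrability are included because the Bochner integral of a
  non-integrable function is 0, so the limit by itself would not express convergence. Nothing is
  required of the functions outside A except measurability.\<close>

definition L2conv :: "'a::euclidean_space set \<Rightarrow> (nat \<Rightarrow> 'a \<Rightarrow> real) \<Rightarrow> ('a \<Rightarrow> real) \<Rightarrow> bool" where
  "L2conv A f g \<longleftrightarrow> A \<in> sets borel \<and> (\<forall>n. f n \<in> borel_measurable borel) \<and> g \<in> borel_measurable borel \<and>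
    integrable lborel (\<lambda>x. indicator A x * (g x)\<^sup>2) \<and>
    (\<forall>n. integrable lborel (\<lambda>x. indicator A x * (f n x - g x)\<^sup>2)) \<and>
    (\<lambda>n. \<integral>x. indicator A x * (f n x - g x)\<^sup>2 \<partial>lborel) \<longlonglongrightarrow> 0"

lemma L2convD:
  assumes "L2conv A f g"
  shows "A \<in> sets borel" "f n \<in> borel_measurable borel" "g \<in> borel_measurable borel"
    "integrable lborel (\<lambda>x. indicator A x * (g x)\<^sup>2)"
    "integrable lborel (\<lambda>x. indicator A x * (f n x - g x)\<^sup>2)"
    "(\<lambda>n. \<integral>x. indicator A x * (f n x - g x)\<^sup>2 \<partial>lborel) \<longlonglongrightarrow> 0"
  using assms by (auto simp: L2conv_def)

text \<open>The common pattern behind the closure properties below: a pointwise bound on A by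
  integrable functions whose integrals tend to 0.\<close>

lemma L2conv_dominated:
  fixes g :: "'a::euclidean_space \<Rightarrow> real"
  assumes A[measurable]: "A \<in> sets borel" and m[measurable]: "\<And>n. f n \<in> borel_measurable borel" "g \<in> borel_measurable borel"
    and g: "integrable lborel g0" "\<And>x. x \<in> A \<Longrightarrow> (g x)\<^sup>2 \<le> g0 x"
    and f: "\<And>n. integrable lborel (h n)" "\<And>n x. x \<in> A \<Longrightarrow> (f n x - g x)\<^sup>2 \<le> h n x"
    and nn: "\<And>x. 0 \<le> g0 x" "\<And>n x. 0 \<le> h n x" and lim: "(\<lambda>n. \<integral>x. h n x \<partial>lborel) \<longlonglongrightarrow> 0"
  shows "L2conv A f g"
proof -
  have ig: "integrable lborel (\<lambda>x. indicator A x * (g x)\<^sup>2)"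
    by (rule Bochner_Integration.integrable_bound[OF g(1)])
      (measurable, use g(2) nn in \<open>auto simp: indicator_def\<close>)
  have ih: "integrable lborel (\<lambda>x. indicator A x * (f n x - g x)\<^sup>2)" for n
    by (rule Bochner_Integration.integrable_bound[OF f(1)[of n]])
      (measurable, use f(2)[of _ n] nn in \<open>auto simp: indicator_def\<close>)
  have "(\<lambda>n. \<integral>x. indicator A x * (f n x - g x)\<^sup>2 \<partial>lborel) \<longlonglongrightarrow> 0"
  proof (rule tendsto_sandwich[OF _ _ tendsto_const lim])
    show "\<forall>\<^sub>F n in sequentially. 0 \<le> (\<integral>x. indicator A x * (f n x - g x)\<^sup>2 \<partial>lborel)"
      by (intro always_eventually allI Bochner_Integration.integral_nonneg) simp
    show "\<forall>\<^sub>F n in sequentially. (\<integral>x. indicator A x * (f n x - g x)\<^sup>2 \<partial>lborel) \<le> (\<integral>x. h n x \<partial>lborel)"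
    proof (intro always_eventually allI integral_mono[OF ih f(1)])
      fix n x show "indicator A x * (f n x - g x)\<^sup>2 \<le> h n x"
        using f(2)[of x n] nn(2)[of n x] by (cases "x \<in> A") auto
    qed
  qed
  then show ?thesis unfolding L2conv_def using A m ig ih by blast
qed

lemma L2conv_add:
  assumes "L2conv A f g" "L2conv A f' g'"
  shows "L2conv A (\<lambda>n x. f n x + f' n x) (\<lambda>x. g x + g' x)"
proof (rule L2conv_dominated)
  note a = L2convD[OF assms(1)] and b = L2convD[OF assms(2)]
  show "A \<in> sets borel" by (rule a)
  show "(\<lambda>x. f n x + f' n x) \<in> borel_measurable borel" for n using a(2) b(2) by simp
  show "(\<lambda>x. g x + g' x) \<in> borel_measurable borel" using a(3) b(3) by simp
  show "integrable lborel (\<lambda>x. 2 * (indicator A x * (g x)\<^sup>2) + 2 * (indicator A x * (g' x)\<^sup>2))"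
    using a(4) b(4) by simp
  show "integrable lborel (\<lambda>x. 2 * (indicator A x * (f n x - g x)\<^sup>2) + 2 * (indicator A x * (f' n x - g' x)\<^sup>2))" for n
    using a(5) b(5) by simp
  show "(g x + g' x)\<^sup>2 \<le> 2 * (indicator A x * (g x)\<^sup>2) + 2 * (indicator A x * (g' x)\<^sup>2)" if "x \<in> A" for x
    using that square_add_le[of "g x" "g' x"] by simp
  show "(f n x + f' n x - (g x + g' x))\<^sup>2 \<le> 2 * (indicator A x * (f n x - g x)\<^sup>2) + 2 * (indicator A x * (f' n x - g' x)\<^sup>2)"
    if "x \<in> A" for n x
    using that square_add_le[of "f n x - g x" "f' n x - g' x"] by (simp add: algebra_simps)
  have "(\<lambda>n. 2 * (\<integral>x. indicator A x * (f n x - g x)\<^sup>2 \<partial>lborel) + 2 * (\<integral>x. indicator A x * (f' n x - g' x)\<^sup>2 \<partial>lborel)) \<longlonglongrightarrow> 2 * 0 + 2 * 0"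
    by (intro tendsto_intros a(6) b(6))
  then show "(\<lambda>n. \<integral>x. 2 * (indicator A x * (f n x - g x)\<^sup>2) + 2 * (indicator A x * (f' n x - g' x)\<^sup>2) \<partial>lborel) \<longlonglongrightarrow> 0"
    using a(5) b(5) by simp
qed auto

lemma L2conv_mult:
  assumes "L2conv A f g" and c[measurable]: "c \<in> borel_measurable borel" and b: "\<And>x. x \<in> A \<Longrightarrow> \<bar>c x\<bar> \<le> B"
  shows "L2conv A (\<lambda>n x. c x * f n x) (\<lambda>x. c x * g x)"
proof (rule L2conv_dominated)
  note a = L2convD[OF assms(1)]
  have b2: "(c x * y)\<^sup>2 \<le> B\<^sup>2 * (indicator A x * y\<^sup>2)" if "x \<in> A" for x y
  proof -
    have "(c x)\<^sup>2 \<le> B\<^sup>2" using b[OF that] by (intro abs_le_square_iff[THEN iffD1]) auto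
    then have "(c x)\<^sup>2 * y\<^sup>2 \<le> B\<^sup>2 * y\<^sup>2" by (rule mult_right_mono) simp
    then show ?thesis using that by (simp add: power_mult_distrib)
  qed
  show "A \<in> sets borel" by (rule a)
  show "(\<lambda>x. c x * f n x) \<in> borel_measurable borel" for n using a(2) by simp
  show "(\<lambda>x. c x * g x) \<in> borel_measurable borel" using a(3) by simp
  show "integrable lborel (\<lambda>x. B\<^sup>2 * (indicator A x * (g x)\<^sup>2))" using a(4) by simp
  show "integrable lborel (\<lambda>x. B\<^sup>2 * (indicator A x * (f n x - g x)\<^sup>2))" for n using a(5) by simp
  show "(c x * g x)\<^sup>2 \<le> B\<^sup>2 * (indicator A x * (g x)\<^sup>2)" if "x \<in> A" for x by (rule b2[OF that])
  show "(c x * f n x - c x * g x)\<^sup>2 \<le> B\<^sup>2 * (indicator A x * (f n x - g x)\<^sup>2)" if "x \<in> A" for n x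
    using b2[OF that, of "f n x - g x"] by (simp add: right_diff_distrib)
  have "(\<lambda>n. B\<^sup>2 * (\<integral>x. indicator A x * (f n x - g x)\<^sup>2 \<partial>lborel)) \<longlonglongrightarrow> B\<^sup>2 * 0"
    by (intro tendsto_intros a(6))
  then show "(\<lambda>n. \<integral>x. B\<^sup>2 * (indicator A x * (f n x - g x)\<^sup>2) \<partial>lborel) \<longlonglongrightarrow> 0" by simp
qed auto

lemma L2conv_zero: "A \<in> sets borel \<Longrightarrow> L2conv A (\<lambda>n x. 0) (\<lambda>x. 0)"
  by (simp add: L2conv_def)

lemma L2conv_sum:
  assumes "A \<in> sets borel" "\<And>i. i \<in> I \<Longrightarrow> L2conv A (f i) (g i)"
  shows "L2conv A (\<lambda>n x. \<Sum>i\<in>I. f i n x) (\<lambda>x. \<Sum>i\<in>I. g i x)"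
  using assms(2)
  by (induction I rule: infinite_finite_induct) (simp_all add: L2conv_zero[OF assms(1)] L2conv_add)

lemma L2conv_subset:
  assumes "L2conv A f g" and [measurable]: "A' \<in> sets borel" and "A' \<subseteq> A"
  shows "L2conv A' f g"
proof (rule L2conv_dominated)
  note a = L2convD[OF assms(1)]
  show "integrable lborel (\<lambda>x. indicator A x * (g x)\<^sup>2)" by (rule a)
  show "integrable lborel (\<lambda>x. indicator A x * (f n x - g x)\<^sup>2)" for n by (rule a)
  show "(\<lambda>n. \<integral>x. indicator A x * (f n x - g x)\<^sup>2 \<partial>lborel) \<longlonglongrightarrow> 0" by (rule a)
  show "f n \<in> borel_measurable borel" "g \<in> borel_measurable borel" for n by (rule a)+
qed (use assms in auto)

text \<open>The squares are compared through |y^2 - z^2| \<le> \<eta> z^2 + (1 + 1/\<eta>) (y -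
  z)^2: a small \<eta> handles the fixed norm of g, and a large n then handles the second
  term.\<close>

lemma L2conv_limit:
  assumes "L2conv A f g"
  shows "(\<lambda>n. \<integral>x. indicator A x * (f n x)\<^sup>2 \<partial>lborel) \<longlonglongrightarrow> (\<integral>x. indicator A x * (g x)\<^sup>2 \<partial>lborel)"
proof (rule LIMSEQ_I)
  fix e :: real assume e: "e > 0"
  note a = L2convD[OF assms]
  have [measurable]: "A \<in> sets borel" "f n \<in> borel_measurable borel" "g \<in> borel_measurable borel" for n
    by (rule a)+
  define I where "I = (\<integral>x. indicator A x * (g x)\<^sup>2 \<partial>lborel)"
  have I: "I \<ge> 0" unfolding I_def by (intro Bochner_Integration.integral_nonneg) simp
  define \<eta> where "\<eta> = e / (2 * (I + 1))"
  have \<eta>: "\<eta> > 0" using e I by (simp add: \<eta>_def)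
  have \<eta>I: "\<eta> * I < e"
  proof -
    have "\<eta> * I \<le> \<eta> * (I + 1)" using \<eta> by simp
    also have "\<dots> = e / 2" using I by (simp add: \<eta>_def field_simps)
    finally show ?thesis using e by linarith
  qed
  have "(\<lambda>n. \<eta> * I + (1 + 1 / \<eta>) * (\<integral>x. indicator A x * (f n x - g x)\<^sup>2 \<partial>lborel)) \<longlonglongrightarrow> \<eta> * I + (1 + 1 / \<eta>) * 0"
    by (intro tendsto_intros a(6))
  then have "\<forall>\<^sub>F n in sequentially. \<eta> * I + (1 + 1 / \<eta>) * (\<integral>x. indicator A x * (f n x - g x)\<^sup>2 \<partial>lborel) < e"
    by (rule order_tendstoD) (use \<eta>I in simp)
  then obtain N where N: "\<And>n. n \<ge> N \<Longrightarrow> \<eta> * I + (1 + 1 / \<eta>) * (\<integral>x. indicator A x * (f n x - g x)\<^sup>2 \<partial>lborel) < e"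
    unfolding eventually_sequentially by blast
  have pt: "\<bar>y\<^sup>2 - z\<^sup>2\<bar> \<le> \<eta> * z\<^sup>2 + (1 + 1 / \<eta>) * (y - z)\<^sup>2" for y z :: real
  proof -
    have "0 \<le> (\<eta> * z + (y - z))\<^sup>2 / \<eta>" "0 \<le> (\<eta> * z - (y - z))\<^sup>2 / \<eta>" using \<eta> by simp_all
    then have "\<bar>2 * z * (y - z)\<bar> \<le> \<eta> * z\<^sup>2 + 1 / \<eta> * (y - z)\<^sup>2"
      using \<eta> by (simp add: power2_sum power2_diff field_simps power2_eq_square abs_le_iff)
    moreover have "y\<^sup>2 - z\<^sup>2 = 2 * z * (y - z) + (y - z)\<^sup>2" by (simp add: power2_eq_square algebra_simps)
    moreover have "\<bar>2 * z * (y - z) + (y - z)\<^sup>2\<bar> \<le> \<bar>2 * z * (y - z)\<bar> + (y - z)\<^sup>2"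
      by (rule order_trans[OF abs_triangle_ineq]) simp
    ultimately show ?thesis unfolding distrib_right by linarith
  qed
  have i: "integrable lborel (\<lambda>x. indicator A x * (f n x)\<^sup>2)" for n
  proof (rule Bochner_Integration.integrable_bound)
    show "integrable lborel (\<lambda>x. 2 * (indicator A x * (f n x - g x)\<^sup>2) + 2 * (indicator A x * (g x)\<^sup>2))"
      using a(4) a(5) by simp
    show "AE x in lborel. norm (indicator A x * (f n x)\<^sup>2) \<le> norm (2 * (indicator A x * (f n x - g x)\<^sup>2) + 2 * (indicator A x * (g x)\<^sup>2))"
      using square_add_le[of "f n x - g x" "g x" for x] by (auto intro!: AE_I2 simp: indicator_def)
  qed measurable
  have "norm ((\<integral>x. indicator A x * (f n x)\<^sup>2 \<partial>lborel) - I) < e" if "n \<ge> N" for n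
  proof -
    have "(\<integral>x. indicator A x * (f n x)\<^sup>2 \<partial>lborel) - I = (\<integral>x. indicator A x * (f n x)\<^sup>2 - indicator A x * (g x)\<^sup>2 \<partial>lborel)"
      unfolding I_def using i a(4) by simp
    also have "norm \<dots> \<le> (\<integral>x. norm (indicator A x * (f n x)\<^sup>2 - indicator A x * (g x)\<^sup>2) \<partial>lborel)"
      by (rule integral_norm_bound)
    also have "\<dots> \<le> (\<integral>x. \<eta> * (indicator A x * (g x)\<^sup>2) + (1 + 1 / \<eta>) * (indicator A x * (f n x - g x)\<^sup>2) \<partial>lborel)"
    proof (rule integral_mono)
      show "integrable lborel (\<lambda>x. norm (indicator A x * (f n x)\<^sup>2 - indicator A x * (g x)\<^sup>2))"
        by (intro integrable_norm Bochner_Integration.integrable_diff i a(4))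
      show "integrable lborel (\<lambda>x. \<eta> * (indicator A x * (g x)\<^sup>2) + (1 + 1 / \<eta>) * (indicator A x * (f n x - g x)\<^sup>2))"
        by (intro Bochner_Integration.integrable_add integrable_mult_right a)
      show "norm (indicator A x * (f n x)\<^sup>2 - indicator A x * (g x)\<^sup>2) \<le> \<eta> * (indicator A x * (g x)\<^sup>2) + (1 + 1 / \<eta>) * (indicator A x * (f n x - g x)\<^sup>2)" for x
        using pt[of "f n x" "g x"] by (cases "x \<in> A") auto
    qed
    also have "\<dots> = \<eta> * I + (1 + 1 / \<eta>) * (\<integral>x. indicator A x * (f n x - g x)\<^sup>2 \<partial>lborel)"
      unfolding I_def using a(4) a(5)[of n]
      by (subst Bochner_Integration.integral_add) (auto intro!: integrable_mult_right)
    finally show ?thesis using N[OF that] by linarith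
  qed
  then show "\<exists>no. \<forall>n\<ge>no. norm ((\<integral>x. indicator A x * (f n x)\<^sup>2 \<partial>lborel) - (\<integral>x. indicator A x * (g x)\<^sup>2 \<partial>lborel)) < e"
    unfolding I_def by blast
qed

lemma corr_localize:
  assumes K: "unit_kernel \<delta> K" and x: "cball x \<delta> \<subseteq> A"
  shows "corr (\<lambda>y. indicator A y * g y) K x = corr g K x"
proof -
  have "(indicator A y * g y) *\<^sub>R K (y - x) = g y *\<^sub>R K (y - x)" for y
    using kernD(3)[OF K, of "y - x"] x
    by (cases "y \<in> cball x \<delta>") (auto simp: dist_norm norm_minus_commute)
  then show ?thesis unfolding corr_def by presburger
qed

text \<open>The weak gradient and the source are square integrable only on compact parts of the
  domain. They are therefore cut off to the larger set A' before convolution; by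
  \<open>corr_localize\<close> the cut-off is invisible at points of A once the kernels are small
  enough.\<close>

lemma L2conv_local:
  fixes g :: "'a::euclidean_space \<Rightarrow> real"
  assumes g[measurable]: "g \<in> borel_measurable borel" and A[measurable]: "A \<in> sets borel" "A' \<in> sets borel"
    and b: "\<And>x. x \<in> A' \<Longrightarrow> norm x \<le> R" and int: "integrable lborel (\<lambda>x. indicator A' x * (g x)\<^sup>2)"
    and sub: "A \<subseteq> A'" and K: "\<And>n. unit_kernel (\<delta> n) (K n)" and \<delta>: "\<delta> \<longlonglongrightarrow> 0"
  shows "L2conv A (\<lambda>n. corr (\<lambda>y. indicator A' y * g y) (K n)) g"
proof -
  define f where "f y = indicator A' y * g y" for y
  have fm[measurable]: "f \<in> borel_measurable borel" unfolding f_def[abs_def] by measurable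
  have fz: "f x = 0" if "norm x > R" for x using b[of x] that by (cases "x \<in> A'") (auto simp: f_def)
  have f2: "(f x)\<^sup>2 = indicator A' x * (g x)\<^sup>2" for x by (simp add: f_def indicator_def)
  have fin: "(\<integral>\<^sup>+x. ennreal ((f x)\<^sup>2) \<partial>lborel) < \<infinity>"
    unfolding f2 using nn_integral_eq_integral[OF int] by simp
  have fint: "integrable lborel f" by (rule integrable_of_square_integrable[OF fm fz fin])
  have cm[measurable]: "corr f (K n) \<in> borel_measurable borel" for n by (rule corr_measurable[OF K fint])
  have lim: "(\<lambda>n. \<integral>\<^sup>+x. ennreal ((corr f (K n) x - f x)\<^sup>2) \<partial>lborel) \<longlonglongrightarrow> 0"
    by (rule corr_L2_convergence[OF fm fz fin K \<delta>])
  have f2i: "integrable lborel (\<lambda>x. (f x)\<^sup>2)" unfolding f2 by (rule int)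
  have c2i: "integrable lborel (\<lambda>x. (corr f (K n) x)\<^sup>2)" for n
  proof (rule integrableI_nonneg)
    show "(\<integral>\<^sup>+x. ennreal ((corr f (K n) x)\<^sup>2) \<partial>lborel) < \<infinity>"
      using corr_contraction[OF K fm, of n] fin by (rule le_less_trans)
  qed auto
  have di: "integrable lborel (\<lambda>x. (corr f (K n) x - f x)\<^sup>2)" for n
  proof (rule Bochner_Integration.integrable_bound)
    show "integrable lborel (\<lambda>x. 2 * (corr f (K n) x)\<^sup>2 + 2 * (f x)\<^sup>2)" using f2i c2i by simp
    show "AE x in lborel. norm ((corr f (K n) x - f x)\<^sup>2) \<le> norm (2 * (corr f (K n) x)\<^sup>2 + 2 * (f x)\<^sup>2)"
      using square_add_le[of "corr f (K n) x" "- f x" for x] by (intro AE_I2) simp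
  qed measurable
  have "(\<lambda>n. ennreal (\<integral>x. (corr f (K n) x - f x)\<^sup>2 \<partial>lborel)) \<longlonglongrightarrow> ennreal 0"
    using lim nn_integral_eq_integral[OF di] by simp
  then have lim': "(\<lambda>n. \<integral>x. (corr f (K n) x - f x)\<^sup>2 \<partial>lborel) \<longlonglongrightarrow> 0"
    by (subst (asm) tendsto_ennreal_iff) (auto intro!: always_eventually Bochner_Integration.integral_nonneg)
  have "L2conv A (\<lambda>n. corr f (K n)) g"
  proof (rule L2conv_dominated)
    show "integrable lborel (\<lambda>x. (f x)\<^sup>2)" by (rule f2i)
    show "integrable lborel (\<lambda>x. (corr f (K n) x - f x)\<^sup>2)" for n by (rule di)
    show "(\<lambda>n. \<integral>x. (corr f (K n) x - f x)\<^sup>2 \<partial>lborel) \<longlonglongrightarrow> 0" by (rule lim')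
    show "(g x)\<^sup>2 \<le> (f x)\<^sup>2" "(corr f (K n) x - g x)\<^sup>2 \<le> (corr f (K n) x - f x)\<^sup>2" if "x \<in> A" for x n
      using that sub by (auto simp: f_def)
  qed (use A g cm in auto)
  then show ?thesis by (simp add: f_def[abs_def])
qed

lemma annulus_compact: "compact {x::'a::euclidean_space. p \<le> norm (x - a) \<and> norm (x - a) \<le> q}"
proof -
  have "{x. p \<le> norm (x - a) \<and> norm (x - a) \<le> q} = cball a q - ball a p"
    by (auto simp: dist_norm norm_minus_commute)
  then show ?thesis by (simp add: compact_diff)
qed

lemma cE_continuous: "continuous_on UNIV (cE a \<beta> l \<tau>)"
  unfolding cE_def[abs_def] by (intro continuous_intros) auto

section \<open>Unique continuation from exponential decay\<close>

text \<open>Transfers the Carleman estimate to u itself. Between the radii \<rho>1 and \<rho>2 a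
  cut-off is inserted, and H is the resulting right side: the source N beyond \<rho>2, with
  commutator terms in G and u before it. H does not depend on \<tau>. The source vanishes beyond R1,
  so after mollification the right side still lives in A1. Thus L2 convergence on a compact annulus
  suffices for the limit, although the mollified functions live on the whole space and need the
  version of the estimate with decay.\<close>

lemma carleman_weak:
  fixes u N :: "'a::euclidean_space \<Rightarrow> real" and G :: "'a \<Rightarrow> 'a" and a \<beta> :: 'a
    and \<rho> \<rho>1 \<rho>2 R0 R1 L l k C C1 :: real
  defines "\<Omega> \<equiv> {x. \<rho> < norm (x - a)}"
  defines "A0 \<equiv> {x. \<rho>2 \<le> norm (x - a) \<and> norm (x - a) \<le> R0}" and "A1 \<equiv> {x. \<rho>1 \<le> norm (x - a) \<and> norm (x - a) \<le> R0}"
  assumes dim: "DIM('a) \<ge> 2" and \<rho>: "\<rho> > 0" "\<rho> < \<rho>1" "\<rho>1 < \<rho>2" "\<rho>2 \<le> R0" "R1 + 1 \<le> R0"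
    and l: "l > 0" and k: "l\<^sup>2 + k \<ge> 0" and L: "l + norm \<beta> / 2 < L"
    and um[measurable]: "u \<in> borel_measurable borel" and Gm[measurable]: "G \<in> borel_measurable borel"
    and Nm[measurable]: "N \<in> borel_measurable borel"
    and ub: "\<And>x. \<bar>u x\<bar> \<le> C * exp (- L * norm (x - a))"
    and Gloc: "\<And>A. compact A \<Longrightarrow> A \<subseteq> \<Omega> \<Longrightarrow> integrable lborel (\<lambda>x. indicator A x * (G x \<bullet> G x))"
    and Nb: "\<And>x. \<bar>N x\<bar> \<le> C1 * (norm (G x) + \<bar>u x\<bar>)" and Nfar: "\<And>x. norm (x - a) \<ge> R1 \<Longrightarrow> N x = 0"
    and w1: "\<And>\<phi> D\<phi> i. test_function \<Omega> \<phi> \<Longrightarrow> (\<And>y. GDERIV \<phi> y :> D\<phi> y) \<Longrightarrow> i \<in> Basis \<Longrightarrow>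
       (\<integral>y. u y * (D\<phi> y \<bullet> i) \<partial>lborel) = - (\<integral>y. (G y \<bullet> i) * \<phi> y \<partial>lborel)"
    and w2: "\<And>\<phi> D\<phi>. test_function \<Omega> \<phi> \<Longrightarrow> (\<And>y. GDERIV \<phi> y :> D\<phi> y) \<Longrightarrow>
       (\<integral>y. G y \<bullet> D\<phi> y \<partial>lborel) = - (\<integral>y. (N y - \<beta> \<bullet> G y - (\<beta> \<bullet> \<beta> / 4 + k) * u y) * \<phi> y \<partial>lborel)"
  obtains H where "H \<in> borel_measurable borel" "integrable lborel (\<lambda>x. indicator A1 x * (H x)\<^sup>2)"
    "\<And>x. \<rho>2 \<le> norm (x - a) \<Longrightarrow> H x = N x"
    "\<And>\<tau>. \<tau> \<ge> 2 * (real DIM('a))\<^sup>2 * \<rho>1 powr (-1/2) \<Longrightarrow> \<tau>\<^sup>2 \<ge> R0 * l\<^sup>2 \<Longrightarrow> \<tau>\<^sup>2 \<ge> R0 * (\<beta> \<bullet> \<beta>) \<Longrightarrow> \<tau>\<^sup>2 \<ge> R0 \<Longrightarrow>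
       (\<integral>x. indicator A0 x * ((cE a \<beta> l \<tau> x)\<^sup>2 * (G x \<bullet> G x + (u x)\<^sup>2)) \<partial>lborel)
       \<le> 19 * (2 + 16 * (real DIM('a))\<^sup>2) / \<tau> *
         (\<integral>x. indicator A1 x * (rp a (3/2) x * (cE a \<beta> l \<tau> x)\<^sup>2 * (H x)\<^sup>2) \<partial>lborel)"
proof -
  define \<kappa> where "\<kappa> = \<beta> \<bullet> \<beta> / 4 + k"
  have Lpos: "L > 0" using l L norm_ge_zero[of \<beta>] by linarith
  have Cpos: "C \<ge> 0" using ub[of a] by simp
  have uint: "integrable lborel u"
  proof (rule Bochner_Integration.integrable_bound)
    show "integrable lborel (\<lambda>x. C * exp (- L * norm (x - a)))"
      by (intro integrable_mult_right integrable_exp_decay Lpos)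
    show "AE x in lborel. norm (u x) \<le> norm (C * exp (- L * norm (x - a)))"
      using ub Cpos by (intro AE_I2) simp
  qed simp
  \<comment> \<open>A radius below \<rho>1 - \<rho> keeps kernels centred at distance at least
    \<rho>1 inside the domain. A radius of at most 1/2 keeps kernels centred in A1 inside A', and
    the mollified source zero beyond R0, as R1 + 1 \<le> R0.\<close>
  define \<delta>0 where "\<delta>0 = min (1/2) ((\<rho>1 - \<rho>) / 2)"
  have \<delta>0: "\<delta>0 > 0" "\<delta>0 \<le> 1/2" "\<delta>0 < \<rho>1 - \<rho>" using \<rho> by (auto simp: \<delta>0_def min_def)
  define \<delta> where "\<delta> n = \<delta>0 * inverse (real (Suc n))" for n
  have \<delta>: "\<delta> n > 0" "\<delta> n \<le> \<delta>0" for n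
  proof -
    show "\<delta> n > 0" using \<delta>0 by (simp add: \<delta>_def)
    have "inverse (real (Suc n)) \<le> 1" by (simp add: inverse_le_1_iff)
    then show "\<delta> n \<le> \<delta>0" using \<delta>0(1) mult_left_mono[of "inverse (real (Suc n))" 1 \<delta>0] by (simp add: \<delta>_def)
  qed
  have \<delta>lim: "\<delta> \<longlonglongrightarrow> 0"
    using tendsto_mult_left[OF LIMSEQ_inverse_real_of_nat, of \<delta>0] by (simp add: \<delta>_def[abs_def])
  have "\<exists>K DK D2K. mollifier (\<delta> n) (K :: 'a \<Rightarrow> real) DK D2K" for n
    using mollifier_exists[OF \<delta>(1)[of n]] by metis
  then obtain K :: "nat \<Rightarrow> 'a \<Rightarrow> real" and DK D2K where moll: "\<And>n. mollifier (\<delta> n) (K n) (DK n) (D2K n)"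
    by metis
  have unit_kernel: "unit_kernel (\<delta> n) (K n)" for n by (rule mollifier_unit_kernel[OF moll])
  have KC: "C2_on UNIV (K n) (DK n) (D2K n)"
    and Kz: "\<And>z. norm z \<ge> \<delta> n \<Longrightarrow> K n z = 0" "\<And>z. norm z \<ge> \<delta> n \<Longrightarrow> DK n z = 0"
      "\<And>z h. norm z \<ge> \<delta> n \<Longrightarrow> D2K n z h = 0" for n
    using moll[of n] unfolding mollifier_def by auto
  define un where "un n = corr u (K n)" for n
  define Dun where "Dun n x = - corr u (DK n) x" for n x
  define D2un where "D2un n x h = corr u (\<lambda>z. D2K n z h) x" for n x h
  have C2un: "C2_on UNIV (un n) (Dun n) (D2un n)" for n
    unfolding un_def[abs_def] Dun_def[abs_def] D2un_def[abs_def]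
    by (rule C2_on_corr[OF uint KC Kz])
  define A' where "A' = {x. \<rho>1 - \<delta>0 \<le> norm (x - a) \<and> norm (x - a) \<le> R0 + 1}"
  have A'c: "compact A'" unfolding A'_def by (rule annulus_compact)
  have A'\<Omega>: "A' \<subseteq> \<Omega>" using \<delta>0 by (auto simp: A'_def \<Omega>_def)
  have A1c: "compact A1" unfolding A1_def by (rule annulus_compact)
  have A0c: "compact A0" unfolding A0_def by (rule annulus_compact)
  have Am[measurable]: "A' \<in> sets borel" "A1 \<in> sets borel" "A0 \<in> sets borel"
    using A'c A1c A0c by (auto intro: borel_closed compact_imp_closed)
  have A01: "A0 \<subseteq> A1" using \<rho> by (auto simp: A0_def A1_def)
  have A1': "A1 \<subseteq> A'" using \<delta>0 by (auto simp: A1_def A'_def)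
  have tri: "norm (x - a) - \<delta> n \<le> norm (y - a)" "norm (y - a) \<le> norm (x - a) + \<delta> n" if "y \<in> cball x (\<delta> n)" for x y n
    using that norm_triangle_ineq[of "y - a" "x - y"] norm_triangle_ineq[of "x - a" "y - x"]
    by (simp_all add: dist_norm norm_minus_commute)
  have ball1: "cball x (\<delta> n) \<subseteq> \<Omega>" if "\<rho>1 \<le> norm (x - a)" for x n
    using tri(1)[of _ x n] that \<delta>0 \<delta>(2)[of n] by (force simp: \<Omega>_def)
  have ball2: "cball x (\<delta> n) \<subseteq> A'" if "x \<in> A1" for x n
    using tri[of _ x n] that \<delta>0 \<delta>(2)[of n] by (force simp: A1_def A'_def)
  have A'b: "norm x \<le> R0 + 1 + norm a" if "x \<in> A'" for x
    using that norm_triangle_sub[of x a] by (simp add: A'_def)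
  have indA: "integrable lborel (\<lambda>x. indicator A x :: real)" if "compact A" for A :: "'a set"
    using that by (intro integrable_real_indicator emeasure_compact_finite) (auto intro: borel_closed compact_imp_closed)
  have Gi2: "integrable lborel (\<lambda>x. indicator A x * (G x \<bullet> i)\<^sup>2)" if "compact A" "A \<subseteq> \<Omega>" "i \<in> Basis" for A i
  proof (rule Bochner_Integration.integrable_bound[OF Gloc[OF that(1,2)]])
    have "(G x \<bullet> i)\<^sup>2 \<le> G x \<bullet> G x" for x
      using power_mono[OF Basis_le_norm[OF that(3), of "G x"], of 2] by (simp add: power2_norm_eq_inner)
    then show "AE x in lborel. norm (indicator A x * (G x \<bullet> i)\<^sup>2) \<le> norm (indicator A x * (G x \<bullet> G x))"
      by (intro AE_I2) (auto simp: indicator_def)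
    have [measurable]: "A \<in> sets borel" using that by (auto intro: borel_closed compact_imp_closed)
    show "(\<lambda>x. indicator A x * (G x \<bullet> i)\<^sup>2) \<in> borel_measurable lborel" by measurable
  qed
  have u2: "integrable lborel (\<lambda>x. indicator A x * (u x)\<^sup>2)" if "compact A" for A
  proof (rule Bochner_Integration.integrable_bound[OF integrable_mult_right[OF indA[OF that], of "C\<^sup>2"]])
    have "\<bar>u x\<bar> \<le> \<bar>C\<bar>" for x
    proof -
      have "C * exp (- L * norm (x - a)) \<le> C * 1" using Lpos Cpos by (intro mult_left_mono) auto
      then show ?thesis using ub[of x] Cpos by linarith
    qed
    then have "(u x)\<^sup>2 \<le> C\<^sup>2" for x by (rule abs_le_square_iff[THEN iffD1])
    then show "AE x in lborel. norm (indicator A x * (u x)\<^sup>2) \<le> norm (C\<^sup>2 * indicator A x)"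
      by (intro AE_I2) (auto simp: indicator_def)
    have [measurable]: "A \<in> sets borel" using that by (auto intro: borel_closed compact_imp_closed)
    show "(\<lambda>x. indicator A x * (u x)\<^sup>2) \<in> borel_measurable lborel" by measurable
  qed
  have N2le: "(N x)\<^sup>2 \<le> 2 * C1\<^sup>2 * (G x \<bullet> G x + (u x)\<^sup>2)" for x
  proof -
    have "0 \<le> C1 * (norm (G x) + \<bar>u x\<bar>)" using Nb[of x] by linarith
    then have "(N x)\<^sup>2 \<le> (C1 * (norm (G x) + \<bar>u x\<bar>))\<^sup>2" using Nb[of x] by (intro abs_le_square_iff[THEN iffD1]) simp
    also have "\<dots> \<le> C1\<^sup>2 * (2 * (norm (G x))\<^sup>2 + 2 * \<bar>u x\<bar>\<^sup>2)"
      unfolding power_mult_distrib by (intro mult_left_mono square_add_le) simp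
    finally show ?thesis by (simp add: power2_norm_eq_inner algebra_simps)
  qed
  have N2: "integrable lborel (\<lambda>x. indicator A x * (N x)\<^sup>2)" if "compact A" "A \<subseteq> \<Omega>" for A
  proof (rule Bochner_Integration.integrable_bound)
    show "integrable lborel (\<lambda>x. 2 * C1\<^sup>2 * (indicator A x * (G x \<bullet> G x) + indicator A x * (u x)\<^sup>2))"
      by (intro integrable_mult_right Bochner_Integration.integrable_add Gloc u2 that)
    have [measurable]: "A \<in> sets borel" using that by (auto intro: borel_closed compact_imp_closed)
    show "(\<lambda>x. indicator A x * (N x)\<^sup>2) \<in> borel_measurable lborel" by measurable
    show "AE x in lborel. norm (indicator A x * (N x)\<^sup>2) \<le> norm (2 * C1\<^sup>2 * (indicator A x * (G x \<bullet> G x) + indicator A x * (u x)\<^sup>2))"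
      using N2le by (intro AE_I2) (auto simp: indicator_def)
  qed
  have L1: "integrable lborel (\<lambda>x. indicator A x * g x)"
    if i: "integrable lborel (\<lambda>x. indicator A x * (g x)\<^sup>2)" and A: "compact A" and [measurable]: "g \<in> borel_measurable borel"
    for A and g :: "'a \<Rightarrow> real"
  proof (rule Bochner_Integration.integrable_bound[OF Bochner_Integration.integrable_add[OF i indA[OF A]]])
    have [measurable]: "A \<in> sets borel" using A by (auto intro: borel_closed compact_imp_closed)
    show "(\<lambda>x. indicator A x * g x) \<in> borel_measurable lborel" by measurable
    have "\<bar>g x\<bar> \<le> (g x)\<^sup>2 + 1" for x
      using zero_le_power2[of "\<bar>g x\<bar> - 1"] by (simp add: power2_eq_square algebra_simps)
    then show "AE x in lborel. norm (indicator A x * g x) \<le> norm (indicator A x * (g x)\<^sup>2 + indicator A x)"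
      by (intro AE_I2) (auto simp: indicator_def)
  qed
  have eqs: "i \<in> Basis \<Longrightarrow> Dun n x \<bullet> i = corr (\<lambda>y. G y \<bullet> i) (K n) x"
    "trace_op (D2un n x) + \<beta> \<bullet> Dun n x + \<kappa> * un n x = corr N (K n) x" if x: "\<rho>1 \<le> norm (x - a)" for n x i
  proof -
    have c: "compact (cball x (\<delta> n))" by simp
    have iG: "\<And>i. i \<in> Basis \<Longrightarrow> integrable lborel (\<lambda>y. indicator (cball x (\<delta> n)) y * (G y \<bullet> i))"
      by (rule L1[OF Gi2[OF c ball1[OF x]] c]) auto
    have iN: "integrable lborel (\<lambda>y. indicator (cball x (\<delta> n)) y * N y)"
      by (rule L1[OF N2[OF c ball1[OF x]] c]) auto
    note m = mollified_equation[OF moll uint ball1[OF x] iG iN w1 w2]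
    show "i \<in> Basis \<Longrightarrow> Dun n x \<bullet> i = corr (\<lambda>y. G y \<bullet> i) (K n) x"
      unfolding Dun_def using m(1) by blast
    show "trace_op (D2un n x) + \<beta> \<bullet> Dun n x + \<kappa> * un n x = corr N (K n) x"
      unfolding Dun_def D2un_def un_def \<kappa>_def by (rule m(2))
  qed
  define Gn where "Gn n i = corr (\<lambda>y. indicator A' y * (G y \<bullet> i)) (K n)" for n i
  define Nn where "Nn n = corr (\<lambda>y. indicator A' y * N y) (K n)" for n
  define un' where "un' n = corr (\<lambda>y. indicator A' y * u y) (K n)" for n
  have loc: "Dun n x \<bullet> i = Gn n i x" if "x \<in> A1" "i \<in> Basis" for n x i
    unfolding Gn_def corr_localize[OF unit_kernel ball2[OF that(1)]] using eqs(1)[of x i n] that by (simp add: A1_def)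
  have locN: "trace_op (D2un n x) + \<beta> \<bullet> Dun n x + \<kappa> * un n x = Nn n x" if "x \<in> A1" for n x
    unfolding Nn_def corr_localize[OF unit_kernel ball2[OF that(1)]] using eqs(2)[of x n] that by (simp add: A1_def)
  have locu: "un n x = un' n x" if "x \<in> A1" for n x
    unfolding un'_def un_def corr_localize[OF unit_kernel ball2[OF that(1)]] ..
  have farN: "trace_op (D2un n x) + \<beta> \<bullet> Dun n x + \<kappa> * un n x = 0" if "R0 < norm (x - a)" for n x
  proof -
    have "corr N (K n) x = 0"
    proof (rule corr_local_zero[OF unit_kernel])
      fix y assume "norm (y - x) < \<delta> n"
      then have "y \<in> cball x (\<delta> n)" by (simp add: dist_norm norm_minus_commute)
      from tri(1)[OF this] show "N y = 0" using that \<rho> \<delta>(2)[of n] \<delta>0 by (intro Nfar) linarith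
    qed
    then show ?thesis using eqs(2)[of x n] that \<rho> by simp
  qed
  have Lu: "L2conv A1 un' u" and LG: "\<And>i. i \<in> Basis \<Longrightarrow> L2conv A1 (\<lambda>n. Gn n i) (\<lambda>x. G x \<bullet> i)" and LN: "L2conv A1 Nn N"
    unfolding un'_def[abs_def] Gn_def[abs_def] Nn_def[abs_def]
    by (rule L2conv_local[OF _ Am(2,1) A'b _ A1' unit_kernel \<delta>lim], measurable, rule u2[OF A'c])
      (rule L2conv_local[OF _ Am(2,1) A'b _ A1' unit_kernel \<delta>lim], measurable, rule Gi2[OF A'c A'\<Omega>], assumption,
        rule L2conv_local[OF _ Am(2,1) A'b _ A1' unit_kernel \<delta>lim], measurable, rule N2[OF A'c A'\<Omega>])
  obtain S S' S'' :: "real \<Rightarrow> real" and B :: real where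
    S: "\<And>t. (S has_real_derivative S' t) (at t)" "\<And>t. (S' has_real_derivative S'' t) (at t)"
    "continuous_on UNIV S''" and S0: "\<And>t. t \<le> 0 \<Longrightarrow> S t = 0" and S1: "\<And>t. t \<ge> 1 \<Longrightarrow> S t = 1"
    and Sz: "\<And>t. t \<le> 0 \<or> t \<ge> 1 \<Longrightarrow> S' t = 0 \<and> S'' t = 0" and Sr: "\<And>t. 0 \<le> S t \<and> S t \<le> 1"
    using C2_step_exists by metis
  \<comment> \<open>The affine function q of |x - a|^2 takes the value 0 on the sphere of radius
    \<rho>1 and 1 on that of radius \<rho>2.\<close>
  define m where "m = 1 / (\<rho>2\<^sup>2 - \<rho>1\<^sup>2)"
  have m0: "\<rho>1\<^sup>2 < \<rho>2\<^sup>2" using \<rho> by (intro power_strict_mono) auto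
  define q where "q x = - (\<rho>1\<^sup>2 * m) + m * ((x - a) \<bullet> (x - a))" for x
  define ch where "ch x = S (q x)" for x
  define Dch where "Dch x = (2 * m * S' (q x)) *\<^sub>R (x - a)" for x
  define D2ch where "D2ch x h = (2 * m * S' (q x)) *\<^sub>R h + (4 * m\<^sup>2 * S'' (q x)) *\<^sub>R (((x - a) \<bullet> h) *\<^sub>R (x - a))" for x h
  have Cch: "C2_on UNIV ch Dch D2ch"
    using C2_on_radial[OF S, of "- (\<rho>1\<^sup>2 * m)" m a]
    unfolding ch_def[abs_def] Dch_def[abs_def] D2ch_def[abs_def] q_def .
  have qe: "q x = (norm (x - a) ^ 2 - \<rho>1\<^sup>2) / (\<rho>2\<^sup>2 - \<rho>1\<^sup>2)" for x
    by (simp add: q_def m_def power2_norm_eq_inner diff_divide_distrib)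
  have out: "ch x = 1 \<and> Dch x = 0 \<and> (\<forall>h. D2ch x h = 0)" if "\<rho>2 \<le> norm (x - a)" for x
  proof -
    have "\<rho>2\<^sup>2 \<le> norm (x - a) ^ 2" using that \<rho> by (intro power_mono) auto
    then have "q x \<ge> 1" using m0 by (simp add: qe)
    then show ?thesis using S1 Sz[of "q x"] by (simp add: ch_def Dch_def D2ch_def)
  qed
  have inn: "ch x = 0 \<and> Dch x = 0 \<and> (\<forall>h. D2ch x h = 0)" if "norm (x - a) \<le> \<rho>1" for x
  proof -
    have "norm (x - a) ^ 2 \<le> \<rho>1\<^sup>2" using that by (intro power_mono) auto
    then have "q x \<le> 0" using m0 by (simp add: qe divide_le_0_iff)
    then show ?thesis using S0 Sz[of "q x"] by (simp add: ch_def Dch_def D2ch_def)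
  qed
  define \<Theta> where "\<Theta> x = trace_op (D2ch x) + \<beta> \<bullet> Dch x" for x
  have c\<Theta>: "continuous_on UNIV \<Theta>" "continuous_on UNIV Dch" "continuous_on UNIV ch"
    unfolding \<Theta>_def[abs_def] trace_op_def by (intro continuous_intros C2_onD(4-6)[OF Cch])+
  define vn where "vn n x = ch x * un n x" for n x
  define Dvn where "Dvn n x = ch x *\<^sub>R Dun n x + un n x *\<^sub>R Dch x" for n x
  define D2vn where "D2vn n x h = ch x *\<^sub>R D2un n x h + (Dch x \<bullet> h) *\<^sub>R Dun n x + (Dun n x \<bullet> h) *\<^sub>R Dch x + un n x *\<^sub>R D2ch x h" for n x h
  have C2vn: "C2_on UNIV (vn n) (Dvn n) (D2vn n)" for n
    using C2_on_mult[OF Cch C2un] unfolding vn_def[abs_def] Dvn_def[abs_def] D2vn_def[abs_def] .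
  \<comment> \<open>By the product rule the operator applied to the cut-off mollified function is
    the cut-off times the source, plus 2 \<nabla>ch \<bullet> \<nabla>u, plus \<Theta> u, where
    \<Theta> collects \<Delta>ch + \<beta> \<bullet> \<nabla>ch. \<open>Hn\<close> is built from the
    localized convolutions, \<open>H\<close> is its L2 limit on A1.\<close>
  define Hn where "Hn n x = ch x * Nn n x + (\<Sum>i\<in>Basis. (2 * (Dch x \<bullet> i)) * Gn n i x) + \<Theta> x * un' n x" for n x
  define H where "H x = ch x * N x + (\<Sum>i\<in>Basis. (2 * (Dch x \<bullet> i)) * (G x \<bullet> i)) + \<Theta> x * u x" for x
  define gv where "gv n = gauged \<beta> k (vn n) (Dvn n) (D2vn n)" for n
  have gv0: "gv n x = ch x * (trace_op (D2un n x) + \<beta> \<bullet> Dun n x + \<kappa> * un n x) + 2 * (Dch x \<bullet> Dun n x) + \<Theta> x * un n x" for n x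
    unfolding gv_def gauged_def D2vn_def Dvn_def vn_def trace_op_add trace_op_scaleR trace_op_rank_one \<Theta>_def \<kappa>_def
    by (simp add: inner_add_right inner_commute[of "Dun n x"] algebra_simps)
  \<comment> \<open>Inside \<rho>1 the cut-off and its derivatives vanish; beyond R0 the cut-off is
    identically 1 and the mollified source is 0. Only A1 remains.\<close>
  have gv: "gv n x = indicator A1 x * Hn n x" for n x
  proof -
    consider "norm (x - a) < \<rho>1" | "R0 < norm (x - a)" | "x \<in> A1" unfolding A1_def by force
    then show ?thesis
    proof cases
      case 1
      then show ?thesis using inn[of x] by (simp add: gv0 \<Theta>_def trace_op_def A1_def)
    next
      case 2
      then have "\<rho>2 \<le> norm (x - a)" using \<rho> by simp
      then show ?thesis using out[of x] farN[OF 2] 2 by (simp add: gv0 \<Theta>_def trace_op_def A1_def)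
    next
      case 3
      have "2 * (Dch x \<bullet> Dun n x) = (\<Sum>i\<in>Basis. (2 * (Dch x \<bullet> i)) * Gn n i x)"
        by (subst euclidean_inner) (simp add: sum_distrib_left loc[OF 3] mult.assoc)
      then show ?thesis unfolding gv0 locN[OF 3] using 3 by (simp add: Hn_def locu)
    qed
  qed
  have bddA: "\<exists>B. \<forall>x\<in>A1. norm (f x) \<le> B" if "continuous_on UNIV f" for f :: "'a \<Rightarrow> 'b::real_normed_vector"
    using compact_imp_bounded[OF compact_continuous_image[OF continuous_on_subset[OF that subset_UNIV] A1c]]
    unfolding bounded_iff by simp
  have mc: "f \<in> borel_measurable borel" if "continuous_on UNIV f" for f :: "'a \<Rightarrow> real"
    using that by (rule borel_measurable_continuous_onI)
  have LH: "L2conv A1 Hn H"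
    unfolding Hn_def[abs_def] H_def[abs_def]
  proof (intro L2conv_add L2conv_sum Am(2))
    have L2m: "L2conv A1 (\<lambda>n x. c x * f n x) (\<lambda>x. c x * g x)" if c: "continuous_on UNIV c" and f: "L2conv A1 f g" for c f g
    proof -
      obtain B where "\<forall>x\<in>A1. norm (c x) \<le> B" using bddA[OF c] by blast
      then show ?thesis by (intro L2conv_mult[OF f mc[OF c], of B]) simp
    qed
    show "L2conv A1 (\<lambda>n x. ch x * Nn n x) (\<lambda>x. ch x * N x)" by (rule L2m[OF c\<Theta>(3) LN])
    show "L2conv A1 (\<lambda>n x. \<Theta> x * un' n x) (\<lambda>x. \<Theta> x * u x)" by (rule L2m[OF c\<Theta>(1) Lu])
    fix i :: 'a assume i: "i \<in> Basis"
    have "continuous_on UNIV (\<lambda>x. 2 * (Dch x \<bullet> i))" by (intro continuous_intros c\<Theta>)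
    then show "L2conv A1 (\<lambda>n x. (2 * (Dch x \<bullet> i)) * Gn n i x) (\<lambda>x. (2 * (Dch x \<bullet> i)) * (G x \<bullet> i))"
      by (rule L2m[OF _ LG[OF i]])
  qed
  have dec: "\<exists>D\<ge>0. \<forall>x. \<bar>un n x\<bar> \<le> D * exp (- L * norm (x - a)) \<and> norm (Dun n x) \<le> D * exp (- L * norm (x - a))" for n
  proof -
    obtain D1 where D1: "\<And>x. norm (corr u (K n) x) \<le> D1 * exp (- L * norm (x - a))" "D1 \<ge> 0"
      using corr_decay[OF uint ub less_imp_le[OF Lpos] C2_onD(6)[OF KC[of n]] Kz(1)] by blast
    obtain D2 where D2: "\<And>x. norm (corr u (DK n) x) \<le> D2 * exp (- L * norm (x - a))" "D2 \<ge> 0"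
      using corr_decay[OF uint ub less_imp_le[OF Lpos] C2_onD(5)[OF KC[of n]] Kz(2)] by blast
    have "D1 * exp (- L * norm (x - a)) \<le> (D1 + D2) * exp (- L * norm (x - a))"
      "D2 * exp (- L * norm (x - a)) \<le> (D1 + D2) * exp (- L * norm (x - a))" for x
      using D1(2) D2(2) by (simp_all add: mult_right_mono)
    then have "norm (corr u (K n) x) \<le> (D1 + D2) * exp (- L * norm (x - a))"
      "norm (corr u (DK n) x) \<le> (D1 + D2) * exp (- L * norm (x - a))" for x
      using order_trans[OF D1(1)] order_trans[OF D2(1)] by blast+
    then show ?thesis
      using D1(2) D2(2) unfolding un_def Dun_def norm_minus_cancel real_norm_def
      by (intro exI[of _ "D1 + D2"]) simp
  qed
  have wint: "integrable lborel (\<lambda>x. rp a (3/2) x * (cE a \<beta> l \<tau> x)\<^sup>2 * (vn n x)\<^sup>2)"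
    "integrable lborel (\<lambda>x. rp a (3/2) x * (cE a \<beta> l \<tau> x)\<^sup>2 * (Dvn n x \<bullet> Dvn n x))"
    "integrable lborel (\<lambda>x. rp a (3/2) x * (cE a \<beta> l \<tau> x)\<^sup>2 * (gv n x)\<^sup>2)" for n \<tau>
  proof -
    obtain D where D: "D \<ge> 0" "\<And>x. \<bar>un n x\<bar> \<le> D * exp (- L * norm (x - a))"
      "\<And>x. norm (Dun n x) \<le> D * exp (- L * norm (x - a))"
      using dec[of n] by blast
    have e2: "(exp (- L * norm (x - a)))\<^sup>2 = exp (- (2 * L) * norm (x - a))" for x
      by (simp add: power2_eq_square exp_add[symmetric])
    have ch1: "\<bar>ch x\<bar> \<le> 1" for x using Sr[of "q x"] by (simp add: ch_def)
    obtain B1 where B1: "B1 > 0" "\<And>x. norm (Dch x) \<le> B1"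
    proof (rule bounded_of_compact_support[OF c\<Theta>(2), of "\<rho>2 + norm a"])
      fix z :: 'a assume "\<rho>2 + norm a \<le> norm z"
      then have "\<rho>2 \<le> norm (z - a)" using norm_triangle_ineq2[of z a] by linarith
      then show "Dch z = 0" using out by blast
    qed blast
    note cv' = C2_onD(4-6)[OF C2vn[of n]]
    have vb: "\<bar>vn n x\<bar> \<le> D * exp (- L * norm (x - a))" for x
    proof -
      have "\<bar>vn n x\<bar> \<le> 1 * \<bar>un n x\<bar>" unfolding vn_def abs_mult by (intro mult_right_mono ch1) simp
      then show ?thesis using D(2)[of x] by linarith
    qed
    have Dvb: "norm (Dvn n x) \<le> (D + B1 * D) * exp (- L * norm (x - a))" for x
    proof -
      have "norm (Dvn n x) \<le> \<bar>ch x\<bar> * norm (Dun n x) + \<bar>un n x\<bar> * norm (Dch x)"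
        unfolding Dvn_def by (rule order_trans[OF norm_triangle_ineq]) simp
      also have "\<dots> \<le> 1 * (D * exp (- L * norm (x - a))) + (D * exp (- L * norm (x - a))) * B1"
        using ch1 D B1 by (intro add_mono mult_mono) auto
      finally show ?thesis by (simp add: algebra_simps)
    qed
    show "integrable lborel (\<lambda>x. rp a (3/2) x * (cE a \<beta> l \<tau> x)\<^sup>2 * (vn n x)\<^sup>2)"
    proof (rule weighted_integrable[OF L])
      show "(\<lambda>x. (vn n x)\<^sup>2) \<in> borel_measurable borel" by (intro mc continuous_intros cv')
      fix x
      have "\<bar>vn n x\<bar>\<^sup>2 \<le> (D * exp (- L * norm (x - a)))\<^sup>2" by (intro power_mono vb) simp
      then show "\<bar>(vn n x)\<^sup>2\<bar> \<le> D\<^sup>2 * exp (- (2 * L) * norm (x - a))" unfolding power_mult_distrib e2 by simp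
    qed
    show "integrable lborel (\<lambda>x. rp a (3/2) x * (cE a \<beta> l \<tau> x)\<^sup>2 * (Dvn n x \<bullet> Dvn n x))"
    proof (rule weighted_integrable[OF L])
      show "(\<lambda>x. Dvn n x \<bullet> Dvn n x) \<in> borel_measurable borel" by (intro mc continuous_intros cv')
      fix x
      have "(norm (Dvn n x))\<^sup>2 \<le> ((D + B1 * D) * exp (- L * norm (x - a)))\<^sup>2" by (intro power_mono Dvb) simp
      then show "\<bar>Dvn n x \<bullet> Dvn n x\<bar> \<le> (D + B1 * D)\<^sup>2 * exp (- (2 * L) * norm (x - a))"
        unfolding power_mult_distrib e2 by (simp add: power2_norm_eq_inner)
    qed
    have cgv: "continuous_on UNIV (gv n)"
      unfolding gv_def gauged_def[abs_def] trace_op_def by (intro continuous_intros cv')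
    \<comment> \<open>On the bounded set A1 a constant bound already has the required exponential
      form, and outside A1 the function \<open>gv\<close> is zero.\<close>
    obtain B2 where B2: "\<forall>x\<in>A1. norm (gv n x) \<le> B2" using bddA[OF cgv] by blast
    show "integrable lborel (\<lambda>x. rp a (3/2) x * (cE a \<beta> l \<tau> x)\<^sup>2 * (gv n x)\<^sup>2)"
    proof (rule weighted_integrable[OF L])
      show "(\<lambda>x. (gv n x)\<^sup>2) \<in> borel_measurable borel" by (intro mc continuous_intros cgv)
      fix x
      show "\<bar>(gv n x)\<^sup>2\<bar> \<le> (B2\<^sup>2 * exp (2 * L * R0)) * exp (- (2 * L) * norm (x - a))"
      proof (cases "x \<in> A1")
        case True
        then have "norm (x - a) \<le> R0" by (simp add: A1_def)
        then have "2 * L * norm (x - a) \<le> 2 * L * R0" using Lpos by simp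
        then have "1 \<le> exp (2 * L * R0) * exp (- (2 * L) * norm (x - a))"
          by (simp add: exp_add[symmetric])
        then have "B2\<^sup>2 * 1 \<le> B2\<^sup>2 * (exp (2 * L * R0) * exp (- (2 * L) * norm (x - a)))" by (intro mult_left_mono) auto
        moreover have "(gv n x)\<^sup>2 \<le> B2\<^sup>2" using B2 True by (intro abs_le_square_iff[THEN iffD1]) force
        ultimately show ?thesis by (simp add: mult.assoc)
      next
        case False
        then show ?thesis by (simp add: gv)
      qed
    qed
  qed
  have Hm: "H \<in> borel_measurable borel" by (rule L2convD(3)[OF LH])
  show ?thesis
  proof (rule that[OF Hm L2convD(4)[OF LH]])
    fix x assume "\<rho>2 \<le> norm (x - a)"
    then show "H x = N x" using out[of x] by (simp add: H_def \<Theta>_def trace_op_def)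
  next
    fix \<tau> assume \<tau>: "\<tau> \<ge> 2 * (real DIM('a))\<^sup>2 * \<rho>1 powr (-1/2)" "\<tau>\<^sup>2 \<ge> R0 * l\<^sup>2" "\<tau>\<^sup>2 \<ge> R0 * (\<beta> \<bullet> \<beta>)" "\<tau>\<^sup>2 \<ge> R0"
    define C0 where "C0 = 19 * (2 + 16 * (real DIM('a))\<^sup>2) / \<tau>"
    define E where "E = cE a \<beta> l \<tau>"
    have Ec: "continuous_on UNIV E" unfolding E_def by (rule cE_continuous)
    note [measurable] = mc[OF Ec]
    obtain BE where BE: "\<forall>x\<in>A1. norm (E x) \<le> BE" using bddA[OF Ec] by blast
    \<comment> \<open>The square root of the weight turns the weighted integral into a plain square,
      so that \<open>L2conv_mult\<close> and \<open>L2conv_limit\<close> apply.\<close>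
    define sW where "sW x = sqrt (rp a (3/2) x) * E x" for x
    have sWm: "sW \<in> borel_measurable borel" unfolding sW_def[abs_def] rp_def by measurable
    have sWb: "\<bar>sW x\<bar> \<le> sqrt (R0 powr (3/2)) * BE" if "x \<in> A1" for x
    proof -
      have "rp a (3/2) x \<le> R0 powr (3/2)" unfolding rp_def using that by (intro powr_mono2) (auto simp: A1_def)
      then have "sqrt (rp a (3/2) x) \<le> sqrt (R0 powr (3/2))" by simp
      then show ?thesis using BE that unfolding sW_def abs_mult by (intro mult_mono) (auto simp: rp_nonneg)
    qed
    have sW2: "(sW x)\<^sup>2 = rp a (3/2) x * (E x)\<^sup>2" for x by (simp add: sW_def power_mult_distrib rp_nonneg)
    have R: "(\<lambda>n. \<integral>x. indicator A1 x * (sW x * Hn n x)\<^sup>2 \<partial>lborel) \<longlonglongrightarrow> (\<integral>x. indicator A1 x * (sW x * H x)\<^sup>2 \<partial>lborel)"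
      by (rule L2conv_limit[OF L2conv_mult[OF LH sWm sWb]])
    have EG: "L2conv A0 (\<lambda>n x. E x * Gn n i x) (\<lambda>x. E x * (G x \<bullet> i))" if "i \<in> Basis" for i
      by (rule L2conv_subset[OF L2conv_mult[OF LG[OF that] mc[OF Ec], of BE] Am(3) A01]) (use BE in auto)
    have Eu: "L2conv A0 (\<lambda>n x. E x * un' n x) (\<lambda>x. E x * u x)"
      by (rule L2conv_subset[OF L2conv_mult[OF Lu mc[OF Ec], of BE] Am(3) A01]) (use BE in auto)
    have sqi: "integrable lborel (\<lambda>x. indicator A0 x * (f n x)\<^sup>2)" if "L2conv A0 f g" for f g n
    proof (rule Bochner_Integration.integrable_bound)
      note a = L2convD[OF that]
      show "integrable lborel (\<lambda>x. 2 * (indicator A0 x * (f n x - g x)\<^sup>2) + 2 * (indicator A0 x * (g x)\<^sup>2))"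
        using a(4) a(5)[of n] by simp
      show "(\<lambda>x. indicator A0 x * (f n x)\<^sup>2) \<in> borel_measurable lborel" using a(2)[of n] by simp
      show "AE x in lborel. norm (indicator A0 x * (f n x)\<^sup>2) \<le> norm (2 * (indicator A0 x * (f n x - g x)\<^sup>2) + 2 * (indicator A0 x * (g x)\<^sup>2))"
        using square_add_le[of "f n x - g x" "g x" for x] by (auto intro!: AE_I2 simp: indicator_def)
    qed
    define LHS where "LHS n = (\<Sum>i\<in>Basis. \<integral>x. indicator A0 x * (E x * Gn n i x)\<^sup>2 \<partial>lborel) + (\<integral>x. indicator A0 x * (E x * un' n x)\<^sup>2 \<partial>lborel)" for n
    have Llim: "LHS \<longlonglongrightarrow> (\<Sum>i\<in>Basis. \<integral>x. indicator A0 x * (E x * (G x \<bullet> i))\<^sup>2 \<partial>lborel) + (\<integral>x. indicator A0 x * (E x * u x)\<^sup>2 \<partial>lborel)"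
      unfolding LHS_def[abs_def] by (intro tendsto_intros L2conv_limit EG Eu)
    have sumeq: "(\<Sum>i\<in>Basis. \<integral>x. indicator A0 x * (E x * g i x)\<^sup>2 \<partial>lborel) + (\<integral>x. indicator A0 x * (E x * w x)\<^sup>2 \<partial>lborel)
      = (\<integral>x. indicator A0 x * ((E x)\<^sup>2 * ((\<Sum>i\<in>Basis. (g i x)\<^sup>2) + (w x)\<^sup>2)) \<partial>lborel)"
      if "\<And>i. i \<in> Basis \<Longrightarrow> integrable lborel (\<lambda>x. indicator A0 x * (E x * g i x)\<^sup>2)"
        "integrable lborel (\<lambda>x. indicator A0 x * (E x * w x)\<^sup>2)" for g :: "'a \<Rightarrow> 'a \<Rightarrow> real" and w
    proof -
      have "(\<integral>x. indicator A0 x * ((E x)\<^sup>2 * ((\<Sum>i\<in>Basis. (g i x)\<^sup>2) + (w x)\<^sup>2)) \<partial>lborel)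
        = (\<integral>x. (\<Sum>i\<in>Basis. indicator A0 x * (E x * g i x)\<^sup>2) + indicator A0 x * (E x * w x)\<^sup>2 \<partial>lborel)"
        by (intro Bochner_Integration.integral_cong refl)
          (simp add: power_mult_distrib sum_distrib_left distrib_left)
      also have "\<dots> = (\<integral>x. (\<Sum>i\<in>Basis. indicator A0 x * (E x * g i x)\<^sup>2) \<partial>lborel) + (\<integral>x. indicator A0 x * (E x * w x)\<^sup>2 \<partial>lborel)"
        by (rule Bochner_Integration.integral_add) (intro Bochner_Integration.integrable_sum that | assumption)+
      also have "(\<integral>x. (\<Sum>i\<in>Basis. indicator A0 x * (E x * g i x)\<^sup>2) \<partial>lborel) = (\<Sum>i\<in>Basis. \<integral>x. indicator A0 x * (E x * g i x)\<^sup>2 \<partial>lborel)"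
        by (rule Bochner_Integration.integral_sum) (rule that)
      finally show ?thesis by simp
    qed
    \<comment> \<open>On A0 the cut-off equals 1, so the gradient of the cut-off function has the
      components \<open>Gn\<close> there. The integrand is nonnegative, so the ball on the left side
      may be shrunk to A0.\<close>
    have ineq: "LHS n \<le> C0 * (\<integral>x. indicator A1 x * (sW x * Hn n x)\<^sup>2 \<partial>lborel)" for n
    proof -
      have z: "vn n x = 0" "Dvn n x = 0" "D2vn n x h = 0" if "norm (x - a) < \<rho>1" for x h
        using inn[of x] that by (simp_all add: vn_def Dvn_def D2vn_def)
      have car: "(LINT x:cball a R0|lborel. (E x)\<^sup>2 * (Dvn n x \<bullet> Dvn n x + (vn n x)\<^sup>2))
        \<le> C0 * (\<integral>x. rp a (3/2) x * (E x)\<^sup>2 * (gv n x)\<^sup>2 \<partial>lborel)"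
        unfolding C0_def E_def gv_def
        by (rule carleman_decay[OF _ dim l k \<tau> C2vn z])
          (use \<rho> in simp, assumption, assumption, assumption, (rule wint[unfolded gv_def])+)
      have "LHS n = (\<integral>x. indicator A0 x * ((E x)\<^sup>2 * ((\<Sum>i\<in>Basis. (Gn n i x)\<^sup>2) + (un' n x)\<^sup>2)) \<partial>lborel)"
        unfolding LHS_def by (rule sumeq[OF sqi[OF EG] sqi[OF Eu]])
      also have "\<dots> = (\<integral>x. indicator A0 x * ((E x)\<^sup>2 * (Dvn n x \<bullet> Dvn n x + (vn n x)\<^sup>2)) \<partial>lborel)"
      proof (intro Bochner_Integration.integral_cong refl)
        fix x
        show "indicator A0 x * ((E x)\<^sup>2 * ((\<Sum>i\<in>Basis. (Gn n i x)\<^sup>2) + (un' n x)\<^sup>2))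
          = indicator A0 x * ((E x)\<^sup>2 * (Dvn n x \<bullet> Dvn n x + (vn n x)\<^sup>2))"
        proof (cases "x \<in> A0")
          case True
          then have x1: "x \<in> A1" using A01 by auto
          have "\<rho>2 \<le> norm (x - a)" using True by (simp add: A0_def)
          from out[OF this] have v: "vn n x = un' n x" "Dvn n x = Dun n x"
            using locu[OF x1] by (simp_all add: vn_def Dvn_def)
          have "Dun n x \<bullet> Dun n x = (\<Sum>i\<in>Basis. (Gn n i x)\<^sup>2)"
            by (subst euclidean_inner) (simp add: loc[OF x1] power2_eq_square)
          then show ?thesis unfolding v by simp
        qed simp
      qed
      also have "\<dots> \<le> (LINT x:cball a R0|lborel. (E x)\<^sup>2 * (Dvn n x \<bullet> Dvn n x + (vn n x)\<^sup>2))"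
        unfolding set_lebesgue_integral_def
      proof (rule integral_mono)
        have c: "continuous_on UNIV (\<lambda>x. (E x)\<^sup>2 * (Dvn n x \<bullet> Dvn n x + (vn n x)\<^sup>2))"
          by (intro continuous_intros Ec C2_onD(4-6)[OF C2vn])
        show "integrable lborel (\<lambda>x. indicat_real (cball a R0) x *\<^sub>R ((E x)\<^sup>2 * (Dvn n x \<bullet> Dvn n x + (vn n x)\<^sup>2)))"
          by (rule borel_integrable_compact) (auto intro: continuous_on_subset[OF c])
        show "integrable lborel (\<lambda>x. indicat_real A0 x * ((E x)\<^sup>2 * (Dvn n x \<bullet> Dvn n x + (vn n x)\<^sup>2)))"
          using borel_integrable_compact[OF A0c continuous_on_subset[OF c subset_UNIV]] by simp
        fix x
        have "0 \<le> (E x)\<^sup>2 * (Dvn n x \<bullet> Dvn n x + (vn n x)\<^sup>2)" by simp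
        moreover have "x \<in> A0 \<Longrightarrow> x \<in> cball a R0" by (simp add: A0_def dist_norm norm_minus_commute)
        ultimately show "indicat_real A0 x * ((E x)\<^sup>2 * (Dvn n x \<bullet> Dvn n x + (vn n x)\<^sup>2))
          \<le> indicat_real (cball a R0) x *\<^sub>R ((E x)\<^sup>2 * (Dvn n x \<bullet> Dvn n x + (vn n x)\<^sup>2))"
          by (cases "x \<in> A0") (simp_all add: indicator_def)
      qed
      also note car
      also have "(\<integral>x. rp a (3/2) x * (E x)\<^sup>2 * (gv n x)\<^sup>2 \<partial>lborel) = (\<integral>x. indicator A1 x * (sW x * Hn n x)\<^sup>2 \<partial>lborel)"
        by (intro Bochner_Integration.integral_cong refl) (simp add: gv power_mult_distrib sW2 indicator_def)
      finally show ?thesis .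
    qed
    have "(\<Sum>i\<in>Basis. \<integral>x. indicator A0 x * (E x * (G x \<bullet> i))\<^sup>2 \<partial>lborel) + (\<integral>x. indicator A0 x * (E x * u x)\<^sup>2 \<partial>lborel)
      \<le> C0 * (\<integral>x. indicator A1 x * (sW x * H x)\<^sup>2 \<partial>lborel)"
      by (rule LIMSEQ_le[OF Llim tendsto_mult_left[OF R]]) (use ineq in auto)
    also have "(\<Sum>i\<in>Basis. \<integral>x. indicator A0 x * (E x * (G x \<bullet> i))\<^sup>2 \<partial>lborel) + (\<integral>x. indicator A0 x * (E x * u x)\<^sup>2 \<partial>lborel)
      = (\<integral>x. indicator A0 x * ((E x)\<^sup>2 * ((\<Sum>i\<in>Basis. (G x \<bullet> i)\<^sup>2) + (u x)\<^sup>2)) \<partial>lborel)"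
      by (rule sumeq[OF L2convD(4)[OF EG] L2convD(4)[OF Eu]])
    also have "\<dots> = (\<integral>x. indicator A0 x * ((E x)\<^sup>2 * (G x \<bullet> G x + (u x)\<^sup>2)) \<partial>lborel)"
      by (intro Bochner_Integration.integral_cong refl) (simp add: euclidean_inner[of "G _" "G _"] power2_eq_square)
    also have "(\<lambda>x. indicator A1 x * (sW x * H x)\<^sup>2) = (\<lambda>x. indicator A1 x * (rp a (3/2) x * (E x)\<^sup>2 * (H x)\<^sup>2))"
      by (simp add: power_mult_distrib sW2)
    finally show "(\<integral>x. indicator A0 x * ((cE a \<beta> l \<tau> x)\<^sup>2 * (G x \<bullet> G x + (u x)\<^sup>2)) \<partial>lborel)
       \<le> 19 * (2 + 16 * (real DIM('a))\<^sup>2) / \<tau> *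
         (\<integral>x. indicator A1 x * (rp a (3/2) x * (cE a \<beta> l \<tau> x)\<^sup>2 * (H x)\<^sup>2) \<partial>lborel)"
      unfolding C0_def E_def .
  qed
qed

text \<open>The part of the weight that depends on \<tau> is exp (2 \<tau> \<surd>r). Its square is
  at least m = exp (4 \<tau> \<surd>\<rho>2) on A0 and at most m on the rest of A1. On A0 the
  function H equals N, which is bounded by G and u, so its contribution is absorbed by the left side
  for large \<tau>. Then m cancels and leaves \<tau> J \<le> 2 C0 J2 with J and J2 independent of
  \<tau>. The two regions touch, so no exponential gain is available; the factor 1/\<tau> of the
  estimate does the work.\<close>

lemma vanishes_on_annulus:
  fixes u N :: "'a::euclidean_space \<Rightarrow> real" and G :: "'a \<Rightarrow> 'a" and a \<beta> :: 'a
    and \<rho> \<rho>1 \<rho>2 R0 l C C1 :: real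
  defines "\<Omega> \<equiv> {x. \<rho> < norm (x - a)}"
  defines "A0 \<equiv> {x. \<rho>2 \<le> norm (x - a) \<and> norm (x - a) \<le> R0}" and "A1 \<equiv> {x. \<rho>1 \<le> norm (x - a) \<and> norm (x - a) \<le> R0}"
  assumes \<rho>: "\<rho> > 0" "\<rho> < \<rho>1" "\<rho>1 < \<rho>2" "\<rho>2 \<le> R0"
    and um[measurable]: "u \<in> borel_measurable borel" and Gm[measurable]: "G \<in> borel_measurable borel"
    and Nm[measurable]: "N \<in> borel_measurable borel" and Hm[measurable]: "H \<in> borel_measurable borel"
    and ub: "\<And>x. \<bar>u x\<bar> \<le> C"
    and Gloc: "\<And>A. compact A \<Longrightarrow> A \<subseteq> \<Omega> \<Longrightarrow> integrable lborel (\<lambda>x. indicator A x * (G x \<bullet> G x))"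
    and Nb: "\<And>x. \<bar>N x\<bar> \<le> C1 * (norm (G x) + \<bar>u x\<bar>)"
    and Hi: "integrable lborel (\<lambda>x. indicator A1 x * (H x)\<^sup>2)"
    and HN: "\<And>x. \<rho>2 \<le> norm (x - a) \<Longrightarrow> H x = N x"
    and ineq: "\<And>\<tau>. \<tau> \<ge> tmin \<Longrightarrow>
       (\<integral>x. indicator A0 x * ((cE a \<beta> l \<tau> x)\<^sup>2 * (G x \<bullet> G x + (u x)\<^sup>2)) \<partial>lborel)
       \<le> C0 / \<tau> * (\<integral>x. indicator A1 x * (rp a (3/2) x * (cE a \<beta> l \<tau> x)\<^sup>2 * (H x)\<^sup>2) \<partial>lborel)"
    and C0: "C0 > 0"
  shows "AE x in lborel. x \<in> A0 \<longrightarrow> u x = 0"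
proof -
  have A1c: "compact A1" unfolding A1_def by (rule annulus_compact)
  have A0c: "compact A0" unfolding A0_def by (rule annulus_compact)
  have Am[measurable]: "A1 \<in> sets borel" "A0 \<in> sets borel"
    using A1c A0c by (auto intro: borel_closed compact_imp_closed)
  have A01: "A0 \<subseteq> A1" using \<rho> by (auto simp: A0_def A1_def)
  have A0\<Omega>: "A0 \<subseteq> \<Omega>" using \<rho> by (auto simp: A0_def \<Omega>_def)
  define e0 where "e0 = cE a \<beta> l 0"
  have e0c: "continuous_on UNIV e0" unfolding e0_def by (rule cE_continuous)
  have e0m[measurable]: "e0 \<in> borel_measurable borel" by (rule borel_measurable_continuous_onI[OF e0c])
  have Ee: "cE a \<beta> l \<tau> x = exp (2 * \<tau> * sqrt (norm (x - a))) * e0 x" for \<tau> x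
    unfolding e0_def cE_def by (simp add: exp_add[symmetric])
  define P where "P = R0 powr (3/2)"
  have P: "rp a (3/2) x \<le> P" if "x \<in> A1" for x
    unfolding P_def rp_def using that by (intro powr_mono2) (auto simp: A1_def)
  have P0: "P \<ge> 0" by (simp add: P_def)
  define h where "h x = G x \<bullet> G x + (u x)\<^sup>2" for x
  have h0: "h x \<ge> 0" for x by (simp add: h_def)
  have hm[measurable]: "h \<in> borel_measurable borel" unfolding h_def[abs_def] by measurable
  have hi: "integrable lborel (\<lambda>x. indicator A0 x * h x)"
  proof -
    have "integrable lborel (\<lambda>x. indicator A0 x * (u x)\<^sup>2)"
    proof (rule Bochner_Integration.integrable_bound)
      show "integrable lborel (\<lambda>x. C\<^sup>2 * indicator A0 x)"
        by (intro integrable_mult_right integrable_real_indicator emeasure_compact_finite A0c) simp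
      have "(u x)\<^sup>2 \<le> C\<^sup>2" for x using ub[of x] by (intro abs_le_square_iff[THEN iffD1]) simp
      then show "AE x in lborel. norm (indicator A0 x * (u x)\<^sup>2) \<le> norm (C\<^sup>2 * indicator A0 x)"
        by (intro AE_I2) (auto simp: indicator_def)
    qed measurable
    then show ?thesis using Gloc[OF A0c A0\<Omega>] by (simp add: h_def distrib_left)
  qed
  have bdd: "integrable lborel (\<lambda>x. indicator A x * (c x * f x))"
    if A: "compact A" "A \<in> sets borel" and c: "c \<in> borel_measurable borel" "\<And>x. x \<in> A \<Longrightarrow> \<bar>c x\<bar> \<le> B"
      and f: "integrable lborel (\<lambda>x. indicator A x * f x)" "f \<in> borel_measurable borel" for A and c f :: "'a \<Rightarrow> real" and B
  proof (rule Bochner_Integration.integrable_bound)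
    show "integrable lborel (\<lambda>x. B * (indicator A x * f x))" using f by simp
    show "(\<lambda>x. indicator A x * (c x * f x)) \<in> borel_measurable lborel" using A c f by measurable
    show "AE x in lborel. norm (indicator A x * (c x * f x)) \<le> norm (B * (indicator A x * f x))"
    proof (intro AE_I2)
      fix x
      show "norm (indicator A x * (c x * f x)) \<le> norm (B * (indicator A x * f x))"
      proof (cases "x \<in> A")
        case True
        then have "\<bar>c x\<bar> \<le> \<bar>B\<bar>" using c(2)[of x] by linarith
        then show ?thesis using True by (simp add: abs_mult mult_right_mono)
      qed simp
    qed
  qed
  have bA: "\<exists>B. \<forall>x\<in>A1. \<bar>f x\<bar> \<le> B" if "continuous_on UNIV f" for f :: "'a \<Rightarrow> real"
    using compact_imp_bounded[OF compact_continuous_image[OF continuous_on_subset[OF that subset_UNIV] A1c]]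
    unfolding bounded_iff by simp
  define J where "J = (\<integral>x. indicator A0 x * ((e0 x)\<^sup>2 * h x) \<partial>lborel)"
  define J2 where "J2 = (\<integral>x. indicator A1 x * (rp a (3/2) x * (e0 x)\<^sup>2 * (H x)\<^sup>2) \<partial>lborel)"
  have cEm[measurable]: "cE a \<beta> l \<tau> \<in> borel_measurable borel" for \<tau>
    by (rule borel_measurable_continuous_onI[OF cE_continuous])
  have rpm[measurable]: "rp a p \<in> borel_measurable borel" for p unfolding rp_def[abs_def] by measurable
  have iE: "integrable lborel (\<lambda>x. indicator A0 x * ((cE a \<beta> l \<tau> x)\<^sup>2 * h x))" for \<tau>
  proof -
    have "continuous_on UNIV (\<lambda>x. (cE a \<beta> l \<tau> x)\<^sup>2)" by (intro continuous_intros cE_continuous)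
    from bA[OF this] obtain B where "\<forall>x\<in>A1. \<bar>(cE a \<beta> l \<tau> x)\<^sup>2\<bar> \<le> B" by blast
    then show ?thesis using A01 by (intro bdd[OF A0c Am(2) _ _ hi hm, of _ B]) auto
  qed
  have iR: "integrable lborel (\<lambda>x. indicator A1 x * (rp a (3/2) x * (cE a \<beta> l \<tau> x)\<^sup>2 * (H x)\<^sup>2))" for \<tau>
  proof -
    have "continuous_on UNIV (\<lambda>x. (cE a \<beta> l \<tau> x)\<^sup>2)" by (intro continuous_intros cE_continuous)
    from bA[OF this] obtain B where B: "\<forall>x\<in>A1. \<bar>(cE a \<beta> l \<tau> x)\<^sup>2\<bar> \<le> B" by blast
    have "\<bar>rp a (3/2) x * (cE a \<beta> l \<tau> x)\<^sup>2\<bar> \<le> P * B" if "x \<in> A1" for x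
      unfolding abs_mult using P[OF that] B that P0 by (intro mult_mono) (auto simp: rp_nonneg)
    then show ?thesis by (intro bdd[OF A1c Am(1) _ _ Hi, of _ "P * B"]) auto
  qed
  have J2i: "integrable lborel (\<lambda>x. indicator A1 x * (rp a (3/2) x * (e0 x)\<^sup>2 * (H x)\<^sup>2))"
    unfolding e0_def by (rule iR)
  have Ji: "integrable lborel (\<lambda>x. indicator A0 x * ((e0 x)\<^sup>2 * h x))"
    unfolding e0_def by (rule iE)
  have J0: "J \<ge> 0" "J2 \<ge> 0"
    unfolding J_def J2_def by (intro Bochner_Integration.integral_nonneg, simp add: h0 rp_nonneg)+
  have main: "J * \<tau> \<le> 2 * C0 * J2" if \<tau>: "\<tau> \<ge> tmin" "\<tau> > 0" "\<tau> \<ge> 4 * C0 * C1\<^sup>2 * P" for \<tau>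
  proof -
    \<comment> \<open>The squared \<tau>-dependent part of the weight on the sphere of radius
      \<rho>2, which separates the two regions.\<close>
    define m where "m = exp (4 * \<tau> * sqrt \<rho>2)"
    have m0: "m > 0" by (simp add: m_def)
    have E2: "(cE a \<beta> l \<tau> x)\<^sup>2 = exp (4 * \<tau> * sqrt (norm (x - a))) * (e0 x)\<^sup>2" for x
      unfolding Ee power_mult_distrib by (simp add: power2_eq_square exp_add[symmetric])
    define I where "I = (\<integral>x. indicator A0 x * ((cE a \<beta> l \<tau> x)\<^sup>2 * h x) \<partial>lborel)"
    have I0: "I \<ge> 0" unfolding I_def by (intro Bochner_Integration.integral_nonneg) (simp add: h0)
    have IJ: "m * J \<le> I"
    proof -
      have "m * J = (\<integral>x. m * (indicator A0 x * ((e0 x)\<^sup>2 * h x)) \<partial>lborel)" by (simp add: J_def)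
      also have "\<dots> \<le> I"
        unfolding I_def
      proof (rule integral_mono[OF integrable_mult_right[OF Ji] iE])
        fix x
        show "m * (indicator A0 x * ((e0 x)\<^sup>2 * h x)) \<le> indicator A0 x * ((cE a \<beta> l \<tau> x)\<^sup>2 * h x)"
        proof (cases "x \<in> A0")
          case True
          then have "m \<le> exp (4 * \<tau> * sqrt (norm (x - a)))" using \<tau>(2) by (simp add: m_def A0_def)
          then have "m * ((e0 x)\<^sup>2 * h x) \<le> exp (4 * \<tau> * sqrt (norm (x - a))) * ((e0 x)\<^sup>2 * h x)"
            by (rule mult_right_mono) (simp add: h0)
          then show ?thesis using True by (simp add: E2 mult.assoc)
        qed simp
      qed
      finally show ?thesis .
    qed
    have "(\<integral>x. indicator A1 x * (rp a (3/2) x * (cE a \<beta> l \<tau> x)\<^sup>2 * (H x)\<^sup>2) \<partial>lborel)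
      \<le> (\<integral>x. (2 * C1\<^sup>2 * P) * (indicator A0 x * ((cE a \<beta> l \<tau> x)\<^sup>2 * h x)) + m * (indicator A1 x * (rp a (3/2) x * (e0 x)\<^sup>2 * (H x)\<^sup>2)) \<partial>lborel)"
    proof (rule integral_mono[OF iR])
      show "integrable lborel (\<lambda>x. (2 * C1\<^sup>2 * P) * (indicator A0 x * ((cE a \<beta> l \<tau> x)\<^sup>2 * h x)) + m * (indicator A1 x * (rp a (3/2) x * (e0 x)\<^sup>2 * (H x)\<^sup>2)))"
        by (intro Bochner_Integration.integrable_add integrable_mult_right iE J2i)
      fix x
      have nn1: "0 \<le> (2 * C1\<^sup>2 * P) * (indicator A0 x * ((cE a \<beta> l \<tau> x)\<^sup>2 * h x))" using P0 h0 by simp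
      have nn2: "0 \<le> m * (indicator A1 x * (rp a (3/2) x * (e0 x)\<^sup>2 * (H x)\<^sup>2))" using m0 by (simp add: rp_nonneg)
      consider "x \<notin> A1" | "x \<in> A0" | "x \<in> A1" "norm (x - a) < \<rho>2" unfolding A0_def A1_def by force
      then show "indicator A1 x * (rp a (3/2) x * (cE a \<beta> l \<tau> x)\<^sup>2 * (H x)\<^sup>2)
        \<le> (2 * C1\<^sup>2 * P) * (indicator A0 x * ((cE a \<beta> l \<tau> x)\<^sup>2 * h x)) + m * (indicator A1 x * (rp a (3/2) x * (e0 x)\<^sup>2 * (H x)\<^sup>2))"
      proof cases
        case 1
        then show ?thesis using nn1 nn2 by simp
      next
        case 2
        have "(H x)\<^sup>2 \<le> 2 * C1\<^sup>2 * h x"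
        proof -
          have HNx: "H x = N x" using 2 by (intro HN) (simp add: A0_def)
          have "(N x)\<^sup>2 \<le> (C1 * (norm (G x) + \<bar>u x\<bar>))\<^sup>2"
            using Nb[of x] by (intro abs_le_square_iff[THEN iffD1]) linarith
          also have "\<dots> \<le> C1\<^sup>2 * (2 * (norm (G x))\<^sup>2 + 2 * \<bar>u x\<bar>\<^sup>2)"
            unfolding power_mult_distrib by (intro mult_left_mono square_add_le) simp
          finally show ?thesis by (simp add: HNx h_def power2_norm_eq_inner algebra_simps)
        qed
        then have "(rp a (3/2) x * (cE a \<beta> l \<tau> x)\<^sup>2) * (H x)\<^sup>2 \<le> (P * (cE a \<beta> l \<tau> x)\<^sup>2) * (2 * C1\<^sup>2 * h x)"
          using P[of x] 2 A01 P0 by (intro mult_mono) (auto simp: rp_nonneg)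
        then show ?thesis using nn2 2 A01 by (simp add: mult_ac add_increasing2 subsetD)
      next
        case 3
        have "exp (4 * \<tau> * sqrt (norm (x - a))) \<le> m" using 3 \<tau>(2) by (simp add: m_def)
        then have "exp (4 * \<tau> * sqrt (norm (x - a))) * (rp a (3/2) x * (e0 x)\<^sup>2 * (H x)\<^sup>2) \<le> m * (rp a (3/2) x * (e0 x)\<^sup>2 * (H x)\<^sup>2)"
          by (rule mult_right_mono) (simp add: rp_nonneg)
        then show ?thesis using 3 nn1 by (simp add: E2 mult_ac)
      qed
    qed
    also have "\<dots> = (2 * C1\<^sup>2 * P) * I + m * J2"
      unfolding I_def J2_def using iE[of \<tau>] J2i by simp
    finally have "I \<le> C0 / \<tau> * ((2 * C1\<^sup>2 * P) * I + m * J2)"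
      using ineq[OF \<tau>(1)] C0 \<tau>(2) unfolding I_def h_def
      by (smt (verit, best) divide_pos_pos mult_left_mono)
    then have "\<tau> * I \<le> C0 * ((2 * C1\<^sup>2 * P) * I + m * J2)" using \<tau>(2) by (simp add: field_simps)
    \<comment> \<open>By this threshold the contribution of the source is at most half of \<tau> I,
      which is why the constant doubles after absorption.\<close>
    moreover have "(4 * C0 * C1\<^sup>2 * P) * I \<le> \<tau> * I" using \<tau>(3) I0 by (rule mult_right_mono)
    ultimately have "\<tau> * I \<le> 2 * C0 * (m * J2)" by (simp add: algebra_simps)
    moreover have "\<tau> * (m * J) \<le> \<tau> * I" using IJ \<tau>(2) by simp
    ultimately have "m * (\<tau> * J) \<le> m * (2 * C0 * J2)" by (simp add: mult_ac)
    then show ?thesis using m0 by (simp add: mult.commute)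
  qed
  have "J = 0"
  proof (rule ccontr)
    assume "J \<noteq> 0"
    then have Jp: "J > 0" using J0 by simp
    \<comment> \<open>The last entry makes J \<tau> at least 2 C0 J2 + J, which contradicts
      \<open>main\<close> when J is positive.\<close>
    define \<tau> where "\<tau> = max (max tmin 1) (max (4 * C0 * C1\<^sup>2 * P) (2 * C0 * J2 / J + 1))"
    have "2 * C0 * J2 / J + 1 \<le> \<tau>" by (simp add: \<tau>_def)
    then have "J * (2 * C0 * J2 / J + 1) \<le> J * \<tau>" using Jp by simp
    also have "J * \<tau> \<le> 2 * C0 * J2" by (rule main) (auto simp: \<tau>_def)
    finally show False using Jp by (simp add: distrib_left)
  qed
  then have "AE x in lborel. indicator A0 x * ((e0 x)\<^sup>2 * h x) = 0"
    unfolding J_def by (subst (asm) integral_nonneg_eq_0_iff_AE[OF Ji]) (auto simp: h0)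
  then show ?thesis
  proof eventually_elim
    case (elim x)
    show ?case
    proof
      assume "x \<in> A0"
      then have "h x = 0" using elim cE_pos[of a \<beta> l 0 x] by (simp add: e0_def)
      moreover have "0 \<le> G x \<bullet> G x" "0 \<le> (u x)\<^sup>2" by simp_all
      ultimately have "(u x)\<^sup>2 = 0" unfolding h_def by linarith
      then show "u x = 0" by simp
    qed
  qed
qed

text \<open>The domain is a countable union of annuli on each of which the preceding lemma applies.
  Their inner radii may be any numbers above \<rho>; the intermediate radius \<rho>1, where the
  cut-off begins, is placed halfway between.\<close>

theorem unique_continuation_core:
  fixes u N :: "'a::euclidean_space \<Rightarrow> real" and G :: "'a \<Rightarrow> 'a" and a \<beta> :: 'a
    and \<rho> R1 L l k C C1 :: real
  defines "\<Omega> \<equiv> {x. \<rho> < norm (x - a)}"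
  assumes dim: "DIM('a) \<ge> 2" and \<rho>: "\<rho> > 0"
    and l: "l > 0" and k: "l\<^sup>2 + k \<ge> 0" and L: "l + norm \<beta> / 2 < L"
    and um: "u \<in> borel_measurable borel" and Gm: "G \<in> borel_measurable borel"
    and Nm: "N \<in> borel_measurable borel"
    and ub: "\<And>x. \<bar>u x\<bar> \<le> C * exp (- L * norm (x - a))"
    and Gloc: "\<And>A. compact A \<Longrightarrow> A \<subseteq> \<Omega> \<Longrightarrow> integrable lborel (\<lambda>x. indicator A x * (G x \<bullet> G x))"
    and Nb: "\<And>x. \<bar>N x\<bar> \<le> C1 * (norm (G x) + \<bar>u x\<bar>)" and Nfar: "\<And>x. norm (x - a) \<ge> R1 \<Longrightarrow> N x = 0"
    and w1: "\<And>\<phi> D\<phi> i. test_function \<Omega> \<phi> \<Longrightarrow> (\<And>y. GDERIV \<phi> y :> D\<phi> y) \<Longrightarrow> i \<in> Basis \<Longrightarrow>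
       (\<integral>y. u y * (D\<phi> y \<bullet> i) \<partial>lborel) = - (\<integral>y. (G y \<bullet> i) * \<phi> y \<partial>lborel)"
    and w2: "\<And>\<phi> D\<phi>. test_function \<Omega> \<phi> \<Longrightarrow> (\<And>y. GDERIV \<phi> y :> D\<phi> y) \<Longrightarrow>
       (\<integral>y. G y \<bullet> D\<phi> y \<partial>lborel) = - (\<integral>y. (N y - \<beta> \<bullet> G y - (\<beta> \<bullet> \<beta> / 4 + k) * u y) * \<phi> y \<partial>lborel)"
  shows "AE x in lborel. x \<in> \<Omega> \<longrightarrow> u x = 0"
proof -
  have Cpos: "C \<ge> 0" using ub[of a] by simp
  have Lpos: "L > 0" using l L norm_ge_zero[of \<beta>] by linarith
  have ann: "AE x in lborel. x \<in> {x. \<rho>2 \<le> norm (x - a) \<and> norm (x - a) \<le> R0} \<longrightarrow> u x = 0"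
    if r: "\<rho> < \<rho>2" "\<rho>2 \<le> R0" "R1 + 1 \<le> R0" for \<rho>2 R0
  proof -
    define \<rho>1 where "\<rho>1 = (\<rho> + \<rho>2) / 2"
    have \<rho>1: "\<rho> < \<rho>1" "\<rho>1 < \<rho>2" using r by (auto simp: \<rho>1_def)
    obtain H where H: "H \<in> borel_measurable borel"
      "integrable lborel (\<lambda>x. indicator {x. \<rho>1 \<le> norm (x - a) \<and> norm (x - a) \<le> R0} x * (H x)\<^sup>2)"
      "\<And>x. \<rho>2 \<le> norm (x - a) \<Longrightarrow> H x = N x"
      and ineq: "\<And>\<tau>. \<tau> \<ge> 2 * (real DIM('a))\<^sup>2 * \<rho>1 powr (-1/2) \<Longrightarrow> \<tau>\<^sup>2 \<ge> R0 * l\<^sup>2 \<Longrightarrow> \<tau>\<^sup>2 \<ge> R0 * (\<beta> \<bullet> \<beta>) \<Longrightarrow> \<tau>\<^sup>2 \<ge> R0 \<Longrightarrow>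
       (\<integral>x. indicator {x. \<rho>2 \<le> norm (x - a) \<and> norm (x - a) \<le> R0} x * ((cE a \<beta> l \<tau> x)\<^sup>2 * (G x \<bullet> G x + (u x)\<^sup>2)) \<partial>lborel)
       \<le> 19 * (2 + 16 * (real DIM('a))\<^sup>2) / \<tau> *
         (\<integral>x. indicator {x. \<rho>1 \<le> norm (x - a) \<and> norm (x - a) \<le> R0} x * (rp a (3/2) x * (cE a \<beta> l \<tau> x)\<^sup>2 * (H x)\<^sup>2) \<partial>lborel)"
      by (rule carleman_weak[OF dim \<rho> \<rho>1 r(2,3) l k L um Gm Nm ub Gloc[unfolded \<Omega>_def] Nb Nfar w1[unfolded \<Omega>_def] w2[unfolded \<Omega>_def]])
        (assumption | rule that)+
    have uC: "\<bar>u x\<bar> \<le> C" for x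
    proof -
      have "C * exp (- L * norm (x - a)) \<le> C * 1" using Lpos Cpos by (intro mult_left_mono) auto
      then show ?thesis using ub[of x] by linarith
    qed
    \<comment> \<open>As T is at least 1, \<tau> \<ge> T gives \<tau> \<le> \<tau>^2, so the
      thresholds on \<tau>^2 follow from linear ones.\<close>
    define T where "T = max (max 1 (2 * (real DIM('a))\<^sup>2 * \<rho>1 powr (-1/2))) (max (R0 * l\<^sup>2) (max (R0 * (\<beta> \<bullet> \<beta>)) R0))"
    have sq: "\<tau> \<le> \<tau>\<^sup>2" if "\<tau> \<ge> T" for \<tau>
    proof -
      have "1 \<le> \<tau>" using that by (simp add: T_def)
      then show ?thesis using mult_left_mono[of 1 \<tau> \<tau>] by (simp add: power2_eq_square)
    qed
    show ?thesis
    proof (rule vanishes_on_annulus[OF \<rho> \<rho>1 r(2) um Gm Nm H(1) uC Gloc[unfolded \<Omega>_def] Nb H(2,3), where tmin=T])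
      fix \<tau> assume \<tau>: "\<tau> \<ge> T"
      have b: "2 * (real DIM('a))\<^sup>2 * \<rho>1 powr (-1/2) \<le> \<tau>" "R0 * l\<^sup>2 \<le> \<tau>" "R0 * (\<beta> \<bullet> \<beta>) \<le> \<tau>" "R0 \<le> \<tau>"
        using \<tau> unfolding T_def by simp_all
      show "(\<integral>x. indicator {x. \<rho>2 \<le> norm (x - a) \<and> norm (x - a) \<le> R0} x * ((cE a \<beta> l \<tau> x)\<^sup>2 * (G x \<bullet> G x + (u x)\<^sup>2)) \<partial>lborel)
       \<le> 19 * (2 + 16 * (real DIM('a))\<^sup>2) / \<tau> *
         (\<integral>x. indicator {x. \<rho>1 \<le> norm (x - a) \<and> norm (x - a) \<le> R0} x * (rp a (3/2) x * (cE a \<beta> l \<tau> x)\<^sup>2 * (H x)\<^sup>2) \<partial>lborel)"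
        by (rule ineq[OF b(1)]) (use b sq[OF \<tau>] in linarith)+
    qed (auto intro: add_pos_nonneg)
  qed
  \<comment> \<open>Inner radii decrease to \<rho> and outer radii grow to infinity while respecting
    p n \<le> q n and R1 + 1 \<le> q n. A sequence is used because the exceptional null sets must be
    countably many.\<close>
  define p where "p n = \<rho> + inverse (real (Suc n))" for n
  define q where "q n = max (p n) (R1 + 1) + real n" for n
  have "\<forall>n. AE x in lborel. x \<in> {x. p n \<le> norm (x - a) \<and> norm (x - a) \<le> q n} \<longrightarrow> u x = 0"
    by (intro allI ann) (auto simp: p_def q_def)
  then have "AE x in lborel. \<forall>n. x \<in> {x. p n \<le> norm (x - a) \<and> norm (x - a) \<le> q n} \<longrightarrow> u x = 0"
    by (subst AE_all_countable)
  then show ?thesis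
  proof eventually_elim
    case (elim x)
    show ?case
    proof
      assume "x \<in> \<Omega>"
      then have gt: "norm (x - a) - \<rho> > 0" by (simp add: \<Omega>_def)
      obtain n1 where n1: "inverse (real (Suc n1)) < norm (x - a) - \<rho>" using reals_Archimedean[OF gt] by blast
      obtain n2 :: nat where n2: "norm (x - a) - (R1 + 1) \<le> real n2" using real_arch_simple by blast
      obtain n3 :: nat where n3: "norm (x - a) \<le> real n3" using real_arch_simple by blast
      define n where "n = max n1 (max n2 n3)"
      have "inverse (real (Suc n)) \<le> inverse (real (Suc n1))" by (intro le_imp_inverse_le) (auto simp: n_def)
      then have "p n \<le> norm (x - a)" using n1 unfolding p_def by linarith
      moreover have "norm (x - a) \<le> q n"
      proof -
        have "real n3 \<le> real n" by (simp add: n_def)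
        moreover have "0 \<le> p n" using \<rho> by (simp add: p_def)
        ultimately show ?thesis using n3 unfolding q_def by linarith
      qed
      ultimately show "u x = 0" using elim by blast
    qed
  qed
qed

section \<open>Borel representatives of weak derivatives\<close>

lemma Ck_prod: "(\<And>i. i \<in> I \<Longrightarrow> Ck k (f i)) \<Longrightarrow> Ck k (\<lambda>x. \<Prod>i\<in>I. f i x)"
  by (induction I rule: infinite_finite_induct) (auto simp: Ck_const Ck_mult)

lemma flat_scaled_limit: "(\<lambda>n. flat 0 (real (Suc n) * t)) \<longlonglongrightarrow> (if 0 < t then 1 else 0)"
proof (cases "0 < t")
  case True
  have "(\<lambda>n. exp (- (inverse t * inverse (real (Suc n))))) \<longlonglongrightarrow> exp (- (inverse t * 0))"
    by (intro tendsto_intros LIMSEQ_inverse_real_of_nat)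
  moreover have "flat 0 (real (Suc n) * t) = exp (- (inverse t * inverse (real (Suc n))))" for n
    using True by (simp add: flat_def)
  ultimately show ?thesis using True by simp
next
  case False
  then have "flat 0 (real (Suc n) * t) = 0" for n by (intro flat_zero) (simp add: mult_nonneg_nonpos)
  then show ?thesis using False by simp
qed

lemma flat_le_one: "flat 0 t \<le> 1" by (simp add: flat_def)

text \<open>Products over the coordinates of the smooth factors exp (- 1 / (n t)), with t the
  distance to each face, are supported in the closed box and converge pointwise to the indicator of
  the open box.\<close>

lemma integral_box_zero:
  fixes w :: "'a::euclidean_space \<Rightarrow> real"
  assumes w[measurable]: "w \<in> borel_measurable borel"
    and int: "integrable lborel (\<lambda>x. indicator (cbox c d) x * w x)" and sub: "cbox c d \<subseteq> \<Omega>"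
    and test: "\<And>\<phi>. test_function \<Omega> \<phi> \<Longrightarrow> (\<integral>x. w x * \<phi> x \<partial>lborel) = 0"
  shows "(\<integral>x. indicator (box c d) x * w x \<partial>lborel) = 0"
proof -
  define p where "p n y = (\<Prod>i\<in>Basis. flat 0 (real (Suc n) * (y \<bullet> i - c \<bullet> i)) * flat 0 (real (Suc n) * (d \<bullet> i - y \<bullet> i)))" for n y
  have Ckp: "Ck k (p n)" for n k
  proof -
    have "Ck k (\<lambda>y. flat 0 (real (Suc n) * (y \<bullet> i + - (c \<bullet> i))) * flat 0 (real (Suc n) * (d \<bullet> i + (-1) * (y \<bullet> i))))" for i :: 'a
      by (intro Ck_mult Ck_compose[OF Ck_flat] Ck_add Ck_const Ck_inner_left)
    then show ?thesis unfolding p_def[abs_def] by (intro Ck_prod) simp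
  qed
  have pz: "p n y = 0" if y: "y \<notin> box c d" for n y
  proof -
    obtain i where i: "i \<in> Basis" "y \<bullet> i \<le> c \<bullet> i \<or> d \<bullet> i \<le> y \<bullet> i" using y unfolding mem_box by force
    have "flat 0 (real (Suc n) * (y \<bullet> i - c \<bullet> i)) * flat 0 (real (Suc n) * (d \<bullet> i - y \<bullet> i)) = 0"
    proof (cases "y \<bullet> i \<le> c \<bullet> i")
      case True
      then have "real (Suc n) * (y \<bullet> i - c \<bullet> i) \<le> 0" by (intro mult_nonneg_nonpos) auto
      then show ?thesis by (simp only: flat_zero mult_zero_left)
    next
      case False
      then have "real (Suc n) * (d \<bullet> i - y \<bullet> i) \<le> 0" using i by (intro mult_nonneg_nonpos) auto
      then show ?thesis by (simp only: flat_zero mult_zero_right)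
    qed
    then show ?thesis unfolding p_def using i(1) by (intro prod_zero) auto
  qed
  have t: "test_function \<Omega> (p n)" for n
    unfolding test_function_def
  proof (intro conjI allI)
    have "{y. p n y \<noteq> 0} \<subseteq> cbox c d" using pz box_subset_cbox by blast
    then have cl: "closure {y. p n y \<noteq> 0} \<subseteq> cbox c d" by (intro closure_minimal) auto
    then show "closure {y. p n y \<noteq> 0} \<subseteq> \<Omega>" using sub by blast
    show "compact (closure {y. p n y \<noteq> 0})"
      using cl by (meson bounded_cbox bounded_subset closed_closure compact_eq_bounded_closed)
  qed (rule Ckp)
  have p01: "0 \<le> p n y" "p n y \<le> 1" for n y
    unfolding p_def by (auto intro!: prod_nonneg prod_le_1 mult_le_one mult_nonneg_nonneg flat_nonneg flat_le_one)
  have lim: "(\<lambda>n. p n y) \<longlonglongrightarrow> indicator (box c d) y" for y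
  proof (cases "y \<in> box c d")
    case True
    have "(\<lambda>n. p n y) \<longlonglongrightarrow> (\<Prod>i\<in>Basis. (if 0 < y \<bullet> i - c \<bullet> i then 1 else 0) * (if 0 < d \<bullet> i - y \<bullet> i then 1 else 0))"
      unfolding p_def by (intro tendsto_prod tendsto_mult flat_scaled_limit)
    also have "(\<Prod>i\<in>Basis. (if 0 < y \<bullet> i - c \<bullet> i then 1 else 0) * (if 0 < d \<bullet> i - y \<bullet> i then 1 else (0::real))) = 1"
      using True by (intro prod.neutral) (auto simp: mem_box)
    finally show ?thesis using True by simp
  qed (simp add: pz)
  have "(\<lambda>n. \<integral>x. w x * p n x \<partial>lborel) \<longlonglongrightarrow> (\<integral>x. w x * indicator (box c d) x \<partial>lborel)"
  proof (rule integral_dominated_convergence)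
    show "integrable lborel (\<lambda>x. \<bar>indicator (cbox c d) x * w x\<bar>)" using int by (rule integrable_abs)
    show "AE x in lborel. (\<lambda>n. w x * p n x) \<longlonglongrightarrow> w x * indicator (box c d) x"
      by (intro AE_I2 tendsto_intros lim)
    show "AE x in lborel. norm (w x * p n x) \<le> \<bar>indicator (cbox c d) x * w x\<bar>" for n
    proof (intro AE_I2)
      fix x
      show "norm (w x * p n x) \<le> \<bar>indicator (cbox c d) x * w x\<bar>"
      proof (cases "x \<in> box c d")
        case True
        then have "x \<in> cbox c d" using box_subset_cbox by blast
        then show ?thesis using p01[where n=n and y=x] by (simp add: abs_mult mult_left_le)
      qed (simp add: pz)
    qed
    have [measurable]: "p n \<in> borel_measurable borel" for n
      by (rule borel_measurable_continuous_onI[OF Ck_imp_continuous[OF Ckp]])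
    show "(\<lambda>x. w x * p n x) \<in> borel_measurable lborel" for n by measurable
  qed measurable
  then have "(\<integral>x. w x * indicator (box c d) x \<partial>lborel) = 0"
    using test[OF t] by (simp add: LIMSEQ_const_iff)
  then show ?thesis by (simp add: mult.commute)
qed

text \<open>The fundamental lemma of the calculus of variations, through Lebesgue differentiation:
  at almost every point the function is the limit of its averages over small cubes with a corner
  there, and \<open>integral_box_zero\<close> makes these averages vanish. Integrability is
  available on A only, hence the interior.\<close>

lemma test_function_orthogonal_AE_zero:
  fixes w :: "'a::euclidean_space \<Rightarrow> real"
  assumes w[measurable]: "w \<in> borel_measurable borel" and A: "compact A" "A \<subseteq> \<Omega>"
    and int: "integrable lborel (\<lambda>x. indicator A x * w x)"
    and test: "\<And>\<phi>. test_function \<Omega> \<phi> \<Longrightarrow> (\<integral>x. w x * \<phi> x \<partial>lborel) = 0"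
  shows "AE x in lborel. x \<in> interior A \<longrightarrow> w x = 0"
proof -
  have Am[measurable]: "A \<in> sets borel" using A(1) by (auto intro: borel_closed compact_imp_closed)
  define f where "f x = indicator A x * w x" for x
  have fi: "integrable lborel f" using int by (simp add: f_def[abs_def])
  have fS: "set_integrable lborel S f" if "S \<in> sets borel" for S
    unfolding set_integrable_def by (rule integrable_mult_indicator[OF _ fi]) (use that in simp)
  have "f integrable_on cbox c d" for c d
    by (rule set_borel_integral_eq_integral(1)[OF fS]) simp
  then obtain N where N: "negligible N"
    and diff: "\<And>x e. \<lbrakk>x \<notin> N; 0 < e\<rbrakk> \<Longrightarrow> \<exists>d>0. \<forall>h. 0 < h \<and> h < d \<longrightarrow>
        norm (integral (cbox x (x + h *\<^sub>R One)) f /\<^sub>R h ^ DIM('a) - f x) < e"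
    using integrable_ccontinuous_explicit[of f] by blast
  have zero: "w x = 0" if x: "x \<in> interior A" "x \<notin> N" for x
  proof (rule ccontr)
    assume nz: "w x \<noteq> 0"
    have xA: "x \<in> A" using x interior_subset by blast
    obtain e where e: "e > 0" "ball x e \<subseteq> A"
      using x(1) mem_interior by blast
    obtain d where d: "d > 0" "\<And>h. 0 < h \<Longrightarrow> h < d \<Longrightarrow> norm (integral (cbox x (x + h *\<^sub>R One)) f /\<^sub>R h ^ DIM('a) - f x) < \<bar>w x\<bar>"
      using diff[OF x(2), of "\<bar>w x\<bar>"] nz by auto
    \<comment> \<open>Points of the cube have distance at most h times the dimension from its
      corner, so the second bound keeps the cube inside the ball of radius e and thus inside
      A.\<close>
    define h where "h = min (d / 2) (e / (2 * (real DIM('a) + 1)))"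
    have h: "0 < h" "h < d" "h * real DIM('a) < e"
    proof -
      have "0 < e / (2 * (real DIM('a) + 1))" using e(1) by (intro divide_pos_pos) auto
      then show "0 < h" using d(1) by (simp add: h_def)
      have "h \<le> d / 2" unfolding h_def by (rule min.cobounded1)
      then show "h < d" using d(1) by linarith
      have "h * (2 * (real DIM('a) + 1)) \<le> e" using e(1)
      proof -
        have "h \<le> e / (2 * (real DIM('a) + 1))" unfolding h_def by (rule min.cobounded2)
        then show ?thesis by (subst (asm) pos_le_divide_eq) auto
      qed
      moreover have "h * real DIM('a) \<le> h * (real DIM('a) + 1)" using \<open>0 < h\<close> by simp
      moreover have "h * (real DIM('a) + 1) > 0" using \<open>0 < h\<close> by (simp add: add_nonneg_pos)
      ultimately show "h * real DIM('a) < e" by (simp add: algebra_simps)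
    qed
    have sub: "cbox x (x + h *\<^sub>R One) \<subseteq> A"
    proof
      fix y assume y: "y \<in> cbox x (x + h *\<^sub>R One)"
      have "\<bar>(y - x) \<bullet> i\<bar> \<le> h" if "i \<in> Basis" for i
        using y that unfolding mem_box by (auto simp: inner_diff_left inner_add_left)
      then have "norm (y - x) \<le> h * real DIM('a)"
        using norm_le_l1[of "y - x"] sum_bounded_above[of Basis "\<lambda>i. \<bar>(y - x) \<bullet> i\<bar>" h] by (simp add: mult.commute)
      then show "y \<in> A" using h(3) e(2) by (auto simp: dist_norm norm_minus_commute subset_iff)
    qed
    have "integral (cbox x (x + h *\<^sub>R One)) f = integral (box x (x + h *\<^sub>R One)) f"
      by (simp add: integral_open_interval)
    also have "\<dots> = (LINT y:box x (x + h *\<^sub>R One)|lborel. f y)"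
      by (rule set_borel_integral_eq_integral(2)[OF fS, symmetric]) simp
    also have "\<dots> = (\<integral>y. indicator (box x (x + h *\<^sub>R One)) y * w y \<partial>lborel)"
      unfolding set_lebesgue_integral_def
    proof (intro Bochner_Integration.integral_cong refl)
      fix y
      show "indicat_real (box x (x + h *\<^sub>R One)) y *\<^sub>R f y = indicator (box x (x + h *\<^sub>R One)) y * w y"
        using sub box_subset_cbox[of x "x + h *\<^sub>R One"]
        by (cases "y \<in> box x (x + h *\<^sub>R One)") (auto simp: f_def)
    qed
    also have "\<dots> = 0"
    proof (rule integral_box_zero[OF w _ _ test])
      show "cbox x (x + h *\<^sub>R One) \<subseteq> \<Omega>" using sub A(2) by blast
      have "integrable lborel (\<lambda>y. indicator (cbox x (x + h *\<^sub>R One)) y *\<^sub>R f y)"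
        using fS[of "cbox x (x + h *\<^sub>R One)"] by (simp add: set_integrable_def)
      moreover have "(\<lambda>y. indicator (cbox x (x + h *\<^sub>R One)) y *\<^sub>R f y) = (\<lambda>y. indicator (cbox x (x + h *\<^sub>R One)) y * w y)"
      proof
        fix y show "indicator (cbox x (x + h *\<^sub>R One)) y *\<^sub>R f y = indicator (cbox x (x + h *\<^sub>R One)) y * w y"
          using sub by (cases "y \<in> cbox x (x + h *\<^sub>R One)") (auto simp: f_def)
      qed
      ultimately show "integrable lborel (\<lambda>y. indicator (cbox x (x + h *\<^sub>R One)) y * w y)" by metis
    qed
    finally have "integral (cbox x (x + h *\<^sub>R One)) f = 0" .
    then show False using d(2)[OF h(1,2)] xA by (simp add: f_def)
  qed
  have "AE x in lebesgue. x \<notin> N" using N by (auto simp: negligible_iff_null_sets intro: AE_not_in)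
  then have "AE x in lborel. x \<notin> N" by (simp add: AE_completion_iff)
  then show ?thesis by eventually_elim (use zero in blast)
qed

lemma AE_lebesgue_on_iff:
  "S \<in> sets lebesgue \<Longrightarrow> (AE x in lebesgue_on S. P x) \<longleftrightarrow> (AE x in lborel. x \<in> S \<longrightarrow> P x)"
  by (simp add: AE_restrict_space_iff AE_completion_iff)

text \<open>Local Lebesgue classes are defined with Lebesgue measurability on the domain, whereas
  the integral estimates work with Borel functions on the whole space. This lemma and the next two
  form the bridge between the two settings.\<close>

lemma borel_representative:
  fixes f :: "'a::euclidean_space \<Rightarrow> real"
  assumes "f \<in> borel_measurable (lebesgue_on S)" "S \<in> sets lebesgue"
  obtains g where "g \<in> borel_measurable borel" "AE x in lborel. x \<in> S \<longrightarrow> f x = g x"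
proof -
  have "(\<lambda>x. if x \<in> S then f x else 0) \<in> borel_measurable lebesgue"
    by (rule borel_measurable_if_I[OF assms])
  then obtain g where g: "g \<in> borel_measurable lborel" "AE x in lborel. (if x \<in> S then f x else 0) = g x"
    using completion_ex_borel_measurable_real by blast
  have "AE x in lborel. x \<in> S \<longrightarrow> f x = g x" using g(2) by eventually_elim auto
  then show ?thesis using that g(1) by simp
qed

lemma integral_lebesgue_on_representative:
  fixes f g :: "'a::euclidean_space \<Rightarrow> real"
  assumes f: "f \<in> borel_measurable (lebesgue_on S)" and S: "S \<in> sets lebesgue" and g: "g \<in> borel_measurable borel"
    and ae: "AE x in lborel. x \<in> S \<longrightarrow> f x = g x" and z: "\<And>x. x \<notin> S \<Longrightarrow> g x = 0"
  shows "(\<integral>x. f x \<partial>lebesgue_on S) = (\<integral>x. g x \<partial>lborel)"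
proof -
  have e: "(\<lambda>x. indicator S x *\<^sub>R f x) = (\<lambda>x. if x \<in> S then f x else 0)" by auto
  have "(\<integral>x. f x \<partial>lebesgue_on S) = (\<integral>x. indicator S x *\<^sub>R f x \<partial>lebesgue)"
    by (rule integral_restrict_space) (use S in simp)
  also have "\<dots> = (\<integral>x. g x \<partial>lebesgue)"
  proof (rule integral_cong_AE)
    show "(\<lambda>x. indicator S x *\<^sub>R f x) \<in> borel_measurable lebesgue"
      unfolding e by (rule borel_measurable_if_I[OF f S])
    show "g \<in> borel_measurable lebesgue" using g by (intro measurable_completion) simp
    have "AE x in lborel. indicator S x *\<^sub>R f x = g x"
      using ae by eventually_elim (use z in \<open>auto simp: indicator_def\<close>)
    then show "AE x in lebesgue. indicator S x *\<^sub>R f x = g x" by (rule AE_completion)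
  qed
  also have "\<dots> = (\<integral>x. g x \<partial>lborel)" by (rule integral_completion) (use g in simp)
  finally show ?thesis .
qed

lemma integrable_representative:
  fixes f g :: "'a::euclidean_space \<Rightarrow> real"
  assumes f: "integrable (lebesgue_on A) f" and A: "compact A" and g: "g \<in> borel_measurable borel"
    and ae: "AE x in lborel. x \<in> A \<longrightarrow> f x = g x"
  shows "integrable lborel (\<lambda>x. indicator A x * g x)"
proof -
  have Am: "A \<in> sets borel" using A by (auto intro: borel_closed compact_imp_closed)
  have i: "integrable lebesgue (\<lambda>x. indicator A x *\<^sub>R f x)"
    using f by (subst (asm) integrable_restrict_space) (use Am in auto)
  have m: "(\<lambda>x. indicator A x * g x) \<in> borel_measurable lborel" using g Am by measurable
  have "integrable lebesgue (\<lambda>x. indicator A x * g x)"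
  proof (rule integrable_cong_AE_imp[OF i])
    show "(\<lambda>x. indicator A x * g x) \<in> borel_measurable lebesgue" by (rule measurable_completion[OF m])
    have "AE x in lborel. indicator A x *\<^sub>R f x = indicator A x * g x"
      using ae by eventually_elim (auto simp: indicator_def)
    then show "AE x in lebesgue. indicator A x *\<^sub>R f x = indicator A x * g x" by (rule AE_completion)
  qed
  then show ?thesis using integrable_completion[OF m] by blast
qed

text \<open>A nonempty open set is not null. The statement P does not depend on x, so this extracts
  a definite fact, or a contradiction, from one that holds almost everywhere on an open set.\<close>

lemma open_AE_const:
  fixes U :: "'a::euclidean_space set"
  assumes "open U" "U \<noteq> {}" "AE x in lborel. x \<in> U \<longrightarrow> P"
  shows P
proof (rule ccontr)
  assume "\<not> P"
  then have "AE x in lborel. x \<notin> U" using assms(3) by simp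
  then have "AE x in lebesgue. x \<notin> U" by (rule AE_completion)
  then have "negligible U"
    using assms(1) by (subst (asm) AE_iff_measurable[where N=U])
      (auto simp: negligible_iff_null_sets intro!: null_setsI)
  then show False using open_not_negligible assms by blast
qed

lemma Lp_loc_1_representative:
  fixes f g :: "'a::euclidean_space \<Rightarrow> real"
  assumes f: "Lp_loc 1 \<Omega> f" and A: "compact A" "A \<subseteq> \<Omega>"
    and g: "g \<in> borel_measurable borel" "AE x in lborel. x \<in> \<Omega> \<longrightarrow> f x = g x"
  shows "integrable lborel (\<lambda>x. indicator A x * g x)"
proof -
  have "integrable (lebesgue_on A) (\<lambda>x. \<bar>f x\<bar> powr 1)" using f A by (simp add: Lp_loc_def)
  then have "integrable (lebesgue_on A) (\<lambda>x. \<bar>f x\<bar>)" by simp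
  then have i: "integrable lborel (\<lambda>x. indicator A x * \<bar>g x\<bar>)"
  proof (rule integrable_representative[OF _ A(1)])
    show "(\<lambda>x. \<bar>g x\<bar>) \<in> borel_measurable borel" using g by measurable
    show "AE x in lborel. x \<in> A \<longrightarrow> \<bar>f x\<bar> = \<bar>g x\<bar>" using g(2) by eventually_elim (use A in auto)
  qed
  have [measurable]: "A \<in> sets borel" using A by (auto intro: borel_closed compact_imp_closed)
  show ?thesis
  proof (rule Bochner_Integration.integrable_bound[OF i])
    show "(\<lambda>x. indicator A x * g x) \<in> borel_measurable lborel" using g(1) by measurable
  qed (auto simp: indicator_def)
qed

lemma test_function_derivative:
  assumes \<phi>: "test_function \<Omega> \<phi>" and D: "\<And>y. GDERIV \<phi> y :> D\<phi> y"
  shows "continuous_on UNIV \<phi>" "i \<in> Basis \<Longrightarrow> continuous_on UNIV (\<lambda>y. D\<phi> y \<bullet> i)"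
    "compact (closure {y. \<phi> y \<noteq> 0})" "closure {y. \<phi> y \<noteq> 0} \<subseteq> \<Omega>"
    "y \<notin> closure {y. \<phi> y \<noteq> 0} \<Longrightarrow> \<phi> y = 0" "y \<notin> closure {y. \<phi> y \<noteq> 0} \<Longrightarrow> D\<phi> y = 0"
proof -
  have Ck: "\<And>k. Ck k \<phi>" and K: "compact (closure {y. \<phi> y \<noteq> 0})" "closure {y. \<phi> y \<noteq> 0} \<subseteq> \<Omega>"
    using \<phi> by (auto simp: test_function_def)
  show "compact (closure {y. \<phi> y \<noteq> 0})" "closure {y. \<phi> y \<noteq> 0} \<subseteq> \<Omega>" by (rule K)+
  show "continuous_on UNIV \<phi>" by (rule Ck_imp_continuous[OF Ck])
  obtain g where g: "\<And>y. GDERIV \<phi> y :> g y" "\<And>i. i \<in> Basis \<Longrightarrow> Ck 0 (\<lambda>y. g y \<bullet> i)"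
    using Ck[of "Suc 0"] unfolding Ck.simps(2) by blast
  have "g = D\<phi>" by (rule ext) (rule GDERIV_unique[OF g(1) D])
  then show "i \<in> Basis \<Longrightarrow> continuous_on UNIV (\<lambda>y. D\<phi> y \<bullet> i)" using g(2) by simp
  show "\<phi> y = 0" if "y \<notin> closure {y. \<phi> y \<noteq> 0}" using that closure_subset[of "{y. \<phi> y \<noteq> 0}"] by auto
  show "D\<phi> y = 0" if y: "y \<notin> closure {y. \<phi> y \<noteq> 0}"
  proof -
    have "(\<phi> has_derivative (\<lambda>h. 0)) (at y)"
    proof (rule has_derivative_transform_within_open[OF has_derivative_const])
      show "open (- closure {y. \<phi> y \<noteq> 0})" by (rule open_Compl) simp
      show "0 = \<phi> x" if "x \<in> - closure {y. \<phi> y \<noteq> 0}" for x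
        using that closure_subset[of "{y. \<phi> y \<noteq> 0}"] by auto
    qed (use y in simp)
    then have "GDERIV \<phi> y :> 0" unfolding gderiv_def by simp
    then have "0 = D\<phi> y" by (rule GDERIV_unique) (rule D)
    then show ?thesis by simp
  qed
qed

lemma integrable_times_compact_support:
  fixes f c :: "'a::euclidean_space \<Rightarrow> real"
  assumes f: "integrable lborel (\<lambda>x. indicator K x * f x)" and K: "compact K"
    and c: "continuous_on UNIV c" "\<And>y. y \<notin> K \<Longrightarrow> c y = 0"
  shows "integrable lborel (\<lambda>y. f y * c y)"
proof -
  have "bounded (c ` K)"
    by (intro compact_imp_bounded compact_continuous_image continuous_on_subset[OF c(1)] K) simp
  then obtain B where B: "\<And>x. x \<in> K \<Longrightarrow> \<bar>c x\<bar> \<le> B" unfolding bounded_iff by auto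
  have e: "(\<lambda>y. (indicator K y * f y) * c y) = (\<lambda>y. f y * c y)"
  proof
    show "(indicator K y * f y) * c y = f y * c y" for y using c(2)[of y] by (cases "y \<in> K") auto
  qed
  have m: "(\<lambda>y. (indicator K y * f y) * c y) \<in> borel_measurable lborel"
    using borel_measurable_integrable[OF f] borel_measurable_continuous_onI[OF c(1)] by measurable
  have "integrable lborel (\<lambda>y. (indicator K y * f y) * c y)"
  proof (rule Bochner_Integration.integrable_bound[OF integrable_mult_right[OF f, of B] m])
    show "AE y in lborel. norm (indicator K y * f y * c y) \<le> norm (B * (indicator K y * f y))"
    proof (intro AE_I2)
      fix y
      show "norm (indicator K y * f y * c y) \<le> norm (B * (indicator K y * f y))"
      proof (cases "y \<in> K")
        case True
        then have "\<bar>c y\<bar> \<le> \<bar>B\<bar>" using B[of y] by linarith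
        then have "\<bar>c y\<bar> * \<bar>f y\<bar> \<le> \<bar>B\<bar> * \<bar>f y\<bar>" by (rule mult_right_mono) simp
        then show ?thesis using True by (simp add: abs_mult mult.commute)
      qed simp
    qed
  qed
  then show ?thesis unfolding e .
qed

text \<open>The defining identity of the weak derivative, rewritten for Borel representatives,
  integrals over the whole space and an explicit gradient of the test function. The products are
  integrable because continuous factors of compact support meet locally integrable ones; this is
  recorded so that integrals can later be added.\<close>

lemma weak_partial_representative:
  fixes f g f' g' :: "'a::euclidean_space \<Rightarrow> real"
  assumes wp: "weak_partial \<Omega> i f g" and i: "i \<in> Basis" and \<Omega>: "\<Omega> \<in> sets borel"
    and f': "f' \<in> borel_measurable borel" "AE x in lborel. x \<in> \<Omega> \<longrightarrow> f x = f' x"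
    and g': "g' \<in> borel_measurable borel" "AE x in lborel. x \<in> \<Omega> \<longrightarrow> g x = g' x"
    and \<phi>: "test_function \<Omega> \<phi>" "\<And>y. GDERIV \<phi> y :> D\<phi> y"
  shows "(\<integral>y. f' y * (D\<phi> y \<bullet> i) \<partial>lborel) = - (\<integral>y. g' y * \<phi> y \<partial>lborel)"
    "integrable lborel (\<lambda>y. f' y * (D\<phi> y \<bullet> i))" "integrable lborel (\<lambda>y. g' y * \<phi> y)"
proof -
  note t = test_function_derivative[OF \<phi>]
  have lp: "Lp_loc 1 \<Omega> f" "Lp_loc 1 \<Omega> g" using wp by (simp_all add: weak_partial_def)
  have S: "\<Omega> \<in> sets lebesgue" using \<Omega> by simp
  have fr: "frechet_derivative \<phi> (at x) i = D\<phi> x \<bullet> i" for x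
  proof -
    have "(\<lambda>h. h \<bullet> D\<phi> x) = frechet_derivative \<phi> (at x)"
      by (rule frechet_derivative_at) (use \<phi>(2) in \<open>simp add: gderiv_def\<close>)
    from fun_cong[OF this, of i] show ?thesis by (simp only: inner_commute)
  qed
  have m: "\<phi> \<in> borel_measurable borel" "(\<lambda>x. D\<phi> x \<bullet> i) \<in> borel_measurable borel"
    by (rule borel_measurable_continuous_onI[OF t(1)], rule borel_measurable_continuous_onI[OF t(2)[OF i]])
  have ml: "h \<in> borel_measurable (lebesgue_on \<Omega>)" if "h \<in> borel_measurable borel" for h :: "'a \<Rightarrow> real"
    using that by (intro measurable_restrict_space1 measurable_completion) simp
  have out: "\<phi> x = 0" "D\<phi> x = 0" if "x \<notin> \<Omega>" for x
    using t(4) t(5)[of x] t(6)[of x] that by (simp_all add: subset_eq) metis+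
  have "(\<integral>x. f x * (D\<phi> x \<bullet> i) \<partial>lebesgue_on \<Omega>) = (\<integral>x. f' x * (D\<phi> x \<bullet> i) \<partial>lborel)"
  proof (rule integral_lebesgue_on_representative[OF _ S])
    show "(\<lambda>x. f x * (D\<phi> x \<bullet> i)) \<in> borel_measurable (lebesgue_on \<Omega>)"
      using lp(1) ml[OF m(2)] by (intro borel_measurable_times) (simp_all add: Lp_loc_def)
    show "(\<lambda>x. f' x * (D\<phi> x \<bullet> i)) \<in> borel_measurable borel" using f'(1) m(2) by (rule borel_measurable_times)
    show "AE x in lborel. x \<in> \<Omega> \<longrightarrow> f x * (D\<phi> x \<bullet> i) = f' x * (D\<phi> x \<bullet> i)"
      using f'(2) by eventually_elim simp
  qed (simp add: out)
  moreover have "(\<integral>x. g x * \<phi> x \<partial>lebesgue_on \<Omega>) = (\<integral>x. g' x * \<phi> x \<partial>lborel)"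
  proof (rule integral_lebesgue_on_representative[OF _ S])
    show "(\<lambda>x. g x * \<phi> x) \<in> borel_measurable (lebesgue_on \<Omega>)"
      using lp(2) ml[OF m(1)] by (intro borel_measurable_times) (simp_all add: Lp_loc_def)
    show "(\<lambda>x. g' x * \<phi> x) \<in> borel_measurable borel" using g'(1) m(1) by (rule borel_measurable_times)
    show "AE x in lborel. x \<in> \<Omega> \<longrightarrow> g x * \<phi> x = g' x * \<phi> x"
      using g'(2) by eventually_elim simp
  qed (simp add: out)
  moreover have "(\<integral>x. f x * (D\<phi> x \<bullet> i) \<partial>lebesgue_on \<Omega>) = - (\<integral>x. g x * \<phi> x \<partial>lebesgue_on \<Omega>)"
  proof -
    have "(\<integral>x. f x * frechet_derivative \<phi> (at x) i \<partial>lebesgue_on \<Omega>) = - (\<integral>x. g x * \<phi> x \<partial>lebesgue_on \<Omega>)"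
      using wp \<phi>(1) unfolding weak_partial_def by blast
    then show ?thesis unfolding fr .
  qed
  ultimately show "(\<integral>y. f' y * (D\<phi> y \<bullet> i) \<partial>lborel) = - (\<integral>y. g' y * \<phi> y \<partial>lborel)" by simp
  show "integrable lborel (\<lambda>y. f' y * (D\<phi> y \<bullet> i))"
    by (rule integrable_times_compact_support[OF Lp_loc_1_representative[OF lp(1) t(3,4) f'] t(3) t(2)[OF i]])
      (subst t(6), assumption, rule inner_zero_left)
  show "integrable lborel (\<lambda>y. g' y * \<phi> y)"
    by (rule integrable_times_compact_support[OF Lp_loc_1_representative[OF lp(2) t(3,4) g'] t(3) t(1)]) (rule t(5))
qed

(* Elements of the Sobolev space are defined up to null sets, and u is not assumed to be its
   continuous representative. Hence "u vanishes identically on -B" is stated as: u = 0 almost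
   everywhere on -B, and u x = 0 at every point x of -B at which u is continuous relative to -B
   (so everywhere on -B if u is continuous there). *)
theorem theorem4p3:
  fixes B :: "'a::euclidean_space set"
    and a :: 'a
    and \<rho> M \<gamma> r \<epsilon> C\<^sub>\<epsilon> :: real
    and b :: "'a \<Rightarrow> 'a"
    and V u :: "'a \<Rightarrow> real"
  assumes dim: "DIM('a) \<ge> 2"
    and ball: "\<rho> > 0" "B = ball a \<rho> \<or> B = cball a \<rho>"
    and borel: "b \<in> borel_measurable (restrict_space borel (- B))"
      "V \<in> borel_measurable (restrict_space borel (- B))"
    and solution: "strong_solution (- closure B) b V u"
    and bounds: "Linf_norm (- B) b \<le> ereal M" "Linf_norm (- B) V \<le> ereal \<gamma>"
    and const: "r > 0" "B \<subseteq> ball 0 r"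
      "b constant_on (- ball 0 r)" "V constant_on (- ball 0 r)"
    and decay: "\<epsilon> > 0" "C\<^sub>\<epsilon> > 0"
      "\<forall>x\<in>- B. \<bar>u x\<bar> \<le> C\<^sub>\<epsilon> * exp (- (M / 2 + sqrt (M\<^sup>2 / 4 + \<gamma>) + \<epsilon>) * norm x)"
  shows "(AE x in lebesgue_on (- B). u x = 0) \<and>
         (\<forall>x\<in>- B. continuous (at x within - B) u \<longrightarrow> u x = 0)"
proof -
  define d where "d = real DIM('a)"
  define \<Omega> where "\<Omega> = {x::'a. \<rho> < norm (x - a)}"
  have clB: "- closure B = \<Omega>"
    using ball by (auto simp: \<Omega>_def dist_norm norm_minus_commute)
  have \<Omega>o: "open \<Omega>" unfolding clB[symmetric] by (rule open_Compl) simp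
  have \<Omega>B: "\<Omega> \<subseteq> - B" unfolding clB[symmetric] using closure_subset by blast
  have Bm: "- B \<in> sets borel" using ball(2) by auto
  have \<Omega>m[measurable]: "\<Omega> \<in> sets borel" using \<Omega>o by (rule borel_open)
  have \<Omega>l: "\<Omega> \<in> sets lebesgue" using \<Omega>m by simp
  have AEB: "(AE x in lebesgue_on (- B). P x) \<longleftrightarrow> (AE x in lborel. x \<in> - B \<longrightarrow> P x)" for P
    by (rule AE_lebesgue_on_iff) (use Bm in simp)
  have AEO: "(AE x in lebesgue_on \<Omega>. P x) \<longleftrightarrow> (AE x in lborel. x \<in> \<Omega> \<longrightarrow> P x)" for P
    by (rule AE_lebesgue_on_iff[OF \<Omega>l])
  have bM: "AE x in lborel. x \<in> - B \<longrightarrow> norm (b x) \<le> M"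
  proof -
    have "AE x in lebesgue_on (- B). ereal (norm (b x)) \<le> Linf_norm (- B) b"
      unfolding Linf_norm_def by (rule esssup_AE)
    then have "AE x in lebesgue_on (- B). norm (b x) \<le> M"
      by eventually_elim (use bounds(1) in \<open>auto dest: order_trans\<close>)
    then show ?thesis by (simp add: AEB)
  qed
  have Vg: "AE x in lborel. x \<in> - B \<longrightarrow> \<bar>V x\<bar> \<le> \<gamma>"
  proof -
    have "AE x in lebesgue_on (- B). ereal (norm (V x)) \<le> Linf_norm (- B) V"
      unfolding Linf_norm_def by (rule esssup_AE)
    then have "AE x in lebesgue_on (- B). \<bar>V x\<bar> \<le> \<gamma>"
      by eventually_elim (use bounds(2) in \<open>auto dest: order_trans\<close>)
    then show ?thesis by (simp add: AEB)
  qed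
  obtain \<beta> where \<beta>: "\<And>x. x \<in> - ball 0 r \<Longrightarrow> b x = \<beta>" using const(3) unfolding constant_on_def by blast
  obtain v where v: "\<And>x. x \<in> - ball 0 r \<Longrightarrow> V x = v" using const(4) unfolding constant_on_def by blast
  \<comment> \<open>The norm bounds hold only almost everywhere, but the far-field values \<beta>
    and v are attained on this nonempty open set and therefore obey them.\<close>
  have U: "open (- cball (0::'a) r)" "- cball (0::'a) r \<noteq> {}"
    by (auto simp: Compl_eq_Diff_UNIV intro: open_Diff) (metis bounded_cball bounded_subset not_bounded_UNIV)
  have far: "x \<in> - B \<and> x \<in> - ball 0 r" if "x \<in> - cball (0::'a) r" for x
    using that const(2) by auto
  have bb: "norm \<beta> \<le> M"
    by (rule open_AE_const[OF U], rule eventually_mono[OF bM]) (use far \<beta> in fastforce)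
  have vb: "\<bar>v\<bar> \<le> \<gamma>"
    by (rule open_AE_const[OF U], rule eventually_mono[OF Vg]) (use far v in fastforce)
  have M0: "M \<ge> 0" using bb norm_ge_zero order_trans by blast
  have g0: "\<gamma> \<ge> 0" using vb by linarith
  define \<kappa> where "\<kappa> = sqrt (M\<^sup>2 / 4 + \<gamma>)"
  have \<kappa>: "\<kappa> \<ge> 0" "\<kappa>\<^sup>2 = M\<^sup>2 / 4 + \<gamma>" using g0 by (auto simp: \<kappa>_def)
  \<comment> \<open>The bounds on \<beta> and v give k \<ge> - \<kappa>^2, so l must be at least
    \<kappa> to have l^2 + k \<ge> 0. Giving l only half of \<epsilon> leaves L - l - |\<beta>|/2
    \<ge> \<epsilon>/2 for the integrability of the weighted functions.\<close>
  define L where "L = M / 2 + \<kappa> + \<epsilon>"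
  define l where "l = \<kappa> + \<epsilon> / 2"
  define k where "k = v - \<beta> \<bullet> \<beta> / 4"
  have l0: "l > 0" using \<kappa> decay(1) by (simp add: l_def add_nonneg_pos)
  have lk: "l\<^sup>2 + k \<ge> 0"
  proof -
    have "\<kappa>\<^sup>2 \<le> l\<^sup>2" using \<kappa> decay(1) by (intro power_mono) (auto simp: l_def)
    moreover have "\<beta> \<bullet> \<beta> \<le> M\<^sup>2" using power_mono[OF bb norm_ge_zero, of 2] by (simp add: power2_norm_eq_inner)
    ultimately show ?thesis using \<kappa>(2) vb unfolding k_def by linarith
  qed
  have lL: "l + norm \<beta> / 2 < L" using bb decay(1) unfolding l_def L_def by linarith
  have L0: "L \<ge> 0" using M0 \<kappa> decay(1) by (simp add: L_def)
  obtain G0 H0 where w1: "\<And>i. i \<in> Basis \<Longrightarrow> weak_partial \<Omega> i u (\<lambda>x. G0 x \<bullet> i)"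
    and w2: "\<And>i. i \<in> Basis \<Longrightarrow> weak_partial \<Omega> i (\<lambda>x. G0 x \<bullet> i) (H0 i)"
    and eq: "AE x in lebesgue_on \<Omega>. (\<Sum>i\<in>Basis. H0 i x) + b x \<bullet> G0 x + V x * u x = 0"
    using solution unfolding strong_solution_def clB by blast
  \<comment> \<open>The gradient G0 from the equation is only known to be locally integrable, while
    membership in the Sobolev space yields weak derivatives S0 that are locally in L^d. The two are
    identified almost everywhere in \<open>sg\<close>.\<close>
  have sob: "\<And>i. i \<in> Basis \<Longrightarrow> \<exists>g. weak_partial \<Omega> i u g \<and> Lp_loc d \<Omega> g"
    using solution unfolding strong_solution_def clB d_def numeral_2_eq_2 sobolev_loc.simps by blast
  obtain S0 where s1: "\<And>i. i \<in> Basis \<Longrightarrow> weak_partial \<Omega> i u (S0 i)" and s2: "\<And>i. i \<in> Basis \<Longrightarrow> Lp_loc d \<Omega> (S0 i)"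
    using sob by metis
  have locm: "f \<in> borel_measurable (lebesgue_on \<Omega>)" if "Lp_loc p \<Omega> f" for p f using that by (simp add: Lp_loc_def)
  have i0: "(SOME i. i \<in> Basis) \<in> (Basis :: 'a set)" by (rule someI_ex) (use nonempty_Basis in blast)
  have lpu: "Lp_loc 1 \<Omega> u" using w1[OF i0] by (simp add: weak_partial_def)
  have lpG: "Lp_loc 1 \<Omega> (\<lambda>x. G0 x \<bullet> i)" "Lp_loc 1 \<Omega> (H0 i)" "Lp_loc 1 \<Omega> (S0 i)" if "i \<in> Basis" for i
    using w1[OF that] w2[OF that] s1[OF that] by (simp_all add: weak_partial_def)
  obtain u1 where u1m: "u1 \<in> borel_measurable borel" and u1: "AE x in lborel. x \<in> \<Omega> \<longrightarrow> u x = u1 x"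
    using borel_representative[OF locm[OF lpu] \<Omega>l] by blast
  have "\<exists>g. i \<in> Basis \<longrightarrow> g \<in> borel_measurable borel \<and> (AE x in lborel. x \<in> \<Omega> \<longrightarrow> G0 x \<bullet> i = g x)" for i
    using borel_representative[OF locm[OF lpG(1)] \<Omega>l] by metis
  then obtain g1 where g1m': "\<And>i. i \<in> Basis \<Longrightarrow> g1 i \<in> borel_measurable borel"
    and g1: "\<And>i. i \<in> Basis \<Longrightarrow> AE x in lborel. x \<in> \<Omega> \<longrightarrow> G0 x \<bullet> i = g1 i x" by metis
  have "\<exists>g. i \<in> Basis \<longrightarrow> g \<in> borel_measurable borel \<and> (AE x in lborel. x \<in> \<Omega> \<longrightarrow> H0 i x = g x)" for i
    using borel_representative[OF locm[OF lpG(2)] \<Omega>l] by metis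
  then obtain h1 where h1m': "\<And>i. i \<in> Basis \<Longrightarrow> h1 i \<in> borel_measurable borel"
    and h1: "\<And>i. i \<in> Basis \<Longrightarrow> AE x in lborel. x \<in> \<Omega> \<longrightarrow> H0 i x = h1 i x" by metis
  have "\<exists>g. i \<in> Basis \<longrightarrow> g \<in> borel_measurable borel \<and> (AE x in lborel. x \<in> \<Omega> \<longrightarrow> S0 i x = g x)" for i
    using borel_representative[OF locm[OF lpG(3)] \<Omega>l] by metis
  then obtain s where sm: "\<And>i. i \<in> Basis \<Longrightarrow> s i \<in> borel_measurable borel"
    and s: "\<And>i. i \<in> Basis \<Longrightarrow> AE x in lborel. x \<in> \<Omega> \<longrightarrow> S0 i x = s i x" by metis
  \<comment> \<open>The decay is assumed around 0 but used around a; |x - a| \<le> |x| + |a| costs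
    the factor exp (L |a|).\<close>
  define C where "C = C\<^sub>\<epsilon> * exp (L * norm a)"
  have C0: "C \<ge> 0" using decay(2) by (simp add: C_def)
  \<comment> \<open>Besides extending by zero into the hole, the definition discards values that
    violate the decay bound. They occur in the domain only on a null set, and the bound now holds at
    every point.\<close>
  define u2 where "u2 x = (if x \<in> \<Omega> \<and> \<bar>u1 x\<bar> \<le> C * exp (- L * norm (x - a)) then u1 x else 0)" for x
  have u2m[measurable]: "u2 \<in> borel_measurable borel"
    unfolding u2_def[abs_def] using u1m by measurable
  have u2b: "\<bar>u2 x\<bar> \<le> C * exp (- L * norm (x - a))" for x using C0 by (simp add: u2_def)
  have ub: "\<bar>u x\<bar> \<le> C * exp (- L * norm (x - a))" if "x \<in> \<Omega>" for x
  proof -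
    have "\<bar>u x\<bar> \<le> C\<^sub>\<epsilon> * exp (- L * norm x)"
      using decay(3) that \<Omega>B unfolding L_def \<kappa>_def by blast
    also have "\<dots> \<le> C\<^sub>\<epsilon> * exp (L * norm a + - L * norm (x - a))"
    proof -
      have "L * norm (x - a) \<le> L * (norm x + norm a)" using L0 by (intro mult_left_mono norm_triangle_ineq4)
      then show ?thesis using decay(2) by (simp add: distrib_left)
    qed
    finally show ?thesis by (simp only: C_def exp_add mult.assoc)
  qed
  have u2: "AE x in lborel. x \<in> \<Omega> \<longrightarrow> u x = u2 x"
    using u1
  proof eventually_elim
    case (elim x)
    then show ?case using ub[of x] by (auto simp: u2_def)
  qed
  define G where "G x = (\<Sum>i\<in>Basis. g1 i x *\<^sub>R i)" for x
  have Gi: "G x \<bullet> i = g1 i x" if "i \<in> Basis" for x i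
    unfolding G_def using that by (simp add: inner_sum_left_Basis)
  have Gm[measurable]: "G \<in> borel_measurable borel"
    unfolding G_def[abs_def] by (intro borel_measurable_sum borel_measurable_scaleR g1m' borel_measurable_const)
  have GG0: "AE x in lborel. x \<in> \<Omega> \<longrightarrow> G0 x = G x"
  proof -
    have "AE x in lborel. \<forall>i\<in>Basis. x \<in> \<Omega> \<longrightarrow> G0 x \<bullet> i = g1 i x"
      by (subst AE_finite_all) (use g1 in auto)
    then show ?thesis by eventually_elim (auto simp: euclidean_eq_iff[of "G0 _"] Gi)
  qed
  \<comment> \<open>The residual of the far-field operator, expressed through the second derivatives
    so that the weak equation for it is immediate. The differential equation identifies it almost
    everywhere with (\<beta> - b) \<bullet> G + (v - V) u2.\<close>
  define N0 where "N0 x = (\<Sum>i\<in>Basis. h1 i x) + \<beta> \<bullet> G x + v * u2 x" for x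
  have N0m[measurable]: "N0 \<in> borel_measurable borel"
    unfolding N0_def[abs_def] by (intro borel_measurable_add borel_measurable_sum h1m') measurable
  \<comment> \<open>The constants come from |\<beta> - b| \<le> 2 M and |v - V| \<le> 2 \<gamma>,
    and from |x - a| \<ge> r + |a| implying |x| \<ge> r. As with \<open>u2\<close>, truncation in N
    turns almost everywhere bounds into bounds at every point.\<close>
  define C1 where "C1 = 2 * M + 2 * \<gamma>"
  define R1 where "R1 = r + norm a"
  define N where "N x = (if x \<in> \<Omega> \<and> \<bar>N0 x\<bar> \<le> C1 * (norm (G x) + \<bar>u2 x\<bar>) \<and> norm (x - a) < R1 then N0 x else 0)" for x
  have Nm: "N \<in> borel_measurable borel" unfolding N_def[abs_def] by measurable
  have C10: "C1 \<ge> 0" using M0 g0 by (simp add: C1_def)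
  have Nb: "\<bar>N x\<bar> \<le> C1 * (norm (G x) + \<bar>u2 x\<bar>)" for x using C10 by (simp add: N_def)
  have Nfar: "N x = 0" if "norm (x - a) \<ge> R1" for x using that by (simp add: N_def)
  have hsum: "AE x in lborel. x \<in> \<Omega> \<longrightarrow> (\<Sum>i\<in>Basis. h1 i x) = (\<Sum>i\<in>Basis. H0 i x)"
  proof -
    have "AE x in lborel. \<forall>i\<in>Basis. x \<in> \<Omega> \<longrightarrow> H0 i x = h1 i x"
      by (subst AE_finite_all) (use h1 in auto)
    then show ?thesis by eventually_elim (auto intro: sum.cong)
  qed
  have NN0: "AE x in lborel. x \<in> \<Omega> \<longrightarrow> N x = N0 x"
    using hsum GG0 u2 eq[unfolded AEO] bM Vg
  proof eventually_elim
    case (elim x)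
    show ?case
    proof
      assume x: "x \<in> \<Omega>"
      have e: "N0 x = (\<beta> - b x) \<bullet> G x + (v - V x) * u2 x"
        using elim x by (simp add: N0_def inner_diff_left left_diff_distrib)
      show "N x = N0 x"
      proof (cases "norm (x - a) < R1")
        case True
        have "norm (\<beta> - b x) \<le> 2 * M" using norm_triangle_ineq4[of \<beta> "b x"] bb elim x \<Omega>B by fastforce
        then have "\<bar>(\<beta> - b x) \<bullet> G x\<bar> \<le> 2 * M * norm (G x)"
          using Cauchy_Schwarz_ineq2[of "\<beta> - b x" "G x"] mult_right_mono[of _ _ "norm (G x)"] order_trans by fastforce
        moreover have "\<bar>v - V x\<bar> \<le> 2 * \<gamma>" using vb elim x \<Omega>B by fastforce
        then have "\<bar>(v - V x) * u2 x\<bar> \<le> 2 * \<gamma> * \<bar>u2 x\<bar>" unfolding abs_mult by (intro mult_right_mono) auto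
        ultimately have "\<bar>N0 x\<bar> \<le> 2 * M * norm (G x) + 2 * \<gamma> * \<bar>u2 x\<bar>" unfolding e by linarith
        also have "\<dots> \<le> C1 * (norm (G x) + \<bar>u2 x\<bar>)"
          using M0 g0 mult_nonneg_nonneg[of M "\<bar>u2 x\<bar>"] mult_nonneg_nonneg[of \<gamma> "norm (G x)"]
          by (simp add: C1_def algebra_simps)
        finally show ?thesis using True x by (simp add: N_def)
      next
        case False
        then have "norm x \<ge> r" using norm_triangle_ineq4[of x a] by (simp add: R1_def)
        then have "b x = \<beta>" "V x = v" using \<beta>[of x] v[of x] by auto
        then show ?thesis using False e by (simp add: N_def)
      qed
    qed
  qed

  have gw: "(\<integral>y. u2 y * (D\<phi> y \<bullet> i) \<partial>lborel) = - (\<integral>y. g1 i y * \<phi> y \<partial>lborel)" "integrable lborel (\<lambda>y. g1 i y * \<phi> y)"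
    if "test_function \<Omega> \<phi>" "\<And>y. GDERIV \<phi> y :> D\<phi> y" and i: "i \<in> Basis" for \<phi> D\<phi> i
    using weak_partial_representative[OF w1[OF i] i \<Omega>m u2m u2 g1m'[OF i] g1[OF i] that(1,2)] by simp_all
  have sw: "(\<integral>y. u2 y * (D\<phi> y \<bullet> i) \<partial>lborel) = - (\<integral>y. s i y * \<phi> y \<partial>lborel)" "integrable lborel (\<lambda>y. s i y * \<phi> y)"
    if "test_function \<Omega> \<phi>" "\<And>y. GDERIV \<phi> y :> D\<phi> y" and i: "i \<in> Basis" for \<phi> D\<phi> i
    using weak_partial_representative[OF s1[OF i] i \<Omega>m u2m u2 sm[OF i] s[OF i] that(1,2)] by simp_all
  have sg: "AE x in lborel. x \<in> \<Omega> \<longrightarrow> s i x = g1 i x" if i: "i \<in> Basis" for i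
  proof -
    have w[measurable]: "(\<lambda>x. s i x - g1 i x) \<in> borel_measurable borel"
      using sm[OF i] g1m'[OF i] by (rule borel_measurable_diff)
    have test: "(\<integral>x. (s i x - g1 i x) * \<phi> x \<partial>lborel) = 0" if \<phi>: "test_function \<Omega> \<phi>" for \<phi>
    proof -
      have "Ck (Suc 0) \<phi>" using \<phi> unfolding test_function_def by blast
      then obtain D\<phi> where D: "\<And>y. GDERIV \<phi> y :> D\<phi> y" unfolding Ck.simps(2) by blast
      have "(\<integral>x. (s i x - g1 i x) * \<phi> x \<partial>lborel) = (\<integral>x. s i x * \<phi> x \<partial>lborel) - (\<integral>x. g1 i x * \<phi> x \<partial>lborel)"
        unfolding left_diff_distrib by (rule Bochner_Integration.integral_diff[OF sw(2)[OF \<phi> D i] gw(2)[OF \<phi> D i]])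
      then show ?thesis using sw(1)[OF \<phi> D i] gw(1)[OF \<phi> D i] by linarith
    qed
    \<comment> \<open>Compact annuli whose interiors exhaust the domain; uniqueness of the weak
      derivative is proved on each of them and glued over countably many.\<close>
    define A where "A m = {x::'a. \<rho> + 1 / real (Suc m) \<le> norm (x - a) \<and> norm (x - a) \<le> real m}" for m
    have Ac: "compact (A m)" for m unfolding A_def by (rule annulus_compact)
    have A\<Omega>: "A m \<subseteq> \<Omega>" for m
    proof
      fix x assume "x \<in> A m"
      moreover have "1 / real (Suc m) > 0" by simp
      ultimately show "x \<in> \<Omega>" unfolding A_def \<Omega>_def mem_Collect_eq by linarith
    qed
    have "AE x in lborel. x \<in> interior (A m) \<longrightarrow> s i x - g1 i x = 0" for m
    proof (rule test_function_orthogonal_AE_zero[OF w Ac A\<Omega> _ test])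
      have "integrable lborel (\<lambda>x. indicator (A m) x * s i x - indicator (A m) x * g1 i x)"
        by (rule Bochner_Integration.integrable_diff[OF Lp_loc_1_representative[OF lpG(3)[OF i] Ac A\<Omega> sm[OF i] s[OF i]]
            Lp_loc_1_representative[OF lpG(1)[OF i] Ac A\<Omega> g1m'[OF i] g1[OF i]]])
      then show "integrable lborel (\<lambda>x. indicator (A m) x * (s i x - g1 i x))" by (simp only: right_diff_distrib)
    qed
    then have "AE x in lborel. \<forall>m. x \<in> interior (A m) \<longrightarrow> s i x - g1 i x = 0"
      by (subst AE_all_countable) blast
    then show ?thesis
    proof eventually_elim
      case (elim x)
      show ?case
      proof
        assume x: "x \<in> \<Omega>"
        then obtain m1 where m1: "1 / real (Suc m1) < norm (x - a) - \<rho>"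
          using reals_Archimedean[of "norm (x - a) - \<rho>"] by (auto simp: \<Omega>_def inverse_eq_divide)
        obtain m2 :: nat where m2: "norm (x - a) < real m2" using reals_Archimedean2 by blast
        define m where "m = max m1 m2"
        have "1 / real (Suc m) \<le> 1 / real (Suc m1)" by (intro divide_left_mono) (auto simp: m_def)
        then have x: "x \<in> {x. \<rho> + 1 / real (Suc m) < norm (x - a)} \<inter> {x. norm (x - a) < real m}"
          using m1 m2 by (auto simp: m_def)
        have "open ({x. \<rho> + 1 / real (Suc m) < norm (x - a)} \<inter> {x. norm (x - a) < real m})"
          by (intro open_Int open_Collect_less continuous_intros)
        then have "x \<in> interior (A m)"
          by (rule interiorI) (use x in \<open>auto simp: A_def\<close>)
        then have "s i x - g1 i x = 0" using elim by blast
        then show "s i x = g1 i x" by simp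
      qed
    qed
  qed
  have Gloc: "integrable lborel (\<lambda>x. indicator A x * (G x \<bullet> G x))" if A: "compact A" "A \<subseteq> \<Omega>" for A
  proof -
    have Am[measurable]: "A \<in> sets borel" using A by (auto intro: borel_closed compact_imp_closed)
    have e: "(\<lambda>x. indicator A x * (G x \<bullet> G x)) = (\<lambda>x. \<Sum>i\<in>Basis. indicator A x * (g1 i x)\<^sup>2)"
      by (rule ext, subst euclidean_inner) (simp add: sum_distrib_left Gi power2_eq_square)
    show ?thesis unfolding e
    proof (rule Bochner_Integration.integrable_sum)
      fix i :: 'a assume i: "i \<in> Basis"
      have m[measurable]: "g1 i \<in> borel_measurable borel" "s i \<in> borel_measurable borel" using g1m' sm i by auto
      have "integrable (lebesgue_on A) (\<lambda>x. \<bar>S0 i x\<bar> powr d)"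
        using s2[OF i] A unfolding Lp_loc_def by blast
      then have i1: "integrable lborel (\<lambda>x. indicator A x * \<bar>s i x\<bar> powr d)"
      proof (rule integrable_representative[OF _ A(1)])
        show "(\<lambda>x. \<bar>s i x\<bar> powr d) \<in> borel_measurable borel" by measurable
        show "AE x in lborel. x \<in> A \<longrightarrow> \<bar>S0 i x\<bar> powr d = \<bar>s i x\<bar> powr d"
          using s[OF i] by eventually_elim (use A in auto)
      qed
      have i2: "integrable lborel (\<lambda>x. indicator A x :: real)"
        by (rule integrable_real_indicator) (use emeasure_bounded_finite[OF compact_imp_bounded[OF A(1)]] in auto)
      have d2: "d \<ge> 2" using dim by (simp add: d_def)
      show "integrable lborel (\<lambda>x. indicator A x * (g1 i x)\<^sup>2)"
      proof (rule Bochner_Integration.integrable_bound[OF Bochner_Integration.integrable_add[OF i2 i1]])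
        show "(\<lambda>x. indicator A x * (g1 i x)\<^sup>2) \<in> borel_measurable lborel" by measurable
        show "AE x in lborel. norm (indicator A x * (g1 i x)\<^sup>2) \<le> norm (indicator A x + indicator A x * \<bar>s i x\<bar> powr d)"
          using sg[OF i]
        proof eventually_elim
          case (elim x)
          \<comment> \<open>Since d \<ge> 2, the local L^d bound on the gradient gives the local L2
            bound that the Carleman argument requires.\<close>
          have "(s i x)\<^sup>2 \<le> 1 + \<bar>s i x\<bar> powr d"
          proof (cases "\<bar>s i x\<bar> \<le> 1")
            case True
            then have "(s i x)\<^sup>2 \<le> 1" by (simp add: abs_square_le_1)
            then show ?thesis using powr_ge_zero[of "\<bar>s i x\<bar>" d] by linarith
          next
            case False
            then have "\<bar>s i x\<bar> powr 2 \<le> \<bar>s i x\<bar> powr d" by (intro powr_mono d2) auto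
            moreover have "\<bar>s i x\<bar> powr 2 = (s i x)\<^sup>2" using False by (simp add: powr_numeral)
            ultimately show ?thesis by linarith
          qed
          then show ?case using elim A(2) by (auto simp: indicator_def)
        qed
      qed
    qed
  qed
  have W1: "(\<integral>y. u2 y * (D\<phi> y \<bullet> i) \<partial>lborel) = - (\<integral>y. (G y \<bullet> i) * \<phi> y \<partial>lborel)"
    if "test_function \<Omega> \<phi>" "\<And>y. GDERIV \<phi> y :> D\<phi> y" "i \<in> Basis" for \<phi> D\<phi> i
    using gw(1)[OF that] by (simp only: Gi[OF that(3)])
  \<comment> \<open>The equation in divergence form: by the choice of k the zeroth-order coefficient
    |\<beta>|^2/4 + k equals v, so the bracket on the right is the sum of the second derivatives
    almost everywhere on the domain.\<close>
  have W2: "(\<integral>y. G y \<bullet> D\<phi> y \<partial>lborel) = - (\<integral>y. (N y - \<beta> \<bullet> G y - (\<beta> \<bullet> \<beta> / 4 + k) * u2 y) * \<phi> y \<partial>lborel)"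
    if \<phi>: "test_function \<Omega> \<phi>" and D: "\<And>y. GDERIV \<phi> y :> D\<phi> y" for \<phi> D\<phi>
  proof -
    have hw: "(\<integral>y. g1 i y * (D\<phi> y \<bullet> i) \<partial>lborel) = - (\<integral>y. h1 i y * \<phi> y \<partial>lborel)"
       "integrable lborel (\<lambda>y. g1 i y * (D\<phi> y \<bullet> i))" "integrable lborel (\<lambda>y. h1 i y * \<phi> y)" if i: "i \<in> Basis" for i
      using weak_partial_representative[OF w2[OF i] i \<Omega>m g1m'[OF i] g1[OF i] h1m'[OF i] h1[OF i] \<phi> D] by simp_all
    note t = test_function_derivative[OF \<phi> D]
    have out: "\<phi> y = 0" if "y \<notin> \<Omega>" for y
      by (rule t(5)) (use t(4) that in blast)
    have \<phi>m[measurable]: "\<phi> \<in> borel_measurable borel" by (rule borel_measurable_continuous_onI[OF t(1)])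
    have hm[measurable]: "(\<lambda>y. \<Sum>i\<in>Basis. h1 i y) \<in> borel_measurable borel"
      by (intro borel_measurable_sum h1m')
    have e: "(\<lambda>y. G y \<bullet> D\<phi> y) = (\<lambda>y. \<Sum>i\<in>Basis. g1 i y * (D\<phi> y \<bullet> i))"
      by (rule ext, subst euclidean_inner) (simp add: Gi)
    have "(\<integral>y. G y \<bullet> D\<phi> y \<partial>lborel) = (\<Sum>i\<in>Basis. \<integral>y. g1 i y * (D\<phi> y \<bullet> i) \<partial>lborel)"
      unfolding e by (rule Bochner_Integration.integral_sum) (rule hw(2))
    also have "\<dots> = - (\<Sum>i\<in>Basis. \<integral>y. h1 i y * \<phi> y \<partial>lborel)"
      by (simp add: hw(1) sum_negf)
    also have "(\<Sum>i\<in>Basis. \<integral>y. h1 i y * \<phi> y \<partial>lborel) = (\<integral>y. (\<Sum>i\<in>Basis. h1 i y * \<phi> y) \<partial>lborel)"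
      by (rule Bochner_Integration.integral_sum[symmetric]) (rule hw(3))
    also have "\<dots> = (\<integral>y. (N y - \<beta> \<bullet> G y - (\<beta> \<bullet> \<beta> / 4 + k) * u2 y) * \<phi> y \<partial>lborel)"
    proof (rule integral_cong_AE)
      show "(\<lambda>y. \<Sum>i\<in>Basis. h1 i y * \<phi> y) \<in> borel_measurable lborel"
        unfolding sum_distrib_right[symmetric] by measurable
      show "(\<lambda>y. (N y - \<beta> \<bullet> G y - (\<beta> \<bullet> \<beta> / 4 + k) * u2 y) * \<phi> y) \<in> borel_measurable lborel"
        using Nm by measurable
      show "AE y in lborel. (\<Sum>i\<in>Basis. h1 i y * \<phi> y) = (N y - \<beta> \<bullet> G y - (\<beta> \<bullet> \<beta> / 4 + k) * u2 y) * \<phi> y"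
        using NN0
      proof eventually_elim
        case (elim y)
        show ?case
        proof (cases "y \<in> \<Omega>")
          case True
          then have "N y - \<beta> \<bullet> G y - (\<beta> \<bullet> \<beta> / 4 + k) * u2 y = (\<Sum>i\<in>Basis. h1 i y)"
            using elim by (simp add: N0_def k_def)
          then show ?thesis by (simp only: sum_distrib_right)
        qed (simp add: out)
      qed
    qed
    finally show ?thesis .
  qed
  have "AE x in lborel. x \<in> \<Omega> \<longrightarrow> u2 x = 0"
    unfolding \<Omega>_def
    by (rule unique_continuation_core[OF dim ball(1) l0 lk lL u2m Gm Nm u2b Gloc[unfolded \<Omega>_def] Nb Nfar W1[unfolded \<Omega>_def] W2[unfolded \<Omega>_def]])
      assumption+
  with u2 have zero: "AE x in lborel. x \<in> \<Omega> \<longrightarrow> u x = 0" by eventually_elim auto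
  show ?thesis
  proof (intro conjI ballI impI)
    \<comment> \<open>For an open ball the complement contains the sphere, which the open domain
      omits; the sphere is a null set.\<close>
    have "AE x in lebesgue. x \<notin> sphere a \<rho>"
      using negligible_sphere[of a \<rho>] by (intro AE_not_in) (simp add: negligible_iff_null_sets)
    then have "AE x in lborel. x \<notin> sphere a \<rho>" by (subst (asm) AE_completion_iff)
    with zero have "AE x in lborel. x \<in> - B \<longrightarrow> u x = 0"
      by eventually_elim (use ball(2) in \<open>auto simp: \<Omega>_def dist_norm norm_minus_commute\<close>)
    then show "AE x in lebesgue_on (- B). u x = 0" by (simp only: AEB)
  next
    fix x assume x: "x \<in> - B" and c: "continuous (at x within - B) u"
    show "u x = 0"
    proof (rule ccontr)
      assume "u x \<noteq> 0"
      then have "\<forall>\<^sub>F y in at x within - B. u y \<noteq> 0"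
        using c tendsto_imp_eventually_ne unfolding continuous_within by blast
      then obtain e where e: "e > 0" "\<And>y. y \<in> - B \<Longrightarrow> y \<noteq> x \<Longrightarrow> dist y x < e \<Longrightarrow> u y \<noteq> 0"
        unfolding eventually_at by blast
      have n: "norm (x - a) \<ge> \<rho>" using x ball(2) by (auto simp: dist_norm norm_minus_commute)
      \<comment> \<open>Moving x radially outwards by e/2 lands strictly outside the closed ball
        even if x lies on the sphere. So every neighbourhood of x meets the domain in a nonempty
        open set, on which u would be nonzero throughout.\<close>
      define t where "t = e / (2 * norm (x - a))"
      have n0: "norm (x - a) > 0" using n ball(1) by linarith
      have t: "t > 0" "t * norm (x - a) = e / 2" using e n0 by (auto simp: t_def)
      define y where "y = x + t *\<^sub>R (x - a)"
      have "y - a = (1 + t) *\<^sub>R (x - a)" by (simp add: y_def algebra_simps)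
      then have "norm (y - a) = (1 + t) * norm (x - a)" using t by simp
      then have "norm (y - a) > \<rho>" using n t e by (simp add: distrib_right)
      moreover have "dist x y < e" using t e(1) by (simp add: y_def dist_norm)
      ultimately have "y \<in> \<Omega> \<inter> ball x e" by (simp add: \<Omega>_def)
      moreover have "y \<noteq> x" using t n0 by (auto simp: y_def)
      ultimately have ne: "\<Omega> \<inter> ball x e - {x} \<noteq> {}" by blast
      have "open (\<Omega> \<inter> ball x e - {x})" using \<Omega>o by (intro open_delete open_Int open_ball)
      then show False
      proof (rule open_AE_const[OF _ ne])
        show "AE y in lborel. y \<in> \<Omega> \<inter> ball x e - {x} \<longrightarrow> False"
          using zero by eventually_elim (use e(2) \<Omega>B in \<open>auto simp: dist_commute\<close>)
      qed
    qed
  qed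
qed

end
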